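(* Let $u_0:\mathbb R^d\to[0,1]$ be measurable and let $\{\mu^n\}_n$ be a sequence of probability measures on $\{0,1\}^{\mathbb Z^d}$ associated to $u_0$. For each $n$ let $\eta^n_t=\eta_{tn^\alpha}$ be the exclusion process with long jumps speeded up by $n^\alpha$ and started from $\mu^n$, and let $\mu^n(t)$ be the law of $\eta^n_t$. Then for every $t\ge0$ the sequence $\{\mu^n(t)\}_n$ is associated to $u(t,\cdot)$, where $u$ is the unique weak solution of the Cauchy problem $\partial_t u=\mathcal L u$, $u(0,\cdot)=u_0$.
   Context: Fix $d\ge1$, $\alpha\in(0,2)$ and a continuous function $h:\mathbb R^d\setminus\{0\}\to(0,\infty)$ which is even ($h(-x)=h(x)$) and homogeneous of degree $-(d+\alpha)$ ($h(\lambda x)=\lambda^{-(d+\alpha)}h(x)$ for $\lambda>0$). Set $p(z)=h(z)$ for $z\in\mathbb Z^d\setminus\{0\}$, $p(0)=0$. The exclusion process with long jumps is the Markov process on $\{0,1\}^{\mathbb Z^d}$ with generator $Lf(\eta)=\sum_{x,y\in\mathbb Z^d}p(y-x)\eta(x)(1-\eta(y))[f(\eta^{xy})-f(\eta)]$, where $\eta^{xy}$ is $\eta$ with the values at $x$ and $y$ exchanged. A sequence of probability measures $\mu^n$ on $\{0,1\}^{\mathbb Z^d}$ is associated to a measurable $v:\mathbb R^d\to\mathbb R$ if for every continuous compactly supported $F$ and every $\epsilon>0$, $\lim_n\mu^n\{\eta:|n^{-d}\sum_{z}\eta(z)F(z/n)-\int v(x)F(x)dx|>\epsilon\}=0$.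 For $F\in C^2_c(\mathbb R^d)$, $\mathcal LF(x)=\frac12\int_{\mathbb R^d}h(y)\big(F(x+y)+F(x-y)-2F(x)\big)dy$. A weak solution of $\partial_tu=\mathcal Lu$, $u(0,\cdot)=u_0$ on $[0,T]$ is a bounded measurable $u:[0,T]\times\mathbb R^d\to\mathbb R$ such that for every $t\in[0,T]$ and every smooth compactly supported $G:[0,T]\times\mathbb R^d\to\mathbb R$, $\int u(t,x)G(t,x)dx-\int u_0(x)G(0,x)dx-\int_0^t\int u(s,x)(\partial_s+\mathcal L)G(s,x)\,dx\,ds=0$. *)

theory Defs
  imports "HOL-Probability.Probability"
begin

text \<open>Sites of the lattice Z^d are vectors int^'d (d = CARD('d) \<ge> 1);
  a configuration is a map from sites to bool (True = occupied, i.e. eta(x)=1).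
  The configuration space carries the product sigma-algebra.\<close>

definition config_space :: "(int^'d \<Rightarrow> bool) measure" where
  "config_space = PiM UNIV (\<lambda>_. count_space UNIV)"

definition site_to_real :: "int^'d \<Rightarrow> real^'d" where
  "site_to_real z = (\<chi> i. real_of_int (z $ i))"

definition occ :: "bool \<Rightarrow> real" where
  "occ b = (if b then 1 else 0)"

definition exch :: "(int^'d \<Rightarrow> bool) \<Rightarrow> int^'d \<Rightarrow> int^'d \<Rightarrow> (int^'d \<Rightarrow> bool)" where
  "exch \<eta> x y = \<eta>(x := \<eta> y, y := \<eta> x)"

definition jump_rate :: "(real^'d \<Rightarrow> real) \<Rightarrow> int^'d \<Rightarrow> real" where
  "jump_rate h z = (if z = 0 then 0 else h (site_to_real z))"

definition excl_gen :: "(real^'d \<Rightarrow> real) \<Rightarrow> ((int^'d \<Rightarrow> bool) \<Rightarrow> real)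
    \<Rightarrow> (int^'d \<Rightarrow> bool) \<Rightarrow> real" where
  "excl_gen h f \<eta> = (\<Sum>\<^sub>\<infinity>(x,y)\<in>UNIV.
      jump_rate h (y - x) * occ (\<eta> x) * (1 - occ (\<eta> y)) * (f (exch \<eta> x y) - f \<eta>))"

definition cylinder_fun :: "((int^'d \<Rightarrow> bool) \<Rightarrow> real) \<Rightarrow> bool" where
  "cylinder_fun f \<longleftrightarrow> (\<exists>\<Lambda>. finite \<Lambda> \<and>
      (\<forall>\<eta> \<zeta>. (\<forall>x\<in>\<Lambda>. \<eta> x = \<zeta> x) \<longrightarrow> f \<eta> = f \<zeta>))"

text \<open>nu t (t \<ge> 0) is the law at time t of the exclusion process with generator
  c * L started from mu (time speeded up by the factor c): characterised by the
  Kolmogorov forward equation on cylinder functions.\<close>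
definition is_excl_law :: "(real^'d \<Rightarrow> real) \<Rightarrow> real \<Rightarrow> (int^'d \<Rightarrow> bool) measure
    \<Rightarrow> (real \<Rightarrow> (int^'d \<Rightarrow> bool) measure) \<Rightarrow> bool" where
  "is_excl_law h c \<mu> \<nu> \<longleftrightarrow>
     \<nu> 0 = \<mu> \<and>
     (\<forall>t\<ge>0. prob_space (\<nu> t) \<and> sets (\<nu> t) = sets config_space) \<and>
     (\<forall>f. cylinder_fun f \<longrightarrow> (\<forall>t\<ge>0.
        ((\<lambda>s. integral\<^sup>L (\<nu> s) f) has_real_derivative
            (c * integral\<^sup>L (\<nu> t) (excl_gen h f))) (at t within {0..})))"

definition has_compact_support :: "('a::real_normed_vector \<Rightarrow> real) \<Rightarrow> bool" where
  "has_compact_support F \<longleftrightarrow> (\<exists>K. compact K \<and> (\<forall>x. x \<notin> K \<longrightarrow> F x = 0))"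

definition empirical :: "nat \<Rightarrow> (real^'d \<Rightarrow> real) \<Rightarrow> (int^'d \<Rightarrow> bool) \<Rightarrow> real" where
  "empirical n F \<eta> = (1 / real n ^ CARD('d)) *
      (\<Sum>z\<in>{z. F (scaleR (1 / real n) (site_to_real z)) \<noteq> 0}.
          occ (\<eta> z) * F (scaleR (1 / real n) (site_to_real z)))"

definition associated :: "(nat \<Rightarrow> (int^'d \<Rightarrow> bool) measure) \<Rightarrow> (real^'d \<Rightarrow> real) \<Rightarrow> bool" where
  "associated \<mu> v \<longleftrightarrow>
     (\<forall>F. continuous_on UNIV F \<and> has_compact_support F \<longrightarrow>
        (\<forall>\<epsilon>>0. (\<lambda>n. measure (\<mu> n)
            {\<eta> \<in> space (\<mu> n). \<bar>empirical n F \<eta> - (\<integral>x. v x * F x \<partial>lborel)\<bar> > \<epsilon>})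
          \<longlonglongrightarrow> 0))"

definition frac_op :: "(real^'d \<Rightarrow> real) \<Rightarrow> (real^'d \<Rightarrow> real) \<Rightarrow> real^'d \<Rightarrow> real" where
  "frac_op h F x = (1/2) * (\<integral>y. h y * (F (x + y) + F (x - y) - 2 * F x) \<partial>lborel)"

fun Ck :: "nat \<Rightarrow> ('a::euclidean_space \<Rightarrow> real) \<Rightarrow> bool" where
  "Ck 0 f = continuous_on UNIV f"
| "Ck (Suc k) f = (continuous_on UNIV f \<and> (\<exists>f'. (\<forall>x. (f has_derivative f' x) (at x)) \<and>
        (\<forall>v. Ck k (\<lambda>x. f' x v))))"

definition smooth :: "('a::euclidean_space \<Rightarrow> real) \<Rightarrow> bool" where
  "smooth f \<longleftrightarrow> (\<forall>k. Ck k f)"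

definition weak_solution :: "(real^'d \<Rightarrow> real) \<Rightarrow> real \<Rightarrow> (real^'d \<Rightarrow> real)
    \<Rightarrow> (real \<Rightarrow> real^'d \<Rightarrow> real) \<Rightarrow> bool" where
  "weak_solution h T u0 u \<longleftrightarrow>
     (\<lambda>(s,x). u s x) \<in> borel_measurable (borel :: (real \<times> (real^'d)) measure) \<and>
     (\<exists>B. \<forall>s\<in>{0..T}. \<forall>x. \<bar>u s x\<bar> \<le> B) \<and>
     (\<forall>G :: real \<times> (real^'d) \<Rightarrow> real. smooth G \<and> has_compact_support G \<longrightarrow>
        (\<forall>t\<in>{0..T}.
          (\<integral>x. u t x * G (t,x) \<partial>lborel) - (\<integral>x. u0 x * G (0,x) \<partial>lborel)
          - (\<integral>s. (\<integral>x. u s x * (deriv (\<lambda>r. G (r,x)) s + frac_op h (\<lambda>y. G (s,y)) x) \<partial>lborel)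
                \<partial>(restrict_space lborel {0..t})) = 0))"

end

theory Submission
  imports Defs "HOL-Computational_Algebra.Polynomial"
begin

text \<open>
  Because the jump rates are symmetric, the density of the exclusion process solves a closed
  linear equation, and its fluctuations are controlled by the square field of a linear statistic,
  which is of order \<open>n\<close> to the power \<open>- d\<close>.
  Let \<open>B m\<close> be the generator of the random walk on the lattice of mesh \<open>1 / m\<close> with jumps truncated at
  distance \<open>m\<close>. It is a finite sum of difference operators commuting with translations, so the Euler
  products of \<open>1 + \<delta> B m\<close> preserve test functions and contract \<open>L\<^sup>1\<close>.
  Running these products backwards in time, a telescoping argument reduces both the weak solution
  and the second moment of the empirical density at time \<open>t\<close> to time \<open>0\<close>, with an error
  governed by the \<open>L\<^sup>1\<close> distance between \<open>B m F\<close> and the fractional operator applied to \<open>F\<close>. This distance tends to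
  \<open>0\<close> by one dominated convergence argument, in which lattice sums are written as integrals of
  functions rounded to the lattice. The Euler products are also Cauchy in \<open>L\<^sup>1\<close>, and their
  limit is a weak solution.
\<close>

section \<open>Test functions\<close>

text \<open>The obstacle is that the natural backward solution, the semigroup of the fractional
  operator applied to \<open>F\<close>, loses compact support, so it is admissible neither in the
  weak formulation nor in the forward equation, which concerns cylinder functions only. A truncated
  walk has finitely many jumps, hence finite Euler products keep test functions within their class.
  All operators involved are translation invariant and commute, so consistency errors are propagated
  by contractions and never grow. Contraction needs \<open>\<delta> * jump_total m \<le> 1\<close>,
  and \<open>jump_total m\<close> depends on the truncation; limits are therefore taken in the
  order: \<open>m\<close>, then the number of steps, and only then \<open>n\<close>. Existence meets
  a different obstacle: \<open>u0\<close> is bounded but need not be integrable, while the estimates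
  live in L1. Cutting it off on growing balls makes the approximations nearly increasing, which
  yields an almost everywhere limit at each time without subsequences and without choosing
  representatives that depend on time.\<close>

lemma Ck_imp_continuous: "Ck k f \<Longrightarrow> continuous_on UNIV f"
  by (cases k) auto

text \<open>Needed for the product and chain rules, where an undifferentiated factor must be known
  to be of class \<open>Ck k\<close>.\<close>

lemma Ck_SucD: "Ck (Suc k) f \<Longrightarrow> Ck k f"
proof (induction k arbitrary: f)
  case 0
  then show ?case by simp
next
  case (Suc k)
  then obtain f' where f': "\<And>x. (f has_derivative f' x) (at x)" "\<And>v. Ck (Suc k) (\<lambda>x. f' x v)"
    by auto
  then show ?case
    using Suc.IH Suc.prems by auto
qed

lemma Ck_SucI:
  assumes "\<And>x. (f has_derivative f' x) (at x)" "\<And>v. Ck k (\<lambda>x. f' x v)"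
  shows "Ck (Suc k) f"
proof -
  have "continuous_on UNIV f"
    using assms(1) by (meson has_derivative_continuous continuous_at_imp_continuous_on)
  then show ?thesis using assms by auto
qed

lemma Ck_const: "Ck k (\<lambda>x. c)"
proof (induction k arbitrary: c)
  case (Suc k)
  show ?case
    by (rule Ck_SucI[where f' = "\<lambda>x v. 0"]) (auto intro: Suc)
qed auto

lemma Ck_add: "Ck k f \<Longrightarrow> Ck k g \<Longrightarrow> Ck k (\<lambda>x. f x + g x)"
proof (induction k arbitrary: f g)
  case 0
  then show ?case by (auto intro: continuous_intros)
next
  case (Suc k)
  obtain f' where f': "\<And>x. (f has_derivative f' x) (at x)" "\<And>v. Ck k (\<lambda>x. f' x v)"
    using Suc.prems by auto
  obtain g' where g': "\<And>x. (g has_derivative g' x) (at x)" "\<And>v. Ck k (\<lambda>x. g' x v)"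
    using Suc.prems by auto
  show ?case
    by (rule Ck_SucI[where f' = "\<lambda>x v. f' x v + g' x v"]) (auto intro: Suc f' g' has_derivative_add)
qed

lemma Ck_mult: "Ck k f \<Longrightarrow> Ck k g \<Longrightarrow> Ck k (\<lambda>x. f x * g x)"
proof (induction k arbitrary: f g)
  case 0
  then show ?case by (auto intro: continuous_intros)
next
  case (Suc k)
  obtain f' where f': "\<And>x. (f has_derivative f' x) (at x)" "\<And>v. Ck k (\<lambda>x. f' x v)"
    using Suc.prems by auto
  obtain g' where g': "\<And>x. (g has_derivative g' x) (at x)" "\<And>v. Ck k (\<lambda>x. g' x v)"
    using Suc.prems by auto
  have "Ck k f" "Ck k g" using Suc.prems Ck_SucD by blast+
  then show ?case
    by (intro Ck_SucI[where f' = "\<lambda>x v. f x * g' x v + f' x v * g x"] has_derivative_mult f' g' Ck_add Suc.IH)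
qed

text \<open>One statement for translations, for sections of space-time functions at a fixed time,
  and for the two coordinate projections.\<close>

lemma Ck_affine:
  assumes L: "bounded_linear L"
  shows "Ck k f \<Longrightarrow> Ck k (\<lambda>x. f (L x + c))"
proof (induction k arbitrary: f)
  case 0
  have "continuous_on UNIV (\<lambda>x. L x + c)"
    by (intro continuous_intros bounded_linear.continuous_on[OF L])
  with 0 show ?case by (auto intro: continuous_on_compose2)
next
  case (Suc k)
  obtain f' where f': "\<And>x. (f has_derivative f' x) (at x)" "\<And>v. Ck k (\<lambda>x. f' x v)"
    using Suc.prems by auto
  have "((\<lambda>x. f (L x + c)) has_derivative (\<lambda>v. f' (L x + c) (L v))) (at x)" for x
    by (rule has_derivative_compose[OF _ f'(1)])
       (auto intro!: derivative_eq_intros bounded_linear.has_derivative[OF L])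
  then show ?case
    by (rule Ck_SucI) (intro Suc.IH f')
qed

lemma Ck_bounded_linear: "bounded_linear f \<Longrightarrow> Ck k f"
proof (cases k)
  case 0
  then show "bounded_linear f \<Longrightarrow> Ck k f"
    using linear_continuous_on by auto
next
  case (Suc l)
  then show "bounded_linear f \<Longrightarrow> Ck k f"
    by (auto intro!: Ck_SucI[where f' = "\<lambda>x. f"] Ck_const bounded_linear_imp_has_derivative simp del: Ck.simps)
qed

lemma Ck_polynomial: "real_polynomial_function f \<Longrightarrow> Ck k f"
  by (induction rule: real_polynomial_function.induct)
     (auto intro: Ck_add Ck_mult Ck_const Ck_bounded_linear)

lemma Ck_sum: "(\<And>i. i \<in> I \<Longrightarrow> Ck k (f i)) \<Longrightarrow> Ck k (\<lambda>x. \<Sum>i\<in>I. f i x)"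
  by (induction I rule: infinite_finite_induct) (auto intro: Ck_add Ck_const)

text \<open>This family is closed under differentiation, which makes all its members smooth at \<open>0\<close>.\<close>

definition flat_exp :: "real poly \<Rightarrow> real \<Rightarrow> real" where
  "flat_exp P t = (if t > 0 then poly P (inverse t) * exp (- inverse t) else 0)"

lemma poly_times_exp_tendsto_0: "((\<lambda>s. poly P s * exp (- s)) \<longlongrightarrow> (0::real)) at_top"
proof -
  have "((\<lambda>s. \<Sum>i\<le>degree P. coeff P i * (s ^ i / exp s)) \<longlongrightarrow> (\<Sum>i\<le>degree P. coeff P i * 0)) at_top"
    by (intro tendsto_intros tendsto_power_div_exp_0)
  then show ?thesis
    by (simp add: poly_altdef sum_distrib_right exp_minus divide_inverse mult.assoc)
qed

text \<open>Writing s for 1/t, the derivative of P(s) exp(-s) in t is s^2 (P(s) - P'(s)) exp(-s),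
  and \<open>[:0,0,1:]\<close> is the polynomial X^2. At 0 the right difference quotient is s P(s)
  exp(-s) with s = 1/x, which tends to 0.\<close>

lemma flat_exp_deriv:
  "(flat_exp P has_real_derivative flat_exp ([:0,0,1:] * (P - pderiv P)) t) (at t)"
proof -
  consider "t > 0" | "t < 0" | "t = 0" by linarith
  then show ?thesis
  proof cases
    case 1
    have d: "((\<lambda>t. poly P (inverse t) * exp (- inverse t)) has_real_derivative
       flat_exp ([:0,0,1:] * (P - pderiv P)) t) (at t)"
      using 1 by (auto intro!: derivative_eq_intros DERIV_chain2[where f = "poly P"] poly_DERIV
          simp: flat_exp_def power2_eq_square field_simps)
    have ev: "\<forall>\<^sub>F x in nhds t. poly P (inverse x) * exp (- inverse x) = flat_exp P x"
      using eventually_nhds_in_open[of "{0<..}" t] 1 by (auto simp: flat_exp_def elim!: eventually_mono)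
    show ?thesis by (rule iffD1[OF DERIV_cong_ev[OF refl ev refl] d])
  next
    case 2
    have d: "((\<lambda>t. 0) has_real_derivative flat_exp ([:0,0,1:] * (P - pderiv P)) t) (at t)"
      using 2 by (simp add: flat_exp_def)
    have ev: "\<forall>\<^sub>F x in nhds t. 0 = flat_exp P x"
      using eventually_nhds_in_open[of "{..<0}" t] 2 by (auto simp: flat_exp_def elim!: eventually_mono)
    show ?thesis by (rule iffD1[OF DERIV_cong_ev[OF refl ev refl] d])
  next
    case 3
    have "((\<lambda>x. flat_exp P x / x) \<longlongrightarrow> 0) (at_left 0)"
      by (rule tendsto_eventually) (auto simp: eventually_at_filter flat_exp_def)
    moreover have "((\<lambda>x. flat_exp P x / x) \<longlongrightarrow> 0) (at_right 0)"
    proof -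
      have "((\<lambda>x. poly ([:0,1:] * P) (inverse x) * exp (- inverse x)) \<longlongrightarrow> 0) (at_right (0::real))"
        by (rule filterlim_compose[OF poly_times_exp_tendsto_0 filterlim_inverse_at_top_right])
      moreover have "\<forall>\<^sub>F x in at_right (0::real). poly ([:0,1:] * P) (inverse x) * exp (- inverse x) = flat_exp P x / x"
        by (auto simp: eventually_at_filter flat_exp_def field_simps)
      ultimately show ?thesis by (rule Lim_transform_eventually)
    qed
    ultimately have "((\<lambda>x. flat_exp P x / x) \<longlongrightarrow> 0) (at 0)"
      by (simp add: filterlim_at_split)
    then show ?thesis using 3 by (simp add: has_field_derivative_iff flat_exp_def)
  qed
qed

text \<open>The induction generalises over \<open>P\<close>, since one differentiation replaces
  \<open>P\<close> by another polynomial.\<close>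

lemma Ck_flat_exp: "Ck k g \<Longrightarrow> Ck k (\<lambda>x. flat_exp P (g x))"
proof (induction k arbitrary: P)
  case 0
  have "continuous_on UNIV (flat_exp P)"
    using flat_exp_deriv DERIV_isCont continuous_at_imp_continuous_on by blast
  with 0 show ?case by (auto intro: continuous_on_compose2)
next
  case (Suc k)
  obtain g' where g': "\<And>x. (g has_derivative g' x) (at x)" "\<And>v. Ck k (\<lambda>x. g' x v)"
    using Suc.prems by auto
  have "((\<lambda>x. flat_exp P (g x)) has_derivative
      (\<lambda>v. flat_exp ([:0,0,1:] * (P - pderiv P)) (g x) * g' x v)) (at x)" for x
    by (rule has_derivative_compose[OF g'(1)]) (rule has_field_derivative_imp_has_derivative, rule flat_exp_deriv)
  then show ?case
    by (rule Ck_SucI) (intro Ck_mult Suc.IH g' Ck_SucD[OF Suc.prems])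
qed

section \<open>Bounds for compactly supported functions and density of test functions\<close>

definition test_fun :: "('a::euclidean_space \<Rightarrow> real) \<Rightarrow> bool" where
  "test_fun f \<longleftrightarrow> smooth f \<and> has_compact_support f"

lemma has_compact_support_iff:
  "has_compact_support f \<longleftrightarrow> (\<exists>R. \<forall>x. norm x > R \<longrightarrow> f x = 0)" for f :: "'a::euclidean_space \<Rightarrow> real"
proof
  assume "has_compact_support f"
  then obtain K where K: "compact K" "\<And>x. x \<notin> K \<Longrightarrow> f x = 0" by (auto simp: has_compact_support_def)
  then obtain R where "\<forall>x\<in>K. norm x \<le> R" using compact_imp_bounded bounded_iff by blast
  then show "\<exists>R. \<forall>x. norm x > R \<longrightarrow> f x = 0" using K(2) by (meson linorder_not_le)
next
  assume "\<exists>R. \<forall>x. norm x > R \<longrightarrow> f x = 0"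
  then obtain R where R: "\<And>x. norm x > R \<Longrightarrow> f x = 0" by blast
  have "f x = 0" if "x \<notin> cball 0 R" for x using that R[of x] by simp
  then show "has_compact_support f" unfolding has_compact_support_def
    by (intro exI[of _ "cball 0 R"]) auto
qed

lemma compact_support_bounded:
  fixes f :: "'a::euclidean_space \<Rightarrow> real"
  assumes "continuous_on UNIV f" "has_compact_support f"
  shows "\<exists>M\<ge>0. \<forall>x. \<bar>f x\<bar> \<le> M"
proof -
  obtain K where K: "compact K" "\<And>x. x \<notin> K \<Longrightarrow> f x = 0" using assms(2) by (auto simp: has_compact_support_def)
  have "compact (f ` K)" using K assms(1) compact_continuous_image continuous_on_subset by blast
  then obtain B where B: "\<And>x. x \<in> K \<Longrightarrow> norm (f x) \<le> B" 
    by (meson compact_imp_bounded bounded_iff imageI)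
  have "\<bar>f x\<bar> \<le> max 0 B" for x using B[of x] K(2)[of x] by (cases "x \<in> K") auto
  then show ?thesis by (intro exI[of _ "max 0 B"]) auto
qed

lemma compact_support_derivative:
  fixes f :: "'a::euclidean_space \<Rightarrow> real"
  assumes "has_compact_support f" "\<And>x. (f has_derivative f' x) (at x)"
  shows "has_compact_support (\<lambda>x. f' x v)"
proof -
  obtain R where R: "\<And>x. norm x > R \<Longrightarrow> f x = 0" using assms(1) by (auto simp: has_compact_support_iff)
  have "f' x v = 0" if "norm x > R" for x
  proof -
    have "open {x::'a. norm x > R}" by (intro open_Collect_less continuous_intros)
    then have "\<forall>\<^sub>F y in nhds x. f y = 0"
      using that R by (auto simp: eventually_nhds)
    then have "((\<lambda>_. 0) has_derivative f' x) (at x)"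
      using assms(2)[of x] that R
      by (intro has_derivative_transform_eventually[OF assms(2)[of x]]) (auto simp: eventually_at_filter elim: eventually_mono)
    then show ?thesis using has_derivative_unique[OF has_derivative_const] by metis
  qed
  then show ?thesis by (auto simp: has_compact_support_iff)
qed

text \<open>\<open>Ck\<close> speaks of each directional derivative separately, so the bound on the
  full derivative is assembled from the finitely many basis directions before the mean value
  inequality is applied.\<close>

lemma Ck1_compact_support_lipschitz:
  fixes f :: "'a::euclidean_space \<Rightarrow> real"
  assumes "Ck 1 f" "has_compact_support f"
  shows "\<exists>K\<ge>0. \<forall>x y. \<bar>f x - f y\<bar> \<le> K * norm (x - y)"
proof -
  obtain f' where f': "\<And>x. (f has_derivative f' x) (at x)" "\<And>v. continuous_on UNIV (\<lambda>x. f' x v)"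
    using assms by auto
  have "\<forall>b. \<exists>M\<ge>0. \<forall>x. \<bar>f' x b\<bar> \<le> M"
    using compact_support_bounded[OF f'(2) compact_support_derivative[OF assms(2) f'(1)]] by blast
  then obtain M where M: "\<And>b. M b \<ge> 0" "\<And>b x. \<bar>f' x b\<bar> \<le> M b" by metis
  have bl: "bounded_linear (f' x)" for x using f'(1) has_derivative_bounded_linear by blast
  have *: "norm (f' x v) \<le> (\<Sum>b\<in>Basis. M b) * norm v" for x v
  proof -
    interpret linear "f' x" using bl by (simp add: bounded_linear.linear)
    have "f' x v = f' x (\<Sum>b\<in>Basis. (v \<bullet> b) *\<^sub>R b)" by (simp add: euclidean_representation)
    also have "\<dots> = (\<Sum>b\<in>Basis. (v \<bullet> b) * f' x b)" by (simp add: sum scale)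
    also have "norm \<dots> \<le> (\<Sum>b\<in>Basis. norm v * M b)"
      by (intro sum_norm_le) (auto simp: abs_mult intro!: mult_mono M Basis_le_norm)
    finally show ?thesis by (simp add: sum_distrib_right mult.commute sum_distrib_left)
  qed
  have "norm (f x - f y) \<le> (\<Sum>b\<in>Basis. M b) * norm (x - y)" for x y
    by (rule differentiable_bound[where S = UNIV and f' = f'])
       (auto intro: f' onorm_bound * sum_nonneg M)
  then show ?thesis by (intro exI[of _ "\<Sum>b\<in>Basis. M b"]) (auto intro: sum_nonneg M)
qed

text \<open>For small \<open>w\<close> the Lipschitz continuity of the derivative gives the
  quadratic bound, for large \<open>w\<close> boundedness of \<open>f\<close> suffices. The minimum
  of the two is what makes second differences integrable against a kernel of order between 0 and
  2.\<close>

lemma second_difference_bound: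
  fixes f :: "'a::euclidean_space \<Rightarrow> real"
  assumes "Ck 2 f" "has_compact_support f"
  shows "\<exists>C\<ge>0. \<forall>x w. \<bar>f (x + w) + f (x - w) - 2 * f x\<bar> \<le> C * min 1 (norm w ^ 2)"
proof -
  have "Ck (Suc 1) f" using assms(1) by (simp only: Suc_1)
  then obtain f' where f': "\<And>x. (f has_derivative f' x) (at x)" "\<And>v. Ck 1 (\<lambda>x. f' x v)"
    by (simp only: Ck.simps) blast
  have "\<forall>b. \<exists>K\<ge>0. \<forall>x y. \<bar>f' x b - f' y b\<bar> \<le> K * norm (x - y)"
    using Ck1_compact_support_lipschitz[OF f'(2) compact_support_derivative[OF assms(2) f'(1)]] by blast
  then obtain K where K: "\<And>b. K b \<ge> 0" "\<And>b x y. \<bar>f' x b - f' y b\<bar> \<le> K b * norm (x - y)" by metis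
  define K' where "K' = (\<Sum>b\<in>Basis. K b)"
  have K'0: "K' \<ge> 0" unfolding K'_def by (intro sum_nonneg K)
  have *: "\<bar>f' x v - f' y v\<bar> \<le> K' * norm v * norm (x - y)" for x y v
  proof -
    have linear_deriv: "linear (f' x)" for x using f'(1) has_derivative_bounded_linear bounded_linear.linear by blast
    have rep: "f' x v = (\<Sum>b\<in>Basis. (v \<bullet> b) * f' x b)" for x
    proof -
      interpret linear "f' x" by (rule linear_deriv)
      have "f' x v = f' x (\<Sum>b\<in>Basis. (v \<bullet> b) *\<^sub>R b)" by (simp add: euclidean_representation)
      also have "\<dots> = (\<Sum>b\<in>Basis. (v \<bullet> b) * f' x b)" by (simp add: sum scale)
      finally show ?thesis .
    qed
    have "\<bar>f' x v - f' y v\<bar> = norm (\<Sum>b\<in>Basis. (v \<bullet> b) * (f' x b - f' y b))"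
      by (simp add: rep[of x] rep[of y] sum_subtractf algebra_simps)
    also have "\<dots> \<le> (\<Sum>b\<in>Basis. norm v * (K b * norm (x - y)))"
      by (intro sum_norm_le) (auto simp: abs_mult intro!: mult_mono K Basis_le_norm)
    finally show ?thesis by (simp add: K'_def sum_distrib_left sum_distrib_right mult_ac)
  qed
  obtain M where M: "M \<ge> 0" "\<And>x. \<bar>f x\<bar> \<le> M"
    using compact_support_bounded[OF Ck_imp_continuous[OF assms(1)] assms(2)] by blast
  have q: "\<bar>f (x + w) + f (x - w) - 2 * f x\<bar> \<le> 2 * K' * norm w ^ 2" for x w
  proof -
    \<comment> \<open>Between 0 and 1 this path runs from \<open>2 * f x\<close> to the sum of the
      two outer values, and its derivative compares \<open>f'\<close> at two points that are only
      \<open>2 * \<tau>\<close> times \<open>w\<close> apart.\<close>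
    let ?g = "\<lambda>\<tau>. f (x + \<tau> *\<^sub>R w) + f (x - \<tau> *\<^sub>R w)"
    have d: "(?g has_derivative (\<lambda>s. s * (f' (x + \<tau> *\<^sub>R w) w - f' (x - \<tau> *\<^sub>R w) w))) (at \<tau>)" for \<tau> :: real
    proof -
      have linear_deriv: "linear (f' x)" for x using f'(1) has_derivative_bounded_linear bounded_linear.linear by blast
      have "(?g has_derivative (\<lambda>s. f' (x + \<tau> *\<^sub>R w) (s *\<^sub>R w) + f' (x - \<tau> *\<^sub>R w) (- (s *\<^sub>R w)))) (at \<tau>)"
        by (intro has_derivative_add has_derivative_compose[OF _ f'(1)]) (auto intro!: derivative_eq_intros)
      then show ?thesis using linear_deriv
        by (simp add: linear_cmul linear_neg algebra_simps)
    qed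
    have "norm (?g 1 - ?g 0) \<le> (2 * K' * norm w ^ 2) * norm (1 - 0 :: real)"
    proof (rule differentiable_bound[where S = "{0..1}" and f' = "\<lambda>\<tau> s. s * (f' (x + \<tau> *\<^sub>R w) w - f' (x - \<tau> *\<^sub>R w) w)"])
      fix \<tau> :: real assume t: "\<tau> \<in> {0..1}"
      have "\<bar>f' (x + \<tau> *\<^sub>R w) w - f' (x - \<tau> *\<^sub>R w) w\<bar> \<le> K' * norm w * norm ((2 * \<tau>) *\<^sub>R w)"
        using *[of "x + \<tau> *\<^sub>R w" w "x - \<tau> *\<^sub>R w"] by (simp add: scaleR_add_left[symmetric])
      also have "\<dots> \<le> K' * norm w * (2 * norm w)"
        using t K'0 by (intro mult_left_mono) (auto intro!: mult_right_mono mult_left_le_one_le)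
      finally have "\<bar>f' (x + \<tau> *\<^sub>R w) w - f' (x - \<tau> *\<^sub>R w) w\<bar> \<le> 2 * K' * norm w ^ 2"
        by (simp add: power2_eq_square algebra_simps)
      then show "onorm (\<lambda>s. s * (f' (x + \<tau> *\<^sub>R w) w - f' (x - \<tau> *\<^sub>R w) w)) \<le> 2 * K' * norm w ^ 2"
        by (intro onorm_bound) (auto simp: abs_mult mult.commute intro: mult_left_mono K'0)
    qed (auto intro: has_derivative_at_withinI[OF d])
    then show ?thesis by simp
  qed
  show ?thesis
  proof (intro exI[of _ "2 * K' + 4 * M"] conjI allI)
    fix x w
    have "\<bar>f (x + w) + f (x - w) - 2 * f x\<bar> \<le> 4 * M"
      using M(2)[of "x + w"] M(2)[of "x - w"] M(2)[of x] by linarith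
    moreover have "2 * K' * norm w ^ 2 \<le> (2 * K' + 4 * M) * norm w ^ 2"
      using M by (intro mult_right_mono) auto
    ultimately show "\<bar>f (x + w) + f (x - w) - 2 * f x\<bar> \<le> (2 * K' + 4 * M) * min 1 (norm w ^ 2)"
      using q[of x w] M K'0 by (simp add: min_def)
  qed (use K'0 M in auto)
qed

text \<open>Smoothing without convolution: the quotient of \<open>F\<close> by a smooth bump
  \<open>\<omega>\<close> is approximated uniformly by a polynomial on a closed ball, and
  multiplying back by \<open>\<omega>\<close> restores smoothness and compact support. The radius
  \<open>R\<close> does not depend on the accuracy, so that a uniform error becomes an L1
  error.\<close>

lemma test_fun_dense:
  fixes F :: "'a::euclidean_space \<Rightarrow> real"
  assumes "continuous_on UNIV F" "has_compact_support F"
  shows "\<exists>R. (\<forall>x. norm x > R \<longrightarrow> F x = 0) \<and>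
    (\<forall>e>0. \<exists>G. test_fun G \<and> (\<forall>x. norm x > R \<longrightarrow> G x = 0) \<and> (\<forall>x. \<bar>F x - G x\<bar> \<le> e))"
proof -
  obtain R0 where R0: "\<And>x. norm x > R0 \<Longrightarrow> F x = 0" using assms(2) by (auto simp: has_compact_support_iff)
  define R where "R = max R0 0 + 1"
  define \<omega> where "\<omega> = (\<lambda>x::'a. flat_exp 1 (R ^ 2 - x \<bullet> x))"
  have "Ck k (\<lambda>x::'a. x \<bullet> x)" for k
    by (subst euclidean_inner) (intro Ck_sum Ck_mult Ck_bounded_linear bounded_linear_inner_left)
  then have "Ck k (\<lambda>x::'a. R^2 + (- 1) * (x \<bullet> x))" for k
    by (intro Ck_add Ck_const Ck_mult)
  then have chiC: "Ck k \<omega>" for k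
    unfolding \<omega>_def by (intro Ck_flat_exp) simp
  have R_pos: "R > 0" "R > R0" by (auto simp: R_def)
  have chi_pos: "\<omega> x > 0" if "norm x < R" for x
    using that R_pos by (auto simp: \<omega>_def flat_exp_def power2_norm_eq_inner[symmetric] power2_eq_square mult_strict_mono)
  have chi_0: "\<omega> x = 0" if "norm x \<ge> R" for x
  proof -
    have "R ^ 2 \<le> norm x ^ 2" using that R_pos by (intro power_mono) auto
    then show ?thesis by (simp add: \<omega>_def flat_exp_def power2_norm_eq_inner[symmetric])
  qed
  have chi_le: "0 \<le> \<omega> x" "\<omega> x \<le> 1" for x
    by (auto simp: \<omega>_def flat_exp_def)
  \<comment> \<open>Although \<open>\<omega>\<close> vanishes on the boundary sphere, the quotient
    is continuous up to it: beyond the smaller radius \<open>R0\<close> the numerator is 0, and so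
    is the quotient, also where the division is by zero.\<close>
  have cont: "continuous_on (cball 0 R) (\<lambda>x. F x / \<omega> x)"
  proof -
    have "continuous_on (ball 0 R) (\<lambda>x. F x / \<omega> x)"
      using chi_pos by (intro continuous_intros continuous_on_subset[OF assms(1)] continuous_on_subset[OF Ck_imp_continuous[OF chiC[of 0]]]) (auto simp: less_le)
    moreover have "continuous_on (- cball 0 R0) (\<lambda>x. F x / \<omega> x)"
      by (rule continuous_on_eq[of _ "\<lambda>_. 0"]) (auto simp: R0)
    ultimately have "continuous_on (ball 0 R \<union> - cball 0 R0) (\<lambda>x. F x / \<omega> x)"
      by (intro continuous_on_open_Un) auto
    then show ?thesis using R_pos by (elim continuous_on_subset) auto
  qed
  have "\<exists>G. test_fun G \<and> (\<forall>x. norm x > R \<longrightarrow> G x = 0) \<and> (\<forall>x. \<bar>F x - G x\<bar> \<le> e)" if "e > 0" for e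
  proof -
    obtain p where p: "real_polynomial_function p" "\<And>x. x \<in> cball 0 R \<Longrightarrow> \<bar>F x / \<omega> x - p x\<bar> < e"
      using Stone_Weierstrass_real_polynomial_function[OF compact_cball cont \<open>e > 0\<close>] by blast
    have s: "smooth (\<lambda>x. \<omega> x * p x)"
      unfolding smooth_def by (intro allI Ck_mult chiC Ck_polynomial p)
    have z: "\<omega> x * p x = 0" if "norm x > R" for x using chi_0[of x] that by simp
    have "\<bar>F x - \<omega> x * p x\<bar> \<le> e" for x
    proof (cases "norm x < R")
      case True
      have "F x - \<omega> x * p x = \<omega> x * (F x / \<omega> x - p x)"
        using chi_pos[OF True] by (simp add: field_simps)
      also have "\<bar>\<dots>\<bar> \<le> 1 * e" unfolding abs_mult
        using p(2)[of x] True chi_le[of x] by (intro mult_mono) auto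
      finally show ?thesis by simp
    next
      case False
      then show ?thesis using R0[of x] chi_0[of x] R_pos \<open>e > 0\<close> by simp
    qed
    then show ?thesis using s z by (intro exI[of _ "\<lambda>x. \<omega> x * p x"]) (auto simp: test_fun_def has_compact_support_iff)
  qed
  moreover have "\<forall>x. norm x > R \<longrightarrow> F x = 0" using R0 R_pos by auto
  ultimately show ?thesis by blast
qed

lemma plateau_function:
  fixes T :: real
  shows "\<exists>\<theta>::real \<Rightarrow> real. test_fun \<theta> \<and> (\<forall>s. -1 < s \<and> s < T + 1 \<longrightarrow> \<theta> s = 1)"
proof -
  define e where "e = flat_exp 1"
  have e0: "e t = 0" if "t \<le> 0" for t using that by (simp add: e_def flat_exp_def)
  have e1: "e t \<ge> exp (-1)" if "t \<ge> 1" for t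
  proof -
    have "inverse t \<le> 1" using that by (simp add: inverse_le_1_iff)
    then show ?thesis using that by (simp add: e_def flat_exp_def)
  qed
  have enn: "e t \<ge> 0" for t by (simp add: e_def flat_exp_def)
  \<comment> \<open>Here e(t) is exp(-1/t) for positive t. On the plateau the inner sum vanishes and
    the value is exp(1) times e(1), that is 1. Far out the inner sum is at least exp(-1), so the
    outer argument is at most 0 and \<open>\<theta>\<close> vanishes.\<close>
  define \<theta> where "\<theta> = (\<lambda>s. exp 1 * e (1 + (- exp 1) * (e (s + (- T - 1)) + e (- s + (- 1)))))"
  have id: "Ck k (\<lambda>s::real. s + c)" "Ck k (\<lambda>s::real. - s + c)" for k c
    by (intro Ck_add Ck_const Ck_bounded_linear bounded_linear_ident bounded_linear_minus)+
  have "Ck k \<theta>" for k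
    unfolding \<theta>_def e_def by (intro Ck_mult Ck_add Ck_const Ck_flat_exp id)
  moreover have "\<theta> s = 1" if "-1 < s" "s < T + 1" for s
  proof -
    have "e (s + (- T - 1)) = 0" "e (- s + (- 1)) = 0" using that by (auto intro!: e0)
    then show ?thesis by (simp add: \<theta>_def e_def flat_exp_def exp_minus)
  qed
  moreover have "\<theta> s = 0" if "norm s > \<bar>T\<bar> + 2" for s
  proof -
    have "exp (-1) \<le> e (s + (- T - 1)) + e (- s + (- 1))"
    proof (cases "s > 0")
      case True
      then have "e (s + (- T - 1)) \<ge> exp (-1)" using that by (intro e1) auto
      then show ?thesis using enn[of "- s + (- 1)"] by linarith
    next
      case False
      then have "e (- s + (- 1)) \<ge> exp (-1)" using that by (intro e1) auto
      then show ?thesis using enn[of "s + (- T - 1)"] by linarith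
    qed
    then have "exp 1 * exp (-1) \<le> exp 1 * (e (s + (- T - 1)) + e (- s + (- 1)))"
      by (intro mult_left_mono) auto
    then show ?thesis by (simp add: \<theta>_def e0 exp_minus)
  qed
  ultimately show ?thesis
    by (intro exI[of _ \<theta>]) (auto simp: test_fun_def smooth_def has_compact_support_iff)
qed

section \<open>Rounding to the lattice\<close>

definition cell_index :: "nat \<Rightarrow> real^'d \<Rightarrow> int^'d" where
  "cell_index n x = (\<chi> i. round (real n * x $ i))"

definition lattice_point :: "nat \<Rightarrow> int^'d \<Rightarrow> real^'d" where
  "lattice_point n z = (1 / real n) *\<^sub>R site_to_real z"

definition lattice_round :: "nat \<Rightarrow> real^'d \<Rightarrow> real^'d" where
  "lattice_round n x = lattice_point n (cell_index n x)"

lemma site_to_real_simps [simp]: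
  "site_to_real 0 = 0" "site_to_real (- z) = - site_to_real z"
  "site_to_real (z + w) = site_to_real z + site_to_real w"
  "site_to_real (z - w) = site_to_real z - site_to_real w"
  by (auto simp: site_to_real_def vec_eq_iff)

lemma site_to_real_eq_iff [simp]: "site_to_real z = site_to_real w \<longleftrightarrow> z = w"
  by (auto simp: site_to_real_def vec_eq_iff)

lemma site_to_real_eq_0_iff [simp]: "site_to_real z = 0 \<longleftrightarrow> z = 0"
  using site_to_real_eq_iff[of z 0] by simp

lemma lattice_point_simps [simp]:
  "lattice_point n 0 = 0" "lattice_point n (- z) = - lattice_point n z"
  "lattice_point n (z + w) = lattice_point n z + lattice_point n w"
  "lattice_point n (z - w) = lattice_point n z - lattice_point n w"
  by (auto simp: lattice_point_def scaleR_add_right scaleR_diff_right)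

lemma lattice_point_eq_0_iff: "n > 0 \<Longrightarrow> lattice_point n z = 0 \<longleftrightarrow> z = 0"
  by (simp add: lattice_point_def)

lemma cell_eq:
  assumes "n > 0"
  shows "cell_index n x = z \<longleftrightarrow>
    (\<forall>i. (of_int (z $ i) - 1/2) / real n \<le> x $ i \<and> x $ i < (of_int (z $ i) + 1/2) / real n)"
proof -
  have "round (real n * x $ i) = z $ i \<longleftrightarrow>
      (of_int (z $ i) - 1/2) / real n \<le> x $ i \<and> x $ i < (of_int (z $ i) + 1/2) / real n" for i
    using assms unfolding round_def floor_eq_iff by (auto simp: field_simps)
  then show ?thesis by (simp add: cell_index_def vec_eq_iff)
qed

lemma cell_sets: "n > 0 \<Longrightarrow> {x. cell_index n x = z} \<in> sets borel"
proof -
  assume "n > 0"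
  then have "{x. cell_index n x = z} = (\<Inter>i. {x. (of_int (z $ i) - 1/2) / real n \<le> x $ i} \<inter> {x. x $ i < (of_int (z $ i) + 1/2) / real n})"
    by (auto simp: cell_eq)
  also have "\<dots> \<in> sets borel"
    by (intro sets.finite_INT sets.Int) (auto intro!: borel_closed borel_open closed_Collect_le open_Collect_less continuous_intros)
  finally show ?thesis .
qed

lemma cell_index_measurable: "n > 0 \<Longrightarrow> cell_index n \<in> measurable borel (count_space UNIV)"
proof -
  assume n: "n > 0"
  have "cell_index n -` {z} = {x. cell_index n x = z}" for z :: "int^'a" by auto
  then show ?thesis using cell_sets[OF n]
    by (subst measurable_count_space_eq_countable) auto
qed

text \<open>A cell is half open, hence lies between an open and a closed box with the same corners,
  and these have equal volume.\<close>

lemma emeasure_cell: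
  fixes z :: "int^'d"
  assumes "n > 0"
  shows "emeasure lborel {x. cell_index n x = z} = ennreal (1 / real n ^ CARD('d))"
proof -
  define l u :: "real^'d" where "l = (\<chi> i. (of_int (z $ i) - 1/2) / real n)"
    and "u = (\<chi> i. (of_int (z $ i) + 1/2) / real n)"
  have d: "(u - l) \<bullet> b = 1 / real n" if "b \<in> Basis" for b
    using that assms by (auto simp: Basis_vec_def inner_axis l_def u_def diff_divide_distrib[symmetric])
  have le: "l \<bullet> b \<le> u \<bullet> b" if "b \<in> Basis" for b
    using that by (auto simp: Basis_vec_def inner_axis l_def u_def intro!: divide_right_mono)
  have p: "(\<Prod>b\<in>Basis. (u - l) \<bullet> b) = 1 / real n ^ CARD('d)"
    using d by (simp add: power_one_over)
  have "emeasure lborel (box l u) \<le> emeasure lborel {x. cell_index n x = z}"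
    by (intro emeasure_mono) (use assms cell_sets in \<open>auto simp: cell_eq mem_box_cart l_def u_def intro: less_imp_le\<close>)
  moreover have "emeasure lborel {x. cell_index n x = z} \<le> emeasure lborel (cbox l u)"
    by (intro emeasure_mono) (use assms in \<open>auto simp: cell_eq mem_box_cart l_def u_def le_less\<close>)
  ultimately show ?thesis
    using p le by (simp add: emeasure_lborel_cbox emeasure_lborel_box)
qed

text \<open>The bridge between sums and integrals: lattice sums become integrals of functions of the
  rounded point, so that they and their continuum limits can be compared on one measure
  space.\<close>

lemma distr_cell_index:
  assumes "n > 0"
  shows "distr lborel (count_space UNIV) (cell_index n :: real^'d \<Rightarrow> int^'d) =
    density (count_space UNIV) (\<lambda>_. ennreal (1 / real n ^ CARD('d)))"
proof (rule measure_eqI_countable[where A = UNIV])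
  fix z :: "int^'d"
  have "cell_index n -` {z} = {x. cell_index n x = z}" by auto
  then show "emeasure (distr lborel (count_space UNIV) (cell_index n)) {z} =
      emeasure (density (count_space UNIV) (\<lambda>_. ennreal (1 / real n ^ CARD('d)))) {z}"
    using assms emeasure_cell[OF assms, of z]
    by (simp add: emeasure_distr cell_index_measurable emeasure_density)
qed auto

lemma lattice_integrable_iff:
  fixes f :: "int^'d \<Rightarrow> real"
  assumes "n > 0"
  shows "integrable lborel (\<lambda>x. f (cell_index n x)) \<longleftrightarrow> integrable (count_space UNIV) f"
proof -
  have "integrable lborel (\<lambda>x. f (cell_index n x)) \<longleftrightarrow> integrable (distr lborel (count_space UNIV) (cell_index n)) f"
    by (rule integrable_distr_eq[symmetric]) (auto intro: cell_index_measurable assms)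
  also have "\<dots> \<longleftrightarrow> integrable (count_space UNIV) (\<lambda>z. (1 / real n ^ CARD('d)) *\<^sub>R f z)"
    unfolding distr_cell_index[OF assms] by (rule integrable_density) auto
  finally show ?thesis using assms by (simp add: integrable_mult_right_iff divide_inverse_commute)
qed

lemma lattice_integral:
  fixes f :: "int^'d \<Rightarrow> real"
  assumes "n > 0"
  shows "(\<integral>x. f (cell_index n x) \<partial>lborel) = (1 / real n ^ CARD('d)) * (\<integral>z. f z \<partial>count_space UNIV)"
proof -
  have "(\<integral>x. f (cell_index n x) \<partial>lborel) = (\<integral>z. f z \<partial>distr lborel (count_space UNIV) (cell_index n))"
    by (rule integral_distr[symmetric]) (auto intro: cell_index_measurable assms)
  also have "\<dots> = (\<integral>z. (1 / real n ^ CARD('d)) *\<^sub>R f z \<partial>count_space UNIV)"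
    unfolding distr_cell_index[OF assms] by (rule integral_density) auto
  finally show ?thesis by simp
qed

lemma lattice_round_measurable: "n > 0 \<Longrightarrow> lattice_round n \<in> borel_measurable borel"
proof -
  assume n: "n > 0"
  have "(\<lambda>x. lattice_point n (cell_index n x)) \<in> measurable lborel borel"
    by (simp, rule measurable_compose[OF cell_index_measurable[OF n]]) auto
  then show ?thesis by (simp add: lattice_round_def[abs_def])
qed

lemma lattice_round_coord:
  "n > 0 \<Longrightarrow> lattice_round n x $ i = of_int (round (real n * x $ i)) / real n"
  by (simp add: lattice_round_def lattice_point_def cell_index_def site_to_real_def)

text \<open>A nonzero rounded value forces \<open>x\<close> to be at least 1/2 in absolute value, so
  an error of at most 1/2 can at most double it.\<close>

lemma abs_round_le: "\<bar>of_int (round x)\<bar> \<le> 2 * \<bar>x :: real\<bar>"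
proof (cases "round x = 0")
  case False
  have "\<bar>of_int (round x) - x\<bar> \<le> 1/2" by (rule of_int_round_abs_le)
  moreover have "\<bar>of_int (round x)\<bar> \<ge> (1::real)" using False by linarith
  ultimately show ?thesis by linarith
qed auto

lemma norm_lattice_round_le: "n > 0 \<Longrightarrow> norm (lattice_round n x) \<le> 2 * norm x"
proof -
  assume n: "n > 0"
  have "norm (lattice_round n x) \<le> norm (2 *\<^sub>R x)"
    using abs_round_le[of "real n * x $ i" for i] n
    by (intro norm_le_componentwise_cart) (auto simp: lattice_round_coord abs_mult field_simps)
  then show ?thesis by simp
qed

lemma lattice_round_coord_diff:
  assumes "n > 0"
  shows "\<bar>lattice_round n x $ i - x $ i\<bar> \<le> 1 / real n"
proof -
  have "lattice_round n x $ i - x $ i = (of_int (round (real n * x $ i)) - real n * x $ i) / real n"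
    using assms by (simp add: lattice_round_coord field_simps)
  also have "\<bar>\<dots>\<bar> = \<bar>of_int (round (real n * x $ i)) - real n * x $ i\<bar> / real n" by simp
  also have "\<dots> \<le> (1/2) / real n" by (intro divide_right_mono of_int_round_abs_le) auto
  finally show ?thesis using assms by (simp add: field_simps)
qed

lemma norm_lattice_round_diff:
  fixes x :: "real^'d"
  assumes "n > 0"
  shows "norm (lattice_round n x - x) \<le> real CARD('d) / real n"
proof -
  have "\<bar>(lattice_round n x - x) $ i\<bar> \<le> 1 / real n" for i
    using lattice_round_coord_diff[OF assms] by simp
  then have "(\<Sum>i\<in>UNIV. \<bar>(lattice_round n x - x) $ i\<bar>) \<le> (\<Sum>i\<in>(UNIV::'d set). 1 / real n)"
    by (intro sum_mono)
  then show ?thesis using norm_le_l1_cart[of "lattice_round n x - x"] by simp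
qed

text \<open>A nonzero lattice vector has norm at least 1/n, which absorbs the rounding error in
  every coordinate. The bound controls the singular factor of the kernel: rounding a jump to a
  nonzero lattice vector cannot bring it much closer to the origin. The dimension enters by
  estimating the Euclidean norm by the l1 norm.\<close>

lemma norm_le_lattice_round:
  fixes x :: "real^'d"
  assumes "n > 0" "lattice_round n x \<noteq> 0"
  shows "norm x \<le> 2 * real CARD('d) * norm (lattice_round n x)"
proof -
  let ?r = "lattice_round n x"
  obtain j where "?r $ j \<noteq> 0" using assms by (auto simp: vec_eq_iff)
  then have "round (real n * x $ j) \<noteq> 0" using assms by (auto simp: lattice_round_coord)
  then have "1 \<le> \<bar>round (real n * x $ j)\<bar>" by linarith
  then have "1 \<le> real_of_int \<bar>round (real n * x $ j)\<bar>" by linarith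
  then have "1 / real n \<le> \<bar>?r $ j\<bar>" using assms by (simp add: lattice_round_coord field_simps)
  also have "\<dots> \<le> norm ?r" by (rule component_le_norm_cart)
  finally have j: "1 / real n \<le> norm ?r" .
  have "\<bar>x $ i\<bar> \<le> 2 * norm ?r" for i
  proof -
    have "\<bar>x $ i - ?r $ i\<bar> \<le> 1 / real n"
      using lattice_round_coord_diff[OF assms(1), of x i] by linarith
    moreover have "\<bar>?r $ i\<bar> \<le> norm ?r" by (rule component_le_norm_cart)
    ultimately show ?thesis using j by linarith
  qed
  then have "(\<Sum>i\<in>UNIV. \<bar>x $ i\<bar>) \<le> (\<Sum>i\<in>(UNIV::'d set). 2 * norm ?r)"
    by (intro sum_mono)
  then show ?thesis using norm_le_l1_cart[of x] by simp
qed

lemma lattice_round_tendsto: "(\<lambda>n. lattice_round n x) \<longlonglongrightarrow> x"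
proof (rule Lim_null[THEN iffD2], rule Lim_null_comparison)
  show "\<forall>\<^sub>F n in sequentially. norm (lattice_round n x - x) \<le> real CARD('a) / real n"
    using eventually_gt_at_top[of 0] by (rule eventually_mono) (rule norm_lattice_round_diff)
  show "(\<lambda>n. real CARD('a) / real n) \<longlonglongrightarrow> 0"
    by (intro tendsto_divide_0[OF tendsto_const] filterlim_at_top_imp_at_infinity filterlim_real_sequentially)
qed

section \<open>Integrability of the Levy weight\<close>

lemma dyadic_small:
  assumes "0 < r" "r \<le> (1::real)"
  shows "\<exists>k. (1/2)^(Suc k) < r \<and> r \<le> (1/2)^k"
proof -
  obtain n where n: "(1/2)^n < r" using real_arch_pow_inv[of r "1/2"] assms by auto
  define m where "m = (LEAST n. (1/2)^n < r)"
  have m: "(1/2)^m < r" unfolding m_def by (rule LeastI[of _ n]) (rule n)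
  have "m \<noteq> 0" using m assms by (intro notI) auto
  then obtain k where k: "m = Suc k" by (cases m) auto
  have "\<not> (1/2)^k < r" using not_less_Least[of k "\<lambda>n. (1/2)^n < r"] k by (simp add: m_def)
  then show ?thesis using m k by auto
qed

lemma dyadic_large:
  assumes "1 < (r::real)"
  shows "\<exists>k. 2^k < r \<and> r \<le> 2^(Suc k)"
proof -
  obtain n where n: "r < 2^n" using real_arch_pow[of 2 r] by auto
  define m where "m = (LEAST n. r \<le> 2^n)"
  have m: "r \<le> 2^m" unfolding m_def by (rule LeastI[of _ n]) (use n in auto)
  have "m \<noteq> 0" using m assms by (intro notI) auto
  then obtain k where k: "m = Suc k" by (cases m) auto
  have "\<not> r \<le> 2^k" using not_less_Least[of k "\<lambda>n. r \<le> 2^n"] k by (simp add: m_def)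
  then show ?thesis using m k by (intro exI[of _ k]) auto
qed

text \<open>Dyadic balls replace polar coordinates. The balls of radius 2^(-k) contribute a
  geometric series with ratio 2^(\<alpha>-2), the balls of radius 2^(k+1) one with ratio
  2^(-\<alpha>); they converge because \<alpha> < 2 and \<alpha> > 0.\<close>

lemma levy_weight_integrable:
  assumes "0 < \<alpha>" "\<alpha> < 2"
  shows "integrable lborel (\<lambda>y::'a::euclidean_space. min 1 (norm y ^ 2) * norm y powr (- (real DIM('a) + \<alpha>)))"
    (is "integrable lborel ?f")
proof -
  define d where "d = DIM('a)"
  define V where "V = unit_ball_vol (real d)"
  have V0: "V \<ge> 0" by (simp add: V_def)
  define a where "a = (\<lambda>k::nat. ((1/2)^k)^2 * ((1/2)^(Suc k)) powr (- (real d + \<alpha>)))"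
  define b where "b = (\<lambda>k::nat. ((2::real)^k) powr (- (real d + \<alpha>)))"
  have a0: "a k \<ge> 0" "b k \<ge> 0" for k by (auto simp: a_def b_def)
  have p1: "(1/2)^k = 2 powr (- real k)" for k :: nat
    by (simp add: powr_minus_divide powr_realpow power_one_over)
  have p2: "2^k = 2 powr (real k)" for k :: nat by (simp add: powr_realpow)
  have p3: "(2 powr c)^k = 2 powr (c * real k)" for c and k :: nat
    by (simp add: powr_power mult.commute)
  have ak: "a k * (V * ((1/2)^k)^d) = V * 2 powr (real d + \<alpha>) * (2 powr (\<alpha> - 2))^k" for k
    unfolding a_def p1 p3 powr_powr using V0
    by (simp add: powr_add[symmetric] algebra_simps)
  have bk: "b k * (V * (2^(Suc k))^d) = V * 2 powr (real d) * (2 powr (- \<alpha>))^k" for k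
    unfolding b_def p2 p3 powr_powr using V0
    by (simp add: powr_add[symmetric] algebra_simps)
  have sa: "summable (\<lambda>k. a k * (V * ((1/2)^k)^d))"
    unfolding ak using assms by (intro summable_mult summable_geometric) (simp add: powr_less_one)
  have sb: "summable (\<lambda>k. b k * (V * (2^(Suc k))^d))"
    unfolding bk using assms by (intro summable_mult summable_geometric) (simp add: powr_less_one)
  \<comment> \<open>The shells are enlarged to full balls, which costs only a constant.
    \<open>a k\<close> takes the outer radius in the square and the inner radius in the negative
    power.\<close>
  let ?A = "\<lambda>k y. ennreal (a k) * indicator (cball (0::'a) ((1/2)^k)) y"
  let ?B = "\<lambda>k y. ennreal (b k) * indicator (cball (0::'a) (2^(Suc k))) y"
  have bound: "ennreal (?f y) \<le> (\<Sum>k. ?A k y) + (\<Sum>k. ?B k y)" for y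
  proof (cases "y = 0")
    case False
    show ?thesis
    proof (cases "norm y \<le> 1")
      case True
      obtain k where k: "(1/2)^(Suc k) < norm y" "norm y \<le> (1/2)^k" using dyadic_small[OF _ True] False by auto
      have "?f y \<le> norm y ^ 2 * norm y powr (- (real d + \<alpha>))" unfolding d_def
        by (intro mult_right_mono) auto
      also have "\<dots> \<le> a k" unfolding a_def using k assms False
        by (intro mult_mono power_mono powr_mono2') auto
      finally have "ennreal (?f y) \<le> ?A k y" using k by (simp add: indicator_def ennreal_leI)
      also have "\<dots> \<le> (\<Sum>k. ?A k y)" using sum_le_suminf[of "\<lambda>k. ?A k y" "{k}"]
        by (simp del: indicator_simps sum_mult_indicator)
      finally show ?thesis by (simp add: add_increasing2)
    next
      case nt: False
      obtain k where k: "2^k < norm y" "norm y \<le> 2^(Suc k)" using dyadic_large[of "norm y"] nt by auto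
      have "?f y \<le> 1 * norm y powr (- (real d + \<alpha>))" unfolding d_def
        by (intro mult_right_mono) auto
      also have "\<dots> \<le> b k" unfolding b_def using k assms False
        by (simp, intro powr_mono2') auto
      finally have "ennreal (?f y) \<le> ?B k y" using k by (simp add: indicator_def ennreal_leI)
      also have "\<dots> \<le> (\<Sum>k. ?B k y)" using sum_le_suminf[of "\<lambda>k. ?B k y" "{k}"]
        by (simp del: indicator_simps sum_mult_indicator)
      finally show ?thesis by (simp add: add_increasing)
    qed
  qed auto
  have "(\<integral>\<^sup>+ y. ennreal (?f y) \<partial>lborel) \<le> (\<integral>\<^sup>+ y. (\<Sum>k. ?A k y) + (\<Sum>k. ?B k y) \<partial>lborel)"
    by (intro nn_integral_mono bound)
  also have "\<dots> = (\<Sum>k. \<integral>\<^sup>+ y. ?A k y \<partial>lborel) + (\<Sum>k. \<integral>\<^sup>+ y. ?B k y \<partial>lborel)"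
  proof -
    have m: "?A k \<in> borel_measurable lborel" "?B k \<in> borel_measurable lborel" for k
      by (simp_all add: borel_measurable_indicator borel_measurable_times_ennreal)
    then have "(\<lambda>y. \<Sum>k. ?A k y) \<in> borel_measurable lborel" "(\<lambda>y. \<Sum>k. ?B k y) \<in> borel_measurable lborel"
      by (auto intro: borel_measurable_suminf_order)
    then show ?thesis using m by (simp only: nn_integral_add nn_integral_suminf)
  qed
  also have "(\<lambda>k. \<integral>\<^sup>+ y. ?A k y \<partial>lborel) = (\<lambda>k. ennreal (a k * (V * ((1/2)^k)^d)))"
    using a0 V0 by (auto simp: nn_integral_cmult_indicator emeasure_cball V_def d_def ennreal_mult)
  also have "(\<lambda>k. \<integral>\<^sup>+ y. ?B k y \<partial>lborel) = (\<lambda>k. ennreal (b k * (V * (2^(Suc k))^d)))"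
    using a0 V0 by (auto simp: nn_integral_cmult_indicator emeasure_cball V_def d_def ennreal_mult simp del: power_Suc)
  also have "(\<Sum>k. ennreal (a k * (V * ((1/2)^k)^d))) + (\<Sum>k. ennreal (b k * (V * (2^(Suc k))^d))) < \<infinity>"
  proof -
    have "(\<Sum>k. ennreal (a k * (V * ((1/2)^k)^d))) = ennreal (\<Sum>k. a k * (V * ((1/2)^k)^d))"
      by (rule suminf_ennreal2[OF _ sa]) (simp add: a0 V0)
    moreover have "(\<Sum>k. ennreal (b k * (V * (2^(Suc k))^d))) = ennreal (\<Sum>k. b k * (V * (2^(Suc k))^d))"
      by (rule suminf_ennreal2[OF _ sb]) (simp add: a0 V0)
    ultimately show ?thesis by (simp only: infinity_ennreal_def ennreal_add_less_top ennreal_less_top)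
  qed
  finally have fin: "(\<integral>\<^sup>+ y. ennreal (?f y) \<partial>lborel) < \<infinity>" .
  have "?f \<in> borel_measurable lborel"
    by measurable
  then show ?thesis
    using fin by (intro integrableI_nonneg) auto
qed

section \<open>The jump kernel and its scaling\<close>

locale levy_kernel =
  fixes h :: "real^'d \<Rightarrow> real" and \<alpha> :: real
  assumes alpha: "0 < \<alpha>" "\<alpha> < 2"
    and h_cont: "continuous_on (UNIV - {0}) h"
    and h_pos: "\<And>x. x \<noteq> 0 \<Longrightarrow> h x > 0"
    and h_even: "\<And>x. x \<noteq> 0 \<Longrightarrow> h (- x) = h x"
    and h_hom: "\<And>x c. x \<noteq> 0 \<Longrightarrow> c > 0 \<Longrightarrow>
                   h (c *\<^sub>R x) = c powr (- (real CARD('d) + \<alpha>)) * h x"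
begin

text \<open>\<open>h\<close> is unconstrained at the origin. The value 0 there makes the kernel
  total and measurable, and agrees with the absence of jumps of length 0 in
  \<open>jump_rate\<close>.\<close>

definition h0 :: "real^'d \<Rightarrow> real" where
  "h0 y = (if y = 0 then 0 else h y)"

lemma h0_nonneg: "h0 y \<ge> 0"
  using h_pos[of y] by (auto simp: h0_def)

lemma h0_even: "h0 (- y) = h0 y"
  using h_even[of y] by (auto simp: h0_def)

lemma h0_measurable [measurable]: "h0 \<in> borel_measurable borel"
proof -
  have "(\<lambda>x. if x \<in> UNIV - {0} then h x else 0) \<in> borel_measurable borel"
    by (intro borel_measurable_continuous_on_if h_cont) auto
  then show ?thesis by (rule measurable_cong[THEN iffD1, rotated]) (auto simp: h0_def)
qed

text \<open>Continuity bounds \<open>h\<close> on the compact unit sphere, and homogeneity carries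
  the bound along rays.\<close>

lemma h0_bound: "\<exists>H\<ge>0. \<forall>y. h0 y \<le> H * norm y powr (- (real CARD('d) + \<alpha>))"
proof -
  have "compact (h ` sphere 0 1)"
    by (intro compact_continuous_image continuous_on_subset[OF h_cont]) auto
  then have "bounded (h ` sphere 0 1)" by (rule compact_imp_bounded)
  then obtain H where H: "\<And>y. norm y = 1 \<Longrightarrow> norm (h y) \<le> H"
    unfolding bounded_iff by (auto simp: sphere_def)
  have "h0 y \<le> max H 0 * norm y powr (- (real CARD('d) + \<alpha>))" for y
  proof (cases "y = 0")
    case False
    have "h y = h (norm y *\<^sub>R ((1 / norm y) *\<^sub>R y))" using False by simp
    also have "\<dots> = norm y powr (- (real CARD('d) + \<alpha>)) * h ((1 / norm y) *\<^sub>R y)"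
      using False by (intro h_hom) auto
    also have "\<dots> \<le> norm y powr (- (real CARD('d) + \<alpha>)) * max H 0"
      using H[of "(1 / norm y) *\<^sub>R y"] False by (intro mult_left_mono) auto
    finally show ?thesis using False by (simp add: h0_def mult.commute)
  qed (simp add: h0_def)
  then show ?thesis by (intro exI[of _ "max H 0"]) auto
qed

text \<open>This explains the time scale: n^\<alpha> times the jump rate of \<open>z\<close> equals
  n^(-d) times \<open>h0\<close> at the rescaled jump, so the generator speeded up by n^\<alpha> is
  a Riemann sum for the fractional operator.\<close>

lemma h0_scale: "n > 0 \<Longrightarrow> h0 (lattice_point n z) = real n powr (real CARD('d) + \<alpha>) * jump_rate h z"
proof (cases "z = 0")
  case False
  assume n: "n > 0"
  have "h (lattice_point n z) = (1 / real n) powr (- (real CARD('d) + \<alpha>)) * h (site_to_real z)"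
    unfolding lattice_point_def using n False by (intro h_hom) auto
  also have "(1 / real n) powr (- (real CARD('d) + \<alpha>)) = real n powr (real CARD('d) + \<alpha>)"
    using n by (simp only: powr_minus powr_divide) simp
  finally show ?thesis using False n by (simp add: h0_def jump_rate_def lattice_point_eq_0_iff)
qed (simp add: h0_def jump_rate_def)

end

section \<open>The fractional operator and its lattice approximations\<close>

lemma lborel_translate:
  fixes f :: "'a::euclidean_space \<Rightarrow> real"
  shows "integrable lborel f \<Longrightarrow> integrable lborel (\<lambda>x. f (x + c))"
    and "f \<in> borel_measurable borel \<Longrightarrow> (\<integral>x. f (x + c) \<partial>lborel) = (\<integral>x. f x \<partial>lborel)"
proof -
  have d: "distr lborel borel ((+) c) = (lborel :: 'a measure)" by (rule lborel_distr_plus)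
  show "integrable lborel (\<lambda>x. f (x + c))" if "integrable lborel f"
  proof -
    have "integrable (distr lborel borel ((+) c)) f" using that by (simp add: d)
    then show ?thesis by (subst (asm) integrable_distr_eq) (use that in \<open>auto simp: add.commute\<close>)
  qed
  show "(\<integral>x. f (x + c) \<partial>lborel) = (\<integral>x. f x \<partial>lborel)" if "f \<in> borel_measurable borel"
  proof -
    have "(\<integral>x. f x \<partial>lborel) = (\<integral>x. f x \<partial>(distr lborel borel ((+) c)))" by (simp add: d)
    also have "\<dots> = (\<integral>x. f (c + x) \<partial>lborel)" by (rule integral_distr) (use that in auto)
    finally show ?thesis by (simp add: add.commute)
  qed
qed

definition second_diff :: "('a::real_vector \<Rightarrow> real) \<Rightarrow> 'a \<Rightarrow> 'a \<Rightarrow> real" where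
  "second_diff F x w = F (x + w) + F (x - w) - 2 * F x"

section \<open>Domination of all approximating operators at once\<close>

context levy_kernel
begin

definition weight :: "real^'d \<Rightarrow> real" where
  "weight y = min 1 (norm y ^ 2) * norm y powr (- (real CARD('d) + \<alpha>))"

lemma weight_nonneg: "weight y \<ge> 0"
  by (simp add: weight_def)

lemma weight_integrable: "integrable lborel weight"
  using levy_weight_integrable[OF alpha, where 'a = "real^'d"] by (simp add: weight_def[abs_def])

lemma weight_measurable [measurable]: "weight \<in> borel_measurable borel"
  using borel_measurable_integrable[OF weight_integrable] by simp

text \<open>Conditions under which a perturbed jump \<open>y'\<close> may replace \<open>y\<close>
  in the estimates: the first bounds the shift of the arguments, the second protects the quadratic
  factor, the third the singular factor. The value 0 is allowed for \<open>y'\<close> because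
  \<open>h0\<close> vanishes there.\<close>

definition comparable :: "real \<Rightarrow> real^'d \<Rightarrow> real^'d \<Rightarrow> bool" where
  "comparable c y' y \<longleftrightarrow> norm (y' - y) \<le> c \<and> norm y' \<le> 2 * norm y \<and> (y' = 0 \<or> norm y \<le> c * norm y')"

lemma comparable_self: "c \<ge> 1 \<Longrightarrow> comparable c y y"
  by (auto simp: comparable_def mult_right_le_one_le)
     (metis mult_1 mult_right_mono norm_ge_zero)

lemma comparable_lattice_round: "n > 0 \<Longrightarrow> comparable (2 * real CARD('d)) (lattice_round n y) y"
proof -
  assume n: "n > 0"
  have "norm (lattice_round n y - y) \<le> real CARD('d) / real n" by (rule norm_lattice_round_diff[OF n])
  also have "\<dots> \<le> 2 * real CARD('d)" using n by (simp add: field_simps)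
  finally show ?thesis using norm_lattice_round_le[OF n] norm_le_lattice_round[OF n] by (auto simp: comparable_def)
qed

text \<open>One bound serves every rounded, truncated or shifted operator, which is what permits a
  single dominated convergence. A second difference is nonzero only if one of its three arguments
  meets the support of \<open>G\<close>; this accounts for the three indicators, and the
  perturbations of point and jump enlarge the radius by \<open>2 * c\<close>.\<close>

lemma kernel_bound:
  fixes G :: "real \<times> (real^'d) \<Rightarrow> real"
  assumes G: "test_fun G" and c: "c \<ge> 1"
  shows "\<exists>K R. K \<ge> 0 \<and> (\<forall>s x y x' y'. norm (x' - x) \<le> c \<longrightarrow> comparable c y' y \<longrightarrow>
    \<bar>h0 y' * second_diff (\<lambda>x. G (s, x)) x' y'\<bar> \<le>
      K * weight y * (indicator (cball 0 R) x + indicator (cball 0 R) (x + y) + indicator (cball 0 R) (x - y)))"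
proof -
  obtain H where H: "H \<ge> 0" "\<And>y. h0 y \<le> H * norm y powr (- (real CARD('d) + \<alpha>))" using h0_bound by blast
  obtain C where C: "C \<ge> 0" "\<And>x w. \<bar>G (x + w) + G (x - w) - 2 * G x\<bar> \<le> C * min 1 (norm w ^ 2)"
    using second_difference_bound[of G] G by (auto simp: test_fun_def smooth_def)
  obtain R where R: "\<And>x. norm x > R \<Longrightarrow> G x = 0" using G by (auto simp: test_fun_def has_compact_support_iff)
  have R': "G (s, x) = 0" if "norm x > R" for s x
    using that norm_snd_le[of x s] R[of "(s, x)"] by simp
  \<comment> \<open>The factor 4 stems from squaring \<open>norm y' \<le> 2 * norm y\<close>, the
    power of \<open>c\<close> from \<open>norm y \<le> c * norm y'\<close> under the negative
    exponent.\<close>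
  define K where "K = 4 * C * H * c powr (real CARD('d) + \<alpha>)"
  have K0: "K \<ge> 0" using C H by (simp add: K_def)
  show ?thesis
  proof (rule exI[of _ K], rule exI[of _ "R + 2 * c"], intro conjI allI impI K0)
    fix s :: real and x y x' y' :: "real^'d"
    assume x': "norm (x' - x) \<le> c" and y': "comparable c y' y"
    let ?D = "second_diff (\<lambda>x. G (s, x)) x' y'"
    let ?S = "indicator (cball 0 (R + 2 * c)) x + indicator (cball 0 (R + 2 * c)) (x + y) + indicator (cball 0 (R + 2 * c)) (x - y) :: real"
    show "\<bar>h0 y' * ?D\<bar> \<le> K * weight y * ?S"
    proof (cases "y' = 0 \<or> ?D = 0")
      case True
      then show ?thesis using K0 weight_nonneg[of y] by (auto simp: h0_def)
    next
      case False
      then have y'0: "y' \<noteq> 0" and y0: "y \<noteq> 0" and le: "norm y \<le> c * norm y'" "norm y' \<le> 2 * norm y"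
        and yd: "norm (y' - y) \<le> c"
        using y' by (auto simp: comparable_def)
      have "\<bar>?D\<bar> \<le> C * min 1 (norm y' ^ 2)"
        using C(2)[of "(s, x')" "(0, y')"] by (simp add: second_diff_def norm_Pair)
      also have "norm y' ^ 2 \<le> 4 * norm y ^ 2"
        using power_mono[OF le(2), of 2] by (simp add: power_mult_distrib)
      then have "C * min 1 (norm y' ^ 2) \<le> C * (4 * min 1 (norm y ^ 2))"
        using C(1) by (intro mult_left_mono) auto
      finally have D: "\<bar>?D\<bar> \<le> 4 * C * min 1 (norm y ^ 2)" by simp
      have "h0 y' \<le> H * norm y' powr (- (real CARD('d) + \<alpha>))" by (rule H)
      also have "\<dots> \<le> H * (norm y / c) powr (- (real CARD('d) + \<alpha>))"
        using H(1) le y'0 y0 alpha c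
        by (intro mult_left_mono powr_mono2') (auto simp: field_simps)
      also have "(norm y / c) powr (- (real CARD('d) + \<alpha>)) = c powr (real CARD('d) + \<alpha>) * norm y powr (- (real CARD('d) + \<alpha>))"
        using c by (simp add: powr_divide powr_minus_divide del: minus_add_distrib)
      finally have hb: "h0 y' \<le> H * c powr (real CARD('d) + \<alpha>) * norm y powr (- (real CARD('d) + \<alpha>))"
        by (simp only: mult.assoc)
      have "\<bar>h0 y' * ?D\<bar> = h0 y' * \<bar>?D\<bar>" using h0_nonneg[of y'] by (simp add: abs_mult)
      also have "\<dots> \<le> (H * c powr (real CARD('d) + \<alpha>) * norm y powr (- (real CARD('d) + \<alpha>))) * (4 * C * min 1 (norm y ^ 2))"
        using H(1) by (intro mult_mono hb D) auto
      also have "\<dots> = K * weight y" by (simp only: K_def weight_def mult_ac)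
      finally have 1: "\<bar>h0 y' * ?D\<bar> \<le> K * weight y" .
      have "norm x' \<le> R \<or> norm (x' + y') \<le> R \<or> norm (x' - y') \<le> R"
      proof (rule ccontr)
        assume "\<not> ?thesis"
        then have "?D = 0" unfolding second_diff_def by (simp add: R')
        then show False using False by simp
      qed
      moreover have "norm x \<le> norm x' + c" using x' norm_triangle_sub[of x x'] by (simp add: norm_minus_commute)
      moreover have "norm (x + y) \<le> norm (x' + y') + 2 * c"
      proof -
        have "x + y = (x' + y') - (x' - x) - (y' - y)" by simp
        then show ?thesis using norm_triangle_ineq4[of "x' + y'" "x' - x"] norm_triangle_ineq4[of "x' + y' - (x' - x)" "y' - y"] x' yd by simp
      qed
      moreover have "norm (x - y) \<le> norm (x' - y') + 2 * c"
      proof -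
        have "x - y = (x' - y') - (x' - x) + (y' - y)" by simp
        then show ?thesis using norm_triangle_ineq4[of "x' - y'" "x' - x"] norm_triangle_ineq[of "x' - y' - (x' - x)" "y' - y"] x' yd by simp
      qed
      ultimately have "norm x \<le> R + 2 * c \<or> norm (x + y) \<le> R + 2 * c \<or> norm (x - y) \<le> R + 2 * c"
        using c by linarith
      then have "?S \<ge> 1" by (auto simp: indicator_def)
      then have "K * weight y * 1 \<le> K * weight y * ?S"
        using K0 weight_nonneg by (intro mult_left_mono) auto
      then show ?thesis using 1 by simp
    qed
  qed
qed

text \<open>Integrating over \<open>x\<close> first, each indicator gives the same ball volume for
  every \<open>y\<close> by translation invariance, and the weight that is left is
  integrable.\<close>

lemma dominating_integrable:
  "integrable (lborel \<Otimes>\<^sub>M lborel) (\<lambda>(y, x). K * weight y * (indicator (cball 0 R) x + indicator (cball 0 R) (x + y) + indicator (cball (0::real^'d) R) (x - y)))"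
proof -
  let ?i = "indicator (cball (0::real^'d) R) :: real^'d \<Rightarrow> real"
  have im[measurable]: "?i \<in> borel_measurable borel" by (intro borel_measurable_indicator) auto
  define v where "v = (\<integral>x. ?i x \<partial>lborel)"
  have i: "integrable lborel ?i" using emeasure_bounded_finite[OF bounded_cball] by (intro integrable_real_indicator) auto
  have it: "integrable lborel (\<lambda>x. ?i (x + y))" "integrable lborel (\<lambda>x. ?i (x - y))" for y
    using lborel_translate(1)[OF i, of y] lborel_translate(1)[OF i, of "- y"] by auto
  have v: "(\<integral>x. ?i (x + y) \<partial>lborel) = v" "(\<integral>x. ?i (x - y) \<partial>lborel) = v" for y
    using lborel_translate(2)[OF im, of y] lborel_translate(2)[OF im, of "- y"] by (auto simp: v_def)
  show ?thesis
  proof (rule lborel_pair.Fubini_integrable)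
    have "(\<lambda>p. K * weight (fst p) * (?i (snd p) + ?i (snd p + fst p) + ?i (snd p - fst p))) \<in> borel_measurable (lborel \<Otimes>\<^sub>M lborel)"
      by measurable
    then show "(\<lambda>(y, x). K * weight y * (?i x + ?i (x + y) + ?i (x - y))) \<in> borel_measurable (lborel \<Otimes>\<^sub>M lborel)"
      by (simp add: case_prod_beta)
    have "(\<integral>x. norm (K * weight y * (?i x + ?i (x + y) + ?i (x - y))) \<partial>lborel) = \<bar>K\<bar> * (3 * v) * weight y" for y
    proof -
      have "norm (K * weight y * (?i x + ?i (x + y) + ?i (x - y))) = \<bar>K\<bar> * weight y * (?i x + ?i (x + y) + ?i (x - y))" for x
        using weight_nonneg[of y] by (simp add: abs_mult)
      moreover have "(\<integral>x. ?i x + ?i (x + y) + ?i (x - y) \<partial>lborel) = 3 * v"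
        using i it[of y] v[of y] by (simp add: v_def)
      ultimately show ?thesis by simp
    qed
    then show "integrable lborel (\<lambda>y. \<integral>x. norm (case (y, x) of (y, x) \<Rightarrow> K * weight y * (?i x + ?i (x + y) + ?i (x - y))) \<partial>lborel)"
      using weight_integrable by simp
    show "AE y in lborel. integrable lborel (\<lambda>x. case (y, x) of (y, x) \<Rightarrow> K * weight y * (?i x + ?i (x + y) + ?i (x - y)))"
      using i it by (intro AE_I2) simp
  qed
qed

text \<open>
  All operators approximating the fractional operator are obtained by replacing the jump \<open>y\<close>
  by a nearby \<open>\<rho> y\<close> and damping it by a factor \<open>k y\<close>.
\<close>

definition lop :: "(real^'d \<Rightarrow> real) \<Rightarrow> real \<Rightarrow> (real \<times> (real^'d) \<Rightarrow> real) \<Rightarrow> (real^'d \<Rightarrow> real^'d) \<Rightarrow> real^'d \<Rightarrow> real" where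
  "lop k s G \<rho> x = (1/2) * (\<integral>y. k y * (h0 (\<rho> y) * second_diff (\<lambda>x. G (s, x)) x (\<rho> y)) \<partial>lborel)"

lemma lop_id: "lop (\<lambda>_. 1) s G (\<lambda>y. y) x = frac_op h (\<lambda>x. G (s, x)) x"
proof -
  have "h0 y * second_diff (\<lambda>x. G (s, x)) x y = h y * (G (s, x + y) + G (s, x - y) - 2 * G (s, x))" for y
    by (auto simp: h0_def second_diff_def)
  then show ?thesis by (simp add: lop_def frac_op_def)
qed

lemma test_fun_section_continuous: "test_fun G \<Longrightarrow> continuous_on UNIV (\<lambda>x. G (s, x))" for G :: "real \<times> (real^'d) \<Rightarrow> real"
proof -
  assume "test_fun G"
  then have "continuous_on UNIV G" by (auto simp: test_fun_def smooth_def intro: Ck_imp_continuous)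
  then show ?thesis by (rule continuous_on_compose2) (auto intro!: continuous_intros)
qed

text \<open>Integrability is obtained at every \<open>x\<close>, not just almost every one; the
  pointwise exchange of the fractional operator with finite sums relies on it.\<close>

lemma lop_integrand_integrable:
  fixes G :: "real \<times> (real^'d) \<Rightarrow> real"
  assumes G: "test_fun G" and [measurable]: "\<rho> \<in> borel_measurable borel" "k \<in> borel_measurable borel"
    and \<rho>: "\<And>y. comparable c (\<rho> y) y" and k: "\<And>y. 0 \<le> k y \<and> k y \<le> 1" and c: "c \<ge> 1"
  shows "integrable lborel (\<lambda>y. k y * (h0 (\<rho> y) * second_diff (\<lambda>x. G (s, x)) x (\<rho> y)))"
proof -
  obtain K R where K: "K \<ge> 0" "\<And>s x y x' y'. norm (x' - x) \<le> c \<Longrightarrow> comparable c y' y \<Longrightarrow>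
    \<bar>h0 y' * second_diff (\<lambda>x. G (s, x)) x' y'\<bar> \<le>
      K * weight y * (indicator (cball 0 R) x + indicator (cball 0 R) (x + y) + indicator (cball 0 R) (x - y))"
    using kernel_bound[OF G c] by metis
  have [measurable]: "(\<lambda>x. G (s, x)) \<in> borel_measurable borel"
    by (intro borel_measurable_continuous_onI test_fun_section_continuous G)
  show ?thesis
  proof (rule Bochner_Integration.integrable_bound)
    show "integrable lborel (\<lambda>y. K * weight y * 3)" using weight_integrable by simp
    show "(\<lambda>y. k y * (h0 (\<rho> y) * second_diff (\<lambda>x. G (s, x)) x (\<rho> y))) \<in> borel_measurable lborel"
      unfolding second_diff_def by measurable
    show "AE y in lborel. norm (k y * (h0 (\<rho> y) * second_diff (\<lambda>x. G (s, x)) x (\<rho> y))) \<le> norm (K * weight y * 3)"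
    proof (intro AE_I2)
      fix y
      have "norm (k y * (h0 (\<rho> y) * second_diff (\<lambda>x. G (s, x)) x (\<rho> y))) \<le> 1 * \<bar>h0 (\<rho> y) * second_diff (\<lambda>x. G (s, x)) x (\<rho> y)\<bar>"
        unfolding norm_mult real_norm_def[symmetric] using k[of y] by (intro mult_right_mono) auto
      also have "\<dots> \<le> K * weight y * (indicator (cball 0 R) x + indicator (cball 0 R) (x + y) + indicator (cball 0 R) (x - y))"
        using K(2)[of x x "\<rho> y" y] \<rho> c by simp
      also have "\<dots> \<le> K * weight y * 3"
        using K(1) weight_nonneg[of y] by (intro mult_left_mono) (auto simp: indicator_def)
      finally show "norm (k y * (h0 (\<rho> y) * second_diff (\<lambda>x. G (s, x)) x (\<rho> y))) \<le> norm (K * weight y * 3)"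
        using K(1) weight_nonneg[of y] by simp
    qed
  qed
qed

text \<open>Dominated convergence takes place on the product space of jumps and points, so that
  Fubini yields both the integrability of the operators and their L1 convergence. The maps
  \<open>\<sigma>\<close>, \<open>\<rho>\<close>, \<open>k\<close> and the times \<open>s\<close>
  may vary together; rounding, truncation and motion in time are instances.\<close>

lemma lop_L1_convergence:
  fixes G :: "real \<times> (real^'d) \<Rightarrow> real"
  assumes G: "test_fun G" and c: "c \<ge> 1"
    and meas: "\<And>n. \<sigma> n \<in> borel_measurable borel" "\<And>n. \<rho> n \<in> borel_measurable borel" "\<And>n. k n \<in> borel_measurable borel"
    and \<rho>: "\<And>n y. comparable c (\<rho> n y) y" and \<sigma>: "\<And>n x. norm (\<sigma> n x - x) \<le> c"
    and k: "\<And>n y. 0 \<le> k n y \<and> k n y \<le> 1"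
    and lim: "\<And>x. (\<lambda>n. \<sigma> n x) \<longlonglongrightarrow> x" "\<And>y. (\<lambda>n. \<rho> n y) \<longlonglongrightarrow> y" "\<And>y. (\<lambda>n. k n y) \<longlonglongrightarrow> 1" "s \<longlonglongrightarrow> s0"
  shows "integrable lborel (\<lambda>x. lop (k n) (s n) G (\<rho> n) (\<sigma> n x))"
    and "integrable lborel (frac_op h (\<lambda>x. G (s0, x)))"
    and "(\<lambda>n. \<integral>x. \<bar>lop (k n) (s n) G (\<rho> n) (\<sigma> n x) - frac_op h (\<lambda>x. G (s0, x)) x\<bar> \<partial>lborel) \<longlonglongrightarrow> 0"
proof -
  obtain K R where K: "K \<ge> 0" "\<And>s x y x' y'. norm (x' - x) \<le> c \<Longrightarrow> comparable c y' y \<Longrightarrow>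
    \<bar>h0 y' * second_diff (\<lambda>x. G (s, x)) x' y'\<bar> \<le>
      K * weight y * (indicator (cball 0 R) x + indicator (cball 0 R) (x + y) + indicator (cball 0 R) (x - y))"
    using kernel_bound[OF G c] by metis
  define Dom :: "(real^'d) \<times> (real^'d) \<Rightarrow> real" where
    "Dom = (\<lambda>(y, x). K * weight y * (indicator (cball 0 R) x + indicator (cball 0 R) (x + y) + indicator (cball 0 R) (x - y)))"
  have Dom: "integrable (lborel \<Otimes>\<^sub>M lborel) Dom" unfolding Dom_def by (rule dominating_integrable)
  define f where "f = (\<lambda>n (p :: (real^'d) \<times> (real^'d)). k n (fst p) * (h0 (\<rho> n (fst p)) * second_diff (\<lambda>x. G (s n, x)) (\<sigma> n (snd p)) (\<rho> n (fst p))))"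
  define g where "g = (\<lambda>p :: (real^'d) \<times> (real^'d). h0 (fst p) * second_diff (\<lambda>x. G (s0, x)) (snd p) (fst p))"
  have [measurable]: "(\<lambda>x. G (s, x)) \<in> borel_measurable borel" for s
    by (intro borel_measurable_continuous_onI test_fun_section_continuous G)
  note [measurable] = meas
  have fm[measurable]: "f n \<in> borel_measurable (lborel \<Otimes>\<^sub>M lborel)" for n
    unfolding f_def second_diff_def by measurable
  have gm[measurable]: "g \<in> borel_measurable (lborel \<Otimes>\<^sub>M lborel)"
    unfolding g_def second_diff_def by measurable
  have fD: "\<bar>f n p\<bar> \<le> Dom p" for n p
  proof (cases p)
    case (Pair y x)
    have "\<bar>f n p\<bar> \<le> 1 * \<bar>h0 (\<rho> n y) * second_diff (\<lambda>x. G (s n, x)) (\<sigma> n x) (\<rho> n y)\<bar>"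
      unfolding f_def Pair abs_mult fst_conv snd_conv using k[of n y] by (intro mult_right_mono) auto
    also have "\<dots> \<le> Dom p" unfolding Dom_def Pair using K(2)[of "\<sigma> n x" x "\<rho> n y" y] \<rho> \<sigma> by simp
    finally show ?thesis .
  qed
  have gD: "\<bar>g p\<bar> \<le> Dom p" for p
  proof (cases p)
    case (Pair y x)
    then show ?thesis unfolding Dom_def g_def using K(2)[of x x y y] comparable_self[OF c] c by simp
  qed
  have fi: "integrable (lborel \<Otimes>\<^sub>M lborel) (f n)" for n
    by (rule Bochner_Integration.integrable_bound[OF Dom]) (use fD in \<open>auto intro!: AE_I2 intro: order_trans[OF fD abs_ge_self]\<close>)
  have gi: "integrable (lborel \<Otimes>\<^sub>M lborel) g"
    by (rule Bochner_Integration.integrable_bound[OF Dom]) (auto intro!: AE_I2 intro: order_trans[OF gD abs_ge_self])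
  have pt: "(\<lambda>n. f n p) \<longlonglongrightarrow> g p" for p
  proof (cases p)
    case (Pair y x)
    have Gc: "isCont G z" for z
      using G Ck_imp_continuous[of 0 G] by (cases z) (auto simp: test_fun_def smooth_def continuous_on_eq_continuous_at)
    show ?thesis
    proof (cases "y = 0")
      case True
      then have "\<rho> n y = 0" for n using \<rho>[of n y] by (simp add: comparable_def)
      then show ?thesis using True by (simp add: f_def g_def Pair second_diff_def)
    next
      case False
      have "isCont h y" using h_cont False by (simp add: continuous_on_eq_continuous_at open_Diff)
      then have 1: "(\<lambda>n. h (\<rho> n y)) \<longlonglongrightarrow> h y" using lim(2) isCont_tendsto_compose by blast
      have "\<forall>\<^sub>F n in sequentially. \<rho> n y \<noteq> 0"
        using lim(2)[of y] False by (rule tendsto_imp_eventually_ne)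
      then have "\<forall>\<^sub>F n in sequentially. h (\<rho> n y) = h0 (\<rho> n y)" by (rule eventually_mono) (simp add: h0_def)
      then have 2: "(\<lambda>n. h0 (\<rho> n y)) \<longlonglongrightarrow> h0 y"
        using Lim_transform_eventually[OF 1] False by (simp add: h0_def)
      have "(\<lambda>n. second_diff (\<lambda>x. G (s n, x)) (\<sigma> n x) (\<rho> n y)) \<longlonglongrightarrow> second_diff (\<lambda>x. G (s0, x)) x y"
        unfolding second_diff_def
        by (intro tendsto_intros isCont_tendsto_compose[OF Gc] tendsto_Pair lim)
      then have "(\<lambda>n. k n y * (h0 (\<rho> n y) * second_diff (\<lambda>x. G (s n, x)) (\<sigma> n x) (\<rho> n y))) \<longlonglongrightarrow> 1 * (h0 y * second_diff (\<lambda>x. G (s0, x)) x y)"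
        by (intro tendsto_mult lim 2)
      then show ?thesis by (simp add: f_def g_def Pair)
    qed
  qed
  have L: "lop (k n) (s n) G (\<rho> n) (\<sigma> n x) = (1/2) * (\<integral>y. f n (y, x) \<partial>lborel)" for n x
    by (simp add: lop_def f_def)
  have Lg: "frac_op h (\<lambda>x. G (s0, x)) x = (1/2) * (\<integral>y. g (y, x) \<partial>lborel)" for x
    using lop_id[of s0 G x] by (simp add: lop_def g_def)
  have fi2: "integrable (lborel \<Otimes>\<^sub>M lborel) (\<lambda>(y,x). f n (y,x))" for n using fi by simp
  have gi2: "integrable (lborel \<Otimes>\<^sub>M lborel) (\<lambda>(y,x). g (y,x))" using gi by simp
  show "integrable lborel (\<lambda>x. lop (k n) (s n) G (\<rho> n) (\<sigma> n x))" for n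
    unfolding L using lborel_pair.integrable_snd[OF fi2[of n]] by simp
  show "integrable lborel (frac_op h (\<lambda>x. G (s0, x)))"
    unfolding Lg[abs_def] using lborel_pair.integrable_snd[OF gi2] by simp
  have di: "integrable (lborel \<Otimes>\<^sub>M lborel) (\<lambda>(y,x). \<bar>f n (y,x) - g (y,x)\<bar>)" for n
    using integrable_abs[OF Bochner_Integration.integrable_diff[OF fi[of n] gi]] by (simp add: case_prod_beta')
  have "(\<lambda>n. \<integral>p. \<bar>f n p - g p\<bar> \<partial>(lborel \<Otimes>\<^sub>M lborel)) \<longlonglongrightarrow> (\<integral>p. 0 \<partial>((lborel :: (real^'d) measure) \<Otimes>\<^sub>M (lborel :: (real^'d) measure)))"
  proof (rule integral_dominated_convergence[where w = "\<lambda>p. 2 * Dom p"])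
    show "AE p in lborel \<Otimes>\<^sub>M lborel. (\<lambda>n. \<bar>f n p - g p\<bar>) \<longlonglongrightarrow> 0"
      using tendsto_rabs_zero[OF Lim_null[THEN iffD1, OF pt]] by (intro AE_I2) auto
    show "AE p in lborel \<Otimes>\<^sub>M lborel. norm \<bar>f n p - g p\<bar> \<le> 2 * Dom p" for n
    proof (intro AE_I2)
      fix p show "norm \<bar>f n p - g p\<bar> \<le> 2 * Dom p" using fD[of n p] gD[of p] by auto
    qed
  qed (use Dom in auto)
  then have lim0: "(\<lambda>n. \<integral>p. \<bar>f n p - g p\<bar> \<partial>(lborel \<Otimes>\<^sub>M lborel)) \<longlonglongrightarrow> 0" by simp
  show "(\<lambda>n. \<integral>x. \<bar>lop (k n) (s n) G (\<rho> n) (\<sigma> n x) - frac_op h (\<lambda>x. G (s0, x)) x\<bar> \<partial>lborel) \<longlonglongrightarrow> 0"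
  proof (rule tendsto_sandwich[OF _ _ tendsto_const lim0])
    show "\<forall>\<^sub>F n in sequentially. 0 \<le> (\<integral>x. \<bar>lop (k n) (s n) G (\<rho> n) (\<sigma> n x) - frac_op h (\<lambda>x. G (s0, x)) x\<bar> \<partial>lborel)"
      by simp
    show "\<forall>\<^sub>F n in sequentially. (\<integral>x. \<bar>lop (k n) (s n) G (\<rho> n) (\<sigma> n x) - frac_op h (\<lambda>x. G (s0, x)) x\<bar> \<partial>lborel)
      \<le> (\<integral>p. \<bar>f n p - g p\<bar> \<partial>(lborel \<Otimes>\<^sub>M lborel))"
    proof (intro always_eventually allI)
      fix n
      have "(\<integral>p. \<bar>f n p - g p\<bar> \<partial>(lborel \<Otimes>\<^sub>M lborel)) = (\<integral>x. (\<integral>y. \<bar>f n (y,x) - g (y,x)\<bar> \<partial>lborel) \<partial>lborel)"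
        using lborel_pair.integral_snd[OF di[of n]] by (simp add: case_prod_beta')
      moreover have "(\<integral>x. \<bar>lop (k n) (s n) G (\<rho> n) (\<sigma> n x) - frac_op h (\<lambda>x. G (s0, x)) x\<bar> \<partial>lborel)
          \<le> (\<integral>x. (\<integral>y. \<bar>f n (y,x) - g (y,x)\<bar> \<partial>lborel) \<partial>lborel)"
      proof (rule integral_mono_AE)
        show "integrable lborel (\<lambda>x. \<bar>lop (k n) (s n) G (\<rho> n) (\<sigma> n x) - frac_op h (\<lambda>x. G (s0, x)) x\<bar>)"
          unfolding L Lg using lborel_pair.integrable_snd[OF gi2] lborel_pair.integrable_snd[OF fi2[of n]]
          by (intro integrable_abs Bochner_Integration.integrable_diff) auto
        show "integrable lborel (\<lambda>x. \<integral>y. \<bar>f n (y,x) - g (y,x)\<bar> \<partial>lborel)"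
          by (rule lborel_pair.integrable_snd[OF di])
        \<comment> \<open>Fubini gives integrable sections only almost everywhere, so the two
          integrands are compared almost everywhere.\<close>
        have "AE x in lborel. integrable lborel (\<lambda>y. f n (y,x))"
          by (rule lborel_pair.AE_integrable_snd[OF fi2])
        moreover have "AE x in lborel. integrable lborel (\<lambda>y. g (y,x))"
          by (rule lborel_pair.AE_integrable_snd[OF gi2])
        ultimately show "AE x in lborel. \<bar>lop (k n) (s n) G (\<rho> n) (\<sigma> n x) - frac_op h (\<lambda>x. G (s0, x)) x\<bar>
          \<le> (\<integral>y. \<bar>f n (y,x) - g (y,x)\<bar> \<partial>lborel)"
        proof eventually_elim
          case (elim x)
          have "lop (k n) (s n) G (\<rho> n) (\<sigma> n x) - frac_op h (\<lambda>x. G (s0, x)) x = (1/2) * (\<integral>y. f n (y,x) - g (y,x) \<partial>lborel)"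
            unfolding L Lg using elim by (simp add: right_diff_distrib)
          also have "\<bar>\<dots>\<bar> \<le> 1 * \<bar>\<integral>y. f n (y,x) - g (y,x) \<partial>lborel\<bar>"
            unfolding abs_mult by (intro mult_right_mono) auto
          also have "\<dots> \<le> (\<integral>y. \<bar>f n (y,x) - g (y,x)\<bar> \<partial>lborel)"
            using integral_norm_bound[of lborel "\<lambda>y. f n (y,x) - g (y,x)"] by simp
          finally show ?case .
        qed
      qed
      ultimately show "(\<integral>x. \<bar>lop (k n) (s n) G (\<rho> n) (\<sigma> n x) - frac_op h (\<lambda>x. G (s0, x)) x\<bar> \<partial>lborel)
        \<le> (\<integral>p. \<bar>f n p - g p\<bar> \<partial>(lborel \<Otimes>\<^sub>M lborel))" by simp
    qed
  qed
qed

end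

section \<open>Closure properties of test functions and the L1 norm\<close>

lemma finite_lattice_ball:
  assumes "n > 0"
  shows "finite {z :: int^'d. norm (lattice_point n z) \<le> R}"
proof -
  define k where "k = \<lceil>real n * R\<rceil>"
  have "{z :: int^'d. norm (lattice_point n z) \<le> R} \<subseteq> vec_lambda ` (PiE UNIV (\<lambda>_. {- k..k}))"
  proof
    fix z :: "int^'d" assume "z \<in> {z. norm (lattice_point n z) \<le> R}"
    then have R: "norm (lattice_point n z) \<le> R" by simp
    have "\<bar>z $ i\<bar> \<le> k" for i
    proof -
      have "\<bar>real_of_int (z $ i)\<bar> / real n = \<bar>lattice_point n z $ i\<bar>"
        using assms by (simp add: lattice_point_def site_to_real_def abs_mult)
      also have "\<dots> \<le> R" using component_le_norm_cart[of "lattice_point n z" i] R by linarith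
      finally have "\<bar>real_of_int (z $ i)\<bar> \<le> real n * R" using assms by (simp add: field_simps)
      then show ?thesis unfolding k_def by linarith
    qed
    then have "($) z \<in> PiE UNIV (\<lambda>_. {- k..k})" by (auto simp: abs_le_iff minus_le_iff)
    then show "z \<in> vec_lambda ` (PiE UNIV (\<lambda>_. {- k..k}))" by (metis imageI vec_nth_inverse)
  qed
  then show ?thesis by (rule finite_subset) (intro finite_imageI finite_PiE; simp)
qed

lemma test_fun_smooth: "test_fun f \<Longrightarrow> Ck k f"
  by (simp add: test_fun_def smooth_def)

lemma test_fun_continuous: "test_fun f \<Longrightarrow> continuous_on UNIV f"
  using test_fun_smooth[of f 0] by simp

lemma test_fun_translate: "test_fun f \<Longrightarrow> test_fun (\<lambda>x. f (x + c))"
proof -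
  assume f: "test_fun f"
  obtain R where R: "\<And>x. norm x > R \<Longrightarrow> f x = 0" using f by (auto simp: test_fun_def has_compact_support_iff)
  have "f (x + c) = 0" if "norm x > R + norm c" for x
    using that norm_triangle_ineq2[of x "- c"] by (intro R) auto
  moreover have "Ck k (\<lambda>x. f (x + c))" for k
    by (rule Ck_affine[OF bounded_linear_ident test_fun_smooth[OF f]])
  ultimately show ?thesis by (auto simp: test_fun_def smooth_def has_compact_support_iff)
qed

lemma test_fun_add: "test_fun f \<Longrightarrow> test_fun g \<Longrightarrow> test_fun (\<lambda>x. f x + g x)"
proof -
  assume f: "test_fun f" "test_fun g"
  obtain R where R: "\<And>x. norm x > R \<Longrightarrow> f x = 0" using f by (auto simp: test_fun_def has_compact_support_iff)
  obtain R' where R': "\<And>x. norm x > R' \<Longrightarrow> g x = 0" using f by (auto simp: test_fun_def has_compact_support_iff)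
  have "f x + g x = 0" if "norm x > max R R'" for x using that R R' by simp
  moreover have "Ck k (\<lambda>x. f x + g x)" for k
    by (intro Ck_add test_fun_smooth f)
  ultimately show ?thesis unfolding test_fun_def smooth_def has_compact_support_iff by blast
qed

lemma test_fun_cmult: "test_fun f \<Longrightarrow> test_fun (\<lambda>x. c * f x)"
  by (auto simp: test_fun_def smooth_def has_compact_support_iff intro!: Ck_mult Ck_const)

lemma test_fun_sum: "(\<And>i. i \<in> I \<Longrightarrow> test_fun (f i)) \<Longrightarrow> test_fun (\<lambda>x. \<Sum>i\<in>I. f i x)"
proof (induction I rule: infinite_finite_induct)
  case empty
  show ?case by (auto simp: test_fun_def smooth_def has_compact_support_iff intro!: Ck_const)
next
  case (infinite A)
  then show ?case by (auto simp: test_fun_def smooth_def has_compact_support_iff intro!: Ck_const)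
qed (auto intro!: test_fun_add)

lemma compact_support_integrable:
  fixes f :: "'a::euclidean_space \<Rightarrow> real"
  assumes "continuous_on UNIV f" "has_compact_support f"
  shows "integrable lborel f"
proof -
  obtain K where K: "compact K" "\<And>x. x \<notin> K \<Longrightarrow> f x = 0" using assms by (auto simp: has_compact_support_def)
  have "integrable lborel (\<lambda>x. indicator K x *\<^sub>R f x)"
    by (rule borel_integrable_compact[OF K(1) continuous_on_subset[OF assms(1)]]) auto
  moreover have "(\<lambda>x. indicator K x *\<^sub>R f x) = f" using K(2) by (auto simp: indicator_def fun_eq_iff)
  ultimately show ?thesis by simp
qed

lemma test_fun_integrable: "test_fun f \<Longrightarrow> integrable lborel f"
  by (intro compact_support_integrable test_fun_continuous) (auto simp: test_fun_def)

text \<open>Weak solutions are tested in space-time. Multiplication by a plateau in time keeps a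
  spatial test function constant on an open neighbourhood of [0,T], so its time derivative vanishes
  at the end points too.\<close>

lemma test_fun_extend:
  fixes F :: "real^'d \<Rightarrow> real" and T :: real
  assumes F: "test_fun F"
  shows "\<exists>G :: real \<times> (real^'d) \<Rightarrow> real. test_fun G \<and> (\<forall>s x. -1 < s \<and> s < T + 1 \<longrightarrow> G (s, x) = F x)"
proof -
  obtain \<theta> :: "real \<Rightarrow> real" where \<theta>: "test_fun \<theta>" "\<And>s. -1 < s \<Longrightarrow> s < T + 1 \<Longrightarrow> \<theta> s = 1"
    using plateau_function[of T] by blast
  define G where "G = (\<lambda>p :: real \<times> (real^'d). \<theta> (fst p) * F (snd p))"
  obtain R where R: "\<And>x. norm x > R \<Longrightarrow> \<theta> x = 0" using \<theta> by (auto simp: test_fun_def has_compact_support_iff)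
  obtain R' where R': "\<And>x. norm x > R' \<Longrightarrow> F x = 0" using F by (auto simp: test_fun_def has_compact_support_iff)
  have z: "G p = 0" if "norm p > R + R'" for p
  proof (rule ccontr)
    assume "G p \<noteq> 0"
    then have "norm (fst p) \<le> R" "norm (snd p) \<le> R'" using R[of "fst p"] R'[of "snd p"] unfolding G_def by (auto simp: not_less[symmetric])
    moreover have "norm p \<le> norm (fst p) + norm (snd p)" using norm_Pair_le[of "fst p" "snd p"] by simp
    ultimately show False using that by linarith
  qed
  have "Ck k (\<lambda>p :: real \<times> (real^'d). \<theta> (fst p + 0) * F (snd p + 0))" for k
    by (intro Ck_mult Ck_affine test_fun_smooth \<theta> F bounded_linear_fst bounded_linear_snd)
  then have "smooth G" by (simp add: smooth_def G_def)
  then have "test_fun G" using z unfolding test_fun_def has_compact_support_iff by blast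
  moreover have "G (s, x) = F x" if "-1 < s" "s < T + 1" for s x using \<theta>(2)[OF that] by (simp add: G_def)
  ultimately show ?thesis by blast
qed

lemma test_fun_section:
  fixes G :: "real \<times> (real^'d) \<Rightarrow> real"
  assumes "test_fun G"
  shows "test_fun (\<lambda>x. G (s, x))"
proof -
  have "Ck k (\<lambda>x. G ((0, x) + (s, 0)))" for k
    by (rule Ck_affine[OF _ test_fun_smooth[OF assms]]) (intro bounded_linear_Pair bounded_linear_zero bounded_linear_ident)
  then have 1: "smooth (\<lambda>x. G (s, x))" by (simp add: smooth_def)
  obtain R where R: "\<And>x. norm x > R \<Longrightarrow> G x = 0" using assms by (auto simp: test_fun_def has_compact_support_iff)
  have "G (s, x) = 0" if "norm x > R" for x
    using that norm_snd_le[of x s] by (intro R) simp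
  then show ?thesis using 1 unfolding test_fun_def has_compact_support_iff by blast
qed

text \<open>An integral that does not exist has the value 0, so this behaves as a norm only on
  integrable functions; the triangle inequalities below carry integrability assumptions for that
  reason.\<close>

definition L1 :: "('a::euclidean_space \<Rightarrow> real) \<Rightarrow> real" where
  "L1 f = (\<integral>x. \<bar>f x\<bar> \<partial>lborel)"

lemma L1_nonneg: "L1 f \<ge> 0"
  by (simp add: L1_def)

lemma L1_add: "integrable lborel f \<Longrightarrow> integrable lborel g \<Longrightarrow> L1 (\<lambda>x. f x + g x) \<le> L1 f + L1 g"
proof -
  assume fg: "integrable lborel f" "integrable lborel g"
  then have "L1 (\<lambda>x. f x + g x) \<le> (\<integral>x. \<bar>f x\<bar> + \<bar>g x\<bar> \<partial>lborel)"
    unfolding L1_def by (intro integral_mono integrable_abs Bochner_Integration.integrable_add) auto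
  then show ?thesis using fg by (simp add: L1_def)
qed

lemma L1_diff_triangle:
  "integrable lborel f \<Longrightarrow> integrable lborel g \<Longrightarrow> integrable lborel k \<Longrightarrow>
    L1 (\<lambda>x. f x - k x) \<le> L1 (\<lambda>x. f x - g x) + L1 (\<lambda>x. g x - k x)"
  using L1_add[of "\<lambda>x. f x - g x" "\<lambda>x. g x - k x"] by simp

lemma L1_sym: "L1 (\<lambda>x. f x - g x) = L1 (\<lambda>x. g x - f x)"
  by (simp add: L1_def abs_minus_commute)

lemma L1_cmult: "L1 (\<lambda>x. c * f x) = \<bar>c\<bar> * L1 f"
  by (simp add: L1_def abs_mult)

lemma L1_translate: "integrable lborel f \<Longrightarrow> L1 (\<lambda>x. f (x + c)) = L1 f"
  unfolding L1_def by (rule lborel_translate(2)[where f = "\<lambda>x. \<bar>f x\<bar>"]) (auto dest: borel_measurable_integrable)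

lemma L1_sum: "finite I \<Longrightarrow> (\<And>i. i \<in> I \<Longrightarrow> integrable lborel (f i)) \<Longrightarrow> L1 (\<lambda>x. \<Sum>i\<in>I. f i x) \<le> (\<Sum>i\<in>I. L1 (f i))"
proof (induction I rule: finite_induct)
  case (insert i I)
  have "L1 (\<lambda>x. f i x + (\<Sum>i\<in>I. f i x)) \<le> L1 (f i) + L1 (\<lambda>x. \<Sum>i\<in>I. f i x)"
    using insert by (intro L1_add Bochner_Integration.integrable_sum) auto
  then show ?case using insert by fastforce
qed (simp add: L1_def)

lemma integral_le_L1: "\<bar>\<integral>x. f x \<partial>lborel\<bar> \<le> L1 f"
  using integral_norm_bound[of lborel f] by (simp add: L1_def)

lemma integral_bounded_L1:
  assumes "u \<in> borel_measurable borel" "\<And>x. \<bar>u x\<bar> \<le> B" "integrable lborel g"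
  shows "integrable lborel (\<lambda>x. u x * g x)" "\<bar>\<integral>x. u x * g x \<partial>lborel\<bar> \<le> B * L1 g"
proof -
  show i: "integrable lborel (\<lambda>x. u x * g x)"
    by (rule Bochner_Integration.integrable_bound[where f = "\<lambda>x. B * g x"])
       (use assms borel_measurable_integrable[OF assms(3)] in \<open>auto simp: abs_mult intro!: AE_I2 mult_right_mono borel_measurable_times intro: order_trans[OF assms(2) abs_ge_self]\<close>)
  have "\<bar>\<integral>x. u x * g x \<partial>lborel\<bar> \<le> (\<integral>x. \<bar>u x * g x\<bar> \<partial>lborel)" using integral_le_L1 by (simp add: L1_def)
  also have "\<dots> \<le> (\<integral>x. B * \<bar>g x\<bar> \<partial>lborel)"
    using assms(2,3) by (intro integral_mono integrable_abs i integrable_mult_right) (auto simp: abs_mult intro!: mult_right_mono)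
  finally show "\<bar>\<integral>x. u x * g x \<partial>lborel\<bar> \<le> B * L1 g" by (simp add: L1_def)
qed

section \<open>Truncated random walks and their Euler steps\<close>

context levy_kernel
begin

text \<open>Truncating the range makes \<open>Bop\<close> a finite sum, so that it preserves compact supports.\<close>

definition jumps :: "nat \<Rightarrow> (int^'d) set" where
  "jumps m = {z. z \<noteq> 0 \<and> norm (lattice_point m z) \<le> real m}"

text \<open>For positive \<open>m\<close>, \<open>h0_scale\<close> identifies this as m^\<alpha>
  times \<open>jump_rate h z\<close>, the rate of the walk speeded up by m^\<alpha>.\<close>

definition rate :: "nat \<Rightarrow> int^'d \<Rightarrow> real" where
  "rate m z = h0 (lattice_point m z) / real m ^ CARD('d)"

definition jump_total :: "nat \<Rightarrow> real" where
  "jump_total m = (\<Sum>z\<in>jumps m. rate m z)"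

definition Bop :: "nat \<Rightarrow> (real^'d \<Rightarrow> real) \<Rightarrow> real^'d \<Rightarrow> real" where
  "Bop m f x = (\<Sum>z\<in>jumps m. rate m z * (f (x + lattice_point m z) - f x))"

definition Sop :: "nat \<Rightarrow> real \<Rightarrow> (real^'d \<Rightarrow> real) \<Rightarrow> real^'d \<Rightarrow> real" where
  "Sop m \<delta> f x = f x + \<delta> * Bop m f x"

lemma finite_jumps: "m > 0 \<Longrightarrow> finite (jumps m)"
  unfolding jumps_def by (rule finite_subset[OF _ finite_lattice_ball[of m "real m"]]) auto

lemma rate_nonneg: "rate m z \<ge> 0"
  by (simp add: rate_def h0_nonneg)

lemma jump_total_nonneg: "jump_total m \<ge> 0"
  unfolding jump_total_def by (intro sum_nonneg rate_nonneg)

lemma jumps_reflect: "(\<Sum>z\<in>jumps m. rate m z * \<phi> (- z)) = (\<Sum>z\<in>jumps m. rate m z * \<phi> z)"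
  by (rule sum.reindex_bij_witness[of _ uminus uminus]) (auto simp: jumps_def rate_def h0_even)

lemma Bop_linear:
  "Bop m (\<lambda>x. f x + g x) x = Bop m f x + Bop m g x"
  "Bop m (\<lambda>x. f x - g x) x = Bop m f x - Bop m g x"
  "Bop m (\<lambda>x. c * f x) x = c * Bop m f x"
  by (simp_all add: Bop_def algebra_simps sum.distrib sum_subtractf sum_distrib_left)

lemma Bop_alt: "Bop m f x = (\<Sum>z\<in>jumps m. rate m z * f (x + lattice_point m z)) - jump_total m * f x"
  by (simp add: Bop_def jump_total_def algebra_simps sum_subtractf sum_distrib_left)

text \<open>Pairing each jump with its reflection brings out the second difference of the fractional
  operator, with the same factor 1/2. First differences would not give a dominated integrand for
  \<alpha> \<ge> 1.\<close>

lemma Bop_second_diff: "Bop m f x = (1/2) * (\<Sum>z\<in>jumps m. rate m z * second_diff f x (lattice_point m z))"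
proof -
  have "(\<Sum>z\<in>jumps m. rate m z * f (x - lattice_point m z)) = (\<Sum>z\<in>jumps m. rate m z * f (x + lattice_point m z))"
    using jumps_reflect[of m "\<lambda>z. f (x + lattice_point m z)"] by simp
  then have "(\<Sum>z\<in>jumps m. rate m z * second_diff f x (lattice_point m z)) = 2 * Bop m f x"
    unfolding second_diff_def Bop_alt by (simp add: distrib_left right_diff_distrib sum.distrib sum_subtractf jump_total_def sum_distrib_left sum_distrib_right mult_ac)
  then show ?thesis by simp
qed

text \<open>For nonnegative \<open>\<delta>\<close> with
  \<open>\<delta> * jump_total m \<le> 1\<close> all coefficients are nonnegative, so a step
  averages translates of \<open>f\<close> with total weight 1. The L1 contraction, the monotonicity
  and the maximum principle rest on this form.\<close>

lemma Sop_alt: "Sop m \<delta> f x = (1 - \<delta> * jump_total m) * f x + \<delta> * (\<Sum>z\<in>jumps m. rate m z * f (x + lattice_point m z))"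
  by (simp add: Sop_def Bop_alt algebra_simps)

lemma Sop_linear:
  "Sop m \<delta> (\<lambda>x. f x + g x) = (\<lambda>x. Sop m \<delta> f x + Sop m \<delta> g x)"
  "Sop m \<delta> (\<lambda>x. f x - g x) = (\<lambda>x. Sop m \<delta> f x - Sop m \<delta> g x)"
  "Sop m \<delta> (\<lambda>x. c * f x) = (\<lambda>x. c * Sop m \<delta> f x)"
  by (rule ext, simp add: Sop_def Bop_linear algebra_simps)+

lemma Sop_pow_linear:
  "(Sop m \<delta> ^^ j) (\<lambda>x. f x + g x) = (\<lambda>x. (Sop m \<delta> ^^ j) f x + (Sop m \<delta> ^^ j) g x)"
  "(Sop m \<delta> ^^ j) (\<lambda>x. f x - g x) = (\<lambda>x. (Sop m \<delta> ^^ j) f x - (Sop m \<delta> ^^ j) g x)"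
  "(Sop m \<delta> ^^ j) (\<lambda>x. c * f x) = (\<lambda>x. c * (Sop m \<delta> ^^ j) f x)"
  by (induction j) (simp_all add: Sop_linear)

text \<open>Translations commute, also when \<open>m\<close> and \<open>l\<close> give different
  meshes; this later lets products at two levels be compared factor by factor.\<close>

lemma Bop_Bop_commute: "Bop m (Bop l f) = Bop l (Bop m f)"
proof
  fix x
  have e: "Bop m (Bop l f) x = (\<Sum>z\<in>jumps m. \<Sum>w\<in>jumps l. rate m z * (rate l w *
      (f (x + lattice_point m z + lattice_point l w) - f (x + lattice_point m z) - f (x + lattice_point l w) + f x)))" for m l
    unfolding Bop_def
    by (intro sum.cong refl) (simp add: sum_distrib_left sum_subtractf[symmetric] algebra_simps)
  show "Bop m (Bop l f) x = Bop l (Bop m f) x"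
    unfolding e by (subst sum.swap) (intro sum.cong refl, simp add: algebra_simps)
qed

lemma Bop_Sop_commute: "Bop m (Sop l \<delta> f) = Sop l \<delta> (Bop m f)"
  using Bop_Bop_commute[of m l f] by (auto simp: Sop_def[abs_def] Bop_linear fun_eq_iff)

lemma Sop_Sop_commute: "Sop m \<delta> (Sop l \<epsilon> f) = Sop l \<epsilon> (Sop m \<delta> f)"
proof
  fix x
  have "Sop m \<delta> (Sop l \<epsilon> f) x = Sop l \<epsilon> f x + \<delta> * Sop l \<epsilon> (Bop m f) x"
    by (simp add: Sop_def[of m] Bop_Sop_commute)
  also have "\<dots> = Sop l \<epsilon> (Sop m \<delta> f) x"
    by (simp add: Sop_def[of m, abs_def] Sop_linear)
  finally show "Sop m \<delta> (Sop l \<epsilon> f) x = Sop l \<epsilon> (Sop m \<delta> f) x" .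
qed

lemma Bop_Sop_pow_commute: "Bop m ((Sop l \<delta> ^^ j) f) = (Sop l \<delta> ^^ j) (Bop m f)"
  by (induction j) (simp_all add: Bop_Sop_commute)

lemma Sop_pow_commute: "Sop m \<delta> ((Sop l \<epsilon> ^^ j) f) = (Sop l \<epsilon> ^^ j) (Sop m \<delta> f)"
  by (induction j) (simp_all add: Sop_Sop_commute)

lemma Bop_test_fun: "test_fun f \<Longrightarrow> test_fun (Bop m f)"
proof -
  assume f: "test_fun f"
  have "test_fun (\<lambda>x. (\<Sum>z\<in>jumps m. rate m z * (f (x + lattice_point m z) + (- 1) * f x)))"
    by (intro test_fun_sum test_fun_cmult test_fun_add test_fun_translate f)
  then show ?thesis by (simp add: Bop_def[abs_def])
qed

lemma Sop_test_fun: "test_fun f \<Longrightarrow> test_fun (Sop m \<delta> f)"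
  unfolding Sop_def[abs_def] by (intro test_fun_add test_fun_cmult Bop_test_fun)

lemma Sop_pow_test_fun: "test_fun f \<Longrightarrow> test_fun ((Sop m \<delta> ^^ j) f)"
  by (induction j) (simp_all add: Sop_test_fun)

lemma Bop_integrable: "integrable lborel f \<Longrightarrow> integrable lborel (Bop m f)"
  unfolding Bop_def[abs_def]
  by (intro Bochner_Integration.integrable_sum integrable_mult_right Bochner_Integration.integrable_diff lborel_translate(1))

lemma Sop_integrable: "integrable lborel f \<Longrightarrow> integrable lborel (Sop m \<delta> f)"
  unfolding Sop_def[abs_def] by (intro Bochner_Integration.integrable_add integrable_mult_right Bop_integrable)

lemma Sop_pow_integrable: "integrable lborel f \<Longrightarrow> integrable lborel ((Sop m \<delta> ^^ j) f)"
  by (induction j) (simp_all add: Sop_integrable)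

lemma Bop_measurable: "f \<in> borel_measurable borel \<Longrightarrow> Bop m f \<in> borel_measurable borel"
proof -
  assume f: "f \<in> borel_measurable borel"
  have "(\<lambda>x. f (x + c)) \<in> borel_measurable borel" for c by (rule measurable_compose[OF _ f]) auto
  then show ?thesis unfolding Bop_def[abs_def]
    by (intro borel_measurable_sum borel_measurable_times borel_measurable_diff borel_measurable_const f)
qed

lemma Sop_measurable: "f \<in> borel_measurable borel \<Longrightarrow> Sop m \<delta> f \<in> borel_measurable borel"
  unfolding Sop_def[abs_def]
  by (intro borel_measurable_add borel_measurable_times borel_measurable_const Bop_measurable)

lemma Sop_pow_measurable: "f \<in> borel_measurable borel \<Longrightarrow> (Sop m \<delta> ^^ j) f \<in> borel_measurable borel"
  by (induction j) (simp_all add: Sop_measurable)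

lemma L1_shift_sum:
  assumes "m > 0" "integrable lborel f"
  shows "L1 (\<lambda>x. \<Sum>z\<in>jumps m. rate m z * f (x + lattice_point m z)) \<le> jump_total m * L1 f"
proof -
  have "L1 (\<lambda>x. \<Sum>z\<in>jumps m. rate m z * f (x + lattice_point m z)) \<le> (\<Sum>z\<in>jumps m. L1 (\<lambda>x. rate m z * f (x + lattice_point m z)))"
    using assms by (intro L1_sum finite_jumps integrable_mult_right lborel_translate(1)) auto
  also have "\<dots> = jump_total m * L1 f"
    using rate_nonneg assms by (simp add: L1_cmult L1_translate jump_total_def sum_distrib_right)
  finally show ?thesis .
qed

lemma L1_Bop: "m > 0 \<Longrightarrow> integrable lborel f \<Longrightarrow> L1 (Bop m f) \<le> 2 * jump_total m * L1 f"
proof -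
  assume m: "m > 0" and f: "integrable lborel f"
  have "L1 (Bop m f) \<le> L1 (\<lambda>x. \<Sum>z\<in>jumps m. rate m z * f (x + lattice_point m z)) + L1 (\<lambda>x. (- jump_total m) * f x)"
    using L1_add[of "\<lambda>x. \<Sum>z\<in>jumps m. rate m z * f (x + lattice_point m z)" "\<lambda>x. (- jump_total m) * f x"] f
    by (simp add: Bop_alt[abs_def] lborel_translate(1) Bochner_Integration.integrable_sum)
  then show ?thesis using L1_shift_sum[OF m f] jump_total_nonneg[of m]
    unfolding L1_cmult by (simp add: algebra_simps)
qed

lemma L1_Sop:
  assumes "m > 0" "0 \<le> \<delta>" "\<delta> * jump_total m \<le> 1" "integrable lborel f"
  shows "L1 (Sop m \<delta> f) \<le> L1 f"
proof -
  have "L1 (Sop m \<delta> f) \<le> L1 (\<lambda>x. (1 - \<delta> * jump_total m) * f x) + L1 (\<lambda>x. \<delta> * (\<Sum>z\<in>jumps m. rate m z * f (x + lattice_point m z)))"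
    unfolding Sop_alt[abs_def] using assms
    by (intro L1_add integrable_mult_right Bochner_Integration.integrable_sum lborel_translate(1))
  also have "\<dots> \<le> (1 - \<delta> * jump_total m) * L1 f + \<delta> * (jump_total m * L1 f)"
    using assms L1_shift_sum[OF assms(1,4)] by (auto simp: L1_cmult intro!: add_mono mult_left_mono)
  finally show ?thesis by (simp add: algebra_simps)
qed

lemma L1_Sop_pow:
  assumes "m > 0" "0 \<le> \<delta>" "\<delta> * jump_total m \<le> 1" "integrable lborel f"
  shows "L1 ((Sop m \<delta> ^^ j) f) \<le> L1 f"
proof (induction j)
  case (Suc j)
  then show ?case using L1_Sop[OF assms(1-3) Sop_pow_integrable[OF assms(4), where j = j and m = m and \<delta> = \<delta>]] by simp
qed simp

lemma Sop_mono:
  assumes "0 \<le> \<delta>" "\<delta> * jump_total m \<le> 1" "\<And>x. f x \<le> g x"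
  shows "Sop m \<delta> f x \<le> Sop m \<delta> g x"
  unfolding Sop_alt using assms rate_nonneg
  by (intro add_mono mult_left_mono sum_mono) auto

lemma Sop_const: "Sop m \<delta> (\<lambda>_. c) = (\<lambda>_. c)"
  by (simp add: Sop_def[abs_def] Bop_def)

lemma Sop_pow_mono:
  assumes "0 \<le> \<delta>" "\<delta> * jump_total m \<le> 1" "\<And>x. f x \<le> g x"
  shows "(Sop m \<delta> ^^ j) f x \<le> (Sop m \<delta> ^^ j) g x"
  by (induction j arbitrary: x) (use assms in \<open>auto intro: Sop_mono\<close>)

lemma Sop_pow_const: "(Sop m \<delta> ^^ j) (\<lambda>_. c) = (\<lambda>_. c)"
  by (induction j) (simp_all add: Sop_const)

lemma Sop_pow_bounds:
  assumes "0 \<le> \<delta>" "\<delta> * jump_total m \<le> 1" "\<And>x. a \<le> f x \<and> f x \<le> b"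
  shows "a \<le> (Sop m \<delta> ^^ j) f x \<and> (Sop m \<delta> ^^ j) f x \<le> b"
  using Sop_pow_mono[OF assms(1,2), of "\<lambda>_. a" f j x] Sop_pow_mono[OF assms(1,2), of f "\<lambda>_. b" j x] assms(3)
  by (simp add: Sop_pow_const)

text \<open>Translation invariance moves a shift from \<open>u\<close> to \<open>g\<close> with
  opposite sign, and the reflection symmetry of the rates undoes the sign. A bounded function is
  paired with an integrable one, since neither \<open>u0\<close> nor a weak solution need be
  integrable.\<close>

lemma integral_Bop_symmetric:
  assumes u: "u \<in> borel_measurable borel" "\<And>x. \<bar>u x\<bar> \<le> B" and g: "integrable lborel g"
  shows "(\<integral>x. Bop m u x * g x \<partial>lborel) = (\<integral>x. u x * Bop m g x \<partial>lborel)"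
proof -
  have i1: "integrable lborel (\<lambda>x. u (x + w) * g x)" for w
    by (rule integral_bounded_L1(1)[of "\<lambda>x. u (x + w)"]) (use u g in auto)
  have i2: "integrable lborel (\<lambda>x. u x * g (x + w))" for w
    by (rule integral_bounded_L1(1)) (use u g lborel_translate(1) in auto)
  have i3: "integrable lborel (\<lambda>x. u x * g x)" using i1[of 0] by simp
  have t: "(\<integral>x. u (x + w) * g x \<partial>lborel) = (\<integral>x. u x * g (x - w) \<partial>lborel)" for w
    using lborel_translate(2)[of "\<lambda>x. u x * g (x - w)" w] u borel_measurable_integrable[OF g] by simp
  have "(\<integral>x. Bop m u x * g x \<partial>lborel) = (\<integral>x. (\<Sum>z\<in>jumps m. rate m z * (u (x + lattice_point m z) * g x)) - jump_total m * (u x * g x) \<partial>lborel)"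
    by (simp add: Bop_alt left_diff_distrib sum_distrib_right mult.assoc)
  also have "\<dots> = (\<Sum>z\<in>jumps m. rate m z * (\<integral>x. u (x + lattice_point m z) * g x \<partial>lborel)) - jump_total m * (\<integral>x. u x * g x \<partial>lborel)"
    using i1 i3 by (simp add: Bochner_Integration.integral_diff Bochner_Integration.integral_sum Bochner_Integration.integrable_sum)
  also have "(\<Sum>z\<in>jumps m. rate m z * (\<integral>x. u (x + lattice_point m z) * g x \<partial>lborel)) = (\<Sum>z\<in>jumps m. rate m z * (\<integral>x. u x * g (x + lattice_point m z) \<partial>lborel))"
    using jumps_reflect[of m "\<lambda>z. \<integral>x. u x * g (x + lattice_point m z) \<partial>lborel"] by (simp add: t)
  also have "\<dots> - jump_total m * (\<integral>x. u x * g x \<partial>lborel) = (\<integral>x. (\<Sum>z\<in>jumps m. rate m z * (u x * g (x + lattice_point m z))) - jump_total m * (u x * g x) \<partial>lborel)"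
    using i2 i3 by (simp add: Bochner_Integration.integral_diff Bochner_Integration.integral_sum Bochner_Integration.integrable_sum)
  also have "\<dots> = (\<integral>x. u x * Bop m g x \<partial>lborel)"
    by (simp add: Bop_alt right_diff_distrib sum_distrib_left mult_ac)
  finally show ?thesis .
qed

lemma Bop_bounded:
  assumes "\<And>x. \<bar>u x\<bar> \<le> B"
  shows "\<bar>Bop m u x\<bar> \<le> 2 * jump_total m * B"
proof -
  have "\<bar>Bop m u x\<bar> \<le> (\<Sum>z\<in>jumps m. rate m z * (2 * B))"
    unfolding Bop_def
  proof (rule order_trans[OF sum_abs], rule sum_mono)
    fix z
    have "\<bar>u (x + lattice_point m z) - u x\<bar> \<le> 2 * B" using assms[of "x + lattice_point m z"] assms[of x] by linarith
    then show "\<bar>rate m z * (u (x + lattice_point m z) - u x)\<bar> \<le> rate m z * (2 * B)"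
      using rate_nonneg[of m z] by (simp add: abs_mult mult_left_mono)
  qed
  then show ?thesis by (simp add: jump_total_def sum_distrib_right sum_distrib_left mult_ac)
qed

lemma integral_Sop_symmetric:
  assumes u: "u \<in> borel_measurable borel" "\<And>x. \<bar>u x\<bar> \<le> B" and g: "integrable lborel g"
  shows "(\<integral>x. Sop m \<delta> u x * g x \<partial>lborel) = (\<integral>x. u x * Sop m \<delta> g x \<partial>lborel)"
proof -
  have "integrable lborel (\<lambda>x. u x * g x)" "integrable lborel (\<lambda>x. Bop m u x * g x)" "integrable lborel (\<lambda>x. u x * Bop m g x)"
    using integral_bounded_L1(1)[OF u g] integral_bounded_L1(1)[OF Bop_measurable[OF u(1)] Bop_bounded[OF u(2)] g]
      integral_bounded_L1(1)[OF u Bop_integrable[OF g]] by auto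
  then show ?thesis
    using integral_Bop_symmetric[OF u g, of m]
    by (simp add: Sop_def algebra_simps)
qed

lemma integral_Sop_pow_symmetric:
  assumes \<delta>: "0 \<le> \<delta>" "\<delta> * jump_total m \<le> 1"
    and u: "u \<in> borel_measurable borel" "\<And>x. \<bar>u x\<bar> \<le> B" and g: "integrable lborel g"
  shows "(\<integral>x. (Sop m \<delta> ^^ j) u x * g x \<partial>lborel) = (\<integral>x. u x * (Sop m \<delta> ^^ j) g x \<partial>lborel)"
  using g
proof (induction j arbitrary: g)
  case (Suc j)
  have b: "\<bar>(Sop m \<delta> ^^ j) u x\<bar> \<le> B" for x
    using Sop_pow_bounds[OF \<delta>, of "- B" u B j x] u(2) by (auto simp: abs_le_iff minus_le_iff)
  have "(\<integral>x. (Sop m \<delta> ^^ Suc j) u x * g x \<partial>lborel) = (\<integral>x. (Sop m \<delta> ^^ j) u x * Sop m \<delta> g x \<partial>lborel)"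
    using integral_Sop_symmetric[OF Sop_pow_measurable[OF u(1)] b Suc.prems] by simp
  also have "\<dots> = (\<integral>x. u x * (Sop m \<delta> ^^ j) (Sop m \<delta> g) x \<partial>lborel)"
    by (rule Suc.IH[OF Sop_integrable[OF Suc.prems]])
  finally show ?case by (simp add: funpow_swap1)
qed simp

section \<open>Commutation with the fractional operator\<close>

lemma frac_op_integrable:
  assumes "test_fun F"
  shows "integrable lborel (frac_op h F)"
proof -
  obtain G :: "real \<times> (real^'d) \<Rightarrow> real" where G: "test_fun G" "\<And>s x. -1 < s \<and> s < 0 + 1 \<Longrightarrow> G (s, x) = F x"
    using test_fun_extend[OF assms, of 0] by blast
  have F: "(\<lambda>x. G (0, x)) = F" using G(2)[of 0] by (auto simp: fun_eq_iff)
  \<comment> \<open>The instance without perturbation: identity maps, no damping and constant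
    time.\<close>
  show ?thesis
    using lop_L1_convergence(2)[OF G(1), where c = 1 and \<sigma> = "\<lambda>n x. x" and \<rho> = "\<lambda>n y. y" and k = "\<lambda>_ _. 1"
        and s = "\<lambda>_. 0" and ?s0.0 = 0] comparable_self[of 1] by (simp add: F)
qed

lemma frac_integrand_integrable:
  assumes "test_fun F"
  shows "integrable lborel (\<lambda>y. h y * (F (x + y) + F (x - y) - 2 * F x))"
proof -
  obtain G :: "real \<times> (real^'d) \<Rightarrow> real" where G: "test_fun G" "\<And>s x. -1 < s \<and> s < 0 + 1 \<Longrightarrow> G (s, x) = F x"
    using test_fun_extend[OF assms, of 0] by blast
  have F: "(\<lambda>x. G (0, x)) = F" using G(2)[of 0] by (auto simp: fun_eq_iff)
  have "integrable lborel (\<lambda>y. 1 * (h0 y * second_diff (\<lambda>x. G (0, x)) x y))"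
    by (rule lop_integrand_integrable[OF G(1), where \<rho> = "\<lambda>y. y" and k = "\<lambda>_. 1" and c = 1])
       (auto intro: comparable_self)
  moreover have "h0 y * second_diff F x y = h y * (F (x + y) + F (x - y) - 2 * F x)" for y
    by (auto simp: h0_def second_diff_def)
  ultimately show ?thesis by (simp add: F)
qed

text \<open>Both operators are translation invariant and \<open>Bop m\<close> is a finite sum, so it
  passes through the integral once each summand is known to be integrable.\<close>

lemma frac_op_Bop:
  assumes F: "test_fun F"
  shows "frac_op h (Bop m F) = Bop m (frac_op h F)"
proof
  fix x
  let ?d = "\<lambda>x y. h y * (F (x + y) + F (x - y) - 2 * F x)"
  let ?p = "lattice_point m"
  have "frac_op h (Bop m F) x = (1/2) * (\<integral>y. (\<Sum>z\<in>jumps m. rate m z * (?d (x + ?p z) y - ?d x y)) \<partial>lborel)"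
    unfolding frac_op_def
  proof (rule arg_cong[where f = "\<lambda>t. 1/2 * t"], rule Bochner_Integration.integral_cong[OF refl])
    fix y
    have "Bop m F (x + y) + Bop m F (x - y) - 2 * Bop m F x =
        (\<Sum>z\<in>jumps m. rate m z * (F (x + ?p z + y) + F (x + ?p z - y) - 2 * F (x + ?p z)))
        - (\<Sum>z\<in>jumps m. rate m z * (F (x + y) + F (x - y) - 2 * F x))"
      unfolding Bop_def by (simp add: algebra_simps sum.distrib sum_subtractf sum_distrib_left)
    also have "\<dots> = (\<Sum>z\<in>jumps m. rate m z * ((F (x + ?p z + y) + F (x + ?p z - y) - 2 * F (x + ?p z)) - (F (x + y) + F (x - y) - 2 * F x)))"
      by (simp only: right_diff_distrib sum_subtractf)
    finally show "h y * (Bop m F (x + y) + Bop m F (x - y) - 2 * Bop m F x) = (\<Sum>z\<in>jumps m. rate m z * (?d (x + ?p z) y - ?d x y))"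
      by (simp only: sum_distrib_left right_diff_distrib mult.left_commute[of "h y"])
  qed
  also have "\<dots> = (1/2) * (\<Sum>z\<in>jumps m. rate m z * ((\<integral>y. ?d (x + ?p z) y \<partial>lborel) - (\<integral>y. ?d x y \<partial>lborel)))"
    by (subst Bochner_Integration.integral_sum)
       (simp_all add: frac_integrand_integrable[OF F] Bochner_Integration.integral_diff)
  also have "\<dots> = Bop m (frac_op h F) x"
    unfolding Bop_def frac_op_def by (simp add: sum_distrib_left algebra_simps)
  finally show "frac_op h (Bop m F) x = Bop m (frac_op h F) x" .
qed

lemma frac_op_Sop:
  assumes F: "test_fun F"
  shows "frac_op h (Sop m \<delta> F) = Sop m \<delta> (frac_op h F)"
proof
  fix x
  have "frac_op h (Sop m \<delta> F) x = (1/2) * (\<integral>y. h y * (F (x + y) + F (x - y) - 2 * F x) +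
      \<delta> * (h y * (Bop m F (x + y) + Bop m F (x - y) - 2 * Bop m F x)) \<partial>lborel)"
    unfolding frac_op_def Sop_def by (simp add: algebra_simps)
  also have "\<dots> = frac_op h F x + \<delta> * frac_op h (Bop m F) x"
    unfolding frac_op_def using frac_integrand_integrable[OF F, of x] frac_integrand_integrable[OF Bop_test_fun[OF F], of m x]
    by (simp add: Bochner_Integration.integral_add)
  finally show "frac_op h (Sop m \<delta> F) x = Sop m \<delta> (frac_op h F) x"
    by (simp add: Sop_def frac_op_Bop[OF F])
qed

lemma frac_op_Sop_pow:
  assumes F: "test_fun F"
  shows "frac_op h ((Sop m \<delta> ^^ j) F) = (Sop m \<delta> ^^ j) (frac_op h F)"
  by (induction j) (simp_all add: frac_op_Sop Sop_pow_test_fun F)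

lemma L1_frac_op_Sop_pow:
  assumes "m > 0" "0 \<le> \<delta>" "\<delta> * jump_total m \<le> 1" and F: "test_fun F"
  shows "L1 (frac_op h ((Sop m \<delta> ^^ j) F)) \<le> L1 (frac_op h F)"
  unfolding frac_op_Sop_pow[OF F] by (rule L1_Sop_pow[OF assms(1-3) frac_op_integrable[OF F]])

text \<open>The consistency error after \<open>j\<close> steps is the Euler product applied to the
  error of \<open>F\<close>, so contraction keeps it from growing. This is why one distance,
  computed for \<open>F\<close>, controls all time steps.\<close>

lemma L1_frac_op_Bop_Sop_pow:
  assumes "m > 0" "0 \<le> \<delta>" "\<delta> * jump_total m \<le> 1" and F: "test_fun F"
  shows "L1 (\<lambda>x. frac_op h ((Sop m \<delta> ^^ j) F) x - Bop m ((Sop m \<delta> ^^ j) F) x) \<le> L1 (\<lambda>x. frac_op h F x - Bop m F x)"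
proof -
  have "(\<lambda>x. frac_op h ((Sop m \<delta> ^^ j) F) x - Bop m ((Sop m \<delta> ^^ j) F) x) = (Sop m \<delta> ^^ j) (\<lambda>x. frac_op h F x - Bop m F x)"
    by (simp add: frac_op_Sop_pow[OF F] Bop_Sop_pow_commute Sop_pow_linear)
  then show ?thesis
    using L1_Sop_pow[OF assms(1-3), of "\<lambda>x. frac_op h F x - Bop m F x" j] frac_op_integrable[OF F] Bop_integrable[OF test_fun_integrable[OF F]]
    by simp
qed

section \<open>Convergence of the lattice operators\<close>

lemma Bop_as_lop:
  assumes m: "m > 0" and G: "\<And>x. G (s, x) = F x"
  shows "lop (\<lambda>y. if norm (lattice_round m y) \<le> real m then 1 else 0) s G (lattice_round m) x = Bop m F x"
proof -
  \<comment> \<open>The integrand depends on \<open>y\<close> only through its cell and vanishes off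
    \<open>jumps m\<close>, so the integral is a finite sum. The zero jump drops out because
    \<open>h0\<close> vanishes at the origin.\<close>
  define \<phi> where "\<phi> = (\<lambda>z :: int^'d. (if norm (lattice_point m z) \<le> real m then 1 else 0) * (h0 (lattice_point m z) * second_diff F x (lattice_point m z)))"
  have sub: "{z. \<phi> z \<noteq> 0} \<subseteq> jumps m" by (auto simp: \<phi>_def jumps_def h0_def)
  have "lop (\<lambda>y. if norm (lattice_round m y) \<le> real m then 1 else 0) s G (lattice_round m) x = (1/2) * (\<integral>y. \<phi> (cell_index m y) \<partial>lborel)"
    by (simp add: lop_def \<phi>_def lattice_round_def G)
  also have "(\<integral>y. \<phi> (cell_index m y) \<partial>lborel) = (1 / real m ^ CARD('d)) * (\<integral>z. \<phi> z \<partial>count_space UNIV)"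
    by (rule lattice_integral[OF m])
  also have "(\<integral>z. \<phi> z \<partial>count_space UNIV) = (\<Sum>z\<in>{z. \<phi> z \<noteq> 0}. \<phi> z)"
    using finite_subset[OF sub finite_jumps[OF m]] by (subst lebesgue_integral_count_space_finite_support) auto
  also have "\<dots> = (\<Sum>z\<in>jumps m. \<phi> z)"
    by (rule sum.mono_neutral_left[OF finite_jumps[OF m] sub]) auto
  also have "\<dots> = (\<Sum>z\<in>jumps m. h0 (lattice_point m z) * second_diff F x (lattice_point m z))"
    by (rule sum.cong) (auto simp: \<phi>_def jumps_def)
  finally show ?thesis by (simp add: Bop_second_diff rate_def sum_distrib_left)
qed

lemma comparable_lattice_round_Suc: "comparable (2 * real CARD('d)) (lattice_round (Suc n) y) y"
  by (rule comparable_lattice_round) simp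

lemma card_ge_1: "2 * real CARD('d) \<ge> 1"
  using zero_less_card_finite[where 'a = 'd] by linarith

lemma lattice_round_Suc_tendsto: "(\<lambda>n. lattice_round (Suc n) y) \<longlonglongrightarrow> y"
  using lattice_round_tendsto by (rule LIMSEQ_Suc)

lemma Bop_converges:
  assumes F: "test_fun F"
  shows "(\<lambda>m. L1 (\<lambda>x. frac_op h F x - Bop m F x)) \<longlonglongrightarrow> 0"
proof -
  obtain G :: "real \<times> (real^'d) \<Rightarrow> real" where G: "test_fun G" "\<And>s x. -1 < s \<and> s < 0 + 1 \<Longrightarrow> G (s, x) = F x"
    using test_fun_extend[OF assms, of 0] by blast
  have G0: "G (0, x) = F x" for x using G(2)[of 0] by auto
  \<comment> \<open>The index is shifted by one so that the mesh is never 1/0. The truncation tends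
    to 1 pointwise because rounding at most doubles the norm while the cutoff distance
    grows.\<close>
  let ?k = "\<lambda>n (y::real^'d). if norm (lattice_round (Suc n) y) \<le> real (Suc n) then 1 else (0::real)"
  have "(\<lambda>n. \<integral>x. \<bar>lop (?k n) 0 G (lattice_round (Suc n)) x - frac_op h (\<lambda>x. G (0, x)) x\<bar> \<partial>lborel) \<longlonglongrightarrow> 0"
  proof (rule lop_L1_convergence(3)[OF G(1) card_ge_1, where \<sigma> = "\<lambda>n x. x" and s = "\<lambda>_. 0"])
    show "(\<lambda>n. ?k n y) \<longlonglongrightarrow> 1" for y :: "real^'d"
    proof (rule tendsto_eventually)
      obtain N :: nat where N: "2 * norm y \<le> real N" using real_arch_simple by blast
      show "\<forall>\<^sub>F n in sequentially. ?k n y = 1"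
        using eventually_ge_at_top[of N]
      proof (rule eventually_mono)
        fix n assume "N \<le> n"
        then have "norm (lattice_round (Suc n) y) \<le> real (Suc n)"
          using N norm_lattice_round_le[of "Suc n" y] by simp
        then show "?k n y = 1" by simp
      qed
    qed
    show "?k n \<in> borel_measurable borel" for n
    proof -
      have [measurable]: "(lattice_round (Suc n) :: real^'d \<Rightarrow> real^'d) \<in> borel_measurable borel"
        by (rule lattice_round_measurable) simp
      show ?thesis by measurable
    qed
  qed (use card_ge_1 in \<open>auto intro!: lattice_round_measurable comparable_lattice_round_Suc lattice_round_Suc_tendsto\<close>)
  then have "(\<lambda>n. L1 (\<lambda>x. frac_op h F x - Bop (Suc n) F x)) \<longlonglongrightarrow> 0"
  proof -
    have "lop (?k n) 0 G (lattice_round (Suc n)) x = Bop (Suc n) F x" for n x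
      by (rule Bop_as_lop) (simp_all add: G0)
    then show "(\<lambda>n. \<integral>x. \<bar>lop (?k n) 0 G (lattice_round (Suc n)) x - frac_op h (\<lambda>x. G (0, x)) x\<bar> \<partial>lborel) \<longlonglongrightarrow> 0 \<Longrightarrow> ?thesis"
      by (simp only: G0 L1_def abs_minus_commute[of "Bop _ F _"])
  qed
  then show ?thesis by (rule LIMSEQ_imp_Suc)
qed

text \<open>The rescaled generator of the walk with jumps of every length, as it occurs in the
  exclusion process; unlike \<open>Bop n\<close> it does not preserve compact support.\<close>

definition Aop :: "nat \<Rightarrow> (real^'d \<Rightarrow> real) \<Rightarrow> real^'d \<Rightarrow> real" where
  "Aop n F x = (1/2) * (\<integral>y. h0 (lattice_round n y) * second_diff F x (lattice_round n y) \<partial>lborel)"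

text \<open>The evaluation point is rounded as well, since a configuration sees a function at
  lattice points only.\<close>

lemma Aop_converges:
  assumes F: "test_fun F"
  shows "n > 0 \<Longrightarrow> integrable lborel (\<lambda>x. Aop n F (lattice_round n x))"
    and "(\<lambda>n. L1 (\<lambda>x. Aop n F (lattice_round n x) - frac_op h F x)) \<longlonglongrightarrow> 0"
proof -
  obtain G :: "real \<times> (real^'d) \<Rightarrow> real" where G: "test_fun G" "\<And>s x. -1 < s \<and> s < 0 + 1 \<Longrightarrow> G (s, x) = F x"
    using test_fun_extend[OF assms, of 0] by blast
  have G0: "G (0, x) = F x" for x using G(2)[of 0] by auto
  have e: "lop (\<lambda>_. 1) 0 G (lattice_round n) x = Aop n F x" for n x
    by (simp add: lop_def Aop_def G0)
  have c: "norm (lattice_round (Suc n) x - x) \<le> 2 * real CARD('d)" for n and x :: "real^'d"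
    using comparable_lattice_round_Suc[of n x] by (simp add: comparable_def)
  have "(\<lambda>n. \<integral>x. \<bar>lop (\<lambda>_. 1) 0 G (lattice_round (Suc n)) (lattice_round (Suc n) x) - frac_op h (\<lambda>x. G (0, x)) x\<bar> \<partial>lborel) \<longlonglongrightarrow> 0"
    by (rule lop_L1_convergence(3)[OF G(1) card_ge_1, where \<sigma> = "\<lambda>n. lattice_round (Suc n)" and s = "\<lambda>_. 0" and k = "\<lambda>_ _. 1"])
       (use c in \<open>auto intro!: lattice_round_measurable comparable_lattice_round_Suc lattice_round_Suc_tendsto\<close>)
  then have "(\<lambda>n. L1 (\<lambda>x. Aop (Suc n) F (lattice_round (Suc n) x) - frac_op h F x)) \<longlonglongrightarrow> 0"
    by (simp add: e G0 L1_def)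
  then show "(\<lambda>n. L1 (\<lambda>x. Aop n F (lattice_round n x) - frac_op h F x)) \<longlonglongrightarrow> 0" by (rule LIMSEQ_imp_Suc)
  have "integrable lborel (\<lambda>x. lop (\<lambda>_. 1) 0 G (lattice_round (Suc n)) (lattice_round (Suc n) x))" for n
    by (rule lop_L1_convergence(1)[OF G(1) card_ge_1, where \<sigma> = "\<lambda>n. lattice_round (Suc n)" and \<rho> = "\<lambda>n. lattice_round (Suc n)" and s = "\<lambda>_. 0" and k = "\<lambda>_ _. 1" and ?s0.0 = 0])
       (use c in \<open>auto intro!: lattice_round_measurable comparable_lattice_round_Suc lattice_round_Suc_tendsto\<close>)
  then show "integrable lborel (\<lambda>x. Aop n F (lattice_round n x))" if "n > 0" for n
    using that by (cases n) (simp_all add: e)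
qed

lemma riemann_sum_converges:
  fixes K :: "real^'d \<Rightarrow> real"
  assumes K: "continuous_on UNIV K" "has_compact_support K"
  shows "n > 0 \<Longrightarrow> integrable lborel (\<lambda>x. K (lattice_round n x))"
    and "(\<lambda>n. L1 (\<lambda>x. K (lattice_round n x) - K x)) \<longlonglongrightarrow> 0"
proof -
  obtain M where M: "M \<ge> 0" "\<And>x. \<bar>K x\<bar> \<le> M" using compact_support_bounded[OF K] by blast
  obtain R where R: "\<And>x. norm x > R \<Longrightarrow> K x = 0" using K by (auto simp: has_compact_support_iff)
  let ?D = "2 * real CARD('d)"
  let ?w = "\<lambda>x::real^'d. 2 * M * indicator (cball 0 (R + ?D)) x"
  have w: "integrable lborel ?w"
    using emeasure_bounded_finite[OF bounded_cball] by (intro integrable_mult_right integrable_real_indicator) auto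
  have Km: "K \<in> borel_measurable borel" by (rule borel_measurable_continuous_onI[OF K(1)])
  have Krm: "(\<lambda>x. K (lattice_round (Suc n) x)) \<in> borel_measurable borel" for n
    by (rule measurable_compose[OF lattice_round_measurable Km]) simp
  have b: "\<bar>K x'\<bar> \<le> M * indicator (cball 0 (R + ?D)) x" if "norm (x' - x) \<le> ?D" for x x' :: "real^'d"
  proof (cases "norm x \<le> R + ?D")
    case True then show ?thesis using M by simp
  next
    case False
    then have "norm x' > R" using that norm_triangle_ineq2[of x x'] by (simp add: norm_minus_commute)
    then show ?thesis using R M by (simp add: indicator_def)
  qed
  have c: "norm (lattice_round (Suc n) x - x) \<le> ?D" for n and x :: "real^'d"
    using comparable_lattice_round_Suc[of n x] by (simp add: comparable_def)
  have "integrable lborel (\<lambda>x. K (lattice_round (Suc n) x))" for n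
  proof (rule Bochner_Integration.integrable_bound[OF w])
    show "AE x in lborel. norm (K (lattice_round (Suc n) x)) \<le> norm (?w x)"
    proof (intro AE_I2)
      fix x :: "real^'d"
      show "norm (K (lattice_round (Suc n) x)) \<le> norm (?w x)" using b[OF c[of n x]] M by (simp add: indicator_def split: if_splits)
    qed
  qed (use Krm in simp)
  then show "integrable lborel (\<lambda>x. K (lattice_round n x))" if "n > 0" for n using that by (cases n) simp_all
  have "(\<lambda>n. L1 (\<lambda>x. K (lattice_round (Suc n) x) - K x)) \<longlonglongrightarrow> (\<integral>x. 0 \<partial>(lborel :: (real^'d) measure))"
    unfolding L1_def
  proof (rule integral_dominated_convergence[OF _ _ w])
    show "AE x in lborel. (\<lambda>n. \<bar>K (lattice_round (Suc n) x) - K x\<bar>) \<longlonglongrightarrow> 0"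
    proof (intro AE_I2)
      fix x
      have "isCont K x" using K(1) by (simp add: continuous_on_eq_continuous_at)
      then have "(\<lambda>n. K (lattice_round (Suc n) x)) \<longlonglongrightarrow> K x"
        using lattice_round_Suc_tendsto by (rule isCont_tendsto_compose)
      then show "(\<lambda>n. \<bar>K (lattice_round (Suc n) x) - K x\<bar>) \<longlonglongrightarrow> 0"
        by (intro tendsto_rabs_zero) (simp add: Lim_null[symmetric])
    qed
    show "AE x in lborel. norm \<bar>K (lattice_round (Suc n) x) - K x\<bar> \<le> ?w x" for n
    proof (intro AE_I2)
      fix x
      show "norm \<bar>K (lattice_round (Suc n) x) - K x\<bar> \<le> ?w x"
        using b[OF c[of n x]] b[of x x] by simp
    qed
  qed (use Krm Km in auto)
  then have "(\<lambda>n. L1 (\<lambda>x. K (lattice_round (Suc n) x) - K x)) \<longlonglongrightarrow> 0" by simp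
  then show "(\<lambda>n. L1 (\<lambda>x. K (lattice_round n x) - K x)) \<longlonglongrightarrow> 0" by (rule LIMSEQ_imp_Suc)
qed

text \<open>Two choices of \<open>K\<close> are used later: a truncated operator applied to
  \<open>F\<close>, to measure how well it closes the moment equation, and the zero function, to
  bound the square field and the drift of cross moments.\<close>

lemma lattice_L1_converges:
  assumes F: "test_fun F" and K: "continuous_on UNIV K" "has_compact_support K"
  shows "(\<lambda>n. L1 (\<lambda>x. Aop n F (lattice_round n x) - K (lattice_round n x))) \<longlonglongrightarrow> L1 (\<lambda>x. frac_op h F x - K x)"
proof (rule Lim_null[THEN iffD2], rule Lim_null_comparison)
  show "\<forall>\<^sub>F n in sequentially. norm (L1 (\<lambda>x. Aop n F (lattice_round n x) - K (lattice_round n x)) - L1 (\<lambda>x. frac_op h F x - K x))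
    \<le> L1 (\<lambda>x. Aop n F (lattice_round n x) - frac_op h F x) + L1 (\<lambda>x. K (lattice_round n x) - K x)"
    using eventually_gt_at_top[of 0]
  proof (rule eventually_mono)
    fix n :: nat assume n: "n > 0"
    let ?a = "\<lambda>x. Aop n F (lattice_round n x)" and ?k = "\<lambda>x. K (lattice_round n x)" and ?f = "frac_op h F"
    have i: "integrable lborel ?a" "integrable lborel ?k" "integrable lborel ?f" "integrable lborel K"
      using Aop_converges(1)[OF F n] riemann_sum_converges(1)[OF K n] frac_op_integrable[OF F] compact_support_integrable[OF K] by auto
    have 1: "L1 (\<lambda>x. ?a x - ?k x) \<le> L1 (\<lambda>x. ?a x - ?f x) + (L1 (\<lambda>x. ?f x - K x) + L1 (\<lambda>x. K x - ?k x))"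
      using L1_diff_triangle[OF i(1,3,2)] L1_diff_triangle[OF i(3,4,2)] by linarith
    have 2: "L1 (\<lambda>x. ?f x - K x) \<le> L1 (\<lambda>x. ?f x - ?a x) + (L1 (\<lambda>x. ?a x - ?k x) + L1 (\<lambda>x. ?k x - K x))"
      using L1_diff_triangle[OF i(3,1,4)] L1_diff_triangle[OF i(1,2,4)] by linarith
    show "norm (L1 (\<lambda>x. ?a x - ?k x) - L1 (\<lambda>x. ?f x - K x)) \<le> L1 (\<lambda>x. ?a x - ?f x) + L1 (\<lambda>x. ?k x - K x)"
      using 1 2 L1_sym[of ?a ?f] L1_sym[of ?k K] by simp
  qed
  show "(\<lambda>n. L1 (\<lambda>x. Aop n F (lattice_round n x) - frac_op h F x) + L1 (\<lambda>x. K (lattice_round n x) - K x)) \<longlonglongrightarrow> 0"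
    using tendsto_add[OF Aop_converges(2)[OF F] riemann_sum_converges(2)[OF K]] by simp
qed

end

section \<open>Uniqueness of weak solutions\<close>

text \<open>\<open>weak_solution\<close> asserts only that some bound exists; one is fixed here as
  \<open>B\<close>.\<close>

locale weak_sol = levy_kernel h \<alpha> for h :: "real^'d \<Rightarrow> real" and \<alpha> +
  fixes u0 :: "real^'d \<Rightarrow> real" and u :: "real \<Rightarrow> real^'d \<Rightarrow> real" and T B :: real
  assumes sol: "weak_solution h T u0 u" and bound: "\<And>s x. s \<in> {0..T} \<Longrightarrow> \<bar>u s x\<bar> \<le> B"
begin

lemma u_joint [measurable]: "(\<lambda>(s, x). u s x) \<in> borel_measurable (borel \<Otimes>\<^sub>M borel)"
  using sol by (simp add: weak_solution_def borel_prod)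

lemma u_section: "u s \<in> borel_measurable borel"
  using measurable_compose[OF measurable_Pair1' u_joint, of s] by simp

definition pairing :: "(real^'d \<Rightarrow> real) \<Rightarrow> real \<Rightarrow> real" where
  "pairing g s = (\<integral>x. u s x * g x \<partial>lborel)"

lemma pairing_integrable: "integrable lborel g \<Longrightarrow> s \<in> {0..T} \<Longrightarrow> integrable lborel (\<lambda>x. u s x * g x)"
  by (rule integral_bounded_L1(1)[OF u_section bound])

lemma pairing_bound: "integrable lborel g \<Longrightarrow> s \<in> {0..T} \<Longrightarrow> \<bar>pairing g s\<bar> \<le> B * L1 g"
  unfolding pairing_def by (rule integral_bounded_L1(2)[OF u_section bound])

lemma pairing_linear:
  assumes "integrable lborel f" "integrable lborel g" "s \<in> {0..T}"
  shows "pairing (\<lambda>x. f x + c * g x) s = pairing f s + c * pairing g s"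
    and "pairing (\<lambda>x. f x - g x) s = pairing f s - pairing g s"
  using pairing_integrable[OF assms(1,3)] pairing_integrable[OF assms(2,3)]
  by (simp_all add: pairing_def algebra_simps)

lemma pairing_measurable:
  assumes "g \<in> borel_measurable borel"
  shows "pairing g \<in> borel_measurable borel"
proof -
  note [measurable] = assms
  have "(\<lambda>(s, x). u s x * g x) \<in> borel_measurable (borel \<Otimes>\<^sub>M lborel)"
    by measurable
  then show ?thesis unfolding pairing_def[abs_def]
    by (rule lborel.borel_measurable_lebesgue_integral)
qed

text \<open>Tested with an extension of \<open>F\<close> that is constant in time near [0,T], the
  weak formulation loses its time derivative and only the fractional operator remains.\<close>

lemma weak_equation:
  assumes F: "test_fun F" and t: "t \<in> {0..T}"
  shows "pairing F t = (\<integral>x. u0 x * F x \<partial>lborel) + (\<integral>s. indicator {0..t} s * pairing (frac_op h F) s \<partial>lborel)"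
proof -
  obtain G :: "real \<times> (real^'d) \<Rightarrow> real" where G: "test_fun G" "\<And>s x. -1 < s \<Longrightarrow> s < T + 1 \<Longrightarrow> G (s, x) = F x"
    using test_fun_extend[OF F, of T] by blast
  have e: "pairing F t - (\<integral>x. u0 x * F x \<partial>lborel)
          - (\<integral>s. (\<integral>x. u s x * (deriv (\<lambda>r. G (r,x)) s + frac_op h (\<lambda>y. G (s,y)) x) \<partial>lborel)
                \<partial>(restrict_space lborel {0..t})) = 0"
    using sol G t unfolding weak_solution_def test_fun_def pairing_def by force
  have "(\<integral>s. (\<integral>x. u s x * (deriv (\<lambda>r. G (r,x)) s + frac_op h (\<lambda>y. G (s,y)) x) \<partial>lborel) \<partial>(restrict_space lborel {0..t}))
    = (\<integral>s. pairing (frac_op h F) s \<partial>(restrict_space lborel {0..t}))"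
  proof (rule Bochner_Integration.integral_cong[OF refl])
    fix s assume "s \<in> space (restrict_space lborel {0..t})"
    then have s: "-1 < s" "s < T + 1" using t by (auto simp: space_restrict_space)
    have "deriv (\<lambda>r. G (r,x)) s = 0" for x
    proof -
      have "\<forall>\<^sub>F r in nhds s. r \<in> {-1<..<T+1}" using s by (intro eventually_nhds_in_open) auto
      then have "\<forall>\<^sub>F r in nhds s. G (r, x) = F x" by (rule eventually_mono) (use G(2) in auto)
      then have "deriv (\<lambda>r. G (r,x)) s = deriv (\<lambda>r. F x) s" by (rule deriv_cong_ev) simp
      then show ?thesis by simp
    qed
    then show "(\<integral>x. u s x * (deriv (\<lambda>r. G (r,x)) s + frac_op h (\<lambda>y. G (s,y)) x) \<partial>lborel) = pairing (frac_op h F) s"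
      using G(2)[OF s] by (simp add: pairing_def)
  qed
  also have "\<dots> = (\<integral>s. indicator {0..t} s * pairing (frac_op h F) s \<partial>lborel)"
    by (subst integral_restrict_space) auto
  finally show ?thesis using e by simp
qed

lemma indicator_pairing_integrable:
  assumes "integrable lborel g" "b \<le> T"
  shows "integrable lborel (\<lambda>s. indicator {0..b} s * pairing g s)"
proof (rule Bochner_Integration.integrable_bound[where f = "\<lambda>s. B * L1 g * indicator {0..b} s"])
  show "(\<lambda>s. indicator {0..b} s * pairing g s) \<in> borel_measurable lborel"
    using pairing_measurable borel_measurable_integrable[OF assms(1)] by (auto intro!: borel_measurable_times)
  show "AE s in lborel. norm (indicator {0..b} s * pairing g s) \<le> norm (B * L1 g * indicator {0..b} s)"
    using pairing_bound[OF assms(1)] assms(2)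
    by (intro AE_I2) (auto simp: indicator_def intro: order_trans[OF _ abs_ge_self])
  show "integrable lborel (\<lambda>s. B * L1 g * indicator {0..b} s)"
    by (intro integrable_mult_right integrable_real_indicator) (auto simp: emeasure_lborel_Icc_eq)
qed

text \<open>A mean value inequality in integrated form: the weak equation provides integrals in time
  rather than derivatives, and a nearly constant integrand with value \<open>c\<close> takes the
  place of the derivative.\<close>

lemma pairing_step:
  assumes F: "test_fun F" and ab: "0 \<le> a" "a \<le> b" "b \<le> T"
    and e: "\<And>s. s \<in> {a..b} \<Longrightarrow> \<bar>pairing (frac_op h F) s - c\<bar> \<le> \<epsilon>"
  shows "\<bar>pairing F b - pairing F a - (b - a) * c\<bar> \<le> (b - a) * \<epsilon>"
proof -
  let ?e = "pairing (frac_op h F)"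
  have ic: "integrable lborel (\<lambda>s. k * indicator {a<..b} s)" for k :: real
    using ab by (intro integrable_mult_right integrable_real_indicator) auto
  note ii = indicator_pairing_integrable[OF frac_op_integrable[OF F]]
  have aT: "a \<le> T" using ab by linarith
  note ia = ii[OF aT] and ib = ii[OF ab(3)]
  have 1: "pairing F b - pairing F a = (\<integral>s. indicator {0..b} s * ?e s - indicator {0..a} s * ?e s \<partial>lborel)"
    using weak_equation[OF F, of a] weak_equation[OF F, of b] ab aT ia ib by simp
  have 2: "(\<integral>s. c * indicator {a<..b} s \<partial>lborel) = (b - a) * c" using ab by simp
  define f where "f = (\<lambda>s. (indicator {0..b} s * ?e s - indicator {0..a} s * ?e s) - c * indicator {a<..b} s)"
  have fi: "integrable lborel f"
    unfolding f_def by (rule Bochner_Integration.integrable_diff[OF Bochner_Integration.integrable_diff[OF ib ia] ic])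
  have eq: "pairing F b - pairing F a - (b - a) * c = (\<integral>s. f s \<partial>lborel)"
    unfolding f_def 1 2[symmetric]
    by (rule Bochner_Integration.integral_diff[OF Bochner_Integration.integrable_diff[OF ib ia] ic, symmetric])
  have fb: "\<bar>f s\<bar> \<le> \<epsilon> * indicator {a<..b} s" for s
  proof (cases "s \<in> {a<..b}")
    case True
    then have "s \<in> {0..b}" "s \<notin> {0..a}" "s \<in> {a..b}" using ab by auto
    then show ?thesis using e[of s] True by (simp only: f_def indicator_simps) simp
  next
    case False
    then have "s \<in> {0..b} \<longleftrightarrow> s \<in> {0..a}" using ab by auto
    then have "indicator {0..b} s = (indicator {0..a} s :: real)" by (simp only: indicator_def)
    then show ?thesis using False by (simp only: f_def indicator_simps) simp
  qed
  have "\<bar>\<integral>s. f s \<partial>lborel\<bar> \<le> (\<integral>s. \<bar>f s\<bar> \<partial>lborel)"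
    using integral_norm_bound[of lborel f] by simp
  also have "\<dots> \<le> (\<integral>s. \<epsilon> * indicator {a<..b} s \<partial>lborel)"
    by (rule integral_mono[OF integrable_abs[OF fi] ic fb])
  also have "\<dots> = (b - a) * \<epsilon>" using ab by simp
  finally show ?thesis unfolding eq .
qed

text \<open>Uniqueness is contained in this bound: apart from \<open>B\<close> the right-hand side
  does not see \<open>u\<close>, and it becomes small by choosing first \<open>m\<close> and then
  \<open>N\<close>.\<close>

lemma duality_estimate:
  assumes F: "test_fun F" and t: "t \<in> {0..T}" and m: "m > 0" and N: "N > 0"
    and \<delta>: "\<delta> = t / real N" "\<delta> * jump_total m \<le> 1" and B: "B \<ge> 0"
  shows "\<bar>(\<integral>x. u t x * F x \<partial>lborel) - (\<integral>x. u0 x * (Sop m \<delta> ^^ N) F x \<partial>lborel)\<bar>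
    \<le> t * (B * (L1 (\<lambda>x. frac_op h F x - Bop m F x) + \<delta> * L1 (frac_op h (Bop m F))))"
proof -
  \<comment> \<open>The first summand is the defect of the truncated walk; the second comes from
    freezing the pairing with \<open>Bop m (G j)\<close> at the left end of a step of length
    \<open>\<delta>\<close>.\<close>
  define E where "E = B * (L1 (\<lambda>x. frac_op h F x - Bop m F x) + \<delta> * L1 (frac_op h (Bop m F)))"
  have \<delta>0: "\<delta> \<ge> 0" using \<delta> t by simp
  define G where "G j = (Sop m \<delta> ^^ j) F" for j
  have G: "test_fun (G j)" for j unfolding G_def by (rule Sop_pow_test_fun[OF F])
  have step: "\<bar>pairing (G j) (s + \<delta>) - pairing (G (Suc j)) s\<bar> \<le> \<delta> * E" if s: "0 \<le> s" "s + \<delta> \<le> T" for s j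
  proof -
    have sT: "s \<in> {0..T}" using s \<delta>0 by auto
    have iG: "integrable lborel (G j)" "integrable lborel (Bop m (G j))" "integrable lborel (frac_op h (G j))"
      "integrable lborel (frac_op h (Bop m (G j)))"
      using G[of j] by (auto intro: test_fun_integrable Bop_integrable frac_op_integrable Bop_test_fun)
    have "G (Suc j) = (\<lambda>x. G j x + \<delta> * Bop m (G j) x)"
      by (simp add: G_def Sop_def[abs_def])
    then have 1: "pairing (G (Suc j)) s = pairing (G j) s + \<delta> * pairing (Bop m (G j)) s"
      using pairing_linear(1)[OF iG(1,2) sT, of \<delta>] by simp
    \<comment> \<open>The weak equation is used once more, now for \<open>Bop m (G j)\<close>; this
      is where the fractional operator of \<open>Bop m F\<close> enters.\<close>
    have lip: "\<bar>pairing (Bop m (G j)) r - pairing (Bop m (G j)) s\<bar> \<le> \<delta> * (B * L1 (frac_op h (Bop m F)))" if r: "r \<in> {s..s+\<delta>}" for r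
    proof -
      have "\<bar>pairing (Bop m (G j)) r - pairing (Bop m (G j)) s - (r - s) * 0\<bar> \<le> (r - s) * (B * L1 (frac_op h (Bop m (G j))))"
        using r s pairing_bound[OF iG(4)] by (intro pairing_step Bop_test_fun G) auto
      also have "\<dots> \<le> \<delta> * (B * L1 (frac_op h (Bop m F)))"
      proof (intro mult_mono mult_left_mono B)
        show "L1 (frac_op h (Bop m (G j))) \<le> L1 (frac_op h (Bop m F))"
          using L1_frac_op_Sop_pow[OF m \<delta>0 \<delta>(2) Bop_test_fun[OF F], of j m] by (simp add: G_def Bop_Sop_pow_commute)
      qed (use r \<delta>0 B in \<open>auto intro!: mult_nonneg_nonneg L1_nonneg\<close>)
      finally show ?thesis by simp
    qed
    have "\<bar>pairing (G j) (s + \<delta>) - pairing (G j) s - ((s + \<delta>) - s) * pairing (Bop m (G j)) s\<bar> \<le> ((s + \<delta>) - s) * E"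
    proof (rule pairing_step[OF G])
      fix r assume r: "r \<in> {s..s+\<delta>}"
      then have rT: "r \<in> {0..T}" using s by auto
      have "pairing (frac_op h (G j)) r - pairing (Bop m (G j)) s =
          pairing (\<lambda>x. frac_op h (G j) x - Bop m (G j) x) r + (pairing (Bop m (G j)) r - pairing (Bop m (G j)) s)"
        using pairing_linear(2)[OF iG(3,2) rT] by simp
      moreover have "\<bar>pairing (\<lambda>x. frac_op h (G j) x - Bop m (G j) x) r\<bar> \<le> B * L1 (\<lambda>x. frac_op h F x - Bop m F x)"
      proof -
        have "\<bar>pairing (\<lambda>x. frac_op h (G j) x - Bop m (G j) x) r\<bar> \<le> B * L1 (\<lambda>x. frac_op h (G j) x - Bop m (G j) x)"
          using iG rT by (intro pairing_bound) auto
        also have "\<dots> \<le> B * L1 (\<lambda>x. frac_op h F x - Bop m F x)"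
          unfolding G_def by (intro mult_left_mono L1_frac_op_Bop_Sop_pow m \<delta>0 \<delta>(2) F B)
        finally show ?thesis .
      qed
      ultimately show "\<bar>pairing (frac_op h (G j)) r - pairing (Bop m (G j)) s\<bar> \<le> E"
        using lip[OF r] unfolding E_def by (simp add: algebra_simps)
    qed (use s \<delta>0 in auto)
    then show ?thesis using 1 by simp
  qed
  \<comment> \<open>At time \<open>real k * \<delta>\<close> there are \<open>N - k\<close> Euler
    factors on the test function, so moving from time 0 to \<open>t\<close> removes all of
    them.\<close>
  have "k \<le> N \<Longrightarrow> \<bar>pairing (G (N - k)) (real k * \<delta>) - pairing (G N) 0\<bar> \<le> real k * (\<delta> * E)" for k
  proof (induction k)
    case (Suc k)
    have NS: "N - k = Suc (N - Suc k)" using Suc.prems by simp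
    have "real (Suc k) * \<delta> \<le> real N * \<delta>" using Suc.prems \<delta>0 by (intro mult_right_mono) auto
    moreover have "real N * \<delta> \<le> T" using \<delta>(1) N t by simp
    moreover have "real (Suc k) * \<delta> = real k * \<delta> + \<delta>" by (simp add: algebra_simps)
    ultimately have "real k * \<delta> + \<delta> \<le> T" by linarith
    then have "\<bar>pairing (G (N - Suc k)) (real k * \<delta> + \<delta>) - pairing (G (N - k)) (real k * \<delta>)\<bar> \<le> \<delta> * E"
      unfolding NS using \<delta>0 by (intro step) auto
    moreover have "real (Suc k) * \<delta> = real k * \<delta> + \<delta>" "real (Suc k) * (\<delta> * E) = real k * (\<delta> * E) + \<delta> * E"
      by (simp_all add: algebra_simps)
    ultimately show ?case using Suc.IH Suc.prems by simp
  qed simp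
  from this[of N] have "\<bar>pairing F t - pairing (G N) 0\<bar> \<le> t * E"
    using \<delta> N by (simp add: G_def)
  moreover have "pairing (G N) 0 = (\<integral>x. u0 x * G N x \<partial>lborel)"
  proof -
    have z: "indicator {0..0} s * pairing (frac_op h (G N)) s = indicator {0} s * pairing (frac_op h (G N)) 0" for s :: real
      by (simp add: indicator_def)
    have "(\<integral>s. indicator {0..0::real} s * pairing (frac_op h (G N)) s \<partial>lborel) = 0"
      unfolding z by simp
    moreover have "0 \<in> {0..T}" using t by auto
    ultimately show ?thesis using weak_equation[OF G[of N], of 0] by simp
  qed
  ultimately show ?thesis by (simp add: pairing_def E_def G_def)
qed

end

section \<open>Existence of weak solutions\<close>

text \<open>A measurable function is an almost everywhere limit of continuous ones. Clipping the
  values by \<open>c M\<close> and cutting off in space by \<open>\<eta> M\<close> supply a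
  dominating function and compact support, after which uniform approximation on a fixed ball gives
  the L1 bound.\<close>

lemma L1_dense:
  fixes f :: "real^'d \<Rightarrow> real"
  assumes f: "integrable lborel f" and e: "e > 0"
  shows "\<exists>F. test_fun F \<and> L1 (\<lambda>x. f x - F x) \<le> e"
proof -
  have fm[measurable]: "f \<in> borel_measurable borel" using borel_measurable_integrable[OF f] by simp
  then have "f measurable_on UNIV" by (intro lebesgue_measurable_imp_measurable_on_real measurable_completion) auto
  then obtain N g where N: "negligible N" and g: "\<And>n. continuous_on UNIV (g n)" and lim: "\<And>x. x \<notin> N \<Longrightarrow> (\<lambda>n. g n x) \<longlonglongrightarrow> f x"
    unfolding measurable_on_def by auto
  define \<eta> where "\<eta> = (\<lambda>(M::nat) (x::real^'d). max 0 (min 1 (real M + 1 - norm x)))"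
  define c where "c = (\<lambda>(M::nat) (r::real). max (- real M) (min (real M) r))"
  have \<eta>01: "0 \<le> \<eta> M x" "\<eta> M x \<le> 1" for M x by (auto simp: \<eta>_def)
  have cM: "\<bar>c M r\<bar> \<le> real M" "\<bar>c M r\<bar> \<le> \<bar>r\<bar>" for M r by (auto simp: c_def)
  have gm[measurable]: "g n \<in> borel_measurable borel" for n by (rule borel_measurable_continuous_onI[OF g])
  have [measurable]: "\<eta> M \<in> borel_measurable borel" for M unfolding \<eta>_def by measurable
  have [measurable]: "c M \<in> borel_measurable borel" for M unfolding c_def by measurable
  have le: "\<bar>\<eta> M x * c M r\<bar> \<le> \<bar>r\<bar>" for M x r
    using mult_mono[OF \<eta>01(2)[of M x] cM(2)[of M r]] \<eta>01(1)[of M x] by (simp add: abs_mult)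
  have "(\<lambda>M. L1 (\<lambda>x. f x - \<eta> M x * c M (f x))) \<longlonglongrightarrow> (\<integral>x. 0 \<partial>(lborel :: (real^'d) measure))"
    unfolding L1_def
  proof (rule integral_dominated_convergence[where w = "\<lambda>x. 2 * \<bar>f x\<bar>"])
    show "AE x in lborel. (\<lambda>M. \<bar>f x - \<eta> M x * c M (f x)\<bar>) \<longlonglongrightarrow> 0"
    proof (intro AE_I2 tendsto_eventually)
      fix x
      obtain M0 :: nat where M0: "norm x + \<bar>f x\<bar> \<le> real M0" using real_arch_simple by blast
      show "\<forall>\<^sub>F M in sequentially. \<bar>f x - \<eta> M x * c M (f x)\<bar> = 0"
        using eventually_ge_at_top[of M0]
      proof (rule eventually_mono)
        fix M assume "M0 \<le> M"
        then have "norm x + \<bar>f x\<bar> \<le> real M" using M0 by linarith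
        then have "norm x \<le> real M" "\<bar>f x\<bar> \<le> real M" using norm_ge_zero[of x] abs_ge_zero[of "f x"] by linarith+
        then have "\<eta> M x = 1" "c M (f x) = f x" by (auto simp: \<eta>_def c_def)
        then show "\<bar>f x - \<eta> M x * c M (f x)\<bar> = 0" by simp
      qed
    qed
    show "AE x in lborel. norm \<bar>f x - \<eta> M x * c M (f x)\<bar> \<le> 2 * \<bar>f x\<bar>" for M
    proof (intro AE_I2)
      fix x show "norm \<bar>f x - \<eta> M x * c M (f x)\<bar> \<le> 2 * \<bar>f x\<bar>"
        using le[of M x "f x"] unfolding real_norm_def by linarith
    qed
  qed (use f in auto)
  then have "\<forall>\<^sub>F M in sequentially. L1 (\<lambda>x. f x - \<eta> M x * c M (f x)) < e / 3"
    using e by (intro order_tendstoD) auto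
  then obtain M where M: "L1 (\<lambda>x. f x - \<eta> M x * c M (f x)) < e / 3"
    using eventually_happens'[OF sequentially_bot] by blast
  let ?w = "\<lambda>x::real^'d. 2 * real M * indicator (cball 0 (real M + 1)) x"
  have w: "integrable lborel ?w"
    using emeasure_bounded_finite[OF bounded_cball] by (intro integrable_mult_right integrable_real_indicator) auto
  have b: "\<bar>\<eta> M x * c M r\<bar> \<le> real M * indicator (cball 0 (real M + 1)) x" for x r
  proof (cases "norm x \<le> real M + 1")
    case True
    then show ?thesis using mult_mono[OF \<eta>01(2)[of M x] cM(1)[of M r]] \<eta>01(1)[of M x] by (simp add: abs_mult)
  next
    case False
    then show ?thesis by (simp add: \<eta>_def)
  qed
  have "(\<lambda>n. L1 (\<lambda>x. \<eta> M x * c M (f x) - \<eta> M x * c M (g n x))) \<longlonglongrightarrow> (\<integral>x. 0 \<partial>(lborel :: (real^'d) measure))"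
    unfolding L1_def
  proof (rule integral_dominated_convergence[OF _ _ w])
    have ae: "AE x in lborel. x \<notin> N"
      using AE_not_in[of N lebesgue] N by (simp add: negligible_iff_null_sets AE_completion_iff)
    show "AE x in lborel. (\<lambda>n. \<bar>\<eta> M x * c M (f x) - \<eta> M x * c M (g n x)\<bar>) \<longlonglongrightarrow> 0"
      using ae
    proof eventually_elim
      case (elim x)
      have "(\<lambda>n. \<bar>\<eta> M x * c M (f x) - \<eta> M x * c M (g n x)\<bar>) \<longlonglongrightarrow> \<bar>\<eta> M x * c M (f x) - \<eta> M x * c M (f x)\<bar>"
        unfolding c_def by (intro tendsto_intros lim elim)
      then show ?case by simp
    qed
    show "AE x in lborel. norm \<bar>\<eta> M x * c M (f x) - \<eta> M x * c M (g n x)\<bar> \<le> ?w x" for n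
    proof (intro AE_I2)
      fix x show "norm \<bar>\<eta> M x * c M (f x) - \<eta> M x * c M (g n x)\<bar> \<le> ?w x"
        using b[of x "f x"] b[of x "g n x"] by simp
    qed
  qed auto
  then have "\<forall>\<^sub>F n in sequentially. L1 (\<lambda>x. \<eta> M x * c M (f x) - \<eta> M x * c M (g n x)) < e / 3"
    using e by (intro order_tendstoD) auto
  then obtain n where n: "L1 (\<lambda>x. \<eta> M x * c M (f x) - \<eta> M x * c M (g n x)) < e / 3"
    using eventually_happens'[OF sequentially_bot] by blast
  define k where "k = (\<lambda>x. \<eta> M x * c M (g n x))"
  have kc: "continuous_on UNIV k" unfolding k_def \<eta>_def c_def
    by (intro continuous_intros continuous_on_compose2[OF g[of n]]) auto
  have ks: "has_compact_support k"
    unfolding has_compact_support_iff k_def \<eta>_def by (intro exI[of _ "real M + 1"]) auto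
  obtain R where R: "\<And>x. norm x > R \<Longrightarrow> k x = 0"
    "\<And>e. e > 0 \<Longrightarrow> \<exists>G. test_fun G \<and> (\<forall>x. norm x > R \<longrightarrow> G x = 0) \<and> (\<forall>x. \<bar>k x - G x\<bar> \<le> e)"
    using test_fun_dense[OF kc ks] by blast
  define V where "V = measure lborel (cball (0::real^'d) R)"
  obtain F where F: "test_fun F" "\<And>x. norm x > R \<Longrightarrow> F x = 0" "\<And>x. \<bar>k x - F x\<bar> \<le> e / (3 * (V + 1))"
    using R(2)[of "e / (3 * (V + 1))"] e by (auto simp: V_def add_nonneg_pos)
  have kF: "L1 (\<lambda>x. k x - F x) \<le> e / 3"
  proof -
    have "L1 (\<lambda>x. k x - F x) \<le> (\<integral>x. e / (3 * (V + 1)) * indicator (cball (0::real^'d) R) x \<partial>lborel)"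
      unfolding L1_def
    proof (rule integral_mono)
      show "integrable lborel (\<lambda>x. \<bar>k x - F x\<bar>)"
        using compact_support_integrable[OF kc ks] test_fun_integrable[OF F(1)] by simp
      show "integrable lborel (\<lambda>x. e / (3 * (V + 1)) * indicator (cball (0::real^'d) R) x)"
        using emeasure_bounded_finite[OF bounded_cball] by (intro integrable_mult_right integrable_real_indicator) auto
      show "\<bar>k x - F x\<bar> \<le> e / (3 * (V + 1)) * indicator (cball 0 R) x" for x
        using F(2,3)[of x] R(1)[of x] by (auto simp: indicator_def not_le)
    qed
    also have "\<dots> = e / (3 * (V + 1)) * V"
      using emeasure_bounded_finite[OF bounded_cball, of "0::real^'d" R] by (simp add: V_def)
    also have "\<dots> \<le> e / 3"
    proof -
      have "V \<ge> 0" by (simp add: V_def)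
      then show ?thesis using e by (simp add: field_simps)
    qed
    finally show ?thesis .
  qed
  have i: "integrable lborel (\<lambda>x. \<eta> M x * c M (f x))" "integrable lborel k" "integrable lborel F"
  proof -
    show "integrable lborel (\<lambda>x. \<eta> M x * c M (f x))"
      by (rule Bochner_Integration.integrable_bound[OF f]) (use le in auto)
  qed (auto intro: compact_support_integrable kc ks test_fun_integrable F)
  have "L1 (\<lambda>x. f x - F x) \<le> e"
    using L1_diff_triangle[OF f i(1,3)] L1_diff_triangle[OF i] M n kF unfolding k_def by linarith
  then show ?thesis using F by blast
qed

text \<open>The difference of the powers is a sum of products with a single factor S - S';
  commutation brings it next to \<open>f\<close>, and contraction drops the other factors. Abstract
  \<open>S\<close> and \<open>S'\<close> allow one of them to be a power of finer steps.\<close>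

lemma telescoping_L1:
  fixes S S' :: "(real^'d \<Rightarrow> real) \<Rightarrow> real^'d \<Rightarrow> real"
  assumes linear_op: "\<And>f g. S (\<lambda>x. f x - g x) = (\<lambda>x. S f x - S g x)" "\<And>f g. S' (\<lambda>x. f x - g x) = (\<lambda>x. S' f x - S' g x)"
    and int: "\<And>f. integrable lborel f \<Longrightarrow> integrable lborel (S f)" "\<And>f. integrable lborel f \<Longrightarrow> integrable lborel (S' f)"
    and contr: "\<And>f. integrable lborel f \<Longrightarrow> L1 (S f) \<le> L1 f" "\<And>f. integrable lborel f \<Longrightarrow> L1 (S' f) \<le> L1 f"
    and comm: "\<And>f. S (S' f) = S' (S f)"
    and f: "integrable lborel f"
  shows "L1 (\<lambda>x. (S ^^ N) f x - (S' ^^ N) f x) \<le> real N * L1 (\<lambda>x. S f x - S' f x)"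
  using f
proof (induction N arbitrary: f)
  case 0
  then show ?case by (simp add: L1_def)
next
  case (Suc N)
  have Si: "integrable lborel g \<Longrightarrow> integrable lborel ((S ^^ j) g)" "integrable lborel g \<Longrightarrow> integrable lborel ((S' ^^ j) g)" for g j
    by (induction j) (auto intro: int)
  have Sc: "integrable lborel g \<Longrightarrow> L1 ((S ^^ j) g) \<le> L1 g" for g j
    by (induction j) (auto intro: order_trans[OF contr(1)] Si)
  have Sl: "(S ^^ j) (\<lambda>x. f x - g x) = (\<lambda>x. (S ^^ j) f x - (S ^^ j) g x)" for f g j
    by (induction j) (auto simp: linear_op)
  note iS = int(1)[OF Suc.prems] and iS' = int(2)[OF Suc.prems]
  have "L1 (\<lambda>x. (S ^^ Suc N) f x - (S' ^^ Suc N) f x) =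
      L1 (\<lambda>x. (S ^^ N) (S f) x - (S' ^^ N) (S' f) x)"
    by (simp add: funpow_Suc_right del: funpow.simps)
  also have "\<dots> \<le> L1 (\<lambda>x. (S ^^ N) (S f) x - (S ^^ N) (S' f) x) + L1 (\<lambda>x. (S ^^ N) (S' f) x - (S' ^^ N) (S' f) x)"
    by (intro L1_diff_triangle Si iS iS')
  finally have 1: "L1 (\<lambda>x. (S ^^ Suc N) f x - (S' ^^ Suc N) f x) \<le>
      L1 (\<lambda>x. (S ^^ N) (S f) x - (S ^^ N) (S' f) x) + L1 (\<lambda>x. (S ^^ N) (S' f) x - (S' ^^ N) (S' f) x)" .
  have 2: "L1 (\<lambda>x. (S ^^ N) (S f) x - (S ^^ N) (S' f) x) \<le> L1 (\<lambda>x. S f x - S' f x)"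
    unfolding Sl[symmetric] using iS iS' by (intro Sc) auto
  have 3: "L1 (\<lambda>x. (S ^^ N) (S' f) x - (S' ^^ N) (S' f) x) \<le> real N * L1 (\<lambda>x. S (S' f) x - S' (S' f) x)"
    by (rule Suc.IH[OF iS'])
  have "L1 (\<lambda>x. S (S' f) x - S' (S' f) x) \<le> L1 (\<lambda>x. S f x - S' f x)"
    unfolding comm linear_op(2)[symmetric] using iS iS' by (intro contr) auto
  then have 4: "real N * L1 (\<lambda>x. S (S' f) x - S' (S' f) x) \<le> real N * L1 (\<lambda>x. S f x - S' f x)"
    by (rule mult_left_mono) simp
  have "real (Suc N) * L1 (\<lambda>x. S f x - S' f x) = L1 (\<lambda>x. S f x - S' f x) + real N * L1 (\<lambda>x. S f x - S' f x)"
    by (simp add: algebra_simps)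
  then show ?case using 1 2 3 4 by linarith
qed

context levy_kernel
begin

lemma Sop_telescoping:
  assumes "m > 0" "0 \<le> \<delta>" "\<delta> * jump_total m \<le> 1" "l > 0" "0 \<le> \<epsilon>" "\<epsilon> * jump_total l \<le> 1" and f: "integrable lborel f"
  shows "L1 (\<lambda>x. (Sop m \<delta> ^^ N) f x - (Sop l \<epsilon> ^^ N) f x) \<le> real N * L1 (\<lambda>x. Sop m \<delta> f x - Sop l \<epsilon> f x)"
  by (rule telescoping_L1) (auto simp: Sop_linear Sop_Sop_commute intro: Sop_integrable L1_Sop assms)

text \<open>Comparison with the step of length 0, which is the identity, turns the telescoping bound
  into a first-order estimate in time.\<close>

lemma Sop_pow_minus_id:
  assumes "m > 0" "0 \<le> \<epsilon>" "\<epsilon> * jump_total m \<le> 1" and f: "integrable lborel f"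
  shows "L1 (\<lambda>x. (Sop m \<epsilon> ^^ k) f x - f x) \<le> real k * \<epsilon> * L1 (Bop m f)"
proof -
  have z: "Sop m 0 = (\<lambda>f. f)" by (auto simp: Sop_def fun_eq_iff)
  have "(Sop m 0 ^^ k) f = f" unfolding z by (induction k) auto
  moreover have "(\<lambda>x. Sop m \<epsilon> f x - Sop m 0 f x) = (\<lambda>x. \<epsilon> * Bop m f x)" by (simp add: Sop_def)
  ultimately show ?thesis using Sop_telescoping[OF assms(1-3,1) _ _ f, of 0 k] assms by (simp add: L1_cmult)
qed

text \<open>Both sides agree to first order in \<open>\<epsilon>\<close>: each further small step
  adds \<open>\<epsilon>\<close> times the change of \<open>Bop m f\<close> under the earlier ones,
  hence the error is quadratic.\<close>

lemma Sop_refine: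
  assumes "m > 0" "0 \<le> \<epsilon>" "\<epsilon> * jump_total m \<le> 1" and f: "integrable lborel f"
  shows "L1 (\<lambda>x. (Sop m \<epsilon> ^^ k) f x - Sop m (real k * \<epsilon>) f x) \<le> (real k * \<epsilon>)^2 * L1 (Bop m (Bop m f))"
proof (induction k)
  case 0
  then show ?case by (simp add: Sop_def L1_def)
next
  case (Suc k)
  let ?S = "Sop m \<epsilon>"
  have "(\<lambda>x. (?S ^^ Suc k) f x - Sop m (real (Suc k) * \<epsilon>) f x) =
    (\<lambda>x. ((?S ^^ k) f x - Sop m (real k * \<epsilon>) f x) + \<epsilon> * ((?S ^^ k) (Bop m f) x - Bop m f x))"
    by (simp add: Sop_def[of m \<epsilon> "(Sop m \<epsilon> ^^ k) f"] Bop_Sop_pow_commute Sop_def[of m "_ * _"] Sop_def[of m "_ + _"] fun_eq_iff algebra_simps)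
  then have "L1 (\<lambda>x. (?S ^^ Suc k) f x - Sop m (real (Suc k) * \<epsilon>) f x) \<le>
      L1 (\<lambda>x. (?S ^^ k) f x - Sop m (real k * \<epsilon>) f x) + L1 (\<lambda>x. \<epsilon> * ((?S ^^ k) (Bop m f) x - Bop m f x))"
    using L1_add[of "\<lambda>x. (?S ^^ k) f x - Sop m (real k * \<epsilon>) f x" "\<lambda>x. \<epsilon> * ((?S ^^ k) (Bop m f) x - Bop m f x)"] f
    by (simp add: Sop_pow_integrable Sop_integrable Bop_integrable)
  also have "L1 (\<lambda>x. \<epsilon> * ((?S ^^ k) (Bop m f) x - Bop m f x)) \<le> \<epsilon> * (real k * \<epsilon> * L1 (Bop m (Bop m f)))"
    unfolding L1_cmult using assms Sop_pow_minus_id[OF assms(1-3) Bop_integrable[OF f]] by (auto intro!: mult_left_mono)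
  also have "L1 (\<lambda>x. (?S ^^ k) f x - Sop m (real k * \<epsilon>) f x) + \<epsilon> * (real k * \<epsilon> * L1 (Bop m (Bop m f)))
     \<le> (real k * \<epsilon>)^2 * L1 (Bop m (Bop m f)) + \<epsilon> * (real k * \<epsilon> * L1 (Bop m (Bop m f)))"
    using Suc.IH by simp
  \<comment> \<open>The induction closes because k^2 + k is at most (k + 1)^2.\<close>
  also have "\<dots> = (real k * real k + real k) * (\<epsilon>^2 * L1 (Bop m (Bop m f)))" by (simp add: power2_eq_square algebra_simps)
  also have "\<dots> \<le> (real (Suc k) * real (Suc k)) * (\<epsilon>^2 * L1 (Bop m (Bop m f)))"
    using L1_nonneg by (intro mult_right_mono mult_nonneg_nonneg) (auto simp: algebra_simps)
  finally show ?case by (simp only: power2_eq_square mult_ac)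
qed

text \<open>
  The number of Euler steps is so large that the time discretisation error
  \<open>t\<^sup>2 / N * (2 * jump_total m)\<^sup>2\<close> of \<open>N\<close> steps is at most \<open>4 * t\<^sup>2 / m\<close>.
\<close>

definition steps :: "nat \<Rightarrow> nat" where
  "steps m = nat \<lceil>real m * (1 + jump_total m)^2\<rceil> + 1"

text \<open>An approximate semigroup in which \<open>t\<close> changes the length of the steps,
  never their number; times at one level can thus be compared factor by factor.\<close>

definition Qop :: "nat \<Rightarrow> real \<Rightarrow> (real^'d \<Rightarrow> real) \<Rightarrow> real^'d \<Rightarrow> real" where
  "Qop m t = Sop m (t / real (steps m)) ^^ steps m"

lemma steps_ge: "real m * (1 + jump_total m)^2 \<le> real (steps m)" "real m \<le> real (steps m)" "steps m > 0"
proof -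
  show 1: "real m * (1 + jump_total m)^2 \<le> real (steps m)" unfolding steps_def by linarith
  have "real m * 1 \<le> real m * (1 + jump_total m)^2"
    using jump_total_nonneg[of m] by (intro mult_left_mono) auto
  then show "real m \<le> real (steps m)" using 1 by linarith
  show "steps m > 0" by (simp add: steps_def)
qed

lemma step_small:
  assumes "0 \<le> t" "t \<le> real m"
  shows "t / real (steps m) * jump_total m \<le> 1"
proof -
  have "jump_total m \<le> (1 + jump_total m)^2"
    using jump_total_nonneg[of m] by (simp add: power2_eq_square algebra_simps)
  then have "t * jump_total m \<le> real m * (1 + jump_total m)^2"
    using assms jump_total_nonneg[of m] by (intro mult_mono) auto
  then have "t * jump_total m \<le> real (steps m)" using steps_ge(1)[of m] by linarith
  then show ?thesis using steps_ge(3)[of m] by (simp add: field_simps)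
qed

lemma L1_Qop:
  assumes "m > 0" "0 \<le> t" "t \<le> real m" "integrable lborel f"
  shows "integrable lborel (Qop m t f)" "L1 (Qop m t f) \<le> L1 f"
  unfolding Qop_def using assms step_small[of t m] by (auto intro!: Sop_pow_integrable L1_Sop_pow)

text \<open>One coarse step is compared with the \<open>K\<close> fine steps that cover it. The
  error is governed by the length of the coarse step, hence the bound is uniform in
  \<open>K\<close>.\<close>

lemma Qop_refine:
  assumes m: "m > 0" and t: "0 \<le> t" "t \<le> real m" and K: "K > 0" and f: "integrable lborel f"
  shows "L1 (\<lambda>x. Qop m t f x - (Sop m (t / real (K * steps m)) ^^ (K * steps m)) f x) \<le> 4 * t^2 / real m * L1 f"
proof -
  define N where "N = steps m"
  define \<epsilon> where "\<epsilon> = t / real (K * N)"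
  have N0: "N > 0" unfolding N_def by (rule steps_ge)
  have \<epsilon>0: "\<epsilon> \<ge> 0" using t by (simp add: \<epsilon>_def)
  have \<epsilon>K: "real K * \<epsilon> = t / real N" using K by (simp add: \<epsilon>_def)
  have s: "t / real N * jump_total m \<le> 1" unfolding N_def by (rule step_small[OF t])
  have "\<epsilon> \<le> real K * \<epsilon>" using K \<epsilon>0 by (simp add: mult_le_cancel_right1)
  then have s': "\<epsilon> * jump_total m \<le> 1" using s jump_total_nonneg[of m] \<epsilon>K mult_right_mono[of \<epsilon> "real K * \<epsilon>" "jump_total m"] by simp
  have tN: "0 \<le> t / real N" using t by simp
  let ?S = "Sop m (t / real N)" and ?S' = "Sop m \<epsilon> ^^ K"
  have "L1 (\<lambda>x. (?S ^^ N) f x - (?S' ^^ N) f x) \<le> real N * L1 (\<lambda>x. ?S f x - ?S' f x)"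
    by (rule telescoping_L1)
       (auto simp: Sop_linear Sop_pow_linear Sop_pow_commute intro: Sop_integrable Sop_pow_integrable L1_Sop L1_Sop_pow m tN s \<epsilon>0 s' f)
  also have "L1 (\<lambda>x. ?S f x - ?S' f x) \<le> (t / real N)^2 * L1 (Bop m (Bop m f))"
    using Sop_refine[OF m \<epsilon>0 s' f, of K] unfolding \<epsilon>K by (subst L1_sym)
  also have "L1 (Bop m (Bop m f)) \<le> 2 * jump_total m * L1 (Bop m f)"
    by (rule L1_Bop[OF m Bop_integrable[OF f]])
  also have "L1 (Bop m f) \<le> 2 * jump_total m * L1 f" by (rule L1_Bop[OF m f])
  finally have 1: "L1 (\<lambda>x. (?S ^^ N) f x - (?S' ^^ N) f x) \<le> real N * ((t / real N)^2 * (2 * jump_total m * (2 * jump_total m * L1 f)))"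
    using jump_total_nonneg[of m] by (simp add: mult_left_mono)
  have "real N * ((t / real N)^2 * (2 * jump_total m * (2 * jump_total m * L1 f))) = 4 * t^2 * L1 f * (jump_total m ^ 2 / real N)"
    using N0 by (simp add: power2_eq_square field_simps)
  also have "\<dots> \<le> 4 * t^2 * L1 f * (1 / real m)"
  proof (rule mult_left_mono)
    have "real m * jump_total m ^ 2 \<le> real m * (1 + jump_total m)^2"
      using jump_total_nonneg[of m] by (intro mult_left_mono power_mono) auto
    also have "\<dots> \<le> real N" unfolding N_def by (rule steps_ge)
    finally show "jump_total m ^ 2 / real N \<le> 1 / real m" using m N0 by (simp add: field_simps)
  qed (auto intro!: mult_nonneg_nonneg L1_nonneg)
  finally have "L1 (\<lambda>x. (?S ^^ N) f x - (?S' ^^ N) f x) \<le> 4 * t^2 / real m * L1 f" using 1 by simp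
  then show ?thesis by (simp add: Qop_def N_def \<epsilon>_def funpow_mult)
qed

text \<open>The two levels use different step lengths, so both are first refined to the common
  number \<open>steps l * steps m\<close> of steps; at equal step length the telescoping bound
  applies.\<close>

lemma Qop_compare:
  assumes m: "m > 0" "t \<le> real m" and l: "l > 0" "t \<le> real l" and t: "0 \<le> t" and f: "integrable lborel f"
  shows "L1 (\<lambda>x. Qop m t f x - Qop l t f x) \<le> 4 * t^2 / real m * L1 f + t * L1 (\<lambda>x. Bop m f x - Bop l f x) + 4 * t^2 / real l * L1 f"
proof -
  define P where "P = steps l * steps m"
  have P0: "P > 0" using steps_ge(3) by (simp add: P_def)
  let ?\<epsilon> = "t / real P"
  have \<epsilon>0: "?\<epsilon> \<ge> 0" using t by simp
  have small: "?\<epsilon> * jump_total k \<le> 1" if "steps k \<le> P" "t \<le> real k" for k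
  proof -
    have "?\<epsilon> \<le> t / real (steps k)" using t that steps_ge(3)[of k] by (intro divide_left_mono) auto
    then have "?\<epsilon> * jump_total k \<le> t / real (steps k) * jump_total k" using jump_total_nonneg by (intro mult_right_mono) auto
    then show ?thesis using step_small[OF t that(2)] by linarith
  qed
  have sm: "steps m \<le> P" "steps l \<le> P" unfolding P_def using steps_ge(3)[of m] steps_ge(3)[of l] by auto
  let ?Sm = "(Sop m ?\<epsilon> ^^ P) f" and ?Sl = "(Sop l ?\<epsilon> ^^ P) f"
  have i: "integrable lborel (Qop m t f)" "integrable lborel ?Sm" "integrable lborel ?Sl" "integrable lborel (Qop l t f)"
    using assms by (auto intro: L1_Qop Sop_pow_integrable)
  have "L1 (\<lambda>x. Qop m t f x - ?Sm x) \<le> 4 * t^2 / real m * L1 f"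
    using Qop_refine[OF m(1) t m(2) steps_ge(3)[of l] f] by (simp add: P_def)
  moreover have "L1 (\<lambda>x. ?Sl x - Qop l t f x) \<le> 4 * t^2 / real l * L1 f"
    using Qop_refine[OF l(1) t l(2) steps_ge(3)[of m] f] by (subst L1_sym) (simp add: P_def mult.commute)
  moreover have "L1 (\<lambda>x. ?Sm x - ?Sl x) \<le> t * L1 (\<lambda>x. Bop m f x - Bop l f x)"
  proof -
    have "L1 (\<lambda>x. ?Sm x - ?Sl x) \<le> real P * L1 (\<lambda>x. Sop m ?\<epsilon> f x - Sop l ?\<epsilon> f x)"
      using m l sm by (intro Sop_telescoping \<epsilon>0 small f) auto
    also have "(\<lambda>x. Sop m ?\<epsilon> f x - Sop l ?\<epsilon> f x) = (\<lambda>x. ?\<epsilon> * (Bop m f x - Bop l f x))"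
      by (simp add: Sop_def right_diff_distrib)
    also have "real P * L1 (\<lambda>x. ?\<epsilon> * (Bop m f x - Bop l f x)) = t * L1 (\<lambda>x. Bop m f x - Bop l f x)"
      unfolding L1_cmult using t P0 by simp
    finally show ?thesis .
  qed
  ultimately show ?thesis
    using L1_diff_triangle[OF i(1,2,4)] L1_diff_triangle[OF i(2,3,4)] by linarith
qed

lemma Qop_Cauchy_test:
  assumes F: "test_fun F" and e: "e > 0"
  shows "\<exists>M. \<forall>m\<ge>M. \<forall>l\<ge>M. \<forall>t\<in>{0..T}. L1 (\<lambda>x. Qop m t F x - Qop l t F x) \<le> e"
proof -
  define b where "b m = 4 * T^2 / real m * L1 F + \<bar>T\<bar> * L1 (\<lambda>x. frac_op h F x - Bop m F x)" for m
  have "(\<lambda>m. 4 * T^2 / real m * L1 F + \<bar>T\<bar> * L1 (\<lambda>x. frac_op h F x - Bop m F x)) \<longlonglongrightarrow> 0 * L1 F + \<bar>T\<bar> * 0"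
    by (intro tendsto_intros Bop_converges[OF F] tendsto_divide_0[OF tendsto_const] filterlim_at_top_imp_at_infinity filterlim_real_sequentially)
  then have "b \<longlonglongrightarrow> 0" by (simp add: b_def[abs_def])
  then have "\<forall>\<^sub>F m in sequentially. b m < e / 2" using e by (intro order_tendstoD) auto
  then obtain M1 where M1: "\<And>m. m \<ge> M1 \<Longrightarrow> b m < e / 2" using eventually_sequentially by auto
  obtain M2 :: nat where M2: "T \<le> real M2" using real_arch_simple by blast
  define M where "M = M1 + M2 + 1"
  have "L1 (\<lambda>x. Qop m t F x - Qop l t F x) \<le> e" if ml: "m \<ge> M" "l \<ge> M" and t: "t \<in> {0..T}" for m l t
  proof -
    have tm: "m > 0" "l > 0" "t \<le> real m" "t \<le> real l" using ml t M2 by (auto simp: M_def)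
    note iF = test_fun_integrable[OF F]
    have "L1 (\<lambda>x. Qop m t F x - Qop l t F x) \<le> 4 * t^2 / real m * L1 F + t * L1 (\<lambda>x. Bop m F x - Bop l F x) + 4 * t^2 / real l * L1 F"
      using tm t iF by (intro Qop_compare) auto
    also have "\<dots> \<le> 4 * T^2 / real m * L1 F + T * L1 (\<lambda>x. Bop m F x - Bop l F x) + 4 * T^2 / real l * L1 F"
      using t tm L1_nonneg by (intro add_mono mult_right_mono divide_right_mono mult_left_mono power_mono) auto
    finally have 1: "L1 (\<lambda>x. Qop m t F x - Qop l t F x) \<le> 4 * T^2 / real m * L1 F + T * L1 (\<lambda>x. Bop m F x - Bop l F x) + 4 * T^2 / real l * L1 F" .
    have "L1 (\<lambda>x. Bop m F x - Bop l F x) \<le> L1 (\<lambda>x. frac_op h F x - Bop m F x) + L1 (\<lambda>x. frac_op h F x - Bop l F x)"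
      using L1_diff_triangle[OF Bop_integrable[OF iF] frac_op_integrable[OF F] Bop_integrable[OF iF], of m l] L1_sym[of "Bop m F" "frac_op h F"] by simp
    then have "T * L1 (\<lambda>x. Bop m F x - Bop l F x) \<le> T * (L1 (\<lambda>x. frac_op h F x - Bop m F x) + L1 (\<lambda>x. frac_op h F x - Bop l F x))"
      using t by (intro mult_left_mono) auto
    then have "L1 (\<lambda>x. Qop m t F x - Qop l t F x) \<le> b m + b l"
      using t 1 by (simp add: b_def algebra_simps)
    then show ?thesis using M1[of m] M1[of l] ml by (simp add: M_def)
  qed
  then show ?thesis by blast
qed

lemma Qop_linear: "Qop m t (\<lambda>x. f x - g x) = (\<lambda>x. Qop m t f x - Qop m t g x)"
  by (simp add: Qop_def Sop_pow_linear)

text \<open>Contraction, uniform in the level and the time, extends the Cauchy property from the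
  dense class of test functions.\<close>

lemma Qop_Cauchy:
  assumes f: "integrable lborel f" and e: "e > 0"
  shows "\<exists>M. \<forall>m\<ge>M. \<forall>l\<ge>M. \<forall>t\<in>{0..T}. L1 (\<lambda>x. Qop m t f x - Qop l t f x) \<le> e"
proof -
  obtain F where F: "test_fun F" "L1 (\<lambda>x. f x - F x) \<le> e / 3" using L1_dense[OF f, of "e / 3"] e by auto
  have "e / 3 > 0" using e by simp
  from Qop_Cauchy_test[OF F(1) this, of T]
  obtain M1 where M1: "\<And>m l t. m \<ge> M1 \<Longrightarrow> l \<ge> M1 \<Longrightarrow> t \<in> {0..T} \<Longrightarrow> L1 (\<lambda>x. Qop m t F x - Qop l t F x) \<le> e / 3"
    by blast
  obtain M2 :: nat where M2: "T \<le> real M2" using real_arch_simple by blast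
  define M where "M = M1 + M2 + 1"
  note iF = test_fun_integrable[OF F(1)]
  have "L1 (\<lambda>x. Qop m t f x - Qop l t f x) \<le> e" if ml: "m \<ge> M" "l \<ge> M" and t: "t \<in> {0..T}" for m l t
  proof -
    have tm: "m > 0" "l > 0" "t \<le> real m" "t \<le> real l" "t \<ge> 0" using ml t M2 by (auto simp: M_def)
    have i: "integrable lborel (Qop m t f)" "integrable lborel (Qop m t F)" "integrable lborel (Qop l t F)" "integrable lborel (Qop l t f)"
      using tm iF f by (auto intro: L1_Qop)
    have d: "integrable lborel (\<lambda>x. f x - F x)" using iF f by simp
    have e3: "L1 (\<lambda>x. Qop k t f x - Qop k t F x) \<le> e / 3" if "k > 0" "t \<le> real k" for k
      using L1_Qop(2)[OF that(1) tm(5) that(2) d] F(2) by (simp add: Qop_linear)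
    have "L1 (\<lambda>x. Qop m t F x - Qop l t F x) \<le> e / 3" using ml t by (intro M1) (auto simp: M_def)
    then show ?thesis
      using L1_diff_triangle[OF i(1,2,4)] L1_diff_triangle[OF i(2,3,4)] e3[OF tm(1,3)] e3[OF tm(2,4)] L1_sym[of "Qop l t F" "Qop l t f"]
      by linarith
  qed
  then show ?thesis by blast
qed

end

section \<open>Almost everywhere limits of the approximations\<close>

lemma quasi_monotone_convergent:
  fixes w :: "nat \<Rightarrow> real"
  assumes b: "\<And>k. 0 \<le> w k \<and> w k \<le> 1" and s: "summable (\<lambda>k. max 0 (w k - w (Suc k)))"
  shows "convergent w"
proof -
  define p where "p k = (\<Sum>j<k. max 0 (w j - w (Suc j)))" for k
  have pc: "p \<longlonglongrightarrow> (\<Sum>j. max 0 (w j - w (Suc j)))" unfolding p_def by (rule summable_LIMSEQ[OF s])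
  have pb: "p k \<le> (\<Sum>j. max 0 (w j - w (Suc j)))" for k
    unfolding p_def by (rule sum_le_suminf[OF s]) auto
  \<comment> \<open>Adding back the accumulated decreases makes the sequence increasing, and the
    correction itself converges.\<close>
  have inc: "incseq (\<lambda>k. w k + p k)" by (rule incseq_SucI) (auto simp: p_def)
  have "w k + p k \<le> 1 + (\<Sum>j. max 0 (w j - w (Suc j)))" for k
    using b[of k] pb[of k] by linarith
  then obtain L where "(\<lambda>k. w k + p k) \<longlonglongrightarrow> L" using incseq_convergent[OF inc] by blast
  then have "convergent (\<lambda>k. w k + p k)" by (rule convergentI)
  then have "convergent (\<lambda>k. (w k + p k) - p k)" using convergentI[OF pc] by (rule convergent_diff)
  then show ?thesis by simp
qed

context levy_kernel
begin

text \<open>Time sits inside the step length, so measurability is proved for the pair of time and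
  point; each step involves only finitely many translations in space.\<close>

lemma Sop_pow_joint_measurable:
  assumes f: "f \<in> borel_measurable borel"
  shows "(\<lambda>p. (Sop m (fst p / c) ^^ j) f (snd p)) \<in> borel_measurable (borel \<Otimes>\<^sub>M borel)"
proof (induction j)
  case 0
  then show ?case using f by simp
next
  case (Suc j)
  let ?g = "\<lambda>p. (Sop m (fst p / c) ^^ j) f (snd p)"
  have s: "(\<lambda>p. (Sop m (fst p / c) ^^ j) f (snd p + w)) \<in> borel_measurable (borel \<Otimes>\<^sub>M borel)" for w
  proof -
    have "(\<lambda>p. (fst p, snd p + w)) \<in> measurable (borel \<Otimes>\<^sub>M borel) (borel \<Otimes>\<^sub>M borel)" by measurable
    from measurable_compose[OF this Suc.IH] show ?thesis by simp
  qed
  have s0: "?g \<in> borel_measurable (borel \<Otimes>\<^sub>M borel)" by (rule Suc.IH)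
  have "(\<lambda>p. (Sop m (fst p / c) ^^ j) f (snd p) + fst p / c * (\<Sum>z\<in>jumps m. rate m z *
      ((Sop m (fst p / c) ^^ j) f (snd p + lattice_point m z) - (Sop m (fst p / c) ^^ j) f (snd p)))) \<in> borel_measurable (borel \<Otimes>\<^sub>M borel)"
    by (intro borel_measurable_add borel_measurable_times borel_measurable_sum borel_measurable_diff borel_measurable_const s s0 borel_measurable_divide) auto
  then show ?case by (simp add: Sop_def[of m _ "(Sop m _ ^^ j) f"] Bop_def)
qed

lemma Qop_bounds:
  assumes "0 \<le> t" "t \<le> real m" "\<And>x. a \<le> f x \<and> f x \<le> b"
  shows "a \<le> Qop m t f x \<and> Qop m t f x \<le> b"
  unfolding Qop_def using assms step_small[of t m] by (intro Sop_pow_bounds) auto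

lemma Qop_mono:
  assumes "0 \<le> t" "t \<le> real m" "\<And>x. f x \<le> g x"
  shows "Qop m t f x \<le> Qop m t g x"
  unfolding Qop_def using assms step_small[of t m] by (intro Sop_pow_mono) auto

lemma Qop_measurable: "f \<in> borel_measurable borel \<Longrightarrow> Qop m t f \<in> borel_measurable borel"
  unfolding Qop_def by (rule Sop_pow_measurable)

lemma Qop_symmetric:
  assumes "0 \<le> t" "t \<le> real m" "u \<in> borel_measurable borel" "\<And>x. \<bar>u x\<bar> \<le> B" "integrable lborel g"
  shows "(\<integral>x. Qop m t u x * g x \<partial>lborel) = (\<integral>x. u x * Qop m t g x \<partial>lborel)"
  unfolding Qop_def using assms step_small[of t m] by (intro integral_Sop_pow_symmetric[where B = B]) auto

end

locale initial_datum = levy_kernel h \<alpha> for h :: "real^'d \<Rightarrow> real" and \<alpha> +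
  fixes u0 :: "real^'d \<Rightarrow> real"
  assumes u0_meas: "u0 \<in> borel_measurable borel" and u0_range: "\<And>x. 0 \<le> u0 x \<and> u0 x \<le> 1"
begin

text \<open>\<open>u0\<close> need not be integrable; the cutoff makes the L1 Cauchy property
  applicable and increases with \<open>k\<close>.\<close>

definition cut :: "nat \<Rightarrow> real^'d \<Rightarrow> real" where
  "cut k x = u0 x * indicator (cball 0 (real k)) x"

lemma cut_meas: "cut k \<in> borel_measurable borel"
  unfolding cut_def[abs_def] using u0_meas by (intro borel_measurable_times borel_measurable_indicator) auto

lemma cut_range: "0 \<le> cut k x \<and> cut k x \<le> 1"
  using u0_range[of x] by (auto simp: cut_def indicator_def)

lemma cut_integrable: "integrable lborel (cut k)"
proof (rule Bochner_Integration.integrable_bound)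
  show "integrable lborel (indicator (cball (0::real^'d) (real k)) :: real^'d \<Rightarrow> real)"
    using emeasure_bounded_finite[OF bounded_cball] by (intro integrable_real_indicator) auto
  show "AE x in lborel. norm (cut k x) \<le> norm (indicator (cball 0 (real k)) x :: real)"
    using u0_range by (intro AE_I2) (auto simp: cut_def indicator_def)
qed (use cut_meas in simp)

lemma cut_mono: "cut k x \<le> cut (Suc k) x"
  using u0_range[of x] by (auto simp: cut_def indicator_def)

lemma level_exists: "\<exists>M. \<forall>k. \<forall>m\<ge>M k. \<forall>l\<ge>M k. \<forall>t\<in>{0..real k}. L1 (\<lambda>x. Qop m t (cut k) x - Qop l t (cut k) x) \<le> (1/2)^k"
  by (intro choice allI Qop_Cauchy cut_integrable) simp

definition bare_level :: "nat \<Rightarrow> nat" where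
  "bare_level = (SOME M. \<forall>k. \<forall>m\<ge>M k. \<forall>l\<ge>M k. \<forall>t\<in>{0..real k}. L1 (\<lambda>x. Qop m t (cut k) x - Qop l t (cut k) x) \<le> (1/2)^k)"

text \<open>The partial sums make the level nondecreasing and at least \<open>bare_level k\<close>;
  the summand \<open>k\<close> lets it exceed every fixed time eventually, as
  \<open>step_small\<close> demands, and the 1 keeps it positive.\<close>

definition level :: "nat \<Rightarrow> nat" where
  "level k = (\<Sum>j\<le>k. bare_level j) + k + 1"

lemma level_props: "level k > 0" "real k \<le> real (level k)" "level k \<le> level (Suc k)" "bare_level k \<le> level k" "k \<le> level k"
proof -
  show "bare_level k \<le> level k" using member_le_sum[of k "{..k}" bare_level] by (simp add: level_def)
  show "k \<le> level k" by (simp add: level_def)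
  then show "real k \<le> real (level k)" by (simp only: of_nat_le_iff)
qed (auto simp: level_def)

lemma level_Cauchy:
  assumes "m \<ge> level k" "l \<ge> level k" "0 \<le> t" "t \<le> real k"
  shows "L1 (\<lambda>x. Qop m t (cut k) x - Qop l t (cut k) x) \<le> (1/2)^k"
  using someI_ex[OF level_exists, folded bare_level_def] assms level_props(4)[of k] by auto

text \<open>
  Enlarging the cutoff increases the approximations, and the chosen levels make all other changes
  summable; hence \<open>approx k t\<close> is increasing in \<open>k\<close> up to a summable error and converges almost
  everywhere for every \<open>t\<close>.
\<close>

definition approx :: "nat \<Rightarrow> real \<Rightarrow> real^'d \<Rightarrow> real" where
  "approx k t = Qop (level k) t (cut k)"

lemma approx_range: "0 \<le> t \<Longrightarrow> t \<le> real k \<Longrightarrow> 0 \<le> approx k t x \<and> approx k t x \<le> 1"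
  unfolding approx_def using level_props(2)[of k] by (intro Qop_bounds cut_range) auto

lemma approx_joint_meas: "(\<lambda>p. approx k (fst p) (snd p)) \<in> borel_measurable (borel \<Otimes>\<^sub>M borel)"
  unfolding approx_def Qop_def by (rule Sop_pow_joint_measurable[OF cut_meas])

lemma approx_meas: "approx k t \<in> borel_measurable borel"
  unfolding approx_def by (rule Qop_measurable[OF cut_meas])

text \<open>Passing to \<open>Suc k\<close> enlarges the datum, which can only increase the values,
  and raises the level, whose effect is small for the fixed datum \<open>cut k\<close>. Hence the
  decrease alone is controlled.\<close>

lemma approx_decrease:
  assumes "0 \<le> t" "t \<le> real k"
  shows "(\<integral>\<^sup>+x. ennreal (max 0 (approx k t x - approx (Suc k) t x)) \<partial>lborel) \<le> ennreal ((1/2)^k)"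
proof -
  let ?d = "\<lambda>x. Qop (level k) t (cut k) x - Qop (level (Suc k)) t (cut k) x"
  have i: "integrable lborel ?d"
    using assms level_props[of k] level_props[of "Suc k"] cut_integrable by (intro Bochner_Integration.integrable_diff L1_Qop) auto
  have "max 0 (approx k t x - approx (Suc k) t x) \<le> \<bar>?d x\<bar>" for x
  proof -
    have "Qop (level (Suc k)) t (cut k) x \<le> approx (Suc k) t x"
      unfolding approx_def using assms level_props(2)[of "Suc k"] by (intro Qop_mono cut_mono) auto
    then show ?thesis by (simp add: approx_def)
  qed
  then have "(\<integral>\<^sup>+x. ennreal (max 0 (approx k t x - approx (Suc k) t x)) \<partial>lborel) \<le> (\<integral>\<^sup>+x. ennreal \<bar>?d x\<bar> \<partial>lborel)"
    by (intro nn_integral_mono ennreal_leI)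
  also have "\<dots> = ennreal (L1 ?d)"
    unfolding L1_def using i by (intro nn_integral_eq_integral) auto
  also have "\<dots> \<le> ennreal ((1/2)^k)"
    using assms level_props(3)[of k] by (intro ennreal_leI level_Cauchy) auto
  finally show ?thesis .
qed

text \<open>The total decrease has finite integral, so it is finite almost everywhere, and a bounded
  sequence with summable decreases converges. The shift by \<open>K\<close> discards the indices
  below the time \<open>t\<close>.\<close>

lemma approx_convergent:
  assumes t: "0 \<le> t"
  shows "AE x in lborel. convergent (\<lambda>k. approx k t x)"
proof -
  obtain K :: nat where K: "t \<le> real K" using real_arch_simple by blast
  let ?d = "\<lambda>k x. max 0 (approx (k + K) t x - approx (Suc (k + K)) t x)"
  have m: "?d k \<in> borel_measurable borel" for k
    using approx_meas by (intro borel_measurable_max borel_measurable_diff) auto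
  have me: "(\<lambda>x. ennreal (?d k x)) \<in> borel_measurable lborel" for k
  proof -
    have "?d k \<in> borel_measurable lborel" using m[of k] by simp
    then show ?thesis by (rule measurable_compose[OF _ measurable_ennreal])
  qed
  have "(\<integral>\<^sup>+x. (\<Sum>k. ennreal (?d k x)) \<partial>lborel) = (\<Sum>k. \<integral>\<^sup>+x. ennreal (?d k x) \<partial>lborel)"
    by (rule nn_integral_suminf[OF me])
  also have "\<dots> \<le> (\<Sum>k. ennreal ((1/2)^(k + K)))"
    using t K by (intro suminf_le approx_decrease) auto
  also have "\<dots> = ennreal (\<Sum>k. (1/2)^(k + K))"
    by (rule suminf_ennreal2) (auto simp: power_add intro!: summable_mult2 summable_geometric)
  also have "\<dots> < \<infinity>" by simp
  finally have "(\<integral>\<^sup>+x. (\<Sum>k. ennreal (?d k x)) \<partial>lborel) \<noteq> \<infinity>" by (simp only: less_top infinity_ennreal_def)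
  then have "AE x in lborel. (\<Sum>k. ennreal (?d k x)) \<noteq> \<infinity>"
    by (rule nn_integral_PInf_AE[OF borel_measurable_suminf_order[OF me]])
  then show ?thesis
  proof eventually_elim
    case (elim x)
    then have "summable (\<lambda>k. ?d k x)" by (intro summable_suminf_not_top) (auto simp only: infinity_ennreal_def max.cobounded1)
    then have "convergent (\<lambda>k. approx (k + K) t x)"
      using t K by (intro quasi_monotone_convergent approx_range) auto
    then show ?case by (subst (asm) convergent_ignore_initial_segment)
  qed
qed

text \<open>\<open>lim\<close> is unspecified where the sequence diverges; clipping to [0,1] keeps
  the function bounded at all times and points and changes nothing at points of convergence when
  \<open>t\<close> is nonnegative.\<close>

definition sol :: "real \<Rightarrow> real^'d \<Rightarrow> real" where
  "sol t x = max 0 (min 1 (lim (\<lambda>k. approx k t x)))"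

lemma sol_range: "\<bar>sol t x\<bar> \<le> 1"
  by (auto simp: sol_def)

lemma sol_joint_meas: "(\<lambda>(s, x). sol s x) \<in> borel_measurable borel"
proof -
  have "(\<lambda>p. max 0 (min 1 (lim (\<lambda>k. approx k (fst p) (snd p))))) \<in> borel_measurable (borel \<Otimes>\<^sub>M borel)"
    by (intro borel_measurable_max borel_measurable_min borel_measurable_const borel_measurable_lim_metric approx_joint_meas)
  then show ?thesis by (simp add: sol_def case_prod_beta' borel_prod)
qed

lemma sol_meas: "sol t \<in> borel_measurable borel"
  unfolding sol_def[abs_def]
  by (intro borel_measurable_max borel_measurable_min borel_measurable_const borel_measurable_lim_metric approx_meas)

lemma approx_tendsto:
  assumes t: "0 \<le> t"
  shows "AE x in lborel. (\<lambda>k. approx k t x) \<longlonglongrightarrow> sol t x"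
  using approx_convergent[OF t]
proof eventually_elim
  case (elim x)
  then have l: "(\<lambda>k. approx k t x) \<longlonglongrightarrow> lim (\<lambda>k. approx k t x)" by (simp add: convergent_LIMSEQ_iff)
  obtain K :: nat where K: "t \<le> real K" using real_arch_simple by blast
  have "\<forall>\<^sub>F k in sequentially. 0 \<le> approx k t x \<and> approx k t x \<le> 1"
    using eventually_ge_at_top[of K] by (rule eventually_mono) (use K t in \<open>auto intro!: approx_range\<close>)
  then have "0 \<le> lim (\<lambda>k. approx k t x)" "lim (\<lambda>k. approx k t x) \<le> 1"
    using tendsto_lowerbound[OF l] tendsto_upperbound[OF l] by (auto simp: eventually_conj_iff)
  then show ?case using l by (simp add: sol_def)
qed

text \<open>The pairing with the dynamics moved to the test function and with the full
  \<open>u0\<close> in place of its cutoffs, so that L1 estimates for \<open>Qop\<close> apply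
  directly.\<close>

definition dual :: "nat \<Rightarrow> real \<Rightarrow> (real^'d \<Rightarrow> real) \<Rightarrow> real" where
  "dual k t g = (\<integral>x. u0 x * Qop (level k) t g x \<partial>lborel)"

lemma u0_abs: "\<bar>u0 x\<bar> \<le> 1"
  using u0_range[of x] by auto

text \<open>By symmetry \<open>dual\<close> differs from the pairing with \<open>approx\<close> only
  by the part of \<open>u0\<close> outside a growing ball. That tail is small because the functions
  \<open>Qop (level k) t g\<close> stay close in L1 to one fixed integrable function.\<close>

lemma dual_tendsto:
  assumes t: "0 \<le> t" and g: "integrable lborel g"
  shows "(\<lambda>k. dual k t g) \<longlonglongrightarrow> (\<integral>x. sol t x * g x \<partial>lborel)"
proof -
  obtain K :: nat where K: "t \<le> real K" using real_arch_simple by blast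
  have gm: "g \<in> borel_measurable borel" using borel_measurable_integrable[OF g] by simp
  have 1: "(\<lambda>k. \<integral>x. approx (k + K) t x * g x \<partial>lborel) \<longlonglongrightarrow> (\<integral>x. sol t x * g x \<partial>lborel)"
  proof (rule integral_dominated_convergence[where w = "\<lambda>x. \<bar>g x\<bar>"])
    show "AE x in lborel. (\<lambda>k. approx (k + K) t x * g x) \<longlonglongrightarrow> sol t x * g x"
      using approx_tendsto[OF t] by eventually_elim (intro tendsto_intros LIMSEQ_ignore_initial_segment)
    show "AE x in lborel. norm (approx (k + K) t x * g x) \<le> \<bar>g x\<bar>" for k
    proof (intro AE_I2)
      fix x
      have "0 \<le> approx (k + K) t x \<and> approx (k + K) t x \<le> 1" using K t by (intro approx_range) auto
      then show "norm (approx (k + K) t x * g x) \<le> \<bar>g x\<bar>" by (simp add: abs_mult mult_left_le_one_le)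
    qed
  qed (use g gm sol_meas approx_meas in \<open>auto intro!: borel_measurable_times\<close>)
  have 2: "(\<lambda>k. dual (k + K) t g - (\<integral>x. approx (k + K) t x * g x \<partial>lborel)) \<longlonglongrightarrow> 0"
  proof (rule LIMSEQ_I)
    fix e :: real assume e: "e > 0"
    then have "e / 3 > 0" by simp
    from Qop_Cauchy[OF g this, of t] obtain M0 where M0: "\<And>m l s. m \<ge> M0 \<Longrightarrow> l \<ge> M0 \<Longrightarrow> s \<in> {0..t} \<Longrightarrow> L1 (\<lambda>x. Qop m s g x - Qop l s g x) \<le> e / 3"
      by blast
    define l where "l = M0 + K + 1"
    let ?q = "Qop l t g"
    have l: "l > 0" "t \<le> real l" using K by (auto simp: l_def)
    have qi: "integrable lborel ?q" using l t g by (intro L1_Qop) auto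
    let ?tail = "\<lambda>k x. indicator (- cball (0::real^'d) (real k)) x :: real"
    have "(\<lambda>k. \<integral>x. ?tail k x * \<bar>?q x\<bar> \<partial>lborel) \<longlonglongrightarrow> (\<integral>x. 0 \<partial>(lborel :: (real^'d) measure))"
    proof (rule integral_dominated_convergence[where w = "\<lambda>x. \<bar>?q x\<bar>"])
      show "AE x in lborel. (\<lambda>k. ?tail k x * \<bar>?q x\<bar>) \<longlonglongrightarrow> 0"
      proof (intro AE_I2 tendsto_eventually)
        fix x :: "real^'d"
        obtain R :: nat where R: "norm x \<le> real R" using real_arch_simple by blast
        show "\<forall>\<^sub>F k in sequentially. ?tail k x * \<bar>?q x\<bar> = 0"
          using eventually_ge_at_top[of R] by (rule eventually_mono) (use R in \<open>auto simp: indicator_def\<close>)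
      qed
      show "AE x in lborel. norm (?tail k x * \<bar>?q x\<bar>) \<le> \<bar>?q x\<bar>" for k
        by (intro AE_I2) (auto simp: indicator_def)
    qed (use qi borel_measurable_integrable[OF qi] in \<open>auto intro!: borel_measurable_times borel_measurable_indicator\<close>)
    then have "\<forall>\<^sub>F k in sequentially. (\<integral>x. ?tail k x * \<bar>?q x\<bar> \<partial>lborel) < e / 3"
      using e by (intro order_tendstoD) auto
    then obtain R where R: "\<And>k. k \<ge> R \<Longrightarrow> (\<integral>x. ?tail k x * \<bar>?q x\<bar> \<partial>lborel) < e / 3"
      using eventually_sequentially[THEN iffD1] by blast
    show "\<exists>no. \<forall>k\<ge>no. norm (dual (k + K) t g - (\<integral>x. approx (k + K) t x * g x \<partial>lborel) - 0) < e"
    proof (intro exI[of _ "R + M0"] allI impI)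
      fix k0 assume k0: "R + M0 \<le> k0"
      define k where "k = k0 + K"
      have k: "k \<ge> R" "k \<ge> M0" "t \<le> real k" using k0 K by (auto simp: k_def)
      let ?p = "Qop (level k) t g"
      have lk: "level k > 0" "t \<le> real (level k)" "level k \<ge> M0" using level_props[of k] k by auto
      have pi: "integrable lborel ?p" using lk t g by (intro L1_Qop) auto
      have "(\<integral>x. approx k t x * g x \<partial>lborel) = (\<integral>x. cut k x * ?p x \<partial>lborel)"
        unfolding approx_def using cut_range[of k] lk t by (intro Qop_symmetric[where B = 1] cut_meas g) (auto simp: abs_le_iff intro: order_trans[of _ 0])
      then have "dual k t g - (\<integral>x. approx k t x * g x \<partial>lborel) = (\<integral>x. u0 x * ?p x \<partial>lborel) - (\<integral>x. cut k x * ?p x \<partial>lborel)"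
        by (simp add: dual_def)
      also have "\<dots> = (\<integral>x. u0 x * ?p x - cut k x * ?p x \<partial>lborel)"
        by (rule Bochner_Integration.integral_diff[symmetric, OF integral_bounded_L1(1)[where B = 1] integral_bounded_L1(1)[where B = 1]])
           (use u0_meas u0_abs cut_meas cut_range[of k] pi in \<open>auto simp: abs_le_iff intro: order_trans[of _ 0]\<close>)
      also have "\<dots> = (\<integral>x. u0 x * (?tail k x * ?p x) \<partial>lborel)"
        by (rule Bochner_Integration.integral_cong) (auto simp: cut_def indicator_def)
      finally have eq: "dual k t g - (\<integral>x. approx k t x * g x \<partial>lborel) = (\<integral>x. u0 x * (?tail k x * ?p x) \<partial>lborel)" .
      have tm: "?tail k \<in> borel_measurable borel" by (intro borel_measurable_indicator) auto
      have tb: "\<bar>?tail k x\<bar> \<le> 1" for x by (simp add: indicator_def)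
      have ti: "integrable lborel (\<lambda>x. ?tail k x * f x)" if "integrable lborel f" for f
        by (rule integral_bounded_L1(1)[OF tm tb that])
      have "\<bar>\<integral>x. u0 x * (?tail k x * ?p x) \<partial>lborel\<bar> \<le> 1 * L1 (\<lambda>x. ?tail k x * ?p x)"
        by (rule integral_bounded_L1(2)[OF u0_meas u0_abs ti[OF pi]])
      also have "\<dots> \<le> L1 (\<lambda>x. ?tail k x * (?p x - ?q x)) + L1 (\<lambda>x. ?tail k x * ?q x)"
        using L1_add[OF ti[of "\<lambda>x. ?p x - ?q x"] ti[OF qi]] pi qi by (simp add: right_diff_distrib)
      also have "L1 (\<lambda>x. ?tail k x * (?p x - ?q x)) \<le> L1 (\<lambda>x. ?p x - ?q x)"
        unfolding L1_def using pi qi by (intro integral_mono integrable_abs ti) (auto simp: indicator_def)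
      also have "L1 (\<lambda>x. ?p x - ?q x) \<le> e / 3" using lk t by (intro M0) (auto simp: l_def)
      also have "L1 (\<lambda>x. ?tail k x * ?q x) = (\<integral>x. ?tail k x * \<bar>?q x\<bar> \<partial>lborel)" by (simp add: L1_def abs_mult)
      also have "\<dots> < e / 3" by (rule R[OF k(1)])
      finally have "\<bar>dual k t g - (\<integral>x. approx k t x * g x \<partial>lborel)\<bar> < e" using eq e by simp
      then show "norm (dual (k0 + K) t g - (\<integral>x. approx (k0 + K) t x * g x \<partial>lborel) - 0) < e" by (simp add: k_def)
    qed
  qed
  have "(\<lambda>k. dual (k + K) t g) \<longlonglongrightarrow> (\<integral>x. sol t x * g x \<partial>lborel)" using tendsto_add[OF 2 1] by simp
  then show ?thesis by (rule LIMSEQ_offset)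
qed

end

section \<open>Time regularity and the weak equation\<close>

lemma test_fun_time_derivative:
  fixes G :: "real \<times> (real^'d) \<Rightarrow> real"
  assumes G: "test_fun G"
  shows "\<exists>Gd. test_fun Gd \<and> (\<forall>s x. ((\<lambda>r. G (r, x)) has_real_derivative Gd (s, x)) (at s))"
proof -
  have "Ck (Suc 0) G" by (rule test_fun_smooth[OF G])
  then obtain G' where G': "\<And>p. (G has_derivative G' p) (at p)" by auto
  define Gd where "Gd p = G' p (1, 0)" for p
  have "Ck k Gd" for k
  proof -
    have "Ck (Suc k) G" by (rule test_fun_smooth[OF G])
    then obtain G'' where G'': "\<And>p. (G has_derivative G'' p) (at p)" "\<And>v. Ck k (\<lambda>p. G'' p v)" by auto
    \<comment> \<open>The derivative provided by \<open>Ck (Suc k)\<close> might depend on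
      \<open>k\<close>; uniqueness of derivatives identifies them all with
      \<open>G'\<close>.\<close>
    have "G'' p = G' p" for p using has_derivative_unique[OF G''(1) G'] .
    then show ?thesis using G''(2)[of "(1, 0)"] by (simp add: Gd_def[abs_def])
  qed
  moreover have "has_compact_support Gd"
    unfolding Gd_def[abs_def] using G by (intro compact_support_derivative[OF _ G']) (auto simp: test_fun_def)
  moreover have "((\<lambda>r. G (r, x)) has_real_derivative Gd (s, x)) (at s)" for s x
  proof -
    interpret linear "G' (s, x)" using G' has_derivative_bounded_linear bounded_linear.linear by blast
    have "((\<lambda>r. G (r, x)) has_derivative (\<lambda>v. G' (s, x) (v, 0))) (at s)"
      by (rule has_derivative_compose[OF _ G']) (auto intro!: derivative_eq_intros)
    moreover have "G' (s, x) (v, 0) = Gd (s, x) * v" for v :: real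
      using scale[of v "(1, 0)"] by (simp add: Gd_def mult.commute)
    ultimately show ?thesis by (simp add: has_field_derivative_def)
  qed
  ultimately show ?thesis unfolding test_fun_def smooth_def by blast
qed

lemma L1_ball_bound:
  fixes f :: "real^'d \<Rightarrow> real"
  assumes "integrable lborel f" "\<And>x. \<bar>f x\<bar> \<le> c" "\<And>x. norm x > R \<Longrightarrow> f x = 0"
  shows "L1 f \<le> c * measure lborel (cball (0::real^'d) R)"
proof -
  have "L1 f \<le> (\<integral>x. c * indicator (cball (0::real^'d) R) x \<partial>lborel)"
    unfolding L1_def
  proof (rule integral_mono)
    show "integrable lborel (\<lambda>x. c * indicator (cball (0::real^'d) R) x)"
      using emeasure_bounded_finite[OF bounded_cball] by (intro integrable_mult_right integrable_real_indicator) auto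
    show "\<bar>f x\<bar> \<le> c * indicator (cball 0 R) x" for x
      using assms(2,3)[of x] by (auto simp: indicator_def not_le)
  qed (use assms in auto)
  then show ?thesis by simp
qed

text \<open>A common spatial support turns pointwise Taylor and Lipschitz bounds into L1
  bounds.\<close>

lemma test_fun_time_taylor:
  fixes G Gd :: "real \<times> (real^'d) \<Rightarrow> real"
  assumes G: "test_fun G" and Gd: "test_fun Gd" "\<And>s x. ((\<lambda>r. G (r, x)) has_real_derivative Gd (s, x)) (at s)"
  shows "\<exists>C\<ge>0. \<forall>s s'. L1 (\<lambda>x. G (s', x) - G (s, x) - (s' - s) * Gd (s, x)) \<le> C * \<bar>s' - s\<bar>^2 \<and>
    L1 (\<lambda>x. Gd (s', x) - Gd (s, x)) \<le> C * \<bar>s' - s\<bar>"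
proof -
  obtain K where K: "K \<ge> 0" "\<And>p q. \<bar>Gd p - Gd q\<bar> \<le> K * norm (p - q)"
    using Ck1_compact_support_lipschitz[of Gd] Gd(1) test_fun_smooth[OF Gd(1)] by (auto simp: test_fun_def)
  obtain R1 where R1: "\<And>p. norm p > R1 \<Longrightarrow> G p = 0" using G by (auto simp: test_fun_def has_compact_support_iff)
  obtain R2 where R2: "\<And>p. norm p > R2 \<Longrightarrow> Gd p = 0" using Gd by (auto simp: test_fun_def has_compact_support_iff)
  define R where "R = max R1 R2"
  have R: "G (s, x) = 0" "Gd (s, x) = 0" if "norm x > R" for s x
    using that norm_snd_le[of x s] R1[of "(s, x)"] R2[of "(s, x)"] by (auto simp: R_def)
  have lip: "\<bar>Gd (s', x) - Gd (s, x)\<bar> \<le> K * \<bar>s' - s\<bar>" for s s' x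
    using K(2)[of "(s', x)" "(s, x)"] by (simp add: norm_Pair)
  have tay: "\<bar>G (s', x) - G (s, x) - (s' - s) * Gd (s, x)\<bar> \<le> K * \<bar>s' - s\<bar>^2" for s s' x
  proof -
    let ?f = "\<lambda>r. G (r, x) - r * Gd (s, x)"
    have "norm (?f s' - ?f s) \<le> (K * \<bar>s' - s\<bar>) * norm (s' - s)"
    proof (rule field_differentiable_bound[where S = "closed_segment s s'" and f' = "\<lambda>r. Gd (r, x) - Gd (s, x)"])
      show "(?f has_field_derivative Gd (r, x) - Gd (s, x)) (at r within closed_segment s s')" for r
        by (auto intro!: derivative_eq_intros has_field_derivative_at_within[OF Gd(2)])
      show "norm (Gd (r, x) - Gd (s, x)) \<le> K * \<bar>s' - s\<bar>" if "r \<in> closed_segment s s'" for r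
      proof -
        have "\<bar>r - s\<bar> \<le> \<bar>s' - s\<bar>" using that by (auto simp: closed_segment_eq_real_ivl split: if_splits)
        then have "K * \<bar>r - s\<bar> \<le> K * \<bar>s' - s\<bar>" using K(1) by (rule mult_left_mono)
        then show ?thesis using lip[of r x s] by simp
      qed
    qed auto
    then show ?thesis by (simp add: power2_eq_square algebra_simps)
  qed
  define V where "V = measure lborel (cball (0::real^'d) R)"
  have i: "integrable lborel (\<lambda>x. G (s, x))" "integrable lborel (\<lambda>x. Gd (s, x))" for s
    by (intro test_fun_integrable test_fun_section G Gd)+
  have "L1 (\<lambda>x. G (s', x) - G (s, x) - (s' - s) * Gd (s, x)) \<le> (K * \<bar>s' - s\<bar>^2) * V" for s s'
    unfolding V_def using i tay by (intro L1_ball_bound) (auto simp: R)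
  moreover have "L1 (\<lambda>x. Gd (s', x) - Gd (s, x)) \<le> (K * \<bar>s' - s\<bar>) * V" for s s'
    unfolding V_def using i lip by (intro L1_ball_bound) (auto simp: R)
  ultimately show ?thesis
    using K(1) by (intro exI[of _ "K * V"]) (auto simp: V_def algebra_simps)
qed

context levy_kernel
begin

text \<open>Times \<open>t\<close> and \<open>t'\<close> share the number of steps, so the
  difference telescopes over mixed products with one factor \<open>Bop m\<close> each. The role of
  \<open>F\<close> is that of a test function close to \<open>g\<close>, the fractional operator of
  \<open>\<phi>\<close>: factors are exchanged on \<open>F\<close>, since \<open>Bop m F\<close>
  stays bounded in L1 as \<open>m\<close> grows.\<close>

lemma Qop_time_step:
  assumes m: "m > 0" and t: "0 \<le> t" "t \<le> real m" "0 \<le> t'" "t' \<le> real m"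
    and i: "integrable lborel \<phi>" "integrable lborel g" "integrable lborel F"
  shows "L1 (\<lambda>x. Qop m t' \<phi> x - Qop m t \<phi> x - (t' - t) * Qop m t g x) \<le>
    \<bar>t' - t\<bar> * (L1 (\<lambda>x. Bop m \<phi> x - g x) + 2 * L1 (\<lambda>x. g x - F x) + (\<bar>t' - t\<bar> + t / real (steps m)) * L1 (Bop m F))"
proof -
  define N where "N = steps m"
  have N0: "N > 0" unfolding N_def by (rule steps_ge)
  define S where "S = Sop m (t / real N)"
  define S' where "S' = Sop m (t' / real N)"
  have small: "0 \<le> t / real N" "t / real N * jump_total m \<le> 1" "0 \<le> t' / real N" "t' / real N * jump_total m \<le> 1"
    unfolding N_def using t step_small by auto
  have Si: "integrable lborel f \<Longrightarrow> integrable lborel ((S ^^ j) f)" "integrable lborel f \<Longrightarrow> integrable lborel ((S' ^^ j) f)" for f j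
    unfolding S_def S'_def by (auto intro: Sop_pow_integrable)
  have Sc: "integrable lborel f \<Longrightarrow> L1 ((S ^^ j) f) \<le> L1 f" "integrable lborel f \<Longrightarrow> L1 ((S' ^^ j) f) \<le> L1 f" for f j
    unfolding S_def S'_def using m small by (auto intro: L1_Sop_pow)
  have Sl: "(S ^^ j) (\<lambda>x. f x - g x) = (\<lambda>x. (S ^^ j) f x - (S ^^ j) g x)" "(S' ^^ j) (\<lambda>x. f x - g x) = (\<lambda>x. (S' ^^ j) f x - (S' ^^ j) g x)"
    "(S' ^^ j) (\<lambda>x. c * f x) = (\<lambda>x. c * (S' ^^ j) f x)" for f g j c
    unfolding S_def S'_def by (simp_all add: Sop_pow_linear)
  have Sd: "(\<lambda>x. S' y x - S y x) = (\<lambda>x. ((t' - t) / real N) * Bop m y x)" for y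
    by (simp add: S_def S'_def Sop_def diff_divide_distrib left_diff_distrib)
  \<comment> \<open>A mixed product with one of the \<open>N\<close> factors removed; the removed
    factor is the one that the difference of steps turns into \<open>Bop m\<close>.\<close>
  define T where "T j f = (S' ^^ j) ((S ^^ (N - 1 - j)) f)" for j f
  have Ti: "integrable lborel f \<Longrightarrow> integrable lborel (T j f)" for f j unfolding T_def by (intro Si)
  have Tc: "integrable lborel f \<Longrightarrow> L1 (T j f) \<le> L1 f" for f j
    unfolding T_def using Sc(2)[OF Si(1)] Sc(1) order_trans by blast
  have Tl: "T j (\<lambda>x. f x - g x) = (\<lambda>x. T j f x - T j g x)" for j f g unfolding T_def by (simp add: Sl)
  define Bp where "Bp = Bop m \<phi>"
  have iB: "integrable lborel Bp" "integrable lborel (Bop m F)" unfolding Bp_def by (intro Bop_integrable i)+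
  define a where "a j = (S' ^^ j) ((S ^^ (N - j)) \<phi>)" for j
  have step: "a (Suc j) x - a j x = ((t' - t) / real N) * T j Bp x" if "j < N" for j x
  proof -
    let ?y = "(S ^^ (N - 1 - j)) \<phi>"
    have n: "N - j = Suc (N - 1 - j)" "N - Suc j = N - 1 - j" using that by auto
    have "a (Suc j) = (S' ^^ j) (S' ?y)" unfolding a_def n(2) funpow_Suc_right by simp
    moreover have "a j = (S' ^^ j) (S ?y)" unfolding a_def n(1) by simp
    ultimately have "(\<lambda>x. a (Suc j) x - a j x) = (S' ^^ j) (\<lambda>x. S' ?y x - S ?y x)" by (simp add: Sl)
    also have "\<dots> = (\<lambda>x. ((t' - t) / real N) * (S' ^^ j) (Bop m ?y) x)" unfolding Sd by (rule Sl(3))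
    also have "Bop m ?y = (S ^^ (N - 1 - j)) Bp" by (simp add: S_def Bp_def Bop_Sop_pow_commute)
    finally show ?thesis by (simp add: T_def fun_eq_iff)
  qed
  let ?Q = "(S ^^ N) g"
  have "Qop m t' \<phi> x - Qop m t \<phi> x = (\<Sum>j<N. ((t' - t) / real N) * T j Bp x)" for x
  proof -
    have "Qop m t' \<phi> x - Qop m t \<phi> x = a N x - a 0 x"
      by (simp add: a_def Qop_def S_def S'_def N_def)
    also have "\<dots> = (\<Sum>j<N. a (Suc j) x - a j x)" by (rule sum_lessThan_telescope[symmetric])
    finally show ?thesis by (simp add: step)
  qed
  then have eq: "(\<lambda>x. Qop m t' \<phi> x - Qop m t \<phi> x - (t' - t) * Qop m t g x) = (\<lambda>x. \<Sum>j<N. ((t' - t) / real N) * (T j Bp x - ?Q x))"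
    using N0 by (simp add: fun_eq_iff right_diff_distrib sum_subtractf Qop_def S_def N_def)
  define r where "r = L1 (\<lambda>x. Bp x - g x) + 2 * L1 (\<lambda>x. g x - F x) + (\<bar>t' - t\<bar> + t / real N) * L1 (Bop m F)"
  have main: "L1 (\<lambda>x. T j Bp x - ?Q x) \<le> r" if j: "j < N" for j
  proof -
    let ?y = "(S ^^ (N - 1 - j)) F"
    have yi: "integrable lborel ?y" by (intro Si i)
    have ints: "integrable lborel (T j Bp)" "integrable lborel (T j g)" "integrable lborel (T j F)" "integrable lborel ((S ^^ (N - 1)) F)"
      "integrable lborel ((S ^^ N) F)" "integrable lborel ?Q"
      using i iB by (auto intro: Ti Si)
    have p1: "L1 (\<lambda>x. T j Bp x - T j g x) \<le> L1 (\<lambda>x. Bp x - g x)"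
      unfolding Tl[symmetric] using i iB by (intro Tc) auto
    have p2: "L1 (\<lambda>x. T j g x - T j F x) \<le> L1 (\<lambda>x. g x - F x)"
      unfolding Tl[symmetric] using i by (intro Tc) auto
    have p3: "L1 (\<lambda>x. T j F x - (S ^^ (N - 1)) F x) \<le> \<bar>t' - t\<bar> * L1 (Bop m F)"
    proof -
      have "N - 1 = j + (N - 1 - j)" using j by simp
      then have "(S ^^ (N - 1)) F = (S ^^ j) ?y" by (metis funpow_add comp_apply)
      then have "L1 (\<lambda>x. T j F x - (S ^^ (N - 1)) F x) = L1 (\<lambda>x. (S' ^^ j) ?y x - (S ^^ j) ?y x)" by (simp add: T_def)
      also have "\<dots> \<le> real j * L1 (\<lambda>x. S' ?y x - S ?y x)"
        unfolding S_def S'_def by (rule Sop_telescoping) (use m small yi in \<open>auto simp: S_def\<close>)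
      also have "\<dots> = real j * (\<bar>(t' - t) / real N\<bar> * L1 (Bop m ?y))" unfolding Sd L1_cmult ..
      also have "\<dots> \<le> real N * (\<bar>(t' - t) / real N\<bar> * L1 (Bop m F))"
      proof (intro mult_mono mult_left_mono)
        show "L1 (Bop m ?y) \<le> L1 (Bop m F)" unfolding S_def Bop_Sop_pow_commute using Sc(1)[OF iB(2)] by (simp add: S_def)
      qed (use j in \<open>auto intro!: mult_nonneg_nonneg divide_nonneg_nonneg L1_nonneg\<close>)
      also have "\<dots> = \<bar>t' - t\<bar> * L1 (Bop m F)" using N0 by simp
      finally show ?thesis .
    qed
    have p4: "L1 (\<lambda>x. (S ^^ (N - 1)) F x - (S ^^ N) F x) \<le> t / real N * L1 (Bop m F)"
    proof -
      have "N = Suc (N - 1)" using N0 by simp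
      then have "(S ^^ N) F = (S ^^ (N - 1)) (S F)" by (metis funpow_Suc_right comp_apply)
      then have "(\<lambda>x. (S ^^ (N - 1)) F x - (S ^^ N) F x) = (S ^^ (N - 1)) (\<lambda>x. F x - S F x)" by (simp add: Sl)
      then have "L1 (\<lambda>x. (S ^^ (N - 1)) F x - (S ^^ N) F x) \<le> L1 (\<lambda>x. F x - S F x)"
        using i Si(1)[OF i(3), of 1] by (simp only:) (intro Sc, simp)
      also have "(\<lambda>x. F x - S F x) = (\<lambda>x. (- (t / real N)) * Bop m F x)" by (simp add: S_def Sop_def)
      also have "L1 \<dots> = t / real N * L1 (Bop m F)" unfolding L1_cmult using t by simp
      finally show ?thesis .
    qed
    have p5: "L1 (\<lambda>x. (S ^^ N) F x - ?Q x) \<le> L1 (\<lambda>x. g x - F x)"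
    proof -
      have "L1 (\<lambda>x. (S ^^ N) F x - ?Q x) \<le> L1 (\<lambda>x. F x - g x)" unfolding Sl[symmetric] using i by (intro Sc) auto
      then show ?thesis using L1_sym[of F g] by simp
    qed
    \<comment> \<open>Five moves: replace \<open>Bp\<close> by \<open>g\<close>, then
      \<open>g\<close> by \<open>F\<close>, turn the primed factors into unprimed ones, restore the
      missing factor, and return from \<open>F\<close> to \<open>g\<close>.\<close>
    have "L1 (\<lambda>x. T j Bp x - ?Q x) \<le> L1 (\<lambda>x. T j Bp x - T j g x) + (L1 (\<lambda>x. T j g x - T j F x) +
        (L1 (\<lambda>x. T j F x - (S ^^ (N - 1)) F x) + (L1 (\<lambda>x. (S ^^ (N - 1)) F x - (S ^^ N) F x) + L1 (\<lambda>x. (S ^^ N) F x - ?Q x))))"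
      using L1_diff_triangle[OF ints(1,2,6)] L1_diff_triangle[OF ints(2,3,6)] L1_diff_triangle[OF ints(3,4,6)] L1_diff_triangle[OF ints(4,5,6)]
      by linarith
    then show ?thesis using p1 p2 p3 p4 p5 unfolding r_def by (simp add: algebra_simps)
  qed
  have "L1 (\<lambda>x. \<Sum>j<N. ((t' - t) / real N) * (T j Bp x - ?Q x)) \<le> (\<Sum>j<N. L1 (\<lambda>x. ((t' - t) / real N) * (T j Bp x - ?Q x)))"
    by (rule L1_sum) (auto intro!: integrable_mult_right Bochner_Integration.integrable_diff Ti iB Si i)
  also have "\<dots> \<le> (\<Sum>j<N. \<bar>(t' - t) / real N\<bar> * r)"
    unfolding L1_cmult by (intro sum_mono mult_left_mono main) auto
  also have "\<dots> = \<bar>t' - t\<bar> * r" using N0 by simp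
  finally show ?thesis unfolding eq r_def Bp_def N_def .
qed

end

context initial_datum
begin

definition sol_pairing :: "(real^'d \<Rightarrow> real) \<Rightarrow> real \<Rightarrow> real" where
  "sol_pairing g t = (\<integral>x. sol t x * g x \<partial>lborel)"

lemma sol_pairing_integrable: "integrable lborel g \<Longrightarrow> integrable lborel (\<lambda>x. sol t x * g x)"
  by (rule integral_bounded_L1(1)[OF sol_meas sol_range])

lemma sol_pairing_bound: "integrable lborel g \<Longrightarrow> \<bar>sol_pairing g t\<bar> \<le> L1 g"
  using integral_bounded_L1(2)[OF sol_meas sol_range] by (simp add: sol_pairing_def)

lemma sol_pairing_linear:
  assumes "integrable lborel f" "integrable lborel g"
  shows "sol_pairing (\<lambda>x. f x + c * g x) t = sol_pairing f t + c * sol_pairing g t" "sol_pairing (\<lambda>x. f x - g x) t = sol_pairing f t - sol_pairing g t"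
    "sol_pairing (\<lambda>x. f x + g x) t = sol_pairing f t + sol_pairing g t"
  using sol_pairing_integrable[OF assms(1), of t] sol_pairing_integrable[OF assms(2), of t]
  by (simp_all add: sol_pairing_def algebra_simps)

lemma level_at_top: "filterlim level at_top sequentially"
  by (rule filterlim_at_top_mono[OF filterlim_ident]) (use level_props(5) in auto)

text \<open>The bound of \<open>Qop_time_step\<close> along the chosen levels: in the limit the
  defect of \<open>\<phi>\<close> and the step length vanish, and the distance to \<open>F\<close>
  and a second-order term in time remain.\<close>

lemma sol_pairing_increment:
  assumes t: "0 \<le> t" "0 \<le> t'" and \<phi>: "test_fun \<phi>" and F: "test_fun F"
  shows "\<bar>sol_pairing \<phi> t' - sol_pairing \<phi> t - (t' - t) * sol_pairing (frac_op h \<phi>) t\<bar> \<le>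
    \<bar>t' - t\<bar> * (2 * L1 (\<lambda>x. frac_op h \<phi> x - F x) + \<bar>t' - t\<bar> * L1 (frac_op h F))"
proof -
  let ?g = "frac_op h \<phi>"
  note i = test_fun_integrable[OF \<phi>] frac_op_integrable[OF \<phi>] test_fun_integrable[OF F]
  have l1: "(\<lambda>k. L1 (\<lambda>x. Bop (level k) \<phi> x - ?g x)) \<longlonglongrightarrow> 0"
    using filterlim_compose[OF Bop_converges[OF \<phi>] level_at_top] by (subst L1_sym)
  have l2: "(\<lambda>k. L1 (Bop (level k) F)) \<longlonglongrightarrow> L1 (frac_op h F)"
  proof (rule Lim_null[THEN iffD2], rule Lim_null_comparison)
    show "\<forall>\<^sub>F k in sequentially. norm (L1 (Bop (level k) F) - L1 (frac_op h F)) \<le> L1 (\<lambda>x. frac_op h F x - Bop (level k) F x)"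
    proof (intro always_eventually allI)
      fix k
      note ib = Bop_integrable[OF i(3), of "level k"] and ig = frac_op_integrable[OF F]
      have "L1 (Bop (level k) F) \<le> L1 (\<lambda>x. Bop (level k) F x - frac_op h F x) + L1 (frac_op h F)"
        using L1_add[of "\<lambda>x. Bop (level k) F x - frac_op h F x" "frac_op h F"] ib ig by simp
      moreover have "L1 (frac_op h F) \<le> L1 (\<lambda>x. frac_op h F x - Bop (level k) F x) + L1 (Bop (level k) F)"
        using L1_add[of "\<lambda>x. frac_op h F x - Bop (level k) F x" "Bop (level k) F"] ib ig by simp
      ultimately show "norm (L1 (Bop (level k) F) - L1 (frac_op h F)) \<le> L1 (\<lambda>x. frac_op h F x - Bop (level k) F x)"
        using L1_sym[of "Bop (level k) F" "frac_op h F"] by simp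
    qed
    show "(\<lambda>k. L1 (\<lambda>x. frac_op h F x - Bop (level k) F x)) \<longlonglongrightarrow> 0"
      by (rule filterlim_compose[OF Bop_converges[OF F] level_at_top])
  qed
  have l3: "(\<lambda>k. t / real (steps (level k))) \<longlonglongrightarrow> 0"
  proof (rule Lim_null_comparison)
    show "\<forall>\<^sub>F k in sequentially. norm (t / real (steps (level k))) \<le> t / real k"
      using eventually_gt_at_top[of 0]
    proof (rule eventually_mono)
      fix k :: nat assume "k > 0"
      moreover have "real k \<le> real (steps (level k))" using steps_ge(2)[of "level k"] level_props(2)[of k] by linarith
      ultimately have "t / real (steps (level k)) \<le> t / real k" using t by (intro divide_left_mono) auto
      then show "norm (t / real (steps (level k))) \<le> t / real k" using t by simp
    qed
    show "(\<lambda>k. t / real k) \<longlonglongrightarrow> 0"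
      by (intro tendsto_divide_0[OF tendsto_const] filterlim_at_top_imp_at_infinity filterlim_real_sequentially)
  qed
  have lhs: "(\<lambda>k. \<bar>dual k t' \<phi> - dual k t \<phi> - (t' - t) * dual k t ?g\<bar>) \<longlonglongrightarrow> \<bar>sol_pairing \<phi> t' - sol_pairing \<phi> t - (t' - t) * sol_pairing ?g t\<bar>"
    unfolding sol_pairing_def by (intro tendsto_intros dual_tendsto t i)
  have rhs: "(\<lambda>k. \<bar>t' - t\<bar> * (L1 (\<lambda>x. Bop (level k) \<phi> x - ?g x) + 2 * L1 (\<lambda>x. ?g x - F x) + (\<bar>t' - t\<bar> + t / real (steps (level k))) * L1 (Bop (level k) F)))
    \<longlonglongrightarrow> \<bar>t' - t\<bar> * (0 + 2 * L1 (\<lambda>x. ?g x - F x) + (\<bar>t' - t\<bar> + 0) * L1 (frac_op h F))"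
    by (intro tendsto_intros l1 l2 l3)
  obtain K :: nat where K: "max t t' \<le> real K" using real_arch_simple by blast
  have "\<forall>\<^sub>F k in sequentially. \<bar>dual k t' \<phi> - dual k t \<phi> - (t' - t) * dual k t ?g\<bar> \<le>
     \<bar>t' - t\<bar> * (L1 (\<lambda>x. Bop (level k) \<phi> x - ?g x) + 2 * L1 (\<lambda>x. ?g x - F x) + (\<bar>t' - t\<bar> + t / real (steps (level k))) * L1 (Bop (level k) F))"
    using eventually_ge_at_top[of K]
  proof (rule eventually_mono)
    fix k assume "K \<le> k"
    then have tk: "t \<le> real (level k)" "t' \<le> real (level k)" using K level_props(2)[of k] by auto
    let ?m = "level k"
    have qi: "integrable lborel (Qop ?m t' \<phi>)" "integrable lborel (Qop ?m t \<phi>)" "integrable lborel (Qop ?m t ?g)"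
      using level_props(1)[of k] t tk i by (auto intro: L1_Qop)
    let ?d = "\<lambda>x. Qop ?m t' \<phi> x - Qop ?m t \<phi> x - (t' - t) * Qop ?m t ?g x"
    have eq: "dual k t' \<phi> - dual k t \<phi> - (t' - t) * dual k t ?g = (\<integral>x. u0 x * ?d x \<partial>lborel)"
      unfolding dual_def using integral_bounded_L1(1)[OF u0_meas u0_abs qi(1)] integral_bounded_L1(1)[OF u0_meas u0_abs qi(2)]
        integral_bounded_L1(1)[OF u0_meas u0_abs qi(3)]
      by (simp add: right_diff_distrib mult.left_commute[of _ "t' - t"])
    have "\<bar>\<integral>x. u0 x * ?d x \<partial>lborel\<bar> \<le> 1 * L1 ?d"
      by (rule integral_bounded_L1(2)[OF u0_meas u0_abs]) (use qi in auto)
    then have 1: "\<bar>dual k t' \<phi> - dual k t \<phi> - (t' - t) * dual k t ?g\<bar> \<le> L1 ?d" unfolding eq by (simp only: mult_1)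
    show "\<bar>dual k t' \<phi> - dual k t \<phi> - (t' - t) * dual k t ?g\<bar> \<le>
     \<bar>t' - t\<bar> * (L1 (\<lambda>x. Bop (level k) \<phi> x - ?g x) + 2 * L1 (\<lambda>x. ?g x - F x) + (\<bar>t' - t\<bar> + t / real (steps (level k))) * L1 (Bop (level k) F))"
      by (rule order_trans[OF 1 Qop_time_step]) (use level_props(1)[of k] t tk i in auto)
  qed
  from tendsto_le[OF sequentially_bot rhs lhs this] show ?thesis by simp
qed

text \<open>\<open>F\<close> is chosen first, close to \<open>frac_op h \<phi>\<close>; the
  second-order term, whose constant depends on \<open>F\<close>, is then small for times close to
  \<open>t\<close>.\<close>

lemma sol_pairing_derivative:
  assumes t: "0 \<le> t" and \<phi>: "test_fun \<phi>"
  shows "(sol_pairing \<phi> has_real_derivative sol_pairing (frac_op h \<phi>) t) (at t within {0..})"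
  unfolding has_field_derivative_def has_derivative_within_alt
proof (intro conjI allI impI bounded_linear_mult_right)
  fix e :: real assume e: "0 < e"
  obtain F where F: "test_fun F" "L1 (\<lambda>x. frac_op h \<phi> x - F x) \<le> e / 4"
    using L1_dense[OF frac_op_integrable[OF \<phi>], of "e / 4"] e by auto
  let ?C = "L1 (frac_op h F)"
  have C0: "?C \<ge> 0" by (rule L1_nonneg)
  show "\<exists>d>0. \<forall>y\<in>{0..}. norm (y - t) < d \<longrightarrow> norm (sol_pairing \<phi> y - sol_pairing \<phi> t - sol_pairing (frac_op h \<phi>) t * (y - t)) \<le> e * norm (y - t)"
  proof (intro exI[of _ "e / (2 * (?C + 1))"] conjI ballI impI)
    show "0 < e / (2 * (?C + 1))" using e C0 by auto
    fix y :: real assume y: "y \<in> {0..}" "norm (y - t) < e / (2 * (?C + 1))"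
    have "\<bar>y - t\<bar> * ?C \<le> e / (2 * (?C + 1)) * (?C + 1)" using y C0 e by (intro mult_mono) auto
    also have "\<dots> = e / 2" using C0 by (simp add: field_simps)
    finally have "2 * L1 (\<lambda>x. frac_op h \<phi> x - F x) + \<bar>y - t\<bar> * ?C \<le> e" using F(2) by linarith
    then have "\<bar>y - t\<bar> * (2 * L1 (\<lambda>x. frac_op h \<phi> x - F x) + \<bar>y - t\<bar> * ?C) \<le> \<bar>y - t\<bar> * e" by (rule mult_left_mono) simp
    then show "norm (sol_pairing \<phi> y - sol_pairing \<phi> t - sol_pairing (frac_op h \<phi>) t * (y - t)) \<le> e * norm (y - t)"
      using sol_pairing_increment[OF t _ \<phi> F(1), of y] y by (simp add: mult.commute)
  qed
qed

lemma sol_pairing_continuous: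
  assumes g: "integrable lborel g"
  shows "continuous_on {0..} (sol_pairing g)"
  unfolding continuous_on_iff
proof (intro ballI allI impI)
  fix t e :: real assume t: "t \<in> {0..}" and e: "0 < e"
  obtain F where F: "test_fun F" "L1 (\<lambda>x. g x - F x) \<le> e / 4" using L1_dense[OF g, of "e / 4"] e by auto
  have "continuous (at t within {0..}) (sol_pairing F)"
    using sol_pairing_derivative[OF _ F(1), of t] t by (intro DERIV_continuous) auto
  then obtain d where d: "d > 0" "\<And>y. y \<in> {0..} \<Longrightarrow> dist y t < d \<Longrightarrow> dist (sol_pairing F y) (sol_pairing F t) < e / 4"
    unfolding continuous_within_eps_delta using e by (metis zero_less_divide_iff zero_less_numeral)
  show "\<exists>d>0. \<forall>y\<in>{0..}. dist y t < d \<longrightarrow> dist (sol_pairing g y) (sol_pairing g t) < e"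
  proof (intro exI[of _ d] conjI ballI impI d(1))
    fix y :: real assume y: "y \<in> {0..}" "dist y t < d"
    have "\<bar>sol_pairing g s - sol_pairing F s\<bar> \<le> e / 4" for s
      using sol_pairing_bound[of "\<lambda>x. g x - F x" s] sol_pairing_linear(2)[OF g test_fun_integrable[OF F(1)], of s] F(2) g test_fun_integrable[OF F(1)] by simp
    from this[of y] this[of t] d(2)[OF y] show "dist (sol_pairing g y) (sol_pairing g t) < e" using e unfolding dist_real_def by linarith
  qed
qed

lemma spair_0: "integrable lborel g \<Longrightarrow> sol_pairing g 0 = (\<integral>x. u0 x * g x \<partial>lborel)"
proof -
  assume g: "integrable lborel g"
  have "Sop m 0 f = f" for m f by (auto simp: Sop_def fun_eq_iff)
  then have "(Sop m 0 ^^ n) g = g" for m n by (induction n) simp_all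
  then have "Qop m 0 g = g" for m by (simp add: Qop_def)
  then have "(\<lambda>k. dual k 0 g) = (\<lambda>k. \<integral>x. u0 x * g x \<partial>lborel)" by (simp add: dual_def)
  then have "(\<lambda>k. \<integral>x. u0 x * g x \<partial>lborel) \<longlonglongrightarrow> sol_pairing g 0" using dual_tendsto[OF _ g, of 0] by (simp add: sol_pairing_def)
  then show ?thesis using LIMSEQ_unique tendsto_const by blast
qed

text \<open>A product rule. The three errors are the Taylor remainder of \<open>G\<close>, the
  modulus of continuity of the pairing with \<open>Gd\<close>, and the remainder for the test
  function frozen at time \<open>s\<close>.\<close>

lemma time_dependent_derivative:
  assumes G: "test_fun G" and Gd: "test_fun Gd" "\<And>s x. ((\<lambda>r. G (r, x)) has_real_derivative Gd (s, x)) (at s)"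
    and s: "0 \<le> s"
  shows "((\<lambda>s. sol_pairing (\<lambda>x. G (s, x)) s) has_real_derivative
    sol_pairing (\<lambda>x. Gd (s, x) + frac_op h (\<lambda>x. G (s, x)) x) s) (at s within {0..})"
  unfolding has_field_derivative_def has_derivative_within_alt
proof (intro conjI allI impI bounded_linear_mult_right)
  fix e :: real assume e: "0 < e"
  obtain C where C: "C \<ge> 0" "\<And>s s'. L1 (\<lambda>x. G (s', x) - G (s, x) - (s' - s) * Gd (s, x)) \<le> C * \<bar>s' - s\<bar>^2"
    using test_fun_time_taylor[OF G Gd] by auto
  have i: "integrable lborel (\<lambda>x. G (s, x))" "integrable lborel (\<lambda>x. Gd (s, x))" "integrable lborel (frac_op h (\<lambda>x. G (s, x)))" for s
    by (intro test_fun_integrable frac_op_integrable test_fun_section G Gd)+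
  have "(sol_pairing (\<lambda>x. G (s, x)) has_derivative (*) (sol_pairing (frac_op h (\<lambda>x. G (s, x))) s)) (at s within {0..})"
    using sol_pairing_derivative[OF s test_fun_section[OF G]] by (simp add: has_field_derivative_def)
  then obtain d1 where d1: "d1 > 0" "\<And>y. y \<in> {0..} \<Longrightarrow> norm (y - s) < d1 \<Longrightarrow>
      norm (sol_pairing (\<lambda>x. G (s, x)) y - sol_pairing (\<lambda>x. G (s, x)) s - sol_pairing (frac_op h (\<lambda>x. G (s, x))) s * (y - s)) \<le> e / 3 * norm (y - s)"
    unfolding has_derivative_within_alt using e by (metis zero_less_divide_iff zero_less_numeral)
  have "continuous (at s within {0..}) (sol_pairing (\<lambda>x. Gd (s, x)))"
    using sol_pairing_continuous[OF i(2)] s by (simp add: continuous_on_eq_continuous_within)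
  then obtain d2 where d2: "d2 > 0" "\<And>y. y \<in> {0..} \<Longrightarrow> dist y s < d2 \<Longrightarrow> dist (sol_pairing (\<lambda>x. Gd (s, x)) y) (sol_pairing (\<lambda>x. Gd (s, x)) s) < e / 3"
    unfolding continuous_within_eps_delta using e by (metis zero_less_divide_iff zero_less_numeral)
  let ?D = "sol_pairing (\<lambda>x. Gd (s, x) + frac_op h (\<lambda>x. G (s, x)) x) s"
  define d where "d = min (min d1 d2) (e / (3 * (C + 1)))"
  have d: "d > 0" "d \<le> d1" "d \<le> d2" "d \<le> e / (3 * (C + 1))" using d1 d2 e C(1) by (auto simp: d_def)
  show "\<exists>d>0. \<forall>y\<in>{0..}. norm (y - s) < d \<longrightarrow> norm (sol_pairing (\<lambda>x. G (y, x)) y - sol_pairing (\<lambda>x. G (s, x)) s - ?D * (y - s)) \<le> e * norm (y - s)"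
  proof (intro exI[of _ d] conjI ballI impI d(1))
    fix y :: real assume y: "y \<in> {0..}" "norm (y - s) < d"
    let ?r = "\<lambda>x. G (y, x) - G (s, x) - (y - s) * Gd (s, x)"
    have ri: "integrable lborel ?r" using i by auto
    have D: "?D = sol_pairing (\<lambda>x. Gd (s, x)) s + sol_pairing (frac_op h (\<lambda>x. G (s, x))) s" by (rule sol_pairing_linear(3)[OF i(2,3)])
    have "sol_pairing (\<lambda>x. G (y, x)) y = sol_pairing (\<lambda>x. (G (s, x) + (y - s) * Gd (s, x)) + ?r x) y" by simp
    also have "\<dots> = sol_pairing (\<lambda>x. G (s, x)) y + (y - s) * sol_pairing (\<lambda>x. Gd (s, x)) y + sol_pairing ?r y"
      using i by (subst sol_pairing_linear(3)[OF _ ri]) (auto simp: sol_pairing_linear(1)[OF i(1,2)])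
    finally have e1: "sol_pairing (\<lambda>x. G (y, x)) y = sol_pairing (\<lambda>x. G (s, x)) y + (y - s) * sol_pairing (\<lambda>x. Gd (s, x)) y + sol_pairing ?r y" .
    have b1: "\<bar>sol_pairing ?r y\<bar> \<le> e / 3 * \<bar>y - s\<bar>"
    proof -
      have "\<bar>sol_pairing ?r y\<bar> \<le> C * \<bar>y - s\<bar>^2" using sol_pairing_bound[OF ri, of y] C(2)[of y s] by linarith
      also have "\<dots> = (C * \<bar>y - s\<bar>) * \<bar>y - s\<bar>" by (simp add: power2_eq_square)
      also have "\<dots> \<le> e / 3 * \<bar>y - s\<bar>"
      proof (rule mult_right_mono)
        have "C * \<bar>y - s\<bar> \<le> (C + 1) * (e / (3 * (C + 1)))" using y d C(1) by (intro mult_mono) auto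
        also have "\<dots> = e / 3" using C(1) by (simp add: field_simps)
        finally show "C * \<bar>y - s\<bar> \<le> e / 3" .
      qed auto
      finally show ?thesis .
    qed
    have b2: "\<bar>(y - s) * (sol_pairing (\<lambda>x. Gd (s, x)) y - sol_pairing (\<lambda>x. Gd (s, x)) s)\<bar> \<le> e / 3 * \<bar>y - s\<bar>"
    proof -
      have "\<bar>sol_pairing (\<lambda>x. Gd (s, x)) y - sol_pairing (\<lambda>x. Gd (s, x)) s\<bar> \<le> e / 3"
        using d2(2)[OF y(1)] y(2) d(3) unfolding dist_real_def real_norm_def by linarith
      then have "\<bar>y - s\<bar> * \<bar>sol_pairing (\<lambda>x. Gd (s, x)) y - sol_pairing (\<lambda>x. Gd (s, x)) s\<bar> \<le> \<bar>y - s\<bar> * (e / 3)" by (rule mult_left_mono) simp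
      then show ?thesis by (simp add: abs_mult mult.commute)
    qed
    have b3: "\<bar>sol_pairing (\<lambda>x. G (s, x)) y - sol_pairing (\<lambda>x. G (s, x)) s - sol_pairing (frac_op h (\<lambda>x. G (s, x))) s * (y - s)\<bar> \<le> e / 3 * \<bar>y - s\<bar>"
      using d1(2)[OF y(1)] y(2) d(2) by (simp only: real_norm_def)
    have "sol_pairing (\<lambda>x. G (y, x)) y - sol_pairing (\<lambda>x. G (s, x)) s - ?D * (y - s) =
       (sol_pairing (\<lambda>x. G (s, x)) y - sol_pairing (\<lambda>x. G (s, x)) s - sol_pairing (frac_op h (\<lambda>x. G (s, x))) s * (y - s)) + sol_pairing ?r y
        + (y - s) * (sol_pairing (\<lambda>x. Gd (s, x)) y - sol_pairing (\<lambda>x. Gd (s, x)) s)"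
      unfolding e1 D by (simp add: algebra_simps)
    then show "norm (sol_pairing (\<lambda>x. G (y, x)) y - sol_pairing (\<lambda>x. G (s, x)) s - ?D * (y - s)) \<le> e * norm (y - s)"
      using b1 b2 b3 unfolding real_norm_def by linarith
  qed
qed

text \<open>Continuity of the derivative is what the fundamental theorem asks for. The delicate
  part, the fractional operator of a moving test function, is covered by the varying times in
  \<open>lop_L1_convergence\<close>.\<close>

lemma time_dependent_continuous:
  assumes G: "test_fun G" and Gd: "test_fun Gd" "\<And>s x. ((\<lambda>r. G (r, x)) has_real_derivative Gd (s, x)) (at s)"
  shows "continuous_on {0..t} (\<lambda>s. sol_pairing (\<lambda>x. Gd (s, x) + frac_op h (\<lambda>x. G (s, x)) x) s)"
proof (subst continuous_on_sequentially, intro ballI allI impI, elim conjE)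
  let ?g = "\<lambda>s x. Gd (s, x) + frac_op h (\<lambda>x. G (s, x)) x"
  fix s0 and s :: "nat \<Rightarrow> real" assume s0: "s0 \<in> {0..t}" and s: "\<forall>n. s n \<in> {0..t}" and lim: "s \<longlonglongrightarrow> s0"
  obtain C where C: "C \<ge> 0" "\<And>s s'. L1 (\<lambda>x. Gd (s', x) - Gd (s, x)) \<le> C * \<bar>s' - s\<bar>"
    using test_fun_time_taylor[OF G Gd] by auto
  have i: "integrable lborel (\<lambda>x. Gd (s, x))" "integrable lborel (frac_op h (\<lambda>x. G (s, x)))" for s
    by (intro test_fun_integrable frac_op_integrable test_fun_section G Gd)+
  have gi: "integrable lborel (?g s)" for s using i by simp
  have f0: "(\<lambda>n. L1 (\<lambda>x. frac_op h (\<lambda>x. G (s n, x)) x - frac_op h (\<lambda>x. G (s0, x)) x)) \<longlonglongrightarrow> 0"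
    using lop_L1_convergence(3)[OF G, where c = 1 and \<sigma> = "\<lambda>n x. x" and \<rho> = "\<lambda>n y. y" and k = "\<lambda>_ _. 1" and s = s and ?s0.0 = s0]
      comparable_self[of 1] lim by (simp add: lop_id L1_def)
  have d0: "(\<lambda>n. C * \<bar>s n - s0\<bar>) \<longlonglongrightarrow> C * \<bar>s0 - s0\<bar>" by (intro tendsto_intros lim)
  have "continuous_on {0..t} (sol_pairing (?g s0))" by (rule continuous_on_subset[OF sol_pairing_continuous[OF gi]]) auto
  then have c0: "(\<lambda>n. sol_pairing (?g s0) (s n)) \<longlonglongrightarrow> sol_pairing (?g s0) s0"
    using s0 s lim unfolding continuous_on_sequentially by (auto simp: o_def)
  have "(\<lambda>n. sol_pairing (?g (s n)) (s n) - sol_pairing (?g s0) (s n)) \<longlonglongrightarrow> 0"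
  proof (rule Lim_null_comparison)
    show "\<forall>\<^sub>F n in sequentially. norm (sol_pairing (?g (s n)) (s n) - sol_pairing (?g s0) (s n)) \<le>
        C * \<bar>s n - s0\<bar> + L1 (\<lambda>x. frac_op h (\<lambda>x. G (s n, x)) x - frac_op h (\<lambda>x. G (s0, x)) x)"
    proof (intro always_eventually allI)
      fix n
      have "norm (sol_pairing (?g (s n)) (s n) - sol_pairing (?g s0) (s n)) \<le> L1 (\<lambda>x. ?g (s n) x - ?g s0 x)"
        using sol_pairing_bound[of "\<lambda>x. ?g (s n) x - ?g s0 x" "s n"] gi by (simp add: sol_pairing_linear(2)[OF gi gi])
      also have "\<dots> = L1 (\<lambda>x. (Gd (s n, x) - Gd (s0, x)) + (frac_op h (\<lambda>x. G (s n, x)) x - frac_op h (\<lambda>x. G (s0, x)) x))"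
        by (simp add: algebra_simps)
      also have "\<dots> \<le> L1 (\<lambda>x. Gd (s n, x) - Gd (s0, x)) + L1 (\<lambda>x. frac_op h (\<lambda>x. G (s n, x)) x - frac_op h (\<lambda>x. G (s0, x)) x)"
        using i by (intro L1_add) auto
      finally show "norm (sol_pairing (?g (s n)) (s n) - sol_pairing (?g s0) (s n)) \<le>
        C * \<bar>s n - s0\<bar> + L1 (\<lambda>x. frac_op h (\<lambda>x. G (s n, x)) x - frac_op h (\<lambda>x. G (s0, x)) x)"
        using C(2)[of "s n" s0] by linarith
    qed
    show "(\<lambda>n. C * \<bar>s n - s0\<bar> + L1 (\<lambda>x. frac_op h (\<lambda>x. G (s n, x)) x - frac_op h (\<lambda>x. G (s0, x)) x)) \<longlonglongrightarrow> 0"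
      using tendsto_add[OF d0 f0] by simp
  qed
  from tendsto_add[OF this c0] show "((\<lambda>s. sol_pairing (?g s) s) \<circ> s) \<longlonglongrightarrow> sol_pairing (?g s0) s0" by (simp add: o_def)
qed

theorem weak_solution_exists: "weak_solution h T u0 sol"
  unfolding weak_solution_def
proof (intro conjI allI impI ballI)
  show "(\<lambda>(s, x). sol s x) \<in> borel_measurable borel" by (rule sol_joint_meas)
  show "\<exists>B. \<forall>s\<in>{0..T}. \<forall>x. \<bar>sol s x\<bar> \<le> B" using sol_range by blast
  fix G :: "real \<times> (real^'d) \<Rightarrow> real" and t :: real
  assume "smooth G \<and> has_compact_support G" and t: "t \<in> {0..T}"
  then have G: "test_fun G" by (simp add: test_fun_def)
  obtain Gd where Gd: "test_fun Gd" "\<And>s x. ((\<lambda>r. G (r, x)) has_real_derivative Gd (s, x)) (at s)"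
    using test_fun_time_derivative[OF G] by blast
  let ?D = "\<lambda>s. sol_pairing (\<lambda>x. Gd (s, x) + frac_op h (\<lambda>x. G (s, x)) x) s"
  have dG: "deriv (\<lambda>r. G (r, x)) s = Gd (s, x)" for s x by (rule DERIV_imp_deriv[OF Gd(2)])
  have "(\<integral>s. (\<integral>x. sol s x * (deriv (\<lambda>r. G (r,x)) s + frac_op h (\<lambda>y. G (s,y)) x) \<partial>lborel) \<partial>(restrict_space lborel {0..t}))
      = (\<integral>s. ?D s \<partial>(restrict_space lborel {0..t}))"
    by (simp add: dG sol_pairing_def)
  also have "\<dots> = (\<integral>s. indicator {0..t} s *\<^sub>R ?D s \<partial>lborel)"
    by (rule integral_restrict_space) auto
  also have "\<dots> = sol_pairing (\<lambda>x. G (t, x)) t - sol_pairing (\<lambda>x. G (0, x)) 0"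
  proof (rule integral_FTC_atLeastAtMost)
    show "0 \<le> t" using t by simp
    show "((\<lambda>s. sol_pairing (\<lambda>x. G (s, x)) s) has_vector_derivative ?D s) (at s within {0..t})" if "0 \<le> s" "s \<le> t" for s
      using has_field_derivative_subset[OF time_dependent_derivative[OF G Gd that(1)], of "{0..t}"]
      by (auto simp: has_real_derivative_iff_has_vector_derivative)
    show "continuous_on {0..t} ?D" by (rule time_dependent_continuous[OF G Gd])
  qed
  also have "sol_pairing (\<lambda>x. G (0, x)) 0 = (\<integral>x. u0 x * G (0, x) \<partial>lborel)"
    by (rule spair_0) (intro test_fun_integrable test_fun_section G)
  finally show "(\<integral>x. sol t x * G (t,x) \<partial>lborel) - (\<integral>x. u0 x * G (0,x) \<partial>lborel)
          - (\<integral>s. (\<integral>x. sol s x * (deriv (\<lambda>r. G (r,x)) s + frac_op h (\<lambda>y. G (s,y)) x) \<partial>lborel)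
                \<partial>(restrict_space lborel {0..t})) = 0"
    by (simp add: sol_pairing_def)
qed

end

section \<open>The exclusion process\<close>

lemma summable_on_real_bound:
  fixes f g :: "'a \<Rightarrow> real"
  assumes "f summable_on A" "\<And>x. x \<in> A \<Longrightarrow> \<bar>g x\<bar> \<le> f x"
  shows "g summable_on A"
  by (rule summable_on_iff_abs_summable_on_real[THEN iffD2], rule summable_on_comparison_test[OF assms(1)])
     (use assms(2) in auto)

lemma summable_on_abs: "f summable_on A \<Longrightarrow> (\<lambda>x. \<bar>f x\<bar>) summable_on A" for f :: "'a \<Rightarrow> real"
  by (drule summable_on_iff_abs_summable_on_real[THEN iffD1]) simp

lemma summable_on_iff_integrable:
  "f summable_on (UNIV :: 'a set) \<longleftrightarrow> integrable (count_space UNIV) f" for f :: "'a \<Rightarrow> real"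
  by (rule trans[OF summable_on_iff_abs_summable_on_real trans[OF abs_summable_equivalent]])
     (rule Infinite_Set_Sum.abs_summable_on_def)

lemma infsum_eq_integral:
  fixes f :: "'a \<Rightarrow> real"
  assumes "f summable_on UNIV"
  shows "infsum f UNIV = (\<integral>x. f x \<partial>count_space UNIV)"
proof -
  have "infsetsum f UNIV = infsum f UNIV"
    using assms by (intro infsetsum_infsum)
      (simp add: summable_on_iff_integrable Infinite_Set_Sum.abs_summable_on_def)
  then show ?thesis by (simp add: infsetsum_def)
qed

lemma abs_infsum_le:
  fixes f g :: "'a \<Rightarrow> real"
  assumes "g summable_on A" "\<And>x. x \<in> A \<Longrightarrow> \<bar>f x\<bar> \<le> g x"
  shows "\<bar>infsum f A\<bar> \<le> infsum g A"
proof -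
  have f: "f summable_on A" by (rule summable_on_real_bound[OF assms])
  then have a: "(\<lambda>x. norm (f x)) summable_on A" by (rule summable_on_iff_abs_summable_on_real[THEN iffD1])
  have "\<bar>infsum f A\<bar> \<le> infsum (\<lambda>x. norm (f x)) A" using norm_infsum_bound[OF a] by simp
  also have "\<dots> \<le> infsum g A" by (rule infsum_mono[OF a assms(1)]) (use assms(2) in auto)
  finally show ?thesis .
qed

text \<open>Summing over the support mirrors \<open>empirical\<close>; a plain finite sum over all
  sites would be 0 by convention, the index set being infinite.\<close>

definition occupation_sum :: "('s \<Rightarrow> real) \<Rightarrow> ('s \<Rightarrow> bool) \<Rightarrow> real" where
  "occupation_sum g \<eta> = (\<Sum>z\<in>{z. g z \<noteq> 0}. occ (\<eta> z) * g z)"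

lemma occ_range: "0 \<le> occ b" "occ b \<le> 1" "\<bar>occ b\<bar> \<le> 1" "\<bar>1 - occ b\<bar> \<le> 1"
  by (auto simp: occ_def)

lemma occupation_sum_superset: "finite A \<Longrightarrow> {z. g z \<noteq> 0} \<subseteq> A \<Longrightarrow> occupation_sum g \<eta> = (\<Sum>z\<in>A. occ (\<eta> z) * g z)"
  unfolding occupation_sum_def by (rule sum.mono_neutral_left) auto

lemma occupation_sum_infsum:
  assumes "finite {z. g z \<noteq> 0}"
  shows "((\<lambda>z. occ (\<eta> z) * g z) has_sum occupation_sum g \<eta>) UNIV"
  unfolding occupation_sum_def by (rule has_sum_finite_neutralI[OF assms]) auto

lemma occupation_sum_exch:
  assumes g: "finite {z. g z \<noteq> 0}" and x: "\<eta> x" and y: "\<not> \<eta> y"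
  shows "occupation_sum g (exch \<eta> x y) = occupation_sum g \<eta> + g y - g x"
proof -
  define A where "A = {z. g z \<noteq> 0} \<union> {x, y}"
  have A: "finite A" "{z. g z \<noteq> 0} \<subseteq> A" using g by (auto simp: A_def)
  have ne: "x \<noteq> y" using x y by auto
  have "occupation_sum g (exch \<eta> x y) - occupation_sum g \<eta> = (\<Sum>z\<in>A. (occ (exch \<eta> x y z) - occ (\<eta> z)) * g z)"
    by (simp add: occupation_sum_superset[OF A] sum_subtractf left_diff_distrib)
  also have "\<dots> = (\<Sum>z\<in>{x, y}. (occ (exch \<eta> x y z) - occ (\<eta> z)) * g z)"
    by (rule sum.mono_neutral_right) (use A in \<open>auto simp: A_def exch_def\<close>)
  also have "\<dots> = g y - g x" using ne x y by (simp add: exch_def occ_def)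
  finally show ?thesis by simp
qed

lemma occ_measurable: "(\<lambda>\<eta>. occ (\<eta> z)) \<in> borel_measurable config_space"
proof -
  have "(\<lambda>\<eta>. \<eta> z) \<in> measurable config_space (count_space UNIV)"
    unfolding config_space_def by (rule measurable_component_singleton) simp
  then show ?thesis by (rule measurable_compose) simp
qed

lemma occupation_sum_measurable: "occupation_sum g \<in> borel_measurable config_space"
  unfolding occupation_sum_def[abs_def] by (intro borel_measurable_sum borel_measurable_times occ_measurable) simp

lemma occupation_sum_exch_measurable: "(\<lambda>\<eta>. occupation_sum g (exch \<eta> x y)) \<in> borel_measurable config_space"
proof -
  have "(\<lambda>\<eta>. occ (exch \<eta> x y z)) \<in> borel_measurable config_space" for z
    unfolding exch_def by (cases "z = y"; cases "z = x") (simp_all add: occ_measurable)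
  then show ?thesis unfolding occupation_sum_def by (intro borel_measurable_sum borel_measurable_times) simp_all
qed

lemma occupation_sum_cylinder: "finite {z. g z \<noteq> 0} \<Longrightarrow> finite {z. k z \<noteq> 0} \<Longrightarrow> cylinder_fun (\<lambda>\<eta>. \<Psi> (occupation_sum g \<eta>) (occupation_sum k \<eta>))"
  unfolding cylinder_fun_def
proof (intro exI[of _ "{z. g z \<noteq> 0} \<union> {z. k z \<noteq> 0}"] conjI allI impI)
  fix \<eta> \<zeta> :: "int^'a \<Rightarrow> bool" assume "\<forall>x\<in>{z. g z \<noteq> 0} \<union> {z. k z \<noteq> 0}. \<eta> x = \<zeta> x"
  then have "occupation_sum g \<eta> = occupation_sum g \<zeta>" "occupation_sum k \<eta> = occupation_sum k \<zeta>" unfolding occupation_sum_def by (auto intro!: sum.cong)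
  then show "\<Psi> (occupation_sum g \<eta>) (occupation_sum k \<eta>) = \<Psi> (occupation_sum g \<zeta>) (occupation_sum k \<zeta>)" by simp
qed auto

section \<open>Random walk sums over pairs of sites\<close>

context levy_kernel
begin

abbreviation "p \<equiv> jump_rate h"

lemma jump_rate_nonneg: "p z \<ge> 0"
  using h_pos[of "site_to_real z"] by (auto simp: jump_rate_def)

lemma jump_rate_even: "p (- z) = p z"
  using h_even[of "site_to_real z"] by (auto simp: jump_rate_def)

text \<open>The sum is an integral over cells of side 1. Points of a cell other than that of the
  origin have norm at least 1/2, so there the minimum in \<open>weight\<close> is at least 1/4 and a
  multiple of the weight dominates the rate.\<close>

lemma jump_rate_summable: "p summable_on UNIV"
proof -
  have pe: "h0 (lattice_round 1 y) = p (cell_index 1 y)" for y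
    by (simp add: lattice_round_def h0_scale)
  obtain H where H: "H \<ge> 0" "\<And>y. h0 y \<le> H * norm y powr (- (real CARD('d) + \<alpha>))" using h0_bound by blast
  define c where "c = 2 * real CARD('d)"
  have c: "c \<ge> 1" using card_ge_1 by (simp add: c_def)
  have b: "h0 (lattice_round 1 y) \<le> 4 * H * c powr (real CARD('d) + \<alpha>) * weight y" for y
  proof (cases "lattice_round 1 y = 0")
    case True
    then show ?thesis using H(1) weight_nonneg[of y] by (simp add: h0_def)
  next
    case False
    let ?r = "lattice_round 1 y"
    have y0: "y \<noteq> 0" using False norm_lattice_round_le[of 1 y] by auto
    have "norm y \<le> c * norm ?r" using norm_le_lattice_round[of 1 y] False by (simp add: c_def)
    then have le: "norm y / c \<le> norm ?r" using c by (simp add: field_simps)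
    obtain j where j: "?r $ j \<noteq> 0" using False by (auto simp: vec_eq_iff)
    then have "1 \<le> \<bar>round (y $ j)\<bar>" by (simp add: lattice_round_coord)
    then have "1 \<le> real_of_int \<bar>round (y $ j)\<bar>" by linarith
    then have "1 \<le> \<bar>?r $ j\<bar>" by (simp add: lattice_round_coord)
    also have "\<dots> \<le> norm ?r" by (rule component_le_norm_cart)
    also have "\<dots> \<le> 2 * norm y" by (rule norm_lattice_round_le) simp
    finally have half: "1/2 \<le> norm y" by simp
    then have "(1/2)^2 \<le> norm y ^ 2" by (intro power_mono) auto
    then have q: "1 \<le> 4 * min 1 (norm y ^ 2)" by (simp add: power2_eq_square)
    have "h0 ?r \<le> H * norm ?r powr (- (real CARD('d) + \<alpha>))" by (rule H)
    also have "\<dots> \<le> H * (norm y / c) powr (- (real CARD('d) + \<alpha>))"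
      using H(1) le y0 alpha c by (intro mult_left_mono powr_mono2') auto
    also have "(norm y / c) powr (- (real CARD('d) + \<alpha>)) = c powr (real CARD('d) + \<alpha>) * norm y powr (- (real CARD('d) + \<alpha>))"
      using c by (simp add: powr_divide powr_minus_divide del: minus_add_distrib)
    also have "H * (c powr (real CARD('d) + \<alpha>) * norm y powr (- (real CARD('d) + \<alpha>))) * 1 \<le>
        H * (c powr (real CARD('d) + \<alpha>) * norm y powr (- (real CARD('d) + \<alpha>))) * (4 * min 1 (norm y ^ 2))"
      using H(1) by (intro mult_left_mono q) auto
    finally show ?thesis by (simp add: weight_def mult_ac)
  qed
  have m: "(\<lambda>y. h0 (lattice_round 1 y)) \<in> borel_measurable borel"
    by (rule measurable_compose[OF lattice_round_measurable h0_measurable]) simp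
  have "integrable lborel (\<lambda>y. h0 (lattice_round 1 y))"
  proof (rule Bochner_Integration.integrable_bound)
    show "integrable lborel (\<lambda>y. 4 * H * c powr (real CARD('d) + \<alpha>) * weight y)" using weight_integrable by simp
    show "AE y in lborel. norm (h0 (lattice_round 1 y)) \<le> norm (4 * H * c powr (real CARD('d) + \<alpha>) * weight y)"
    proof (intro AE_I2)
      fix y show "norm (h0 (lattice_round 1 y)) \<le> norm (4 * H * c powr (real CARD('d) + \<alpha>) * weight y)"
        using b[of y] h0_nonneg[of "lattice_round 1 y"] by simp
    qed
  qed (use m in simp)
  then have "integrable (count_space UNIV) p" unfolding pe by (simp add: lattice_integrable_iff)
  then show ?thesis by (simp add: summable_on_iff_integrable)
qed

definition jump_gen :: "(int^'d \<Rightarrow> real) \<Rightarrow> int^'d \<Rightarrow> real" where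
  "jump_gen g x = (\<Sum>\<^sub>\<infinity>y. p y * (g (x + y) - g x))"

lemma bij_shift: "bij_betw (\<lambda>w. x + w) UNIV (UNIV :: (int^'d) set)"
  by (rule bij_betwI[where g = "\<lambda>w. w - x"]) auto

lemma bij_swap: "bij_betw (\<lambda>(x, y). (y, x)) UNIV (UNIV :: ((int^'d) \<times> (int^'d)) set)"
  by (rule bij_betwI[where g = "\<lambda>(x, y). (y, x)"]) auto

lemma pair_summable_fst:
  assumes g: "finite {z. g z \<noteq> 0}"
  shows "(\<lambda>(x, y). p (y - x) * \<bar>g x\<bar>) summable_on UNIV"
proof -
  have "(\<lambda>(x, y). p (y - x) * \<bar>g x\<bar>) summable_on (Sigma UNIV (\<lambda>_. UNIV))"
  proof (rule summable_on_SigmaI)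
    fix x :: "int^'d"
    have "(\<lambda>y. p (y - x)) summable_on UNIV"
      using jump_rate_summable summable_on_reindex_bij_betw[OF bij_shift[of "- x"], of p] by simp
    then have "(\<lambda>y. p (y - x) * \<bar>g x\<bar>) summable_on UNIV" by (rule summable_on_cmult_left)
    then show "((\<lambda>y. case (x, y) of (x, y) \<Rightarrow> p (y - x) * \<bar>g x\<bar>) has_sum (infsum p UNIV * \<bar>g x\<bar>)) UNIV"
    proof -
      have "(p has_sum infsum p UNIV) UNIV" using jump_rate_summable by simp
      then have "((\<lambda>y. p (- x + y)) has_sum infsum p UNIV) UNIV"
        by (subst has_sum_reindex_bij_betw[OF bij_shift[of "- x"]])
      then have "((\<lambda>y. p (- x + y) * \<bar>g x\<bar>) has_sum (infsum p UNIV * \<bar>g x\<bar>)) UNIV" by (rule has_sum_cmult_left)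
      then show ?thesis by simp
    qed
  next
    have "finite {x. infsum p UNIV * \<bar>g x\<bar> \<noteq> 0}" by (rule finite_subset[OF _ g]) auto
    then show "(\<lambda>x. infsum p UNIV * \<bar>g x\<bar>) summable_on UNIV" by (intro finite_nonzero_values_imp_summable_on) simp
  qed (simp add: jump_rate_nonneg)
  then show ?thesis by simp
qed

lemma pair_summable_snd:
  assumes g: "finite {z. g z \<noteq> 0}"
  shows "(\<lambda>(x, y). p (y - x) * \<bar>g y\<bar>) summable_on UNIV"
proof -
  have "(\<lambda>q. (\<lambda>(x, y). p (y - x) * \<bar>g x\<bar>) ((\<lambda>(x, y). (y, x)) q)) summable_on UNIV"
    using pair_summable_fst[OF g] summable_on_reindex_bij_betw[OF bij_swap] by blast
  moreover have "(\<lambda>q. (\<lambda>(x, y). p (y - x) * \<bar>g x\<bar>) ((\<lambda>(x, y). (y, x)) q)) = (\<lambda>(x, y). p (y - x) * \<bar>g y\<bar>)"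
    using jump_rate_even by (auto simp: fun_eq_iff) (metis minus_diff_eq)
  ultimately show ?thesis by simp
qed

text \<open>The double sums below, for the current, for products and for the Dirichlet form, are
  instances with a suitable bounded coefficient \<open>c\<close>.\<close>

lemma pair_summable:
  assumes g: "finite {z. g z \<noteq> 0}" and b: "\<And>x y. \<bar>c x y\<bar> \<le> C"
  shows "(\<lambda>(x, y). p (y - x) * c x y * (g y - g x)) summable_on UNIV"
proof -
  have C0: "C \<ge> 0" using b[of undefined undefined] by linarith
  have "(\<lambda>q. C * ((\<lambda>(x, y). p (y - x) * \<bar>g y\<bar>) q + (\<lambda>(x, y). p (y - x) * \<bar>g x\<bar>) q)) summable_on UNIV"
    by (intro summable_on_cmult_right summable_on_add pair_summable_fst pair_summable_snd g)
  then show ?thesis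
  proof (rule summable_on_real_bound)
    fix q :: "(int^'d) \<times> (int^'d)"
    obtain x y where q: "q = (x, y)" by (cases q)
    have "\<bar>p (y - x) * c x y * (g y - g x)\<bar> = p (y - x) * (\<bar>c x y\<bar> * \<bar>g y - g x\<bar>)"
      using jump_rate_nonneg[of "y - x"] by (simp add: abs_mult)
    also have "\<dots> \<le> p (y - x) * (C * (\<bar>g y\<bar> + \<bar>g x\<bar>))"
      using jump_rate_nonneg b C0 by (intro mult_left_mono mult_mono) auto
    finally show "\<bar>(\<lambda>(x, y). p (y - x) * c x y * (g y - g x)) q\<bar> \<le> C * ((\<lambda>(x, y). p (y - x) * \<bar>g y\<bar>) q + (\<lambda>(x, y). p (y - x) * \<bar>g x\<bar>) q)"
      by (simp add: q algebra_simps)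
  qed
qed

lemma finite_support_bounded:
  assumes "finite {z. g z \<noteq> 0}"
  shows "\<exists>M\<ge>0. \<forall>z. \<bar>g z\<bar> \<le> (M::real)"
proof (intro exI[of _ "\<Sum>z\<in>{z. g z \<noteq> 0}. \<bar>g z\<bar>"] conjI allI)
  fix z show "\<bar>g z\<bar> \<le> (\<Sum>z\<in>{z. g z \<noteq> 0}. \<bar>g z\<bar>)"
    using member_le_sum[of z "{z. g z \<noteq> 0}" "\<lambda>z. \<bar>g z\<bar>"] assms by (cases "g z = 0") (auto intro!: sum_nonneg)
qed (auto intro!: sum_nonneg)

lemma jump_gen_sum:
  assumes g: "finite {z. g z \<noteq> 0}" and b: "\<And>x. \<bar>c x\<bar> \<le> C"
  shows "(\<lambda>x. c x * jump_gen g x) summable_on UNIV"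
    and "(\<Sum>\<^sub>\<infinity>(x, y)\<in>UNIV. p (y - x) * c x * (g y - g x)) = (\<Sum>\<^sub>\<infinity>x. c x * jump_gen g x)"
proof -
  have s: "(\<lambda>(x, y). p (y - x) * c x * (g y - g x)) summable_on (Sigma UNIV (\<lambda>_. UNIV))"
    using pair_summable[OF g, of "\<lambda>x y. c x" C] b by simp
  have inner: "(\<Sum>\<^sub>\<infinity>y. p (y - x) * c x * (g y - g x)) = c x * jump_gen g x" for x
  proof -
    have "(\<Sum>\<^sub>\<infinity>y. p (y - x) * c x * (g y - g x)) = (\<Sum>\<^sub>\<infinity>y. p ((x + y) - x) * c x * (g (x + y) - g x))"
      by (rule infsum_reindex_bij_betw[OF bij_shift, symmetric])
    also have "\<dots> = (\<Sum>\<^sub>\<infinity>y. c x * (p y * (g (x + y) - g x)))" by (simp add: mult_ac)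
    also have "\<dots> = c x * jump_gen g x" unfolding jump_gen_def
    proof (rule infsum_cmult_right)
      obtain M where M: "M \<ge> 0" "\<And>z. \<bar>g z\<bar> \<le> M" using finite_support_bounded[OF g] by blast
      show "(\<lambda>y. p y * (g (x + y) - g x)) summable_on UNIV"
      proof (rule summable_on_real_bound[OF summable_on_cmult_right[OF jump_rate_summable, of "2 * M"]])
        fix y
        have "\<bar>g (x + y) - g x\<bar> \<le> 2 * M" using M(2)[of "x + y"] M(2)[of x] by linarith
        then show "\<bar>p y * (g (x + y) - g x)\<bar> \<le> 2 * M * p y" using jump_rate_nonneg[of y] by (simp add: abs_mult mult_left_mono mult.commute)
      qed
    qed
    finally show ?thesis .
  qed
  show "(\<lambda>x. c x * jump_gen g x) summable_on UNIV"
    using summable_on_Sigma_banach[OF s] by (simp add: inner)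
  show "(\<Sum>\<^sub>\<infinity>(x, y)\<in>UNIV. p (y - x) * c x * (g y - g x)) = (\<Sum>\<^sub>\<infinity>x. c x * jump_gen g x)"
    using infsum_Sigma'_banach[OF s] by (simp add: inner)
qed

lemma jump_gen_summable: "finite {z. g z \<noteq> 0} \<Longrightarrow> jump_gen g summable_on UNIV"
  using jump_gen_sum(1)[of g "\<lambda>_. 1" 1] by simp

text \<open>The exclusion term is antisymmetric in the two sites and cancels.\<close>

lemma current_sum:
  assumes g: "finite {z. g z \<noteq> 0}"
  shows "(\<Sum>\<^sub>\<infinity>(x, y)\<in>UNIV. p (y - x) * (occ (\<eta> x) * (1 - occ (\<eta> y))) * (g y - g x)) = (\<Sum>\<^sub>\<infinity>x. occ (\<eta> x) * jump_gen g x)"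
proof -
  let ?s = "\<lambda>(x, y). p (y - x) * (occ (\<eta> x) * occ (\<eta> y)) * (g y - g x)"
  let ?f = "\<lambda>(x, y). p (y - x) * occ (\<eta> x) * (g y - g x)"
  have bb: "\<bar>occ (\<eta> x) * occ (\<eta> y)\<bar> \<le> 1" for x y using occ_range by (auto simp: abs_mult occ_def)
  have s: "?s summable_on UNIV" using pair_summable[OF g bb] by simp
  have f: "?f summable_on UNIV" using pair_summable[OF g, of "\<lambda>x y. occ (\<eta> x)" 1] occ_range by simp
  have "infsum ?s UNIV = infsum (\<lambda>q. ?s ((\<lambda>(x, y). (y, x)) q)) UNIV"
    by (rule infsum_reindex_bij_betw[OF bij_swap, symmetric])
  also have "(\<lambda>q. ?s ((\<lambda>(x, y). (y, x)) q)) = (\<lambda>q. (- 1) * ?s q)"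
  proof
    fix q :: "(int^'d) \<times> (int^'d)"
    obtain x y where q: "q = (x, y)" by (cases q)
    have "p (x - y) = p (y - x)" using jump_rate_even[of "y - x"] by simp
    then show "?s ((\<lambda>(x, y). (y, x)) q) = (- 1) * ?s q" by (simp add: q algebra_simps)
  qed
  also have "infsum \<dots> UNIV = (- 1) * infsum ?s UNIV" by (rule infsum_cmult_right) (rule s)
  finally have s0: "infsum ?s UNIV = 0" by simp
  have "(\<Sum>\<^sub>\<infinity>(x, y)\<in>UNIV. p (y - x) * (occ (\<eta> x) * (1 - occ (\<eta> y))) * (g y - g x)) = infsum (\<lambda>q. ?f q + (- 1) * ?s q) UNIV"
    by (rule infsum_cong) (auto simp: algebra_simps)
  also have "\<dots> = infsum ?f UNIV + infsum (\<lambda>q. (- 1) * ?s q) UNIV"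
    by (rule infsum_add[OF f summable_on_cmult_right[OF s]])
  also have "infsum (\<lambda>q. (- 1) * ?s q) UNIV = (- 1) * infsum ?s UNIV" by (rule infsum_cmult_right) (rule s)
  finally show ?thesis using s0 jump_gen_sum(2)[OF g, of "\<lambda>x. occ (\<eta> x)" 1] occ_range by simp
qed

text \<open>\<open>jump_gen g\<close> may have infinite support even for finitely supported
  \<open>g\<close>. A finitely supported \<open>k\<close> replaces it at the cost of an l1 distance,
  uniformly in the configuration.\<close>

lemma current_bound:
  assumes g: "finite {z. g z \<noteq> 0}" and k: "finite {z. k z \<noteq> 0}"
  shows "(\<lambda>x. \<bar>jump_gen g x - k x\<bar>) summable_on UNIV"
    and "\<bar>(\<Sum>\<^sub>\<infinity>x. occ (\<eta> x) * jump_gen g x) - occupation_sum k \<eta>\<bar> \<le> (\<Sum>\<^sub>\<infinity>x. \<bar>jump_gen g x - k x\<bar>)"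
proof -
  have ks: "k summable_on UNIV" using k by (intro finite_nonzero_values_imp_summable_on) simp
  have d: "(\<lambda>x. jump_gen g x - k x) summable_on UNIV"
    using summable_on_add[OF jump_gen_summable[OF g] summable_on_cmult_right[OF ks, of "- 1"]] by simp
  then show a: "(\<lambda>x. \<bar>jump_gen g x - k x\<bar>) summable_on UNIV" by (rule summable_on_abs)
  have "(\<lambda>x. occ (\<eta> x) * jump_gen g x) summable_on UNIV" using jump_gen_sum(1)[OF g, of "\<lambda>x. occ (\<eta> x)" 1] occ_range by simp
  then have "((\<lambda>x. occ (\<eta> x) * jump_gen g x) has_sum (\<Sum>\<^sub>\<infinity>x. occ (\<eta> x) * jump_gen g x)) UNIV" by simp
  from has_sum_add[OF this has_sum_cmult_right[OF occupation_sum_infsum[OF k, of \<eta>], of "- 1"]]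
  have "((\<lambda>x. occ (\<eta> x) * jump_gen g x - occ (\<eta> x) * k x) has_sum ((\<Sum>\<^sub>\<infinity>x. occ (\<eta> x) * jump_gen g x) - occupation_sum k \<eta>)) UNIV" by simp
  then have "(\<Sum>\<^sub>\<infinity>x. occ (\<eta> x) * jump_gen g x) - occupation_sum k \<eta> = (\<Sum>\<^sub>\<infinity>x. occ (\<eta> x) * jump_gen g x - occ (\<eta> x) * k x)" by (rule infsumI[symmetric])
  also have "\<bar>\<dots>\<bar> \<le> (\<Sum>\<^sub>\<infinity>x. \<bar>jump_gen g x - k x\<bar>)"
    by (rule abs_infsum_le[OF a]) (auto simp: occ_def)
  finally show "\<bar>(\<Sum>\<^sub>\<infinity>x. occ (\<eta> x) * jump_gen g x) - occupation_sum k \<eta>\<bar> \<le> (\<Sum>\<^sub>\<infinity>x. \<bar>jump_gen g x - k x\<bar>)" .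
qed

text \<open>Summation by parts turns the Dirichlet form into -2 times the sum of \<open>g\<close>
  times \<open>jump_gen g\<close>. For samples of a test function the factor \<open>M\<close> is of
  order n^(-d), which is the source of the small square field.\<close>

lemma dirichlet_bound:
  assumes g: "finite {z. g z \<noteq> 0}" and M: "\<And>z. \<bar>g z\<bar> \<le> M"
  shows "(\<lambda>(x, y). p (y - x) * (g y - g x)^2) summable_on UNIV"
    and "(\<Sum>\<^sub>\<infinity>(x, y)\<in>UNIV. p (y - x) * (g y - g x)^2) \<le> 2 * M * (\<Sum>\<^sub>\<infinity>x. \<bar>jump_gen g x\<bar>)"
proof -
  have M0: "M \<ge> 0" using M[of undefined] by linarith
  have b: "\<bar>g y - g x\<bar> \<le> 2 * M" for x y using M[of x] M[of y] by linarith
  have s2: "(\<lambda>(x, y). p (y - x) * (g y - g x) * (g y - g x)) summable_on UNIV"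
    using pair_summable[OF g b] .
  then show s: "(\<lambda>(x, y). p (y - x) * (g y - g x)^2) summable_on UNIV" by (simp add: power2_eq_square mult.assoc)
  let ?a = "\<lambda>(x, y). p (y - x) * g y * (g y - g x)" and ?b = "\<lambda>(x, y). p (y - x) * g x * (g y - g x)"
  have sa: "?a summable_on UNIV" using pair_summable[OF g, of "\<lambda>x y. g y" M] M by simp
  have sb: "?b summable_on UNIV" using pair_summable[OF g, of "\<lambda>x y. g x" M] M by simp
  have "infsum ?a UNIV = infsum (\<lambda>q. ?a ((\<lambda>(x, y). (y, x)) q)) UNIV"
    by (rule infsum_reindex_bij_betw[OF bij_swap, symmetric])
  also have "(\<lambda>q. ?a ((\<lambda>(x, y). (y, x)) q)) = (\<lambda>q. (- 1) * ?b q)"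
  proof
    fix q :: "(int^'d) \<times> (int^'d)"
    obtain x y where q: "q = (x, y)" by (cases q)
    have "p (x - y) = p (y - x)" using jump_rate_even[of "y - x"] by simp
    then show "?a ((\<lambda>(x, y). (y, x)) q) = (- 1) * ?b q" by (simp add: q algebra_simps)
  qed
  also have "infsum \<dots> UNIV = (- 1) * infsum ?b UNIV" by (rule infsum_cmult_right) (rule sb)
  finally have ab: "infsum ?a UNIV = (- 1) * infsum ?b UNIV" .
  have "(\<Sum>\<^sub>\<infinity>(x, y)\<in>UNIV. p (y - x) * (g y - g x)^2) = infsum (\<lambda>q. ?a q + (- 1) * ?b q) UNIV"
    by (rule infsum_cong) (auto simp: algebra_simps power2_eq_square)
  also have "\<dots> = infsum ?a UNIV + infsum (\<lambda>q. (- 1) * ?b q) UNIV"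
    by (rule infsum_add[OF sa summable_on_cmult_right[OF sb]])
  also have "infsum (\<lambda>q. (- 1) * ?b q) UNIV = (- 1) * infsum ?b UNIV" by (rule infsum_cmult_right) (rule sb)
  finally have eq: "(\<Sum>\<^sub>\<infinity>(x, y)\<in>UNIV. p (y - x) * (g y - g x)^2) = - 2 * (\<Sum>\<^sub>\<infinity>x. g x * jump_gen g x)"
    using ab jump_gen_sum(2)[OF g M] by simp
  have "\<bar>\<Sum>\<^sub>\<infinity>x. g x * jump_gen g x\<bar> \<le> (\<Sum>\<^sub>\<infinity>x. M * \<bar>jump_gen g x\<bar>)"
  proof (rule abs_infsum_le)
    show "(\<lambda>x. M * \<bar>jump_gen g x\<bar>) summable_on UNIV"
      by (intro summable_on_cmult_right summable_on_abs jump_gen_summable[OF g])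
    show "\<bar>g x * jump_gen g x\<bar> \<le> M * \<bar>jump_gen g x\<bar>" for x using M[of x] by (simp add: abs_mult mult_right_mono)
  qed
  also have "\<dots> = M * (\<Sum>\<^sub>\<infinity>x. \<bar>jump_gen g x\<bar>)"
    by (intro infsum_cmult_right summable_on_abs jump_gen_summable[OF g])
  finally show "(\<Sum>\<^sub>\<infinity>(x, y)\<in>UNIV. p (y - x) * (g y - g x)^2) \<le> 2 * M * (\<Sum>\<^sub>\<infinity>x. \<bar>jump_gen g x\<bar>)" unfolding eq by linarith
qed

text \<open>With X and Y the two centred statistics, the generator of XY is X LY + Y LX plus a
  square field. The first two terms are replaced by statistics of \<open>k2\<close> and
  \<open>g2\<close>, the last is estimated through two Dirichlet forms. Different functions are
  allowed since cross moments with \<open>Bop m G\<close> occur besides second moments of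
  \<open>G\<close>.\<close>

lemma excl_gen_product:
  fixes g k g2 k2 :: "int^'d \<Rightarrow> real" and a b :: real
  assumes fin: "finite {z. g z \<noteq> 0}" "finite {z. k z \<noteq> 0}" "finite {z. g2 z \<noteq> 0}" "finite {z. k2 z \<noteq> 0}"
    and M: "\<And>z. \<bar>g z\<bar> \<le> M" "\<And>z. \<bar>k z\<bar> \<le> M'"
  shows "\<bar>excl_gen h (\<lambda>\<eta>. (occupation_sum g \<eta> - a) * (occupation_sum k \<eta> - b)) \<eta> - ((occupation_sum g \<eta> - a) * occupation_sum k2 \<eta> + (occupation_sum k \<eta> - b) * occupation_sum g2 \<eta>)\<bar> \<le>
      \<bar>occupation_sum g \<eta> - a\<bar> * (\<Sum>\<^sub>\<infinity>x. \<bar>jump_gen k x - k2 x\<bar>) + \<bar>occupation_sum k \<eta> - b\<bar> * (\<Sum>\<^sub>\<infinity>x. \<bar>jump_gen g x - g2 x\<bar>)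
      + M * (\<Sum>\<^sub>\<infinity>x. \<bar>jump_gen g x\<bar>) + M' * (\<Sum>\<^sub>\<infinity>x. \<bar>jump_gen k x\<bar>)"
    and "excl_gen h (\<lambda>\<eta>. (occupation_sum g \<eta> - a) * (occupation_sum k \<eta> - b)) \<in> borel_measurable config_space"
proof -
  let ?\<Phi> = "\<lambda>\<eta>. (occupation_sum g \<eta> - a) * (occupation_sum k \<eta> - b)"
  define w where "w \<eta> x y = occ (\<eta> x) * (1 - occ (\<eta> y))" for \<eta> :: "int^'d \<Rightarrow> bool" and x y
  have w1: "\<bar>w \<eta> x y\<bar> \<le> 1" for \<eta> x y by (auto simp: w_def occ_def)
  define t where "t \<eta> = (\<lambda>(x, y). jump_rate h (y - x) * occ (\<eta> x) * (1 - occ (\<eta> y)) * (?\<Phi> (exch \<eta> x y) - ?\<Phi> \<eta>))" for \<eta>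
  define f1 where "f1 \<eta> = (\<lambda>(x, y). p (y - x) * w \<eta> x y * (k y - k x))" for \<eta>
  define f2 where "f2 \<eta> = (\<lambda>(x, y). p (y - x) * w \<eta> x y * (g y - g x))" for \<eta>
  define f3 where "f3 \<eta> = (\<lambda>(x, y). p (y - x) * (w \<eta> x y * (g y - g x)) * (k y - k x))" for \<eta>
  \<comment> \<open>The increment of a product is X dY + Y dX + dX dY; where the exclusion rule
    forbids the jump, the factor \<open>w\<close> makes every term vanish.\<close>
  have t: "t \<eta> q = ((occupation_sum g \<eta> - a) * f1 \<eta> q + (occupation_sum k \<eta> - b) * f2 \<eta> q) + f3 \<eta> q" for \<eta> q
  proof -
    obtain x y where q: "q = (x, y)" by (cases q)
    show ?thesis
    proof (cases "\<eta> x \<and> \<not> \<eta> y")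
      case True
      then have e: "occupation_sum g (exch \<eta> x y) = occupation_sum g \<eta> + g y - g x" "occupation_sum k (exch \<eta> x y) = occupation_sum k \<eta> + k y - k x"
        using occupation_sum_exch fin by blast+
      show ?thesis using True unfolding t_def f1_def f2_def f3_def w_def q by (simp add: e occ_def algebra_simps)
    next
      case False
      then have "occ (\<eta> x) * (1 - occ (\<eta> y)) = 0" by (auto simp: occ_def)
      then show ?thesis unfolding t_def f1_def f2_def f3_def w_def q by auto
    qed
  qed
  have gb: "\<bar>w \<eta> x y * (g y - g x)\<bar> \<le> 2 * M" for \<eta> x y
  proof -
    have "\<bar>g y - g x\<bar> \<le> 2 * M" using M(1)[of x] M(1)[of y] by linarith
    then show ?thesis using mult_mono[OF w1[of \<eta> x y], of "\<bar>g y - g x\<bar>" "2 * M"] by (simp add: abs_mult)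
  qed
  have s1: "f1 \<eta> summable_on UNIV" for \<eta> unfolding f1_def by (rule pair_summable[OF fin(2) w1])
  have s2: "f2 \<eta> summable_on UNIV" for \<eta> unfolding f2_def by (rule pair_summable[OF fin(1) w1])
  have s3: "f3 \<eta> summable_on UNIV" for \<eta> unfolding f3_def by (rule pair_summable[OF fin(2) gb])
  have s12: "(\<lambda>q. (occupation_sum g \<eta> - a) * f1 \<eta> q + (occupation_sum k \<eta> - b) * f2 \<eta> q) summable_on UNIV" for \<eta>
    by (intro summable_on_add summable_on_cmult_right s1 s2)
  have st: "t \<eta> summable_on UNIV" for \<eta>
    unfolding t[abs_def] by (intro summable_on_add s12 s3)
  have gen: "excl_gen h ?\<Phi> \<eta> = infsum (t \<eta>) UNIV" for \<eta> by (simp add: excl_gen_def t_def)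
  have f1v: "infsum (f1 \<eta>) UNIV = (\<Sum>\<^sub>\<infinity>x. occ (\<eta> x) * jump_gen k x)" unfolding f1_def w_def by (rule current_sum[OF fin(2)])
  have f2v: "infsum (f2 \<eta>) UNIV = (\<Sum>\<^sub>\<infinity>x. occ (\<eta> x) * jump_gen g x)" unfolding f2_def w_def by (rule current_sum[OF fin(1)])
  have "infsum (t \<eta>) UNIV = infsum (\<lambda>q. (occupation_sum g \<eta> - a) * f1 \<eta> q + (occupation_sum k \<eta> - b) * f2 \<eta> q) UNIV + infsum (f3 \<eta>) UNIV"
    unfolding t[abs_def] by (rule infsum_add[OF s12 s3])
  also have "infsum (\<lambda>q. (occupation_sum g \<eta> - a) * f1 \<eta> q + (occupation_sum k \<eta> - b) * f2 \<eta> q) UNIV =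
      infsum (\<lambda>q. (occupation_sum g \<eta> - a) * f1 \<eta> q) UNIV + infsum (\<lambda>q. (occupation_sum k \<eta> - b) * f2 \<eta> q) UNIV"
    by (rule infsum_add[OF summable_on_cmult_right[OF s1] summable_on_cmult_right[OF s2]])
  also have "infsum (\<lambda>q. (occupation_sum g \<eta> - a) * f1 \<eta> q) UNIV = (occupation_sum g \<eta> - a) * infsum (f1 \<eta>) UNIV" by (rule infsum_cmult_right) (rule s1)
  also have "infsum (\<lambda>q. (occupation_sum k \<eta> - b) * f2 \<eta> q) UNIV = (occupation_sum k \<eta> - b) * infsum (f2 \<eta>) UNIV" by (rule infsum_cmult_right) (rule s2)
  finally have val: "excl_gen h ?\<Phi> \<eta> = (occupation_sum g \<eta> - a) * (\<Sum>\<^sub>\<infinity>x. occ (\<eta> x) * jump_gen k x) + (occupation_sum k \<eta> - b) * (\<Sum>\<^sub>\<infinity>x. occ (\<eta> x) * jump_gen g x) + infsum (f3 \<eta>) UNIV"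
    by (simp add: gen f1v f2v)
  have f3b: "\<bar>infsum (f3 \<eta>) UNIV\<bar> \<le> M * (\<Sum>\<^sub>\<infinity>x. \<bar>jump_gen g x\<bar>) + M' * (\<Sum>\<^sub>\<infinity>x. \<bar>jump_gen k x\<bar>)"
  proof -
    let ?G = "\<lambda>(x, y). p (y - x) * (g y - g x)^2" and ?K = "\<lambda>(x, y). p (y - x) * (k y - k x)^2"
    note dg = dirichlet_bound[OF fin(1) M(1)] and dk = dirichlet_bound[OF fin(2) M(2)]
    have sGK: "(\<lambda>q. (1/2) * (?G q + ?K q)) summable_on UNIV" by (intro summable_on_cmult_right summable_on_add dg dk)
    have "\<bar>infsum (f3 \<eta>) UNIV\<bar> \<le> infsum (\<lambda>q. (1/2) * (?G q + ?K q)) UNIV"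
    proof (rule abs_infsum_le[OF sGK])
      fix q :: "(int^'d) \<times> (int^'d)"
      obtain x y where q: "q = (x, y)" by (cases q)
      have "\<bar>f3 \<eta> q\<bar> = p (y - x) * (\<bar>w \<eta> x y\<bar> * (\<bar>g y - g x\<bar> * \<bar>k y - k x\<bar>))"
        using jump_rate_nonneg[of "y - x"] by (simp add: f3_def q abs_mult)
      also have "\<dots> \<le> p (y - x) * (1 * ((1/2) * ((g y - g x)^2 + (k y - k x)^2)))"
      proof (rule mult_left_mono[OF mult_mono[OF w1] jump_rate_nonneg])
        have "0 \<le> (\<bar>g y - g x\<bar> - \<bar>k y - k x\<bar>)^2" by simp
        then show "\<bar>g y - g x\<bar> * \<bar>k y - k x\<bar> \<le> (1/2) * ((g y - g x)^2 + (k y - k x)^2)" by (simp add: power2_diff)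
      qed auto
      finally show "\<bar>f3 \<eta> q\<bar> \<le> (1/2) * (?G q + ?K q)" by (simp add: q algebra_simps)
    qed
    also have "\<dots> = (1/2) * infsum (\<lambda>q. ?G q + ?K q) UNIV"
      by (rule infsum_cmult_right) (intro summable_on_add dg dk)
    also have "infsum (\<lambda>q. ?G q + ?K q) UNIV = infsum ?G UNIV + infsum ?K UNIV" by (rule infsum_add[OF dg(1) dk(1)])
    finally have half: "\<bar>infsum (f3 \<eta>) UNIV\<bar> \<le> (1/2) * (infsum ?G UNIV + infsum ?K UNIV)" .
    have "F \<le> C + D" if "F \<le> (1/2) * (A + B)" "A \<le> 2 * C" "B \<le> 2 * D" for F A B C D :: real
      using that by (simp add: field_simps)
    from this[OF half dg(2)[unfolded mult.assoc] dk(2)[unfolded mult.assoc]] show ?thesis .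
  qed
  let ?J = "\<Sum>\<^sub>\<infinity>x. occ (\<eta> x) * jump_gen k x" and ?I = "\<Sum>\<^sub>\<infinity>x. occ (\<eta> x) * jump_gen g x"
  have three: "\<bar>e\<bar> \<le> A + B + C + D" if "e = x + y + z" "\<bar>x\<bar> \<le> A" "\<bar>y\<bar> \<le> B" "\<bar>z\<bar> \<le> C + D" for e x y z A B C D :: real
    using that by linarith
  have e1: "excl_gen h ?\<Phi> \<eta> - ((occupation_sum g \<eta> - a) * occupation_sum k2 \<eta> + (occupation_sum k \<eta> - b) * occupation_sum g2 \<eta>) =
      (occupation_sum g \<eta> - a) * (?J - occupation_sum k2 \<eta>) + (occupation_sum k \<eta> - b) * (?I - occupation_sum g2 \<eta>) + infsum (f3 \<eta>) UNIV"
    unfolding val by (simp add: algebra_simps)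
  have e2: "\<bar>(occupation_sum g \<eta> - a) * (?J - occupation_sum k2 \<eta>)\<bar> \<le> \<bar>occupation_sum g \<eta> - a\<bar> * (\<Sum>\<^sub>\<infinity>x. \<bar>jump_gen k x - k2 x\<bar>)"
    unfolding abs_mult by (intro mult_left_mono current_bound fin) auto
  have e3: "\<bar>(occupation_sum k \<eta> - b) * (?I - occupation_sum g2 \<eta>)\<bar> \<le> \<bar>occupation_sum k \<eta> - b\<bar> * (\<Sum>\<^sub>\<infinity>x. \<bar>jump_gen g x - g2 x\<bar>)"
    unfolding abs_mult by (intro mult_left_mono current_bound fin) auto
  show "\<bar>excl_gen h ?\<Phi> \<eta> - ((occupation_sum g \<eta> - a) * occupation_sum k2 \<eta> + (occupation_sum k \<eta> - b) * occupation_sum g2 \<eta>)\<bar> \<le>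
      \<bar>occupation_sum g \<eta> - a\<bar> * (\<Sum>\<^sub>\<infinity>x. \<bar>jump_gen k x - k2 x\<bar>) + \<bar>occupation_sum k \<eta> - b\<bar> * (\<Sum>\<^sub>\<infinity>x. \<bar>jump_gen g x - g2 x\<bar>)
      + M * (\<Sum>\<^sub>\<infinity>x. \<bar>jump_gen g x\<bar>) + M' * (\<Sum>\<^sub>\<infinity>x. \<bar>jump_gen k x\<bar>)"
    by (rule three[OF e1 e2 e3 f3b])
  \<comment> \<open>Measurability in the configuration follows by reading the countable double sum
    as an integral over counting measure.\<close>
  have "(\<lambda>q. case q of (\<eta>, r) \<Rightarrow> t \<eta> r) \<in> borel_measurable (config_space \<Otimes>\<^sub>M count_space UNIV)"
  proof -
    have "(\<lambda>(r, \<eta>). t \<eta> r) \<in> borel_measurable (count_space UNIV \<Otimes>\<^sub>M config_space)"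
    proof (rule measurable_pair_measure_countable1)
      fix r :: "(int^'d) \<times> (int^'d)"
      obtain x y where r: "r = (x, y)" by (cases r)
      have "(\<lambda>\<eta>. t \<eta> (x, y)) \<in> borel_measurable config_space"
        unfolding t_def prod.case
        by (intro borel_measurable_times borel_measurable_diff borel_measurable_const occ_measurable occupation_sum_measurable occupation_sum_exch_measurable)
      then show "(\<lambda>\<eta>. case (r, \<eta>) of (r, \<eta>) \<Rightarrow> t \<eta> r) \<in> borel_measurable config_space" by (simp add: r)
    qed simp
    then show ?thesis by (subst measurable_pair_swap_iff) (simp add: case_prod_beta')
  qed
  then have "(\<lambda>\<eta>. \<integral>r. t \<eta> r \<partial>count_space UNIV) \<in> borel_measurable config_space"
    by (intro sigma_finite_measure.borel_measurable_lebesgue_integral sigma_finite_measure_count_space_countable) auto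
  then show "excl_gen h ?\<Phi> \<in> borel_measurable config_space"
    unfolding gen[abs_def] infsum_eq_integral[OF st] .
qed

end

section \<open>Empirical averages as occupation sums\<close>

lemma occupation_sum_linear:
  assumes "finite {z. f z \<noteq> 0}" "finite {z. g z \<noteq> 0}"
  shows "occupation_sum (\<lambda>z. f z + c * g z) \<eta> = occupation_sum f \<eta> + c * occupation_sum g \<eta>"
proof -
  define A where "A = {z. f z \<noteq> 0} \<union> {z. g z \<noteq> 0}"
  have A: "finite A" "{z. f z \<noteq> 0} \<subseteq> A" "{z. g z \<noteq> 0} \<subseteq> A" "{z. f z + c * g z \<noteq> 0} \<subseteq> A"
    using assms by (auto simp: A_def)
  show ?thesis
    unfolding occupation_sum_superset[OF A(1,2)] occupation_sum_superset[OF A(1,3)] occupation_sum_superset[OF A(1,4)]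
    by (simp add: algebra_simps sum.distrib sum_distrib_left)
qed

lemma occupation_sum_cmult: "finite {z. g z \<noteq> 0} \<Longrightarrow> occupation_sum (\<lambda>z. c * g z) \<eta> = c * occupation_sum g \<eta>"
  using occupation_sum_linear[of "\<lambda>_. 0" g c \<eta>] by (simp add: occupation_sum_def)

definition lattice_sample :: "nat \<Rightarrow> (real^'d \<Rightarrow> real) \<Rightarrow> int^'d \<Rightarrow> real" where
  "lattice_sample n G z = (1 / real n ^ CARD('d)) * G (lattice_point n z)"

lemma empirical_eq_occupation_sum: "n > 0 \<Longrightarrow> empirical n G = occupation_sum (lattice_sample n G)"
proof
  fix \<eta> :: "int^'a \<Rightarrow> bool" assume "n > 0"
  then have "{z. lattice_sample n G z \<noteq> 0} = {z. G ((1 / real n) *\<^sub>R site_to_real z) \<noteq> 0}"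
    by (auto simp: lattice_sample_def lattice_point_def)
  then show "empirical n G \<eta> = occupation_sum (lattice_sample n G) \<eta>"
    by (simp add: empirical_def occupation_sum_def sum_distrib_left lattice_sample_def lattice_point_def mult_ac)
qed

lemma lattice_sample_finite:
  assumes "n > 0" "has_compact_support G"
  shows "finite {z. lattice_sample n G z \<noteq> 0}"
proof -
  obtain R where R: "\<And>x. norm x > R \<Longrightarrow> G x = 0" using assms(2) by (auto simp: has_compact_support_iff)
  have "{z. lattice_sample n G z \<noteq> 0} \<subseteq> {z. norm (lattice_point n z) \<le> R}" using R by (force simp: lattice_sample_def not_less[symmetric])
  then show ?thesis using finite_lattice_ball[OF assms(1)] finite_subset by blast
qed

lemma lattice_sample_sum:
  fixes \<phi> :: "real^'d \<Rightarrow> real"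
  assumes n: "n > 0" and i: "integrable lborel (\<lambda>x. \<phi> (lattice_round n x))"
  shows "(\<lambda>z. \<bar>lattice_sample n \<phi> z\<bar>) summable_on UNIV" "(\<Sum>\<^sub>\<infinity>z. \<bar>lattice_sample n \<phi> z\<bar>) = L1 (\<lambda>x. \<phi> (lattice_round n x))"
proof -
  have "integrable lborel (\<lambda>x. \<bar>\<phi> (lattice_point n (cell_index n x))\<bar>)" using i by (simp add: lattice_round_def)
  then have c: "integrable (count_space UNIV) (\<lambda>z. \<bar>\<phi> (lattice_point n z)\<bar>)"
    using lattice_integrable_iff[OF n, of "\<lambda>z. \<bar>\<phi> (lattice_point n z)\<bar>"] by simp
  have e: "\<bar>lattice_sample n \<phi> z\<bar> = (1 / real n ^ CARD('d)) * \<bar>\<phi> (lattice_point n z)\<bar>" for z by (simp add: lattice_sample_def abs_mult)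
  show s: "(\<lambda>z. \<bar>lattice_sample n \<phi> z\<bar>) summable_on UNIV"
    unfolding summable_on_iff_integrable e using c by (rule integrable_mult_right)
  have "(\<Sum>\<^sub>\<infinity>z. \<bar>lattice_sample n \<phi> z\<bar>) = (1 / real n ^ CARD('d)) * (\<integral>z. \<bar>\<phi> (lattice_point n z)\<bar> \<partial>count_space UNIV)"
    by (subst infsum_eq_integral[OF s]) (simp only: e integral_mult_right_zero)
  also have "\<dots> = L1 (\<lambda>x. \<phi> (lattice_round n x))"
    using lattice_integral[OF n, of "\<lambda>z. \<bar>\<phi> (lattice_point n z)\<bar>"] by (simp add: L1_def lattice_round_def)
  finally show "(\<Sum>\<^sub>\<infinity>z. \<bar>lattice_sample n \<phi> z\<bar>) = L1 (\<lambda>x. \<phi> (lattice_round n x))" .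
qed

context levy_kernel
begin

definition lattice_norm :: "nat \<Rightarrow> (real^'d \<Rightarrow> real) \<Rightarrow> real" where
  "lattice_norm n G = L1 (\<lambda>x. G (lattice_round n x))"

text \<open>Through \<open>lattice_integral\<close> this is an l1 distance over the sites, with
  weight n^(-d) each; with \<open>K\<close> zero it is the norm of \<open>Aop n G\<close>.\<close>

definition lattice_defect :: "nat \<Rightarrow> (real^'d \<Rightarrow> real) \<Rightarrow> (real^'d \<Rightarrow> real) \<Rightarrow> real" where
  "lattice_defect n G K = L1 (\<lambda>x. Aop n G (lattice_round n x) - K (lattice_round n x))"

lemma lattice_norm_defect_nonneg: "lattice_norm n G \<ge> 0" "lattice_defect n G K \<ge> 0"
  by (simp_all add: lattice_norm_def lattice_defect_def L1_nonneg)

lemma empirical_bound: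
  assumes n: "n > 0" and G: "continuous_on UNIV G" "has_compact_support G"
  shows "\<bar>empirical n G \<eta>\<bar> \<le> lattice_norm n G"
proof -
  note i = riemann_sum_converges(1)[OF G n]
  have "\<bar>occupation_sum (lattice_sample n G) \<eta>\<bar> = \<bar>\<Sum>\<^sub>\<infinity>z. occ (\<eta> z) * lattice_sample n G z\<bar>"
    using infsumI[OF occupation_sum_infsum[OF lattice_sample_finite[OF n G(2)], of \<eta>]] by simp
  also have "\<dots> \<le> (\<Sum>\<^sub>\<infinity>z. \<bar>lattice_sample n G z\<bar>)"
    by (rule abs_infsum_le[OF lattice_sample_sum(1)[OF n i]]) (auto simp: occ_def)
  finally show ?thesis by (simp add: empirical_eq_occupation_sum[OF n] lattice_sample_sum(2)[OF n i] lattice_norm_def)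
qed

text \<open>Two factors n^(-d) occur, one from the rates by \<open>h0_scale\<close> and one from the
  sampling. Averaging over \<open>y\<close> and its reflection matches first differences with the
  second difference in \<open>Aop\<close>.\<close>

lemma jump_gen_samp:
  assumes n: "n > 0" and G: "test_fun G"
  shows "real n powr \<alpha> * jump_gen (lattice_sample n G) z = lattice_sample n (Aop n G) z"
proof -
  let ?d = "real n ^ CARD('d)" and ?w = "lattice_point n z"
  define f where "f y = h0 (lattice_point n y) * (G (?w + lattice_point n y) - G ?w)" for y
  have pe: "real n powr \<alpha> * p y = (1 / ?d) * h0 (lattice_point n y)" for y
    using n by (simp add: h0_scale powr_add powr_realpow)
  obtain M where M: "M \<ge> 0" "\<And>x. \<bar>G x\<bar> \<le> M"
    using compact_support_bounded[OF test_fun_continuous[OF G]] G by (auto simp: test_fun_def)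
  have hs: "(\<lambda>y. h0 (lattice_point n y)) summable_on UNIV"
    unfolding h0_scale[OF n] by (rule summable_on_cmult_right[OF jump_rate_summable])
  have fs: "f summable_on UNIV"
  proof (rule summable_on_real_bound[OF summable_on_cmult_right[OF hs, of "2 * M"]])
    fix y
    have "\<bar>G (?w + lattice_point n y) - G ?w\<bar> \<le> 2 * M" using M(2)[of "?w + lattice_point n y"] M(2)[of ?w] by linarith
    then have "h0 (lattice_point n y) * \<bar>G (?w + lattice_point n y) - G ?w\<bar> \<le> h0 (lattice_point n y) * (2 * M)"
      by (rule mult_left_mono) (rule h0_nonneg)
    then show "\<bar>f y\<bar> \<le> 2 * M * h0 (lattice_point n y)"
      using h0_nonneg[of "lattice_point n y"] by (simp add: f_def abs_mult mult.commute)
  qed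
  have bm: "bij_betw uminus UNIV (UNIV :: (int^'d) set)" by (rule bij_betwI[where g = uminus]) auto
  have fm: "(\<lambda>y. f (- y)) summable_on UNIV" using fs by (subst summable_on_reindex_bij_betw[OF bm])
  have fe: "infsum (\<lambda>y. f (- y)) UNIV = infsum f UNIV" by (rule infsum_reindex_bij_betw[OF bm])
  have d2: "h0 (lattice_point n y) * second_diff G ?w (lattice_point n y) = f y + f (- y)" for y
    by (simp add: f_def second_diff_def h0_even algebra_simps)
  have "(\<integral>y. h0 (lattice_round n y) * second_diff G ?w (lattice_round n y) \<partial>lborel)
      = (1 / ?d) * (\<integral>y. h0 (lattice_point n y) * second_diff G ?w (lattice_point n y) \<partial>count_space UNIV)"
    unfolding lattice_round_def by (rule lattice_integral[OF n])
  also have "(\<integral>y. h0 (lattice_point n y) * second_diff G ?w (lattice_point n y) \<partial>count_space UNIV) = 2 * infsum f UNIV"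
    unfolding d2 infsum_eq_integral[OF summable_on_add[OF fs fm], symmetric] infsum_add[OF fs fm] fe by simp
  finally have A: "Aop n G ?w = (1 / ?d) * infsum f UNIV" by (simp add: Aop_def)
  have "real n powr \<alpha> * jump_gen (lattice_sample n G) z = (\<Sum>\<^sub>\<infinity>y. real n powr \<alpha> * (p y * (lattice_sample n G (z + y) - lattice_sample n G z)))"
    unfolding jump_gen_def using n by (simp add: infsum_cmult_right')
  also have "\<dots> = (\<Sum>\<^sub>\<infinity>y. (1 / ?d * (1 / ?d)) * f y)"
  proof (rule infsum_cong)
    fix y
    have "real n powr \<alpha> * (p y * (lattice_sample n G (z + y) - lattice_sample n G z)) = (real n powr \<alpha> * p y) * (1 / ?d * (G (?w + lattice_point n y) - G ?w))"
      by (simp add: lattice_sample_def right_diff_distrib)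
    then show "real n powr \<alpha> * (p y * (lattice_sample n G (z + y) - lattice_sample n G z)) = (1 / ?d * (1 / ?d)) * f y"
      unfolding pe by (simp add: f_def)
  qed
  also have "\<dots> = (1 / ?d * (1 / ?d)) * infsum f UNIV" by (rule infsum_cmult_right) (rule fs)
  finally show ?thesis by (simp add: lattice_sample_def A)
qed

lemma scaled_jump_gen_sum:
  assumes n: "n > 0" and G: "test_fun G" and K: "continuous_on UNIV K" "has_compact_support K"
  shows "real n powr \<alpha> * (\<Sum>\<^sub>\<infinity>x. \<bar>jump_gen (lattice_sample n G) x - (1 / real n powr \<alpha>) * lattice_sample n K x\<bar>) = lattice_defect n G K"
proof -
  let ?c = "real n powr \<alpha>"
  have c: "?c > 0" using n by simp
  have i: "integrable lborel (\<lambda>x. Aop n G (lattice_round n x) - K (lattice_round n x))"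
    using Aop_converges(1)[OF G n] riemann_sum_converges(1)[OF K n] by simp
  have "?c * \<bar>jump_gen (lattice_sample n G) x - (1 / ?c) * lattice_sample n K x\<bar> = \<bar>lattice_sample n (\<lambda>x. Aop n G x - K x) x\<bar>" for x
  proof -
    have "?c * \<bar>jump_gen (lattice_sample n G) x - (1 / ?c) * lattice_sample n K x\<bar> = \<bar>?c * (jump_gen (lattice_sample n G) x - (1 / ?c) * lattice_sample n K x)\<bar>"
      using c by (simp add: abs_mult)
    also have "?c * (jump_gen (lattice_sample n G) x - (1 / ?c) * lattice_sample n K x) = ?c * jump_gen (lattice_sample n G) x - lattice_sample n K x"
      using c by (simp add: right_diff_distrib)
    also have "\<dots> = lattice_sample n (\<lambda>x. Aop n G x - K x) x" unfolding jump_gen_samp[OF n G] by (simp add: lattice_sample_def right_diff_distrib)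
    finally show ?thesis .
  qed
  then have "?c * (\<Sum>\<^sub>\<infinity>x. \<bar>jump_gen (lattice_sample n G) x - (1 / ?c) * lattice_sample n K x\<bar>) = (\<Sum>\<^sub>\<infinity>x. \<bar>lattice_sample n (\<lambda>x. Aop n G x - K x) x\<bar>)"
    using c by (simp add: infsum_cmult_right'[symmetric])
  also have "\<dots> = lattice_defect n G K" unfolding lattice_defect_def by (rule lattice_sample_sum(2)[OF n i])
  finally show ?thesis .
qed

lemma test_fun_compact: "test_fun G \<Longrightarrow> continuous_on UNIV G \<and> has_compact_support G"
  by (simp add: test_fun_def test_fun_continuous)

lemma zero_compact: "continuous_on UNIV (\<lambda>_::real^'d. 0::real)" "has_compact_support (\<lambda>_::real^'d. 0::real)"
  by (auto simp: has_compact_support_iff)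

text \<open>\<open>K1\<close> and \<open>K2\<close> are compactly supported substitutes for the
  rescaled generator on \<open>G1\<close> and \<open>G2\<close>. The error consists of their two
  defects, weighted by bounds on the centred averages, and of the square field with its factor
  n^(-d).\<close>

lemma scaled_generator:
  fixes a b :: real
  assumes n: "n > 0" and G: "test_fun G1" "test_fun G2"
    and K1: "continuous_on UNIV K1" "has_compact_support K1" and K2: "continuous_on UNIV K2" "has_compact_support K2"
    and M: "\<And>x. \<bar>G1 x\<bar> \<le> M1" "\<And>x. \<bar>G2 x\<bar> \<le> M2"
  shows "\<bar>real n powr \<alpha> * excl_gen h (\<lambda>\<eta>. (empirical n G1 \<eta> - a) * (empirical n G2 \<eta> - b)) \<eta>
      - ((empirical n G1 \<eta> - a) * empirical n K2 \<eta> + (empirical n G2 \<eta> - b) * empirical n K1 \<eta>)\<bar> \<le>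
     (lattice_norm n G1 + \<bar>a\<bar>) * lattice_defect n G2 K2 + (lattice_norm n G2 + \<bar>b\<bar>) * lattice_defect n G1 K1
       + (1 / real n ^ CARD('d)) * (M1 * lattice_defect n G1 (\<lambda>_. 0) + M2 * lattice_defect n G2 (\<lambda>_. 0))"
    and "excl_gen h (\<lambda>\<eta>. (empirical n G1 \<eta> - a) * (empirical n G2 \<eta> - b)) \<in> borel_measurable config_space"
proof -
  let ?c = "real n powr \<alpha>" and ?d = "real n ^ CARD('d)"
  have c: "?c > 0" using n by simp
  note tc = test_fun_compact[OF G(1)] test_fun_compact[OF G(2)]
  have f: "finite {z. lattice_sample n G1 z \<noteq> 0}" "finite {z. lattice_sample n G2 z \<noteq> 0}" "finite {z. lattice_sample n K1 z \<noteq> 0}" "finite {z. lattice_sample n K2 z \<noteq> 0}"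
    using lattice_sample_finite[OF n] tc K1 K2 by auto
  have f': "finite {z. (1 / ?c) * lattice_sample n K1 z \<noteq> 0}" "finite {z. (1 / ?c) * lattice_sample n K2 z \<noteq> 0}"
    using f c by auto
  have sM: "\<bar>lattice_sample n G1 z\<bar> \<le> 1 / ?d * M1" "\<bar>lattice_sample n G2 z\<bar> \<le> 1 / ?d * M2" for z
    using M by (auto simp: lattice_sample_def abs_mult intro!: divide_right_mono)
  note est = excl_gen_product[OF f(1,2) f' sM, of a b]
  show "excl_gen h (\<lambda>\<eta>. (empirical n G1 \<eta> - a) * (empirical n G2 \<eta> - b)) \<in> borel_measurable config_space"
    unfolding empirical_eq_occupation_sum[OF n] by (rule est(2))
  let ?L = "excl_gen h (\<lambda>\<eta>. (occupation_sum (lattice_sample n G1) \<eta> - a) * (occupation_sum (lattice_sample n G2) \<eta> - b)) \<eta>"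
  let ?X = "occupation_sum (lattice_sample n G1) \<eta> - a" and ?Y = "occupation_sum (lattice_sample n G2) \<eta> - b"
  let ?s1 = "\<Sum>\<^sub>\<infinity>x. \<bar>jump_gen (lattice_sample n G2) x - (1 / ?c) * lattice_sample n K2 x\<bar>" and ?s2 = "\<Sum>\<^sub>\<infinity>x. \<bar>jump_gen (lattice_sample n G1) x - (1 / ?c) * lattice_sample n K1 x\<bar>"
  let ?t1 = "\<Sum>\<^sub>\<infinity>x. \<bar>jump_gen (lattice_sample n G1) x\<bar>" and ?t2 = "\<Sum>\<^sub>\<infinity>x. \<bar>jump_gen (lattice_sample n G2) x\<bar>"
  have lk: "occupation_sum (\<lambda>z. (1 / ?c) * lattice_sample n K1 z) \<eta> = (1 / ?c) * occupation_sum (lattice_sample n K1) \<eta>" "occupation_sum (\<lambda>z. (1 / ?c) * lattice_sample n K2 z) \<eta> = (1 / ?c) * occupation_sum (lattice_sample n K2) \<eta>"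
    by (rule occupation_sum_cmult[OF f(3)], rule occupation_sum_cmult[OF f(4)])
  have "?c * \<bar>?L - (?X * ((1 / ?c) * occupation_sum (lattice_sample n K2) \<eta>) + ?Y * ((1 / ?c) * occupation_sum (lattice_sample n K1) \<eta>))\<bar> \<le>
      ?c * (\<bar>?X\<bar> * ?s1 + \<bar>?Y\<bar> * ?s2 + 1 / ?d * M1 * ?t1 + 1 / ?d * M2 * ?t2)"
    using est(1)[of \<eta>] c unfolding lk by (intro mult_left_mono) auto
  also have "?c * (\<bar>?X\<bar> * ?s1 + \<bar>?Y\<bar> * ?s2 + 1 / ?d * M1 * ?t1 + 1 / ?d * M2 * ?t2) =
      \<bar>?X\<bar> * (?c * ?s1) + \<bar>?Y\<bar> * (?c * ?s2) + 1 / ?d * (M1 * (?c * ?t1) + M2 * (?c * ?t2))"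
    by (simp only: distrib_left mult_ac)
  also have "?c * ?s1 = lattice_defect n G2 K2" by (rule scaled_jump_gen_sum[OF n G(2) K2])
  also have "?c * ?s2 = lattice_defect n G1 K1" by (rule scaled_jump_gen_sum[OF n G(1) K1])
  also have "?c * ?t1 = lattice_defect n G1 (\<lambda>_. 0)" using scaled_jump_gen_sum[OF n G(1) zero_compact] by (simp add: lattice_sample_def)
  also have "?c * ?t2 = lattice_defect n G2 (\<lambda>_. 0)" using scaled_jump_gen_sum[OF n G(2) zero_compact] by (simp add: lattice_sample_def)
  also have "?c * \<bar>?L - (?X * ((1 / ?c) * occupation_sum (lattice_sample n K2) \<eta>) + ?Y * ((1 / ?c) * occupation_sum (lattice_sample n K1) \<eta>))\<bar> =
     \<bar>?c * ?L - (?X * occupation_sum (lattice_sample n K2) \<eta> + ?Y * occupation_sum (lattice_sample n K1) \<eta>)\<bar>"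
  proof -
    have "?c * \<bar>?L - (?X * ((1 / ?c) * occupation_sum (lattice_sample n K2) \<eta>) + ?Y * ((1 / ?c) * occupation_sum (lattice_sample n K1) \<eta>))\<bar> =
      \<bar>?c * (?L - (?X * ((1 / ?c) * occupation_sum (lattice_sample n K2) \<eta>) + ?Y * ((1 / ?c) * occupation_sum (lattice_sample n K1) \<eta>)))\<bar>" using c by (simp add: abs_mult)
    also have "?c * (?L - (?X * ((1 / ?c) * occupation_sum (lattice_sample n K2) \<eta>) + ?Y * ((1 / ?c) * occupation_sum (lattice_sample n K1) \<eta>))) =
        ?c * ?L - (?X * occupation_sum (lattice_sample n K2) \<eta> + ?Y * occupation_sum (lattice_sample n K1) \<eta>)" using c by (simp add: field_simps)
    finally show ?thesis .
  qed
  finally have 1: "\<bar>?c * ?L - (?X * occupation_sum (lattice_sample n K2) \<eta> + ?Y * occupation_sum (lattice_sample n K1) \<eta>)\<bar> \<le>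
    \<bar>?X\<bar> * lattice_defect n G2 K2 + \<bar>?Y\<bar> * lattice_defect n G1 K1 + 1 / ?d * (M1 * lattice_defect n G1 (\<lambda>_. 0) + M2 * lattice_defect n G2 (\<lambda>_. 0))" .
  have "\<bar>?X\<bar> \<le> lattice_norm n G1 + \<bar>a\<bar>" "\<bar>?Y\<bar> \<le> lattice_norm n G2 + \<bar>b\<bar>"
    using empirical_bound[OF n, of G1 \<eta>] empirical_bound[OF n, of G2 \<eta>] tc unfolding empirical_eq_occupation_sum[OF n] by auto
  then have "\<bar>?X\<bar> * lattice_defect n G2 K2 \<le> (lattice_norm n G1 + \<bar>a\<bar>) * lattice_defect n G2 K2" "\<bar>?Y\<bar> * lattice_defect n G1 K1 \<le> (lattice_norm n G2 + \<bar>b\<bar>) * lattice_defect n G1 K1"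
    using lattice_norm_defect_nonneg by (auto intro!: mult_right_mono)
  then show "\<bar>?c * excl_gen h (\<lambda>\<eta>. (empirical n G1 \<eta> - a) * (empirical n G2 \<eta> - b)) \<eta>
      - ((empirical n G1 \<eta> - a) * empirical n K2 \<eta> + (empirical n G2 \<eta> - b) * empirical n K1 \<eta>)\<bar> \<le>
     (lattice_norm n G1 + \<bar>a\<bar>) * lattice_defect n G2 K2 + (lattice_norm n G2 + \<bar>b\<bar>) * lattice_defect n G1 K1
       + (1 / ?d) * (M1 * lattice_defect n G1 (\<lambda>_. 0) + M2 * lattice_defect n G2 (\<lambda>_. 0))"
    using 1 unfolding empirical_eq_occupation_sum[OF n] by linarith
qed

end

section \<open>Second moments along the process\<close>

locale excl_process = levy_kernel h \<alpha> for h :: "real^'d \<Rightarrow> real" and \<alpha> +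
  fixes n :: nat and \<mu> :: "(int^'d \<Rightarrow> bool) measure" and \<nu> :: "real \<Rightarrow> (int^'d \<Rightarrow> bool) measure"
  assumes n: "n > 0" and law: "is_excl_law h (real n powr \<alpha>) \<mu> \<nu>"
begin

abbreviation E :: "real \<Rightarrow> ((int^'d \<Rightarrow> bool) \<Rightarrow> real) \<Rightarrow> real" where
  "E s f \<equiv> integral\<^sup>L (\<nu> s) f"

lemma nu_prob: "s \<ge> 0 \<Longrightarrow> prob_space (\<nu> s)" and nu_sets: "s \<ge> 0 \<Longrightarrow> sets (\<nu> s) = sets config_space"
  using law by (auto simp: is_excl_law_def)

lemma nu_integrable:
  fixes f :: "(int^'d \<Rightarrow> bool) \<Rightarrow> real" and C :: real
  assumes "s \<ge> 0" "f \<in> borel_measurable config_space" "\<And>\<eta>. \<bar>f \<eta>\<bar> \<le> C"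
  shows "integrable (\<nu> s) f"
proof -
  interpret prob_space "\<nu> s" by (rule nu_prob[OF assms(1)])
  have "f \<in> borel_measurable (\<nu> s)" using assms(2) measurable_cong_sets[OF nu_sets[OF assms(1)] refl] by blast
  then show ?thesis by (rule integrable_const_bound[where B = C, rotated]) (use assms(3) in auto)
qed

lemma nu_bound:
  fixes f :: "(int^'d \<Rightarrow> bool) \<Rightarrow> real" and C :: real
  assumes "s \<ge> 0" "f \<in> borel_measurable config_space" "\<And>\<eta>. \<bar>f \<eta>\<bar> \<le> C"
  shows "\<bar>E s f\<bar> \<le> C"
proof -
  interpret prob_space "\<nu> s" by (rule nu_prob[OF assms(1)])
  have "E s (\<lambda>\<eta>. \<bar>f \<eta>\<bar>) \<le> E s (\<lambda>_. C)"
    using nu_integrable[OF assms] assms(3) by (intro integral_mono) auto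
  moreover have "\<bar>E s f\<bar> \<le> E s (\<lambda>\<eta>. \<bar>f \<eta>\<bar>)" using integral_norm_bound[of "\<nu> s" f] by simp
  moreover have "E s (\<lambda>_. C) = C" by (simp add: prob_space)
  ultimately show ?thesis by linarith
qed

lemma emp_measurable: "empirical n G \<in> borel_measurable config_space"
  unfolding empirical_eq_occupation_sum[OF n] by (rule occupation_sum_measurable)

lemma product_measurable: "(\<lambda>\<eta>. (empirical n G1 \<eta> - a) * (empirical n G2 \<eta> - b)) \<in> borel_measurable config_space"
  by (intro borel_measurable_times borel_measurable_diff emp_measurable) auto

lemma product_bound:
  assumes "test_fun G1" "test_fun G2"
  shows "\<bar>(empirical n G1 \<eta> - a) * (empirical n G2 \<eta> - b)\<bar> \<le> (lattice_norm n G1 + \<bar>a\<bar>) * (lattice_norm n G2 + \<bar>b\<bar>)"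
  unfolding abs_mult
  using empirical_bound[OF n, of G1 \<eta>] empirical_bound[OF n, of G2 \<eta>] test_fun_compact[OF assms(1)] test_fun_compact[OF assms(2)]
  by (intro mult_mono) auto

text \<open>Hiding the derivative behind an existential keeps the generator out of the later
  estimates; what survives is its distance to an expectation of empirical averages.\<close>

lemma product_derivative:
  fixes a b :: real
  assumes G: "test_fun G1" "test_fun G2" "test_fun K1" "test_fun K2"
    and M: "\<And>x. \<bar>G1 x\<bar> \<le> M1" "\<And>x. \<bar>G2 x\<bar> \<le> M2" and s: "s \<ge> 0"
  shows "\<exists>D. ((\<lambda>s. E s (\<lambda>\<eta>. (empirical n G1 \<eta> - a) * (empirical n G2 \<eta> - b))) has_real_derivative D) (at s within {0..}) \<and>
    \<bar>D - E s (\<lambda>\<eta>. (empirical n G1 \<eta> - a) * empirical n K2 \<eta> + (empirical n G2 \<eta> - b) * empirical n K1 \<eta>)\<bar> \<le>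
     (lattice_norm n G1 + \<bar>a\<bar>) * lattice_defect n G2 K2 + (lattice_norm n G2 + \<bar>b\<bar>) * lattice_defect n G1 K1
       + (1 / real n ^ CARD('d)) * (M1 * lattice_defect n G1 (\<lambda>_. 0) + M2 * lattice_defect n G2 (\<lambda>_. 0))"
    (is "\<exists>D. ?der D \<and> \<bar>D - E s ?R\<bar> \<le> ?B")
proof -
  let ?\<Phi> = "\<lambda>\<eta>. (empirical n G1 \<eta> - a) * (empirical n G2 \<eta> - b)"
  note tc = test_fun_compact
  have fin: "finite {z. lattice_sample n G1 z \<noteq> 0}" "finite {z. lattice_sample n G2 z \<noteq> 0}" using lattice_sample_finite[OF n] tc G by auto
  have cyl: "cylinder_fun ?\<Phi>"
    unfolding empirical_eq_occupation_sum[OF n] by (rule occupation_sum_cylinder[OF fin, where \<Psi> = "\<lambda>u v. (u - a) * (v - b)"])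
  have der: "?der (real n powr \<alpha> * E s (excl_gen h ?\<Phi>))"
    using law cyl s unfolding is_excl_law_def by blast
  note sg = scaled_generator[OF n G(1,2) _ _ _ _ M, of K1 K2 a b]
  have gm: "excl_gen h ?\<Phi> \<in> borel_measurable config_space" using sg(2) tc[OF G(3)] tc[OF G(4)] by auto
  have gb: "\<bar>real n powr \<alpha> * excl_gen h ?\<Phi> \<eta> - ?R \<eta>\<bar> \<le> ?B" for \<eta> using sg(1) tc[OF G(3)] tc[OF G(4)] by auto
  have Rm: "?R \<in> borel_measurable config_space"
    by (intro borel_measurable_add borel_measurable_times borel_measurable_diff emp_measurable) auto
  have Rb: "\<bar>?R \<eta>\<bar> \<le> (lattice_norm n G1 + \<bar>a\<bar>) * (lattice_norm n K2 + \<bar>0\<bar>) + (lattice_norm n G2 + \<bar>b\<bar>) * (lattice_norm n K1 + \<bar>0\<bar>)" for \<eta>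
    using product_bound[OF G(1,4), of \<eta> a 0] product_bound[OF G(2,3), of \<eta> b 0] by simp
  have dm: "(\<lambda>\<eta>. real n powr \<alpha> * excl_gen h ?\<Phi> \<eta> - ?R \<eta>) \<in> borel_measurable config_space"
    by (intro borel_measurable_diff borel_measurable_times gm Rm) auto
  have Ri: "integrable (\<nu> s) ?R" by (rule nu_integrable[OF s Rm Rb])
  have di: "integrable (\<nu> s) (\<lambda>\<eta>. real n powr \<alpha> * excl_gen h ?\<Phi> \<eta> - ?R \<eta>)" by (rule nu_integrable[OF s dm gb])
  have gi: "integrable (\<nu> s) (\<lambda>\<eta>. real n powr \<alpha> * excl_gen h ?\<Phi> \<eta>)"
    using Bochner_Integration.integrable_add[OF di Ri] by simp
  have "real n powr \<alpha> * E s (excl_gen h ?\<Phi>) - E s ?R = E s (\<lambda>\<eta>. real n powr \<alpha> * excl_gen h ?\<Phi> \<eta> - ?R \<eta>)"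
    using Bochner_Integration.integral_diff[OF gi Ri] by simp
  then have "\<bar>real n powr \<alpha> * E s (excl_gen h ?\<Phi>) - E s ?R\<bar> \<le> ?B" using nu_bound[OF s dm gb] by simp
  then show ?thesis using der by blast
qed

lemma derivative_upper_bound:
  fixes f :: "real \<Rightarrow> real"
  assumes "0 \<le> s" "0 \<le> \<delta>" "\<And>r. r \<in> {s..s+\<delta>} \<Longrightarrow> \<exists>D. (f has_real_derivative D) (at r within {0..}) \<and> D \<le> C"
  shows "f (s + \<delta>) - f s \<le> \<delta> * C"
proof (cases "\<delta> = 0")
  case False
  then have lt: "s < s + \<delta>" using assms by simp
  obtain D where D: "\<And>r. r \<in> {s..s+\<delta>} \<Longrightarrow> (f has_real_derivative D r) (at r within {0..}) \<and> D r \<le> C"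
    using assms(3) by metis
  have "(f has_derivative (\<lambda>v. D r * v)) (at r within {s..s+\<delta>})" if "s \<le> r" "r \<le> s + \<delta>" for r
    using D[of r] that assms(1) has_field_derivative_subset[of f "D r" r "{0..}" "{s..s+\<delta>}"] by (auto simp: has_field_derivative_def)
  from mvt_simple[OF lt this] obtain r where r: "r \<in> {s<..<s+\<delta>}" "f (s + \<delta>) - f s = D r * ((s + \<delta>) - s)" by auto
  have "D r * \<delta> \<le> C * \<delta>" using D[of r] r assms(2) by (intro mult_right_mono) auto
  then show ?thesis using r by (simp add: mult.commute)
qed simp

text \<open>
  One Euler step backwards in time adds the nonnegative term \<open>\<delta>\<^sup>2 * (empirical n (Bop m G))\<^sup>2\<close>
  to the second moment, so only an upper bound survives, but this is all that is needed.
\<close>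

lemma second_moment_estimate:
  fixes a :: real
  assumes F: "test_fun F" and t: "0 \<le> t" and N: "N > 0" and \<delta>: "\<delta> = t / real N"
    and M: "\<And>j x. \<bar>(Sop m \<delta> ^^ j) F x\<bar> \<le> M" and M': "\<And>j x. \<bar>Bop m ((Sop m \<delta> ^^ j) F) x\<bar> \<le> M'"
  defines "G j \<equiv> (Sop m \<delta> ^^ j) F"
  shows "E t (\<lambda>\<eta>. (empirical n F \<eta> - a)^2) \<le> E 0 (\<lambda>\<eta>. (empirical n (G N) \<eta> - a)^2) + (\<Sum>j<N. \<delta> *
     (2 * (lattice_norm n (G j) + \<bar>a\<bar>) * lattice_defect n (G j) (Bop m (G j)) + (1 / real n ^ CARD('d)) * (2 * M * lattice_defect n (G j) (\<lambda>_. 0))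
      + \<delta> * (2 * ((lattice_norm n (G j) + \<bar>a\<bar>) * lattice_defect n (Bop m (G j)) (\<lambda>_. 0) + lattice_norm n (Bop m (G j)) * lattice_defect n (G j) (\<lambda>_. 0)
          + (1 / real n ^ CARD('d)) * (M * lattice_defect n (G j) (\<lambda>_. 0) + M' * lattice_defect n (Bop m (G j)) (\<lambda>_. 0))))))"
proof -
  \<comment> \<open>\<open>b j\<close> bounds the error of the generator on the square of the
    centred average of \<open>G j\<close>, and \<open>l j\<close> below bounds the rate of change of
    the cross moment \<open>\<psi> j\<close>.\<close>
  define b where "b j = 2 * (lattice_norm n (G j) + \<bar>a\<bar>) * lattice_defect n (G j) (Bop m (G j)) + (1 / real n ^ CARD('d)) * (2 * M * lattice_defect n (G j) (\<lambda>_. 0))" for j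
  define l where "l j = (lattice_norm n (G j) + \<bar>a\<bar>) * lattice_defect n (Bop m (G j)) (\<lambda>_. 0) + lattice_norm n (Bop m (G j)) * lattice_defect n (G j) (\<lambda>_. 0)
          + (1 / real n ^ CARD('d)) * (M * lattice_defect n (G j) (\<lambda>_. 0) + M' * lattice_defect n (Bop m (G j)) (\<lambda>_. 0))" for j
  have \<delta>0: "\<delta> \<ge> 0" using t \<delta> by simp
  have G: "test_fun (G j)" "test_fun (Bop m (G j))" for j unfolding G_def by (auto intro: Sop_pow_test_fun Bop_test_fun F)
  have z: "test_fun (\<lambda>_::real^'d. 0)" using test_fun_cmult[OF F, of 0] by simp
  have emp0: "empirical n (\<lambda>_. 0) \<eta> = 0" for \<eta> by (simp add: empirical_def)
  have MG: "\<bar>G j x\<bar> \<le> M" "\<bar>Bop m (G j) x\<bar> \<le> M'" for j x using M M' by (auto simp: G_def)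
  define \<phi> where "\<phi> j s = E s (\<lambda>\<eta>. (empirical n (G j) \<eta> - a) * (empirical n (G j) \<eta> - a))" for j s
  define \<psi> where "\<psi> j s = E s (\<lambda>\<eta>. (empirical n (G j) \<eta> - a) * (empirical n (Bop m (G j)) \<eta> - 0))" for j s
  \<comment> \<open>Both substitutes are the zero function here: a crude bound suffices because it
    is later multiplied by an additional \<open>\<delta>\<close>.\<close>
  have lip: "\<psi> j r - \<psi> j s \<le> (r - s) * l j" if "0 \<le> s" "s \<le> r" for j r s
  proof -
    have dd: "\<exists>D. (\<psi> j has_real_derivative D) (at q within {0..}) \<and> D \<le> l j" if q: "q \<in> {s..s+(r-s)}" for q
    proof -
      have "q \<ge> 0" using q \<open>0 \<le> s\<close> by simp
      from product_derivative[OF G(1)[of j] G(2)[of j] z z MG(1) MG(2) this, where a = a and b = 0]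
      show ?thesis unfolding \<psi>_def l_def by (auto simp: emp0 abs_le_iff)
    qed
    have "\<psi> j (s + (r - s)) - \<psi> j s \<le> (r - s) * l j"
      by (rule derivative_upper_bound[OF that(1) _ dd]) (use that in auto)
    then show ?thesis by simp
  qed
  have step: "\<phi> j (s + \<delta>) \<le> \<phi> (Suc j) s + \<delta> * (b j + \<delta> * (2 * l j))" if s: "0 \<le> s" for j s
  proof -
    have ia: "integrable (\<nu> r) (\<lambda>\<eta>. (empirical n (G j) \<eta> - a) * (empirical n (Bop m (G j)) \<eta> - 0))" if "r \<ge> 0" for r
      by (rule nu_integrable[OF that product_measurable product_bound[OF G(1) G(2)]])
    have dd: "\<exists>D. (\<phi> j has_real_derivative D) (at q within {0..}) \<and> D \<le> 2 * \<psi> j s + \<delta> * (2 * l j) + b j" if q: "q \<in> {s..s+\<delta>}" for q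
    proof -
      have q0: "q \<ge> 0" using q s by simp
      from product_derivative[OF G(1)[of j] G(1)[of j] G(2)[of j] G(2)[of j] MG(1) MG(1) q0, where a = a and b = a]
      obtain D where D: "(\<phi> j has_real_derivative D) (at q within {0..})"
        "\<bar>D - E q (\<lambda>\<eta>. (empirical n (G j) \<eta> - a) * empirical n (Bop m (G j)) \<eta> + (empirical n (G j) \<eta> - a) * empirical n (Bop m (G j)) \<eta>)\<bar> \<le>
           (lattice_norm n (G j) + \<bar>a\<bar>) * lattice_defect n (G j) (Bop m (G j)) + (lattice_norm n (G j) + \<bar>a\<bar>) * lattice_defect n (G j) (Bop m (G j))
           + (1 / real n ^ CARD('d)) * (M * lattice_defect n (G j) (\<lambda>_. 0) + M * lattice_defect n (G j) (\<lambda>_. 0))"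
        unfolding \<phi>_def by blast
      have bj: "(lattice_norm n (G j) + \<bar>a\<bar>) * lattice_defect n (G j) (Bop m (G j)) + (lattice_norm n (G j) + \<bar>a\<bar>) * lattice_defect n (G j) (Bop m (G j))
           + (1 / real n ^ CARD('d)) * (M * lattice_defect n (G j) (\<lambda>_. 0) + M * lattice_defect n (G j) (\<lambda>_. 0)) = b j"
        unfolding b_def by (simp add: algebra_simps)
      have e2: "E q (\<lambda>\<eta>. (empirical n (G j) \<eta> - a) * empirical n (Bop m (G j)) \<eta> + (empirical n (G j) \<eta> - a) * empirical n (Bop m (G j)) \<eta>) = 2 * \<psi> j q"
        using Bochner_Integration.integral_add[OF ia[OF q0] ia[OF q0]] by (simp add: \<psi>_def)
      have "D \<le> 2 * \<psi> j q + b j" using D(2) unfolding bj e2 by linarith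
      moreover have "\<psi> j q - \<psi> j s \<le> \<delta> * l j"
      proof -
        have "M \<ge> 0" "M' \<ge> 0" using MG[of j 0] by linarith+
        then have l0: "l j \<ge> 0" unfolding l_def
          by (intro add_nonneg_nonneg mult_nonneg_nonneg lattice_norm_defect_nonneg) auto
        have "(q - s) * l j \<le> \<delta> * l j" using q l0 by (intro mult_right_mono) auto
        then show ?thesis using lip[OF s, of q j] q by auto
      qed
      ultimately show ?thesis using D(1) by (intro exI[of _ D]) auto
    qed
    have "\<phi> j (s + \<delta>) - \<phi> j s \<le> \<delta> * (2 * \<psi> j s + \<delta> * (2 * l j) + b j)"
      by (rule derivative_upper_bound[OF s \<delta>0 dd]) auto
    then have 1: "\<phi> j (s + \<delta>) \<le> \<phi> j s + \<delta> * (2 * \<psi> j s) + \<delta> * (b j + \<delta> * (2 * l j))" by (simp add: algebra_simps)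
    have "\<phi> j s + (2 * \<delta>) * \<psi> j s \<le> \<phi> (Suc j) s"
    proof -
      have emS: "empirical n (G (Suc j)) \<eta> = empirical n (G j) \<eta> + \<delta> * empirical n (Bop m (G j)) \<eta>" for \<eta>
      proof -
        have "lattice_sample n (G (Suc j)) = (\<lambda>z. lattice_sample n (G j) z + \<delta> * lattice_sample n (Bop m (G j)) z)"
          by (auto simp: lattice_sample_def G_def Sop_def fun_eq_iff distrib_left)
        then show ?thesis unfolding empirical_eq_occupation_sum[OF n]
          using occupation_sum_linear[OF lattice_sample_finite[OF n] lattice_sample_finite[OF n], of "G j" "Bop m (G j)"] test_fun_compact[OF G(1)] test_fun_compact[OF G(2)] by simp
      qed
      have i1: "integrable (\<nu> s) (\<lambda>\<eta>. (empirical n (G j) \<eta> - a) * (empirical n (G j) \<eta> - a))" for j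
        by (rule nu_integrable[OF s product_measurable product_bound[OF G(1) G(1)]])
      have "\<phi> j s + (2 * \<delta>) * \<psi> j s = E s (\<lambda>\<eta>. (empirical n (G j) \<eta> - a) * (empirical n (G j) \<eta> - a) + (2 * \<delta>) * ((empirical n (G j) \<eta> - a) * (empirical n (Bop m (G j)) \<eta> - 0)))"
        unfolding \<phi>_def \<psi>_def using i1[of j] ia[OF s] by simp
      also have "\<dots> \<le> \<phi> (Suc j) s"
        unfolding \<phi>_def
      proof (rule integral_mono)
        show "integrable (\<nu> s) (\<lambda>\<eta>. (empirical n (G j) \<eta> - a) * (empirical n (G j) \<eta> - a) + (2 * \<delta>) * ((empirical n (G j) \<eta> - a) * (empirical n (Bop m (G j)) \<eta> - 0)))"
          using i1[of j] ia[OF s] by (intro Bochner_Integration.integrable_add integrable_mult_right)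
        fix \<eta>
        have "0 \<le> (\<delta> * empirical n (Bop m (G j)) \<eta>)^2" by simp
        then show "(empirical n (G j) \<eta> - a) * (empirical n (G j) \<eta> - a) + (2 * \<delta>) * ((empirical n (G j) \<eta> - a) * (empirical n (Bop m (G j)) \<eta> - 0))
          \<le> (empirical n (G (Suc j)) \<eta> - a) * (empirical n (G (Suc j)) \<eta> - a)"
          unfolding emS by (simp add: power2_eq_square algebra_simps)
      qed (rule i1)
      finally show ?thesis .
    qed
    then show ?thesis using 1 by (simp add: algebra_simps)
  qed
  \<comment> \<open>Each step trades a time \<open>\<delta>\<close> for one more Euler factor, so
    after \<open>N\<close> steps the moment sits at time 0.\<close>
  have "k \<le> N \<Longrightarrow> \<phi> 0 t \<le> \<phi> k (t - real k * \<delta>) + (\<Sum>j<k. \<delta> * (b j + \<delta> * (2 * l j)))" for k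
  proof (induction k)
    case (Suc k)
    have "real (Suc k) * \<delta> \<le> real N * \<delta>" using Suc.prems \<delta>0 by (intro mult_right_mono) auto
    then have "0 \<le> t - real (Suc k) * \<delta>" using \<delta> N by simp
    from step[OF this, of k] have "\<phi> k (t - real k * \<delta>) \<le> \<phi> (Suc k) (t - real (Suc k) * \<delta>) + \<delta> * (b k + \<delta> * (2 * l k))"
      by (simp add: algebra_simps)
    then show ?case using Suc by simp
  qed simp
  from this[of N] have "\<phi> 0 t \<le> \<phi> N 0 + (\<Sum>j<N. \<delta> * (b j + \<delta> * (2 * l j)))" using \<delta> N by simp
  then show ?thesis unfolding \<phi>_def b_def l_def by (simp add: G_def power2_eq_square)
qed

end

section \<open>Passage to the limit\<close>

context levy_kernel
begin

lemma lattice_norm_tendsto: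
  assumes K: "continuous_on UNIV K" "has_compact_support K"
  shows "(\<lambda>n. lattice_norm n K) \<longlonglongrightarrow> L1 K"
proof (rule Lim_null[THEN iffD2], rule Lim_null_comparison[OF _ riemann_sum_converges(2)[OF K]])
  show "\<forall>\<^sub>F n in sequentially. norm (lattice_norm n K - L1 K) \<le> L1 (\<lambda>x. K (lattice_round n x) - K x)"
    using eventually_gt_at_top[of 0]
  proof (rule eventually_mono)
    fix n :: nat assume n: "n > 0"
    note i = riemann_sum_converges(1)[OF K n] compact_support_integrable[OF K]
    have "lattice_norm n K \<le> L1 (\<lambda>x. K (lattice_round n x) - K x) + L1 K"
      using L1_add[of "\<lambda>x. K (lattice_round n x) - K x" K] i by (simp add: lattice_norm_def)
    moreover have "L1 K \<le> L1 (\<lambda>x. K x - K (lattice_round n x)) + lattice_norm n K"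
      using L1_add[of "\<lambda>x. K x - K (lattice_round n x)" "\<lambda>x. K (lattice_round n x)"] i by (simp add: lattice_norm_def)
    ultimately show "norm (lattice_norm n K - L1 K) \<le> L1 (\<lambda>x. K (lattice_round n x) - K x)"
      using L1_sym[of K "\<lambda>x. K (lattice_round n x)"] by (simp add: abs_le_iff)
  qed
qed

lemma lattice_defect_tendsto:
  assumes "test_fun G" "continuous_on UNIV K" "has_compact_support K"
  shows "(\<lambda>n. lattice_defect n G K) \<longlonglongrightarrow> L1 (\<lambda>x. frac_op h G x - K x)"
  unfolding lattice_defect_def by (rule lattice_L1_converges[OF assms])

lemma inverse_volume_tendsto: "(\<lambda>n. 1 / real n ^ CARD('d)) \<longlonglongrightarrow> 0"
proof -
  have "(\<lambda>n. (1 / real n) ^ CARD('d)) \<longlonglongrightarrow> 0 ^ CARD('d)"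
    by (intro tendsto_power tendsto_divide_0[OF tendsto_const] filterlim_at_top_imp_at_infinity filterlim_real_sequentially)
  then show ?thesis by (simp only: zero_power[OF zero_less_card_finite] power_one_over)
qed

text \<open>Association gives convergence in probability only. The averages are bounded uniformly in
  the configuration, so the exceptional event contributes at most \<open>C\<close> times its
  probability to the second moment.\<close>

lemma initial_second_moment:
  fixes a \<epsilon> :: real and K :: "real^'d \<Rightarrow> real"
  assumes prob: "\<And>n. prob_space (\<mu> n)" and sets: "\<And>n. sets (\<mu> n) = sets config_space"
    and assoc: "associated \<mu> u0" and K: "continuous_on UNIV K" "has_compact_support K" and \<epsilon>: "\<epsilon> > 0"
  shows "\<forall>\<^sub>F n in sequentially. (\<integral>\<eta>. (empirical n K \<eta> - a)^2 \<partial>(\<mu> n)) \<le> (\<bar>(\<integral>x. u0 x * K x \<partial>lborel) - a\<bar> + \<epsilon>)^2 + \<epsilon>"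
proof -
  let ?c = "\<integral>x. u0 x * K x \<partial>lborel"
  define C where "C = (L1 K + 1 + \<bar>a\<bar>)^2 + 1"
  have C: "C > 0" unfolding C_def by (intro add_nonneg_pos) auto
  let ?P = "\<lambda>n. measure (\<mu> n) {\<eta> \<in> space (\<mu> n). \<bar>empirical n K \<eta> - ?c\<bar> > \<epsilon>}"
  have "?P \<longlonglongrightarrow> 0" using assoc K \<epsilon> unfolding associated_def by blast
  then have ev1: "\<forall>\<^sub>F n in sequentially. ?P n < \<epsilon> / C" using \<epsilon> C by (intro order_tendstoD) auto
  have ev2: "\<forall>\<^sub>F n in sequentially. lattice_norm n K < L1 K + 1" by (rule order_tendstoD[OF lattice_norm_tendsto[OF K]]) simp
  show ?thesis using ev1 ev2 eventually_gt_at_top[of 0]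
  proof eventually_elim
    case (elim n)
    interpret prob_space "\<mu> n" by (rule prob)
    have em: "empirical n K \<in> borel_measurable (\<mu> n)"
      using occupation_sum_measurable[of "lattice_sample n K"] measurable_cong_sets[OF sets refl] empirical_eq_occupation_sum[OF elim(3), of K] by metis
    define A where "A = {\<eta> \<in> space (\<mu> n). \<bar>empirical n K \<eta> - ?c\<bar> > \<epsilon>}"
    have A: "A \<in> events" unfolding A_def using em by measurable
    have b: "(empirical n K \<eta> - a)^2 \<le> C" for \<eta>
    proof -
      have "\<bar>empirical n K \<eta> - a\<bar> \<le> L1 K + 1 + \<bar>a\<bar>" using empirical_bound[OF elim(3) K, of \<eta>] elim(2) by linarith
      then have "\<bar>empirical n K \<eta> - a\<bar>^2 \<le> (L1 K + 1 + \<bar>a\<bar>)^2" by (intro power_mono) auto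
      then show ?thesis by (simp add: C_def)
    qed
    have i: "integrable (\<mu> n) (\<lambda>\<eta>. (empirical n K \<eta> - a)^2)"
      by (rule integrable_const_bound[where B = C]) (use b em in auto)
    have "(\<integral>\<eta>. (empirical n K \<eta> - a)^2 \<partial>(\<mu> n)) \<le> (\<integral>\<eta>. (\<bar>?c - a\<bar> + \<epsilon>)^2 + C * indicator A \<eta> \<partial>(\<mu> n))"
    proof (rule integral_mono[OF i])
      show "integrable (\<mu> n) (\<lambda>\<eta>. (\<bar>?c - a\<bar> + \<epsilon>)^2 + C * indicator A \<eta>)"
        by (intro Bochner_Integration.integrable_add integrable_const integrable_mult_right integrable_real_indicator A) (simp add: emeasure_eq_measure)
      fix \<eta> assume sp: "\<eta> \<in> space (\<mu> n)"
      show "(empirical n K \<eta> - a)^2 \<le> (\<bar>?c - a\<bar> + \<epsilon>)^2 + C * indicator A \<eta>"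
      proof (cases "\<eta> \<in> A")
        case True
        then show ?thesis using b[of \<eta>] by (simp add: add_increasing)
      next
        case False
        then have "\<bar>empirical n K \<eta> - a\<bar> \<le> \<bar>?c - a\<bar> + \<epsilon>" using sp by (auto simp: A_def)
        then have "\<bar>empirical n K \<eta> - a\<bar>^2 \<le> (\<bar>?c - a\<bar> + \<epsilon>)^2" by (intro power_mono) auto
        then show ?thesis using False by simp
      qed
    qed
    also have "\<dots> = (\<bar>?c - a\<bar> + \<epsilon>)^2 + C * prob A"
    proof -
      have "integrable (\<mu> n) (indicator A :: _ \<Rightarrow> real)"
        by (intro integrable_real_indicator A) (simp add: emeasure_eq_measure)
      then show ?thesis using A by (simp add: prob_space)
    qed
    also have "C * prob A \<le> \<epsilon>" using elim(1) C by (simp add: A_def field_simps)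
    finally show ?case by simp
  qed
qed

text \<open>The maximum principle passes the bound on \<open>F\<close> to all Euler products, so the
  constants do not depend on \<open>j\<close>.\<close>

lemma test_fun_sup:
  assumes F: "test_fun F" and \<delta>: "0 \<le> \<delta>" "\<delta> * jump_total m \<le> 1"
  shows "\<exists>M M'. \<forall>j x. \<bar>(Sop m \<delta> ^^ j) F x\<bar> \<le> M \<and> \<bar>Bop m ((Sop m \<delta> ^^ j) F) x\<bar> \<le> M'"
proof -
  obtain M where M: "\<And>x. \<bar>F x\<bar> \<le> M" using compact_support_bounded[of F] test_fun_compact[OF F] by blast
  have 1: "\<bar>(Sop m \<delta> ^^ j) F x\<bar> \<le> M" for j x
    using Sop_pow_bounds[OF \<delta>, of "- M" F M j x] M by (auto simp: abs_le_iff minus_le_iff)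
  have "\<bar>Bop m ((Sop m \<delta> ^^ j) F) x\<bar> \<le> 2 * jump_total m * M" for j x by (rule Bop_bounded[OF 1])
  then show ?thesis using 1 by blast
qed

text \<open>With \<open>m\<close> and \<open>N\<close> fixed only the finitely many test functions
  \<open>G j\<close> and \<open>Bop m (G j)\<close> with \<open>j \<le> N\<close> matter, so all
  lattice quantities converge together as \<open>n\<close> grows.\<close>

lemma second_moment_tendsto:
  assumes law: "\<And>n. is_excl_law h (real n powr \<alpha>) (\<mu> n) (\<nu> n)"
    and prob: "\<And>n. prob_space (\<mu> n)" and sets: "\<And>n. sets (\<mu> n) = sets config_space"
    and assoc: "associated \<mu> u0" and sol: "weak_solution h t u0 u" and t: "0 \<le> t" and F: "test_fun F"
  shows "(\<lambda>n. \<integral>\<eta>. (empirical n F \<eta> - (\<integral>x. u t x * F x \<partial>lborel))^2 \<partial>(\<nu> n t)) \<longlonglongrightarrow> 0"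
proof (rule LIMSEQ_I)
  fix e :: real assume e: "e > 0"
  define a where "a = (\<integral>x. u t x * F x \<partial>lborel)"
  obtain B0 where B0: "\<And>s x. s \<in> {0..t} \<Longrightarrow> \<bar>u s x\<bar> \<le> B0" using sol unfolding weak_solution_def by blast
  define B where "B = max 0 B0"
  have B: "B \<ge> 0" "\<And>s x. s \<in> {0..t} \<Longrightarrow> \<bar>u s x\<bar> \<le> B" using B0 by (auto simp: B_def intro: max.coboundedI2)
  interpret ws: weak_sol h \<alpha> u0 u t B by unfold_locales (use sol B in auto)
  \<comment> \<open>The final bound collects 9r + r from the initial moment and 3r from the
    propagation error; \<open>r \<le> 1\<close> turns the square of 3r into at most 9r.\<close>
  define r where "r = min 1 (e / 14)"
  have r: "r > 0" "r \<le> 1" "14 * r \<le> e" using e by (auto simp: r_def)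
  define q where "q m = L1 (\<lambda>x. frac_op h F x - Bop m F x)" for m
  have "(\<lambda>m. t * (B * q m) + t * (2 * (L1 F + \<bar>a\<bar>) * q m)) \<longlonglongrightarrow> t * (B * 0) + t * (2 * (L1 F + \<bar>a\<bar>) * 0)"
    unfolding q_def by (intro tendsto_intros Bop_converges[OF F])
  then have "\<forall>\<^sub>F m in sequentially. t * (B * q m) + t * (2 * (L1 F + \<bar>a\<bar>) * q m) < r" using r by (intro order_tendstoD) auto
  then have "\<forall>\<^sub>F m in sequentially. t * (B * q m) + t * (2 * (L1 F + \<bar>a\<bar>) * q m) < r \<and> m > 0"
    using eventually_gt_at_top[of 0] by eventually_elim auto
  then obtain m where m: "t * (B * q m) + t * (2 * (L1 F + \<bar>a\<bar>) * q m) < r" "m > 0"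
    using eventually_happens'[OF sequentially_bot] by blast
  have q0: "q m \<ge> 0" unfolding q_def by (rule L1_nonneg)
  have m1: "t * (B * q m) \<le> r" "t * (2 * (L1 F + \<bar>a\<bar>) * q m) \<le> r"
  proof -
    have "0 \<le> t * (B * q m)" "0 \<le> t * (2 * (L1 F + \<bar>a\<bar>) * q m)"
      using t B q0 L1_nonneg[of F] by (auto intro!: mult_nonneg_nonneg add_nonneg_nonneg)
    then show "t * (B * q m) \<le> r" "t * (2 * (L1 F + \<bar>a\<bar>) * q m) \<le> r" using m(1) by linarith+
  qed
  define C1 where "C1 = L1 (frac_op h (Bop m F))"
  define C2 where "C2 = 2 * ((L1 F + \<bar>a\<bar>) * C1 + L1 (Bop m F) * L1 (frac_op h F))"
  have C0: "C1 \<ge> 0" "C2 \<ge> 0" unfolding C2_def C1_def by (auto intro!: add_nonneg_nonneg mult_nonneg_nonneg L1_nonneg)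
  have lims: "(\<lambda>N. t / real N) \<longlonglongrightarrow> 0"
    by (intro tendsto_divide_0[OF tendsto_const] filterlim_at_top_imp_at_infinity filterlim_real_sequentially)
  \<comment> \<open>The step restriction is folded into the same smallness condition: r times
    \<open>\<delta> * jump_total m\<close> at most r means that the step is admissible.\<close>
  have "(\<lambda>N. t * (B * (t / real N * C1)) + t * (t / real N * C2) + r * (t / real N * jump_total m)) \<longlonglongrightarrow> t * (B * (0 * C1)) + t * (0 * C2) + r * (0 * jump_total m)"
    by (intro tendsto_intros lims)
  then have "\<forall>\<^sub>F N in sequentially. t * (B * (t / real N * C1)) + t * (t / real N * C2) + r * (t / real N * jump_total m) < r" using r by (intro order_tendstoD) auto
  then have "\<forall>\<^sub>F N in sequentially. t * (B * (t / real N * C1)) + t * (t / real N * C2) + r * (t / real N * jump_total m) < r \<and> N > 0"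
    using eventually_gt_at_top[of 0] by eventually_elim auto
  then obtain N where N: "t * (B * (t / real N * C1)) + t * (t / real N * C2) + r * (t / real N * jump_total m) < r" "N > 0"
    using eventually_happens'[OF sequentially_bot] by blast
  define \<delta> where "\<delta> = t / real N"
  have \<delta>0: "\<delta> \<ge> 0" using t by (simp add: \<delta>_def)
  have n1: "t * (B * (\<delta> * C1)) \<le> r" "t * (\<delta> * C2) \<le> r" "\<delta> * jump_total m \<le> 1"
  proof -
    have nonneg: "0 \<le> t * (B * (\<delta> * C1))" "0 \<le> t * (\<delta> * C2)" "0 \<le> r * (\<delta> * jump_total m)"
      using t B C0 \<delta>0 r jump_total_nonneg[of m] by (auto intro!: mult_nonneg_nonneg)
    then show "t * (B * (\<delta> * C1)) \<le> r" "t * (\<delta> * C2) \<le> r" using N(1) unfolding \<delta>_def by linarith+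
    have "r * (\<delta> * jump_total m) \<le> r * 1" using nonneg N(1) unfolding \<delta>_def by linarith
    then show "\<delta> * jump_total m \<le> 1" using r(1) by (simp only: mult_le_cancel_left_pos)
  qed
  define G where "G j = (Sop m \<delta> ^^ j) F" for j
  have G: "test_fun (G j)" "test_fun (Bop m (G j))" for j unfolding G_def by (auto intro: Sop_pow_test_fun Bop_test_fun F)
  have Gc: "continuous_on UNIV (G j)" "has_compact_support (G j)" "continuous_on UNIV (Bop m (G j))" "has_compact_support (Bop m (G j))" for j
    using test_fun_compact[OF G(1)] test_fun_compact[OF G(2)] by auto
  have dual: "\<bar>(\<integral>x. u0 x * G N x \<partial>lborel) - a\<bar> \<le> 2 * r"
  proof -
    have "\<bar>a - (\<integral>x. u0 x * G N x \<partial>lborel)\<bar> \<le> t * (B * (q m + \<delta> * C1))"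
      unfolding a_def G_def q_def C1_def by (rule ws.duality_estimate[OF F _ m(2) N(2) \<delta>_def n1(3) B(1)]) (use t in auto)
    also have "\<dots> = t * (B * q m) + t * (B * (\<delta> * C1))" by (simp add: algebra_simps)
    finally show ?thesis using m1 n1 by (simp add: abs_minus_commute)
  qed
  obtain M M' where M: "\<And>j x. \<bar>(Sop m \<delta> ^^ j) F x\<bar> \<le> M" "\<And>j x. \<bar>Bop m ((Sop m \<delta> ^^ j) F) x\<bar> \<le> M'"
    using test_fun_sup[OF F \<delta>0 n1(3)] by blast
  define err where "err n = (\<Sum>j<N. \<delta> *
     (2 * (lattice_norm n (G j) + \<bar>a\<bar>) * lattice_defect n (G j) (Bop m (G j)) + (1 / real n ^ CARD('d)) * (2 * M * lattice_defect n (G j) (\<lambda>_. 0))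
      + \<delta> * (2 * ((lattice_norm n (G j) + \<bar>a\<bar>) * lattice_defect n (Bop m (G j)) (\<lambda>_. 0) + lattice_norm n (Bop m (G j)) * lattice_defect n (G j) (\<lambda>_. 0)
          + (1 / real n ^ CARD('d)) * (M * lattice_defect n (G j) (\<lambda>_. 0) + M' * lattice_defect n (Bop m (G j)) (\<lambda>_. 0))))))" for n
  \<comment> \<open>The limit of \<open>err\<close> as \<open>n\<close> grows. The factors 0 are the
    limits of 1/n^d and remove the square fields.\<close>
  define lim where "lim = (\<Sum>j<N. \<delta> *
     (2 * (L1 (G j) + \<bar>a\<bar>) * L1 (\<lambda>x. frac_op h (G j) x - Bop m (G j) x) + 0 * (2 * M * L1 (\<lambda>x. frac_op h (G j) x - 0))
      + \<delta> * (2 * ((L1 (G j) + \<bar>a\<bar>) * L1 (\<lambda>x. frac_op h (Bop m (G j)) x - 0) + L1 (Bop m (G j)) * L1 (\<lambda>x. frac_op h (G j) x - 0)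
          + 0 * (M * L1 (\<lambda>x. frac_op h (G j) x - 0) + M' * L1 (\<lambda>x. frac_op h (Bop m (G j)) x - 0))))))"
  have "err \<longlonglongrightarrow> lim" unfolding err_def lim_def
    by (intro tendsto_intros lattice_norm_tendsto lattice_defect_tendsto inverse_volume_tendsto G Gc zero_compact)
  moreover have "lim \<le> 2 * r"
  proof -
    have c1: "L1 (G j) \<le> L1 F" "L1 (Bop m (G j)) \<le> L1 (Bop m F)" for j
      unfolding G_def Bop_Sop_pow_commute
      using L1_Sop_pow[OF m(2) \<delta>0 n1(3)] test_fun_integrable[OF F] test_fun_integrable[OF Bop_test_fun[OF F]] by auto
    have c2: "L1 (\<lambda>x. frac_op h (G j) x - Bop m (G j) x) \<le> q m" for j
      unfolding G_def q_def by (rule L1_frac_op_Bop_Sop_pow[OF m(2) \<delta>0 n1(3) F])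
    have c3: "L1 (frac_op h (G j)) \<le> L1 (frac_op h F)" for j unfolding G_def by (rule L1_frac_op_Sop_pow[OF m(2) \<delta>0 n1(3) F])
    have c4: "L1 (frac_op h (Bop m (G j))) \<le> C1" for j
      unfolding G_def Bop_Sop_pow_commute C1_def by (rule L1_frac_op_Sop_pow[OF m(2) \<delta>0 n1(3) Bop_test_fun[OF F]])
    have "lim \<le> (\<Sum>j<N. \<delta> * (2 * (L1 F + \<bar>a\<bar>) * q m + \<delta> * C2))"
      unfolding lim_def C2_def
    proof (rule sum_mono, rule mult_left_mono[OF _ \<delta>0])
      fix j
      have "(L1 (G j) + \<bar>a\<bar>) * L1 (\<lambda>x. frac_op h (G j) x - Bop m (G j) x) \<le> (L1 F + \<bar>a\<bar>) * q m"
        using c1[of j] L1_nonneg[of F] by (intro mult_mono c2 L1_nonneg) auto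
      moreover have "(L1 (G j) + \<bar>a\<bar>) * L1 (frac_op h (Bop m (G j))) \<le> (L1 F + \<bar>a\<bar>) * C1"
        using c1[of j] L1_nonneg[of F] by (intro mult_mono c4 L1_nonneg) auto
      moreover have "L1 (Bop m (G j)) * L1 (frac_op h (G j)) \<le> L1 (Bop m F) * L1 (frac_op h F)"
        by (intro mult_mono c1 c3 L1_nonneg)
      ultimately have ineqs: "2 * ((L1 (G j) + \<bar>a\<bar>) * L1 (\<lambda>x. frac_op h (G j) x - Bop m (G j) x)) \<le> 2 * ((L1 F + \<bar>a\<bar>) * q m)"
        "\<delta> * (2 * ((L1 (G j) + \<bar>a\<bar>) * L1 (frac_op h (Bop m (G j))) + L1 (Bop m (G j)) * L1 (frac_op h (G j)))) \<le>
          \<delta> * (2 * ((L1 F + \<bar>a\<bar>) * C1 + L1 (Bop m F) * L1 (frac_op h F)))"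
        using \<delta>0 by (auto intro!: mult_left_mono add_mono)
      show "2 * (L1 (G j) + \<bar>a\<bar>) * L1 (\<lambda>x. frac_op h (G j) x - Bop m (G j) x) + 0 * (2 * M * L1 (\<lambda>x. frac_op h (G j) x - 0))
      + \<delta> * (2 * ((L1 (G j) + \<bar>a\<bar>) * L1 (\<lambda>x. frac_op h (Bop m (G j)) x - 0) + L1 (Bop m (G j)) * L1 (\<lambda>x. frac_op h (G j) x - 0)
          + 0 * (M * L1 (\<lambda>x. frac_op h (G j) x - 0) + M' * L1 (\<lambda>x. frac_op h (Bop m (G j)) x - 0))))
        \<le> 2 * (L1 F + \<bar>a\<bar>) * q m + \<delta> * (2 * ((L1 F + \<bar>a\<bar>) * C1 + L1 (Bop m F) * L1 (frac_op h F)))"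
        unfolding mult_zero_left add_0_right diff_zero mult.assoc by (rule add_mono[OF ineqs])
    qed
    also have "\<dots> = (real N * \<delta>) * (2 * (L1 F + \<bar>a\<bar>) * q m + \<delta> * C2)" by simp
    also have "real N * \<delta> = t" using N(2) by (simp add: \<delta>_def)
    also have "t * (2 * (L1 F + \<bar>a\<bar>) * q m + \<delta> * C2) \<le> 2 * r" using m1(2) n1(2) by (simp add: distrib_left)
    finally show ?thesis .
  qed
  ultimately have ev1: "\<forall>\<^sub>F n in sequentially. err n < 3 * r"
    using r(1) by (intro order_tendstoD) auto
  have ev2: "\<forall>\<^sub>F n in sequentially. (\<integral>\<eta>. (empirical n (G N) \<eta> - a)^2 \<partial>(\<mu> n)) \<le> (\<bar>(\<integral>x. u0 x * G N x \<partial>lborel) - a\<bar> + r)^2 + r"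
    by (rule initial_second_moment[OF prob sets assoc Gc(1,2) r(1)])
  have "\<forall>\<^sub>F n in sequentially. norm ((\<integral>\<eta>. (empirical n F \<eta> - a)^2 \<partial>(\<nu> n t)) - 0) < e"
    using ev1 ev2 eventually_gt_at_top[of 0]
  proof eventually_elim
    case (elim n)
    interpret ep: excl_process h \<alpha> n "\<mu> n" "\<nu> n" by unfold_locales (use elim(3) law in auto)
    have "\<nu> n 0 = \<mu> n" using law[of n] by (simp add: is_excl_law_def)
    then have "(\<integral>\<eta>. (empirical n F \<eta> - a)^2 \<partial>(\<nu> n t)) \<le> (\<integral>\<eta>. (empirical n (G N) \<eta> - a)^2 \<partial>(\<mu> n)) + err n"
      using ep.second_moment_estimate[OF F t N(2) \<delta>_def M, of a] unfolding err_def G_def by simp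
    moreover have "(\<bar>(\<integral>x. u0 x * G N x \<partial>lborel) - a\<bar> + r)^2 \<le> 9 * r"
    proof -
      have "(\<bar>(\<integral>x. u0 x * G N x \<partial>lborel) - a\<bar> + r)^2 \<le> (3 * r)^2" using dual r by (intro power_mono) auto
      also have "\<dots> = 9 * (r * r)" by (simp add: power2_eq_square)
      also have "\<dots> \<le> 9 * (r * 1)" using r by (intro mult_left_mono) auto
      finally show ?thesis by simp
    qed
    ultimately have "(\<integral>\<eta>. (empirical n F \<eta> - a)^2 \<partial>(\<nu> n t)) < e" using elim(1,2) r by linarith
    moreover have "0 \<le> (\<integral>\<eta>. (empirical n F \<eta> - a)^2 \<partial>(\<nu> n t))" by (rule integral_nonneg_AE) auto
    ultimately show ?case by simp
  qed
  then show "\<exists>no. \<forall>n\<ge>no. norm ((\<integral>\<eta>. (empirical n F \<eta> - (\<integral>x. u t x * F x \<partial>lborel))^2 \<partial>(\<nu> n t)) - 0) < e"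
    unfolding a_def eventually_sequentially .
qed

text \<open>Chebyshev's inequality applied to the second moment.\<close>

lemma deviation_test_fun:
  fixes \<epsilon> :: real
  assumes law: "\<And>n. is_excl_law h (real n powr \<alpha>) (\<mu> n) (\<nu> n)"
    and prob: "\<And>n. prob_space (\<mu> n)" and sets: "\<And>n. sets (\<mu> n) = sets config_space"
    and assoc: "associated \<mu> u0" and sol: "weak_solution h t u0 u" and t: "0 \<le> t" and F: "test_fun F" and \<epsilon>: "\<epsilon> > 0"
  shows "(\<lambda>n. measure (\<nu> n t) {\<eta> \<in> space (\<nu> n t). \<bar>empirical n F \<eta> - (\<integral>x. u t x * F x \<partial>lborel)\<bar> > \<epsilon>}) \<longlonglongrightarrow> 0"
proof -
  let ?a = "\<integral>x. u t x * F x \<partial>lborel"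
  let ?V = "\<lambda>n. \<integral>\<eta>. (empirical n F \<eta> - ?a)^2 \<partial>(\<nu> n t)"
  have "(\<lambda>n. ?V n / \<epsilon>^2) \<longlonglongrightarrow> 0 / \<epsilon>^2"
    by (intro tendsto_divide second_moment_tendsto[OF law prob sets assoc sol t F] tendsto_const) (use \<epsilon> in auto)
  then have lim: "(\<lambda>n. ?V n / \<epsilon>^2) \<longlonglongrightarrow> 0" by simp
  show ?thesis
  proof (rule Lim_null_comparison[OF _ lim])
    show "\<forall>\<^sub>F n in sequentially. norm (measure (\<nu> n t) {\<eta> \<in> space (\<nu> n t). \<bar>empirical n F \<eta> - ?a\<bar> > \<epsilon>}) \<le> ?V n / \<epsilon>^2"
      using eventually_gt_at_top[of 0]
    proof (rule eventually_mono)
      fix n :: nat assume n: "n > 0"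
      interpret ep: excl_process h \<alpha> n "\<mu> n" "\<nu> n" by unfold_locales (use n law in auto)
      interpret prob_space "\<nu> n t" by (rule ep.nu_prob[OF t])
      have em[measurable]: "empirical n F \<in> borel_measurable (\<nu> n t)"
        using ep.emp_measurable[of F] measurable_cong_sets[OF ep.nu_sets[OF t] refl] by blast
      have i: "integrable (\<nu> n t) (\<lambda>\<eta>. (empirical n F \<eta> - ?a)^2)"
        using ep.nu_integrable[OF t ep.product_measurable ep.product_bound[OF F F], of ?a ?a] by (simp add: power2_eq_square)
      define A where "A = {\<eta> \<in> space (\<nu> n t). \<bar>empirical n F \<eta> - ?a\<bar> > \<epsilon>}"
      have A: "A \<in> events" unfolding A_def by measurable
      have "(\<integral>\<eta>. \<epsilon>^2 * indicator A \<eta> \<partial>(\<nu> n t)) \<le> ?V n"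
      proof (rule integral_mono[OF _ i])
        show "integrable (\<nu> n t) (\<lambda>\<eta>. \<epsilon>^2 * indicator A \<eta>)"
          by (intro integrable_mult_right integrable_real_indicator A) (simp add: emeasure_eq_measure)
        fix \<eta>
        show "\<epsilon>^2 * indicator A \<eta> \<le> (empirical n F \<eta> - ?a)^2"
        proof (cases "\<eta> \<in> A")
          case True
          then have "\<epsilon>^2 \<le> \<bar>empirical n F \<eta> - ?a\<bar>^2" using \<epsilon> by (intro power_mono) (auto simp: A_def)
          then show ?thesis using True by simp
        qed simp
      qed
      then have "\<epsilon>^2 * prob A \<le> ?V n" using A by simp
      then show "norm (measure (\<nu> n t) {\<eta> \<in> space (\<nu> n t). \<bar>empirical n F \<eta> - ?a\<bar> > \<epsilon>}) \<le> ?V n / \<epsilon>^2"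
        using \<epsilon> by (simp add: A_def field_simps)
    qed
  qed
qed

text \<open>The generator estimates concern smooth functions. A merely continuous \<open>F\<close>
  is approximated uniformly with a common support, which changes the empirical average and its limit
  by a small amount, uniformly in the configuration.\<close>

theorem associated_at_time:
  assumes law: "\<And>n. is_excl_law h (real n powr \<alpha>) (\<mu> n) (\<nu> n)"
    and prob: "\<And>n. prob_space (\<mu> n)" and sets: "\<And>n. sets (\<mu> n) = sets config_space"
    and assoc: "associated \<mu> u0" and sol: "weak_solution h t u0 u" and t: "0 \<le> t"
  shows "associated (\<lambda>n. \<nu> n t) (u t)"
  unfolding associated_def
proof (intro allI impI, elim conjE)
  fix F :: "real^'d \<Rightarrow> real" and \<epsilon> :: real
  assume F: "continuous_on UNIV F" "has_compact_support F" and \<epsilon>: "\<epsilon> > 0"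
  obtain B0 where B0: "\<And>s x. s \<in> {0..t} \<Longrightarrow> \<bar>u s x\<bar> \<le> B0" using sol unfolding weak_solution_def by blast
  define B where "B = max 0 B0"
  have B: "B \<ge> 0" "\<And>s x. s \<in> {0..t} \<Longrightarrow> \<bar>u s x\<bar> \<le> B" using B0 by (auto simp: B_def intro: max.coboundedI2)
  interpret ws: weak_sol h \<alpha> u0 u t B by unfold_locales (use sol B in auto)
  obtain R where R: "\<And>x. norm x > R \<Longrightarrow> F x = 0"
    "\<And>e. e > 0 \<Longrightarrow> \<exists>G. test_fun G \<and> (\<forall>x. norm x > R \<longrightarrow> G x = 0) \<and> (\<forall>x. \<bar>F x - G x\<bar> \<le> e)"
    using test_fun_dense[OF F] by blast
  define D where "D = 2 * real CARD('d)"
  \<comment> \<open>The mass against which a uniform error counts: the ball enlarged by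
    \<open>D\<close> for rounded points, \<open>B\<close> times the ball for the limit, and 1 to
    keep the divisor positive.\<close>
  define V where "V = measure lborel (cball (0::real^'d) (R + D)) + B * measure lborel (cball (0::real^'d) R) + 1"
  have V: "V > 0" unfolding V_def using B(1) by (intro add_nonneg_pos add_nonneg_nonneg mult_nonneg_nonneg) auto
  obtain G where G: "test_fun G" "\<And>x. norm x > R \<Longrightarrow> G x = 0" "\<And>x. \<bar>F x - G x\<bar> \<le> \<epsilon> / (2 * V)"
    using R(2)[of "\<epsilon> / (2 * V)"] \<epsilon> V by auto
  let ?d = "\<lambda>x. F x - G x"
  have dc: "continuous_on UNIV ?d" using F(1) test_fun_continuous[OF G(1)] by (intro continuous_intros)
  have ds: "has_compact_support ?d" unfolding has_compact_support_iff using R(1) G(2) by (intro exI[of _ R]) auto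
  have di: "integrable lborel ?d" by (rule compact_support_integrable[OF dc ds])
  let ?a = "\<integral>x. u t x * F x \<partial>lborel" and ?b = "\<integral>x. u t x * G x \<partial>lborel"
  have tt: "t \<in> {0..t}" using t by simp
  have ab: "\<bar>?a - ?b\<bar> \<le> B * (\<epsilon> / (2 * V) * measure lborel (cball (0::real^'d) R))"
  proof -
    have "?a - ?b = ws.pairing ?d t"
      using ws.pairing_linear(2)[OF compact_support_integrable[OF F] test_fun_integrable[OF G(1)] tt] by (simp add: ws.pairing_def)
    then have "\<bar>?a - ?b\<bar> \<le> B * L1 ?d" using ws.pairing_bound[OF di tt] by simp
    also have "\<dots> \<le> B * (\<epsilon> / (2 * V) * measure lborel (cball (0::real^'d) R))"
      using R(1) G B(1) by (intro mult_left_mono L1_ball_bound di) auto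
    finally show ?thesis .
  qed
  show "(\<lambda>n. measure (\<nu> n t) {\<eta> \<in> space (\<nu> n t). \<bar>empirical n F \<eta> - ?a\<bar> > \<epsilon>}) \<longlonglongrightarrow> 0"
  proof (rule Lim_null_comparison)
    show "(\<lambda>n. measure (\<nu> n t) {\<eta> \<in> space (\<nu> n t). \<bar>empirical n G \<eta> - ?b\<bar> > \<epsilon> / 2}) \<longlonglongrightarrow> 0"
      by (rule deviation_test_fun[OF law prob sets assoc sol t G(1)]) (use \<epsilon> in simp)
    show "\<forall>\<^sub>F n in sequentially. norm (measure (\<nu> n t) {\<eta> \<in> space (\<nu> n t). \<bar>empirical n F \<eta> - ?a\<bar> > \<epsilon>})
      \<le> measure (\<nu> n t) {\<eta> \<in> space (\<nu> n t). \<bar>empirical n G \<eta> - ?b\<bar> > \<epsilon> / 2}"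
      using eventually_gt_at_top[of 0]
    proof (rule eventually_mono)
      fix n :: nat assume n: "n > 0"
      interpret ep: excl_process h \<alpha> n "\<mu> n" "\<nu> n" by unfold_locales (use n law in auto)
      interpret prob_space "\<nu> n t" by (rule ep.nu_prob[OF t])
      have em[measurable]: "empirical n G \<in> borel_measurable (\<nu> n t)"
        using ep.emp_measurable[of G] measurable_cong_sets[OF ep.nu_sets[OF t] refl] by blast
      have close: "\<bar>empirical n F \<eta> - empirical n G \<eta>\<bar> \<le> \<epsilon> / (2 * V) * measure lborel (cball (0::real^'d) (R + D))" for \<eta>
      proof -
        have "lattice_sample n ?d = (\<lambda>z. lattice_sample n F z + (- 1) * lattice_sample n G z)" by (auto simp: lattice_sample_def fun_eq_iff right_diff_distrib)
        then have "empirical n ?d \<eta> = empirical n F \<eta> - empirical n G \<eta>"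
          unfolding empirical_eq_occupation_sum[OF n] using occupation_sum_linear[OF lattice_sample_finite[OF n F(2)] lattice_sample_finite[OF n], of G "- 1" \<eta>] test_fun_compact[OF G(1)] by simp
        then have "\<bar>empirical n F \<eta> - empirical n G \<eta>\<bar> \<le> lattice_norm n ?d" using empirical_bound[OF n dc ds, of \<eta>] by simp
        also have "\<dots> \<le> \<epsilon> / (2 * V) * measure lborel (cball (0::real^'d) (R + D))"
          unfolding lattice_norm_def
        proof (rule L1_ball_bound)
          show "integrable lborel (\<lambda>x. F (lattice_round n x) - G (lattice_round n x))" by (rule riemann_sum_converges(1)[OF dc ds n])
          fix x :: "real^'d" assume x: "norm x > R + D"
          have "norm (lattice_round n x - x) \<le> D" using comparable_lattice_round[OF n, of x] by (simp add: comparable_def D_def)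
          then have "norm (lattice_round n x) > R" using x norm_triangle_ineq2[of x "lattice_round n x"] by (simp add: norm_minus_commute)
          then show "F (lattice_round n x) - G (lattice_round n x) = 0" using R(1) G(2) by simp
        qed (rule G(3))
        finally show ?thesis .
      qed
      have sum: "\<epsilon> / (2 * V) * measure lborel (cball (0::real^'d) (R + D)) + B * (\<epsilon> / (2 * V) * measure lborel (cball (0::real^'d) R)) \<le> \<epsilon> / 2"
      proof -
        have "\<epsilon> / (2 * V) * measure lborel (cball (0::real^'d) (R + D)) + B * (\<epsilon> / (2 * V) * measure lborel (cball (0::real^'d) R)) = \<epsilon> / (2 * V) * (V - 1)"
        proof -
          have "k * v + B * (k * w) = k * ((v + B * w + 1) - 1)" for k v w :: real by (simp add: algebra_simps)
          from this[of "\<epsilon> / (2 * V)"] show ?thesis unfolding V_def .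
        qed
        also have "\<dots> \<le> \<epsilon> / (2 * V) * V" using \<epsilon> V by (intro mult_left_mono) auto
        also have "\<dots> = \<epsilon> / 2" using V by simp
        finally show ?thesis .
      qed
      have "{\<eta> \<in> space (\<nu> n t). \<bar>empirical n F \<eta> - ?a\<bar> > \<epsilon>} \<subseteq> {\<eta> \<in> space (\<nu> n t). \<bar>empirical n G \<eta> - ?b\<bar> > \<epsilon> / 2}"
      proof (intro Collect_mono impI, elim conjE, intro conjI)
        fix \<eta> assume "\<epsilon> < \<bar>empirical n F \<eta> - ?a\<bar>"
        then show "\<epsilon> / 2 < \<bar>empirical n G \<eta> - ?b\<bar>" using close[of \<eta>] ab sum by linarith
      qed
      then have "measure (\<nu> n t) {\<eta> \<in> space (\<nu> n t). \<bar>empirical n F \<eta> - ?a\<bar> > \<epsilon>} \<le> measure (\<nu> n t) {\<eta> \<in> space (\<nu> n t). \<bar>empirical n G \<eta> - ?b\<bar> > \<epsilon> / 2}"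
        by (rule finite_measure_mono) measurable
      then show "norm (measure (\<nu> n t) {\<eta> \<in> space (\<nu> n t). \<bar>empirical n F \<eta> - ?a\<bar> > \<epsilon>})
        \<le> measure (\<nu> n t) {\<eta> \<in> space (\<nu> n t). \<bar>empirical n G \<eta> - ?b\<bar> > \<epsilon> / 2}" by simp
    qed
  qed
qed

end

text \<open>The first half supplies one solution for all horizons. The second half holds for every
  solution and so expresses uniqueness: any two have the same pairings with continuous compactly
  supported functions, both pairings being limits in probability of the same averages.\<close>

theorem theorem1:
  fixes h :: "real^'d \<Rightarrow> real" and \<alpha> :: real
    and u0 :: "real^'d \<Rightarrow> real"
    and \<mu> :: "nat \<Rightarrow> (int^'d \<Rightarrow> bool) measure"
    and \<nu> :: "nat \<Rightarrow> real \<Rightarrow> (int^'d \<Rightarrow> bool) measure"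
  assumes alpha: "0 < \<alpha>" "\<alpha> < 2"
    and h_cont: "continuous_on (UNIV - {0}) h"
    and h_pos: "\<And>x. x \<noteq> 0 \<Longrightarrow> h x > 0"
    and h_even: "\<And>x. x \<noteq> 0 \<Longrightarrow> h (- x) = h x"
    and h_hom: "\<And>x c. x \<noteq> 0 \<Longrightarrow> c > 0 \<Longrightarrow>
                   h (c *\<^sub>R x) = c powr (- (real CARD('d) + \<alpha>)) * h x"
    and u0_meas: "u0 \<in> borel_measurable lborel"
    and u0_range: "\<And>x. 0 \<le> u0 x \<and> u0 x \<le> 1"
    and mu_prob: "\<And>n. prob_space (\<mu> n)"
    and mu_sets: "\<And>n. sets (\<mu> n) = sets config_space"
    and mu_assoc: "associated \<mu> u0"
    and nu_law: "\<And>n. is_excl_law h (real n powr \<alpha>) (\<mu> n) (\<nu> n)"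
  shows "(\<exists>u. \<forall>T\<ge>0. weak_solution h T u0 u) \<and>
         (\<forall>u. (\<forall>T\<ge>0. weak_solution h T u0 u) \<longrightarrow>
              (\<forall>t\<ge>0. associated (\<lambda>n. \<nu> n t) (u t)))"
proof -
  interpret levy_kernel h \<alpha> by unfold_locales (fact alpha h_cont h_pos h_even h_hom)+
  interpret initial_datum h \<alpha> u0 by unfold_locales (use u0_meas u0_range in auto)
  show ?thesis
  proof (intro conjI exI allI impI)
    show "weak_solution h T u0 sol" for T by (rule weak_solution_exists)
    fix u and t :: real
    assume u: "\<forall>T\<ge>0. weak_solution h T u0 u" and t: "0 \<le> t"
    show "associated (\<lambda>n. \<nu> n t) (u t)"
      by (rule associated_at_time[OF nu_law mu_prob mu_sets mu_assoc _ t]) (use u t in blast)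
  qed
qed

end
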